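(* Let $T>0$ and let $g:\mathbb{R}^d\times[0,T]\to\mathbb{R}$ satisfy $g(\cdot,t)\in W^{3,\infty}(\mathbb{R}^d)$ for $t\in[0,T]$ and $\partial_t g\in W^{1,\infty}(\mathbb{R}^d\times(0,T))$. Let $(\Omega(t))_{t\in[0,T]}$ be a regular mean curvature flow with forcing term $g$ (in the sense given in the context), starting from $\Omega(0)=\Omega_0$. Let $W(s)=\frac12(1-s^2)^2$ and $q(s)=-\tanh(s)$. For $\epsilon>0$ let $u_\epsilon$ be the solution of $$\partial_t u=\Delta u-\frac{1}{\epsilon^2}W'(u)+\frac1\epsilon\sqrt{2W(u)}\,g\quad\text{in }\mathbb{R}^d\times(0,T),\qquad u(x,0)=q\left(\frac{d(x,\Omega_0)}{\epsilon}\right),\ x\in\mathbb{R}^d,$$ and let $\partial\Omega_\epsilon(t)=\{x\in\mathbb{R}^d : u_\epsilon(x,t)=0\}$. Then there exist $\epsilon_0>0$ and a constant $C$ depending only on $T$ such that for all $\epsilon\in(0,\epsilon_0]$, $$\forall t\in[0,T],\quad \partial\Omega_\epsilon(t)\subseteq\left\{x\in\mathbb{R}^d : \operatorname{dist}(x,\partial\Omega(t))\le C\,\epsilon^2|\log\epsilon|^2\right\}.$$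
   Context: For a set $\Omega\subset\mathbb{R}^d$ with boundary $\partial\Omega$, $d(x,\Omega)$ denotes the signed distance: $d(x,\Omega)=\operatorname{dist}(x,\partial\Omega)$ if $x\notin\Omega$, $0$ if $x\in\partial\Omega$, and $-\operatorname{dist}(x,\partial\Omega)$ if $x\in\Omega$. A regular mean curvature flow with forcing term $g$ on $[0,T]$ is a smooth family of bounded domains $\Omega(t)\subset\mathbb{R}^d$ with smooth boundary, $t\in[0,T]$ (only smooth motions are considered; $\Omega_0$ is a smooth bounded domain), such that at each $x\in\partial\Omega(t)$ the normal velocity $V_n$ in the direction of the outward unit normal $n=\nabla d$ satisfies $V_n(x,t)=\kappa(x,t)+g(x,t)$. Here $\kappa=\sum_{i=1}^{d-1}\kappa_i$ is the mean curvature (sum of the principal curvatures), with the sign convention that $\kappa$ is negative for convex sets (for a ball of radius $R$, $\kappa=-(d-1)/R$). It is assumed that the function $d(x,t)=d(x,\Omega(t))$ satisfies $d,\ \partial_t d,\ \partial_t\partial_{xx}d\in C^0(\overline{\Lambda})$ on a tubular neighborhood $\Lambda=\bigcup_{t\in[0,T]}\{x:|d(x,t)|\le D\}\times\{t\}$ of the moving boundary, for some $D>0$. The flow and $g$ are fixed; in particular $C$ does not depend on $\epsilon$ or $t$. The function $q(s)=-\tanh(s)$ is the optimal profile associated with $W(s)=\frac12(1-s^2)^2$, i.e. $q'=-\sqrt{2W(q)}$, $q(0)=0$, $q(\mp\infty)=\pm1$.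
   Formalization: The condition that g(·,t) lies in W^{3,∞} for t in [0,T] is taken with a bound uniform in t; without uniformity the claim fails, e.g. for a stationary domain with forcing oscillating at scale ε during short time intervals. *)

theory Defs
  imports "HOL-Analysis.Analysis"
begin

definition dir_deriv :: "('a::euclidean_space \<Rightarrow> real) \<Rightarrow> 'a \<Rightarrow> 'a \<Rightarrow> real" where
  "dir_deriv f b x = frechet_derivative f (at x) b"

definition grad :: "('a::euclidean_space \<Rightarrow> real) \<Rightarrow> 'a \<Rightarrow> 'a" where
  "grad f x = (\<Sum>b\<in>Basis. dir_deriv f b x *\<^sub>R b)"

definition laplacian :: "('a::euclidean_space \<Rightarrow> real) \<Rightarrow> 'a \<Rightarrow> real" where
  "laplacian f x = (\<Sum>b\<in>Basis. dir_deriv (dir_deriv f b) b x)"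

text \<open>The next two notions are meant for open sets \<open>U\<close>.\<close>

primrec Ck_on :: "nat \<Rightarrow> 'a set \<Rightarrow> ('a::euclidean_space \<Rightarrow> real) \<Rightarrow> bool" where
  "Ck_on 0 U f \<longleftrightarrow> continuous_on U f"
| "Ck_on (Suc k) U f \<longleftrightarrow>
     (\<forall>x\<in>U. f differentiable (at x)) \<and> (\<forall>b\<in>Basis. Ck_on k U (dir_deriv f b))"

definition smooth_on :: "'a set \<Rightarrow> ('a::euclidean_space \<Rightarrow> real) \<Rightarrow> bool" where
  "smooth_on U f \<longleftrightarrow> (\<forall>k. Ck_on k U f)"

definition test_function :: "'a set \<Rightarrow> ('a::euclidean_space \<Rightarrow> real) \<Rightarrow> bool" where
  "test_function U \<phi> \<longleftrightarrow> smooth_on UNIV \<phi> \<and> (\<exists>K. compact K \<and> K \<subseteq> U \<and> (\<forall>x. x \<notin> K \<longrightarrow> \<phi> x = 0))"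

definition has_weak_deriv ::
  "'a set \<Rightarrow> 'a \<Rightarrow> ('a::euclidean_space \<Rightarrow> real) \<Rightarrow> ('a \<Rightarrow> real) \<Rightarrow> bool" where
  "has_weak_deriv U b f h \<longleftrightarrow>
     (\<forall>\<phi>. test_function U \<phi> \<longrightarrow>
        integral\<^sup>L (lebesgue_on U) (\<lambda>x. f x * dir_deriv \<phi> b x) =
        - integral\<^sup>L (lebesgue_on U) (\<lambda>x. h x * \<phi> x))"

text \<open>\<open>sobolev_inf_le k M U f\<close>: \<open>f\<close> lies in \<open>W\<^sup>k\<^sup>,\<^sup>\<infinity>(U)\<close>, and all its weak derivatives of order
  at most \<open>k\<close> are bounded by \<open>M\<close> almost everywhere.\<close>

primrec sobolev_inf_le ::
  "nat \<Rightarrow> real \<Rightarrow> 'a set \<Rightarrow> ('a::euclidean_space \<Rightarrow> real) \<Rightarrow> bool" where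
  "sobolev_inf_le 0 M U f \<longleftrightarrow>
     f \<in> borel_measurable (lebesgue_on U) \<and> (AE x in lebesgue_on U. \<bar>f x\<bar> \<le> M)"
| "sobolev_inf_le (Suc k) M U f \<longleftrightarrow>
     f \<in> borel_measurable (lebesgue_on U) \<and> (AE x in lebesgue_on U. \<bar>f x\<bar> \<le> M) \<and>
     (\<forall>b\<in>Basis. \<exists>h. has_weak_deriv U b f h \<and> sobolev_inf_le k M U h)"

definition sobolev_inf :: "nat \<Rightarrow> 'a set \<Rightarrow> ('a::euclidean_space \<Rightarrow> real) \<Rightarrow> bool" where
  "sobolev_inf k U f \<longleftrightarrow> (\<exists>M. sobolev_inf_le k M U f)"

text \<open>A Sobolev function is represented by its continuous version, and the bound in
  \<open>W\<^sup>3\<^sup>,\<^sup>\<infinity>\<close> is uniform in time.\<close>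

definition admissible_forcing :: "real \<Rightarrow> ('a::euclidean_space \<Rightarrow> real \<Rightarrow> real) \<Rightarrow> bool" where
  "admissible_forcing T g \<longleftrightarrow>
     continuous_on (UNIV \<times> {0..T}) (\<lambda>(x, t). g x t) \<and>
     (\<exists>M. \<forall>t\<in>{0..T}. sobolev_inf_le 3 M UNIV (\<lambda>x. g x t)) \<and>
     (\<exists>g\<^sub>t. has_weak_deriv (UNIV \<times> {0<..<T}) (0, 1) (\<lambda>(x, t). g x t) g\<^sub>t \<and>
           sobolev_inf 1 (UNIV \<times> {0<..<T}) g\<^sub>t)"

definition signed_dist :: "'a::euclidean_space set \<Rightarrow> 'a \<Rightarrow> real" where
  "signed_dist \<Omega> x =
     (if x \<in> frontier \<Omega> then 0
      else if x \<in> \<Omega> then - infdist x (frontier \<Omega>) else infdist x (frontier \<Omega>))"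

text \<open>Smoothness of the family is that of the space-time tube: near every point of
  \<open>\<real>\<^sup>d \<times> [0,T]\<close> the sets are sublevel sets of a smooth function of \<open>(x,t)\<close> whose spatial gradient
  does not vanish on the zero level. Away from the moving boundary this only says
  that no piece of boundary is suddenly created.\<close>

definition smooth_family :: "real \<Rightarrow> (real \<Rightarrow> 'a::euclidean_space set) \<Rightarrow> bool" where
  "smooth_family T \<Omega> \<longleftrightarrow>
     (\<forall>t\<in>{0..T}. \<Omega> t \<noteq> {} \<and> open (\<Omega> t) \<and> connected (\<Omega> t) \<and> bounded (\<Omega> t)) \<and>
     (\<forall>x. \<forall>t\<in>{0..T}. \<exists>N \<phi>. open N \<and> (x, t) \<in> N \<and> smooth_on N \<phi> \<and>
        (\<forall>y s. (y, s) \<in> N \<and> s \<in> {0..T} \<longrightarrow> (y \<in> \<Omega> s \<longleftrightarrow> \<phi> (y, s) < 0)) \<and>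
        (\<forall>y s. (y, s) \<in> N \<and> \<phi> (y, s) = 0 \<longrightarrow> grad (\<lambda>z. \<phi> (z, s)) y \<noteq> 0))"

definition tube :: "real \<Rightarrow> (real \<Rightarrow> 'a::euclidean_space set) \<Rightarrow> real \<Rightarrow> ('a \<times> real) set" where
  "tube T \<Omega> D = (\<Union>t\<in>{0..T}. {x. \<bar>signed_dist (\<Omega> t) x\<bar> \<le> D} \<times> {t})"

text \<open>\<open>d\<close>, \<open>\<partial>\<^sub>t d\<close>, \<open>\<partial>\<^sub>t \<partial>\<^sub>x\<^sub>x d\<close> are continuous up to \<open>t = 0\<close> and \<open>t = T\<close>, with one-sided time derivatives
  there.\<close>

definition regular_distance :: "real \<Rightarrow> (real \<Rightarrow> 'a::euclidean_space set) \<Rightarrow> bool" where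
  "regular_distance T \<Omega> \<longleftrightarrow> (\<exists>D>0.
     continuous_on (closure (tube T \<Omega> D)) (\<lambda>(x, t). signed_dist (\<Omega> t) x) \<and>
     (\<forall>(x, t)\<in>closure (tube T \<Omega> D).
        (\<lambda>s. signed_dist (\<Omega> s) x) differentiable (at t within {0..T})) \<and>
     continuous_on (closure (tube T \<Omega> D))
       (\<lambda>(x, t). vector_derivative (\<lambda>s. signed_dist (\<Omega> s) x) (at t within {0..T})) \<and>
     (\<forall>(x, t)\<in>closure (tube T \<Omega> D).
        signed_dist (\<Omega> t) differentiable (at x) \<and>
        (\<forall>i\<in>Basis. dir_deriv (signed_dist (\<Omega> t)) i differentiable (at x))) \<and>
     (\<forall>i\<in>Basis. \<forall>j\<in>Basis.
        (\<forall>(x, t)\<in>closure (tube T \<Omega> D).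
           (\<lambda>s. dir_deriv (dir_deriv (signed_dist (\<Omega> s)) i) j x)
             differentiable (at t within {0..T})) \<and>
        continuous_on (closure (tube T \<Omega> D))
          (\<lambda>(x, t). vector_derivative
             (\<lambda>s. dir_deriv (dir_deriv (signed_dist (\<Omega> s)) i) j x) (at t within {0..T}))))"

definition outer_normal :: "'a::euclidean_space set \<Rightarrow> 'a \<Rightarrow> 'a" where
  "outer_normal \<Omega> x = grad (signed_dist \<Omega>) x"

text \<open>Normal component of the velocity of a curve carried by the moving boundary; for a smooth
  family such a curve exists through every boundary point, and the value does not depend on it.\<close>

definition has_normal_velocity ::
  "real \<Rightarrow> (real \<Rightarrow> 'a::euclidean_space set) \<Rightarrow> real \<Rightarrow> 'a \<Rightarrow> real \<Rightarrow> bool" where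
  "has_normal_velocity T \<Omega> t x v \<longleftrightarrow>
     (\<exists>\<gamma> \<gamma>'. \<gamma> t = x \<and> (\<forall>\<^sub>F s in at t within {0..T}. \<gamma> s \<in> frontier (\<Omega> s)) \<and>
        (\<gamma> has_vector_derivative \<gamma>') (at t within {0..T}) \<and>
        v = \<gamma>' \<bullet> outer_normal (\<Omega> t) x)"

text \<open>\<open>B\<close> is an orthonormal basis of principal directions of the tangent space, with principal
  curvatures \<open>\<kappa>\<close>. The minus sign makes the curvatures of convex sets nonpositive.\<close>

definition has_mean_curvature :: "'a::euclidean_space set \<Rightarrow> 'a \<Rightarrow> real \<Rightarrow> bool" where
  "has_mean_curvature \<Omega> x k \<longleftrightarrow>
     (\<exists>B \<kappa>. pairwise orthogonal B \<and> (\<forall>e\<in>B. norm e = 1) \<and>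
        span B = {v. v \<bullet> outer_normal \<Omega> x = 0} \<and>
        outer_normal \<Omega> differentiable (at x) \<and>
        (\<forall>e\<in>B. frechet_derivative (outer_normal \<Omega>) (at x) e = - \<kappa> e *\<^sub>R e) \<and>
        k = (\<Sum>e\<in>B. \<kappa> e))"

definition regular_forced_mcf ::
  "real \<Rightarrow> ('a::euclidean_space \<Rightarrow> real \<Rightarrow> real) \<Rightarrow> (real \<Rightarrow> 'a set) \<Rightarrow> bool" where
  "regular_forced_mcf T g \<Omega> \<longleftrightarrow>
     smooth_family T \<Omega> \<and> regular_distance T \<Omega> \<and>
     (\<forall>t\<in>{0..T}. \<forall>x\<in>frontier (\<Omega> t). \<exists>V k.
        has_normal_velocity T \<Omega> t x V \<and> has_mean_curvature (\<Omega> t) x k \<and> V = k + g x t)"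

definition W :: "real \<Rightarrow> real" where
  "W s = (1 - s\<^sup>2)\<^sup>2 / 2"

definition q :: "real \<Rightarrow> real" where
  "q s = - tanh s"

definition C21 :: "real \<Rightarrow> ('a::euclidean_space \<Rightarrow> real \<Rightarrow> real) \<Rightarrow> bool" where
  "C21 T u \<longleftrightarrow>
     (\<forall>x. \<forall>t\<in>{0<..<T}. (\<lambda>s. u x s) differentiable (at t) \<and> (\<lambda>y. u y t) differentiable (at x) \<and>
        (\<forall>i\<in>Basis. dir_deriv (\<lambda>y. u y t) i differentiable (at x))) \<and>
     continuous_on (UNIV \<times> {0<..<T}) (\<lambda>(x, t). deriv (\<lambda>s. u x s) t) \<and>
     (\<forall>i\<in>Basis. continuous_on (UNIV \<times> {0<..<T}) (\<lambda>(x, t). dir_deriv (\<lambda>y. u y t) i x)) \<and>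
     (\<forall>i\<in>Basis. \<forall>j\<in>Basis. continuous_on (UNIV \<times> {0<..<T})
        (\<lambda>(x, t). dir_deriv (dir_deriv (\<lambda>y. u y t) i) j x))"

text \<open>Bounded classical solutions, continuous up to \<open>t = 0\<close> and \<open>t = T\<close>.\<close>

definition allen_cahn_solution ::
  "real \<Rightarrow> ('a::euclidean_space \<Rightarrow> real \<Rightarrow> real) \<Rightarrow> 'a set \<Rightarrow> real \<Rightarrow> ('a \<Rightarrow> real \<Rightarrow> real) \<Rightarrow> bool" where
  "allen_cahn_solution T g \<Omega>\<^sub>0 \<epsilon> u \<longleftrightarrow>
     continuous_on (UNIV \<times> {0..T}) (\<lambda>(x, t). u x t) \<and>
     bounded ((\<lambda>(x, t). u x t) ` (UNIV \<times> {0..T})) \<and>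
     C21 T u \<and>
     (\<forall>x. \<forall>t\<in>{0<..<T}.
        deriv (\<lambda>s. u x s) t =
          laplacian (\<lambda>y. u y t) x - 1 / \<epsilon>\<^sup>2 * deriv W (u x t) + 1 / \<epsilon> * sqrt (2 * W (u x t)) * g x t) \<and>
     (\<forall>x. u x 0 = q (signed_dist \<Omega>\<^sub>0 x / \<epsilon>))"

end

theory Submission
  imports Defs "HOL-Real_Asymp.Real_Asymp" "HOL-Computational_Algebra.Polynomial"
begin

text \<open>
  The signed distance \<open>d\<close> to the moving boundary is inserted into the travelling wave: with
  \<open>u = q (z / \<epsilon>)\<close> and \<open>q'' = W' \<circ> q\<close>, \<open>q' = - sqrt (2 W \<circ> q) < 0\<close>, the left-hand side minus the right-hand
  side of the Allen-Cahn equation is \<open>q' (z / \<epsilon>) / \<epsilon>\<close> times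
  \<open>z\<^sub>t - \<Delta>z + g + (2 / \<epsilon>) tanh (z / \<epsilon>) (\<bar>\<nabla>z\<bar>\<^sup>2 - 1)\<close>,
  so \<open>q (z / \<epsilon>)\<close> is a supersolution as soon as this residual is nonpositive. For \<open>z = d\<close> the last
  term vanishes (\<open>\<bar>\<nabla>d\<bar> = 1\<close>), and the law of motion makes \<open>d\<^sub>t - \<Delta>d + g\<close> vanish on the boundary; hence it
  equals \<open>d h + O(d\<^sup>2)\<close> nearby, with \<open>h\<close> a function on the boundary: the sum of the squared principal
  curvatures plus the normal derivative of \<open>g\<close>. The residual \<open>d h\<close> has order \<open>\<epsilon>\<close> inside the layer and is
  removed by the correction \<open>z = r + \<epsilon>\<^sup>3 h \<phi> (r / \<epsilon>)\<close> with \<open>r = d - \<kappa>(t)\<close>, where \<open>\<psi> = \<phi>'\<close>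
  solves the linear equation \<open>\<psi>' y = 4 * tanh y * \<psi> y + y\<close> and has linear growth
  (\<open>corrector_profile\<close>). What remains has order \<open>\<epsilon>\<^sup>2\<close> and is absorbed by a shift
  \<open>\<kappa>(t) = K \<epsilon>\<^sup>2 exp (\<lambda> t)\<close>. Comparison then keeps the zero level of \<open>u\<close> within distance
  \<open>O(\<epsilon>\<^sup>2)\<close> on one side of the boundary (\<open>zero_level_upper_bound\<close>); the equation is invariant under
  \<open>(u, d, g) \<mapsto> (-u, -d, -g)\<close>, which gives the other side. For \<open>\<epsilon> \<le> 1 / e\<close> this is at least as
  sharp as the bound with \<open>\<bar>ln \<epsilon>\<bar>\<^sup>2\<close>.

  Two devices make the barrier work with few derivatives. The coefficient \<open>h\<close> evaluated at the foot
  point of \<open>x\<close> is only known to be Lipschitz up to an error \<open>\<epsilon>\<close>, so a barrier cannot contain it. It is therefore frozen at an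
  arbitrary point \<open>p\<close> of the space-time boundary, at the price of a penalty
  \<open>- \<epsilon>\<^sup>2 dist ((x, t), p)\<^sup>2\<close> inside \<open>z\<close>; a
  comparison principle for families of barriers (\<open>family_comparison\<close>) asks for the
  supersolution inequality only at those \<open>p\<close> that are optimal for \<open>(x, t)\<close>, and these are close to the
  foot point (\<open>optimal_point_close\<close>). Away from the boundary the distance is replaced by a
  bent function of it (\<open>bent\<close>), whose slope differs from 1 in the direction that gives the last
  term of the residual a favourable sign of size \<open>1 / \<epsilon>\<close>; this joins the barrier to
  constants before \<open>d\<close> loses its smoothness.

  The geometric input is \<open>distance_is_tracked\<close>: inside the tube \<open>\<nabla>d\<close> is constant along normals, which
  expresses the Hessian of \<open>d\<close> through the one at the foot point and identifies its trace with minus the mean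
  curvature on the boundary. The normal derivative of \<open>g\<close>
  is replaced by difference quotients of step \<open>\<epsilon>\<close>, whose
  error is within the tolerance; their regularity comes from mollification of \<open>g\<close> (\<open>sobolev_slope_bounds\<close>,
  \<open>sobolev_mixed_difference\<close>).
\<close>

section \<open>Comparison with a family of barriers\<close>

text \<open>First and second derivative of \<open>f\<close> at \<open>x\<close> along the line in direction
  \<open>b\<close>. Only these enter a maximum principle for the Laplacian, and the distance and the barriers
  have them without any joint smoothness in \<open>(x, t)\<close>.\<close>

definition line_derivs :: "('a::real_vector \<Rightarrow> real) \<Rightarrow> 'a \<Rightarrow> 'a \<Rightarrow> real \<Rightarrow> real \<Rightarrow> bool" where
  "line_derivs f x b D1 D2 \<longleftrightarrow> (\<exists>f1. (\<forall>\<^sub>F s in nhds 0. ((\<lambda>s. f (x + s *\<^sub>R b)) has_real_derivative f1 s) (at s)) \<and>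
      f1 0 = D1 \<and> (f1 has_real_derivative D2) (at 0))"

definition parabolic_jet :: "('a::euclidean_space \<Rightarrow> real \<Rightarrow> real) \<Rightarrow> 'a \<Rightarrow> real \<Rightarrow> real \<Rightarrow> real \<Rightarrow> bool" where
  "parabolic_jet V x t Vt lap \<longleftrightarrow> ((\<lambda>s. V x s) has_real_derivative Vt) (at t) \<and>
     (\<exists>D1 D2. (\<forall>b\<in>Basis. line_derivs (\<lambda>y. V y t) x b (D1 b) (D2 b)) \<and> lap = (\<Sum>b\<in>Basis. D2 b))"

lemma line_derivs_max:
  assumes "line_derivs f x b D1 D2" "\<forall>\<^sub>F s in nhds 0. f (x + s *\<^sub>R b) \<le> f x"
  shows "D2 \<le> 0"
proof (rule ccontr)
  assume "\<not> D2 \<le> 0"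
  hence D2: "D2 > 0" by simp
  obtain f1 where f1: "\<forall>\<^sub>F s in nhds 0. ((\<lambda>s. f (x + s *\<^sub>R b)) has_real_derivative f1 s) (at s)"
    "f1 0 = D1" "(f1 has_real_derivative D2) (at 0)"
    using assms(1) unfolding line_derivs_def by blast
  from f1(1) assms(2) have "\<forall>\<^sub>F s in nhds 0. ((\<lambda>s. f (x + s *\<^sub>R b)) has_real_derivative f1 s) (at s) \<and> f (x + s *\<^sub>R b) \<le> f x"
    by eventually_elim simp
  then obtain e where e: "e > 0" "\<And>s. \<bar>s\<bar> < e \<Longrightarrow> ((\<lambda>s. f (x + s *\<^sub>R b)) has_real_derivative f1 s) (at s)"
    "\<And>s. \<bar>s\<bar> < e \<Longrightarrow> f (x + s *\<^sub>R b) \<le> f x"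
    unfolding eventually_nhds_metric dist_real_def by auto
  have f10: "f1 0 = 0"
    by (rule DERIV_local_max[OF e(2)[of 0] e(1)]) (use e in auto)
  obtain d where d: "d > 0" "\<And>h. 0 < h \<Longrightarrow> h < d \<Longrightarrow> f1 0 < f1 (0 + h)"
    using DERIV_pos_inc_right[OF f1(3) D2] by auto
  define s where "s = min e d / 2"
  have s: "0 < s" "s < e" "s < d" using e(1) d(1) unfolding s_def by auto
  obtain z where z: "0 < z" "z < s" "f (x + s *\<^sub>R b) - f (x + 0 *\<^sub>R b) = (s - 0) * f1 z"
    using MVT2[OF s(1), of "\<lambda>s. f (x + s *\<^sub>R b)" f1] e(2) s by auto
  have "f1 z > 0" using d(2)[of z] z s f10 by auto
  hence "(s - 0) * f1 z > 0" using s by simp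
  thus False using z(3) e(3)[of s] s by simp
qed

lemma line_derivs_lincomb:
  assumes "line_derivs f x b D1 D2" "line_derivs g x b E1 E2"
  shows "line_derivs (\<lambda>y. p0 * f y + q0 * g y) x b (p0 * D1 + q0 * E1) (p0 * D2 + q0 * E2)"
proof -
  obtain f1 where f1: "\<forall>\<^sub>F s in nhds 0. ((\<lambda>s. f (x + s *\<^sub>R b)) has_real_derivative f1 s) (at s)"
    "f1 0 = D1" "(f1 has_real_derivative D2) (at 0)"
    using assms(1) unfolding line_derivs_def by blast
  obtain g1 where g1: "\<forall>\<^sub>F s in nhds 0. ((\<lambda>s. g (x + s *\<^sub>R b)) has_real_derivative g1 s) (at s)"
    "g1 0 = E1" "(g1 has_real_derivative E2) (at 0)"
    using assms(2) unfolding line_derivs_def by blast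
  show ?thesis unfolding line_derivs_def
  proof (intro exI[of _ "\<lambda>s. p0 * f1 s + q0 * g1 s"] conjI)
    show "\<forall>\<^sub>F s in nhds 0. ((\<lambda>s. p0 * f (x + s *\<^sub>R b) + q0 * g (x + s *\<^sub>R b)) has_real_derivative p0 * f1 s + q0 * g1 s) (at s)"
      using f1(1) g1(1) by eventually_elim (auto intro!: derivative_eq_intros)
  qed (use f1 g1 in \<open>auto intro!: derivative_eq_intros\<close>)
qed

lemma line_derivs_compose:
  assumes "line_derivs f x b D1 D2"
    and "\<forall>\<^sub>F y in nhds (f x). (F has_real_derivative F1 y) (at y)"
    and "(F1 has_real_derivative F2) (at (f x))"
  shows "line_derivs (\<lambda>y. F (f y)) x b (F1 (f x) * D1) (F2 * D1\<^sup>2 + F1 (f x) * D2)"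
proof -
  obtain f1 where f1: "\<forall>\<^sub>F s in nhds 0. ((\<lambda>s. f (x + s *\<^sub>R b)) has_real_derivative f1 s) (at s)"
    "f1 0 = D1" "(f1 has_real_derivative D2) (at 0)"
    using assms(1) unfolding line_derivs_def by blast
  have d0: "((\<lambda>s. f (x + s *\<^sub>R b)) has_real_derivative D1) (at 0)"
    using eventually_nhds_x_imp_x[OF f1(1)] f1(2) by simp
  have "((\<lambda>s. f (x + s *\<^sub>R b)) \<longlongrightarrow> f (x + 0 *\<^sub>R b)) (nhds 0)"
    using DERIV_isCont[OF d0] unfolding isCont_def
    by (rule iffD1[OF tendsto_at_iff_tendsto_nhds[of "\<lambda>s. f (x + s *\<^sub>R b)"]])
  hence ev: "\<forall>\<^sub>F s in nhds 0. (F has_real_derivative F1 (f (x + s *\<^sub>R b))) (at (f (x + s *\<^sub>R b)))"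
    using assms(2) by (auto simp: filterlim_iff)
  show ?thesis unfolding line_derivs_def
  proof (intro exI[of _ "\<lambda>s. F1 (f (x + s *\<^sub>R b)) * f1 s"] conjI)
    show "\<forall>\<^sub>F s in nhds 0. ((\<lambda>s. F (f (x + s *\<^sub>R b))) has_real_derivative F1 (f (x + s *\<^sub>R b)) * f1 s) (at s)"
      using f1(1) ev
    proof eventually_elim
      case (elim s)
      show ?case using DERIV_chain2[OF elim(2) elim(1)] .
    qed
    have "((\<lambda>s. F1 (f (x + s *\<^sub>R b))) has_real_derivative F2 * D1) (at 0)"
      by (rule DERIV_chain2[where f=F1 and g="\<lambda>s. f (x + s *\<^sub>R b)"]) (use assms(3) d0 in auto)
    from DERIV_mult[OF this f1(3)]
    show "((\<lambda>s. F1 (f (x + s *\<^sub>R b)) * f1 s) has_real_derivative F2 * D1\<^sup>2 + F1 (f x) * D2) (at 0)"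
      using f1(2) by (simp add: power2_eq_square algebra_simps)
  qed (use f1 in auto)
qed

lemma line_derivs_norm_sq:
  fixes a x b :: "'a::real_inner"
  shows "line_derivs (\<lambda>y. (norm (y - a))\<^sup>2) x b (2 * ((x - a) \<bullet> b)) (2 * (b \<bullet> b))"
proof -
  have eq: "(norm (x + s *\<^sub>R b - a))\<^sup>2 = (x - a) \<bullet> (x - a) + 2 * s * ((x - a) \<bullet> b) + s\<^sup>2 * (b \<bullet> b)" for s
  proof -
    have "x + s *\<^sub>R b - a = (x - a) + s *\<^sub>R b" by simp
    thus ?thesis unfolding power2_norm_eq_inner
      by (simp only: inner_add_left inner_add_right inner_scaleR_left inner_scaleR_right inner_commute[of b "x-a"])
         (simp add: power2_eq_square algebra_simps)
  qed
  show ?thesis unfolding line_derivs_def eq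
    by (intro exI[of _ "\<lambda>s. 2 * ((x - a) \<bullet> b) + 2 * s * (b \<bullet> b)"] conjI always_eventually allI)
       (auto intro!: derivative_eq_intros)
qed

text \<open>The usual maximum principle on the whole space, run on \<open>(u - w) exp (- L' t) - \<eta>
  (\<bar>x\<bar>\<^sup>2 + K t)\<close>, but with the maximum taken over the parameter \<open>p\<close> as
  well. At a maximum, \<open>p\<close> minimises \<open>w x t\<close>; hence the supersolution property is
  only asked for at such \<open>p\<close>, and only for a smooth function \<open>V\<close> touching the
  barrier from above there, which admits barriers that are minima of smooth ones.\<close>

lemma family_comparison:
  fixes u :: "'a::euclidean_space \<Rightarrow> real \<Rightarrow> real" and w :: "'a \<Rightarrow> real \<Rightarrow> 'p::metric_space \<Rightarrow> real"
    and f :: "'a \<Rightarrow> real \<Rightarrow> real \<Rightarrow> real"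
  assumes T: "T > 0"
    and contu: "continuous_on (UNIV \<times> {0..T}) (\<lambda>(x, t). u x t)"
    and bdu: "\<And>x t. t \<in> {0..T} \<Longrightarrow> \<bar>u x t\<bar> \<le> B"
    and bdw: "\<And>x t p. t \<in> {0..T} \<Longrightarrow> p \<in> P \<Longrightarrow> \<bar>w x t p\<bar> \<le> B"
    and P: "compact P"
    and contw: "continuous_on (UNIV \<times> {0..T} \<times> P) (\<lambda>(x, t, p). w x t p)"
    and lip: "\<And>x t a b. t \<in> {0..T} \<Longrightarrow> \<bar>a\<bar> \<le> B \<Longrightarrow> \<bar>b\<bar> \<le> B \<Longrightarrow> \<bar>f x t a - f x t b\<bar> \<le> L * \<bar>a - b\<bar>"
    and usub: "\<And>x t. t \<in> {0<..<T} \<Longrightarrow> \<exists>ut lap. parabolic_jet u x t ut lap \<and> ut \<le> lap + f x t (u x t)"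
    and wsup: "\<And>x t p. t \<in> {0<..<T} \<Longrightarrow> p \<in> P \<Longrightarrow> (\<And>p'. p' \<in> P \<Longrightarrow> w x t p \<le> w x t p') \<Longrightarrow>
       \<exists>V Vt lap. V x t = w x t p \<and> (\<forall>\<^sub>F (y, s) in nhds (x, t). w y s p \<le> V y s) \<and>
         parabolic_jet V x t Vt lap \<and> Vt \<ge> lap + f x t (V x t)"
    and init: "\<And>x p. p \<in> P \<Longrightarrow> u x 0 \<le> w x 0 p"
    and tp: "t \<in> {0..T}" "p \<in> P"
  shows "u x t \<le> w x t p"
proof -
  define n where "n = real DIM('a)"
  have main: "u x1 t1 \<le> w x1 t1 p1" if t1: "0 \<le> t1" "t1 < T" and p1: "p1 \<in> P" for x1 t1 p1
  proof (rule ccontr)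
    assume neg: "\<not> u x1 t1 \<le> w x1 t1 p1"
    define e where "e = u x1 t1 - w x1 t1 p1"
    have e: "e > 0" using neg by (simp add: e_def)
    define L' where "L' = \<bar>L\<bar> + 1"
    define K where "K = 2 * n + 1"
    have n0: "n > 0" "K > 0" unfolding n_def K_def by (auto simp: DIM_positive add_nonneg_pos)
    define \<eta> where "\<eta> = e * exp (- L' * t1) / (2 * ((norm x1)\<^sup>2 + K * t1 + 1))"
    have den: "(norm x1)\<^sup>2 + K * t1 + 1 > 0" using n0 t1 by (simp add: add_nonneg_pos)
    have eta: "\<eta> > 0" unfolding \<eta>_def using e den by simp
    define M where "M = (\<lambda>x t p. (u x t - w x t p) * exp (- L' * t) - \<eta> * ((norm x)\<^sup>2 + K * t))"
    have M1: "M x1 t1 p1 > 0"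
    proof -
      have "\<eta> * ((norm x1)\<^sup>2 + K * t1) \<le> \<eta> * ((norm x1)\<^sup>2 + K * t1 + 1)" using eta by simp
      also have "\<dots> = e * exp (- L' * t1) / 2"
      proof -
        have "a / (2 * D) * D = a / 2" if "D > 0" for a D :: real using that by simp
        from this[OF den] show ?thesis unfolding \<eta>_def .
      qed
      also have "\<dots> < e * exp (- L' * t1)" using e by simp
      finally show ?thesis unfolding M_def e_def by simp
    qed
    have B0: "B \<ge> 0" using bdu[of 0 undefined] T by auto
    define \<rho> where "\<rho> = sqrt ((2 * B + 1) / \<eta>)"
    have far: "M x t p < 0" if "norm x > \<rho>" "t \<in> {0..t1}" "p \<in> P" for x t p
    proof -
      have tt: "t \<in> {0..T}" using that t1 by auto
      have "\<rho>\<^sup>2 = (2 * B + 1) / \<eta>" unfolding \<rho>_def using B0 eta by simp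
      hence r: "\<eta> * \<rho>\<^sup>2 = 2 * B + 1" using eta by simp
      have "\<rho> \<ge> 0" unfolding \<rho>_def using B0 eta by simp
      hence "\<rho>\<^sup>2 \<le> (norm x)\<^sup>2" using that(1) by (intro power_mono) auto
      hence "2 * B + 1 \<le> \<eta> * (norm x)\<^sup>2" using r eta mult_left_mono[of "\<rho>\<^sup>2" "(norm x)\<^sup>2" \<eta>] by linarith
      moreover have "0 \<le> \<eta> * (K * t)" using eta n0 that by simp
      ultimately have 1: "2 * B + 1 \<le> \<eta> * ((norm x)\<^sup>2 + K * t)" by (simp add: distrib_left)
      have "(u x t - w x t p) * exp (- L' * t) \<le> (2 * B) * 1"
      proof (rule mult_mono)
        show "u x t - w x t p \<le> 2 * B" using bdu[OF tt, of x] bdw[OF tt that(3), of x] by linarith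
        show "exp (- L' * t) \<le> 1" using that unfolding L'_def by (simp add: mult_nonpos_nonneg)
      qed (use B0 in auto)
      thus ?thesis unfolding M_def using 1 by simp
    qed
    define Q where "Q = cball (0::'a) \<rho> \<times> {0..t1} \<times> P"
    have cQ: "compact Q" unfolding Q_def by (intro compact_Times compact_cball compact_Icc P)
    have in1: "(x1, t1, p1) \<in> Q"
    proof -
      have "\<not> norm x1 > \<rho>" using far[of x1 t1 p1] M1 t1 p1 by auto
      thus ?thesis unfolding Q_def using t1 p1 by (auto simp: dist_norm)
    qed
    have sub: "Q \<subseteq> UNIV \<times> {0..T} \<times> P" unfolding Q_def using t1 by auto
    have cont: "continuous_on Q (\<lambda>(x, t, p). M x t p)"
    proof -
      have c1: "continuous_on Q (\<lambda>z. u (fst z) (fst (snd z)))"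
      proof -
        have "continuous_on Q ((\<lambda>(x, t). u x t) \<circ> (\<lambda>z. (fst z, fst (snd z))))"
          by (intro continuous_on_compose continuous_intros continuous_on_subset[OF contu])
             (use sub in auto)
        thus ?thesis by (simp add: comp_def)
      qed
      have c2: "continuous_on Q (\<lambda>z. w (fst z) (fst (snd z)) (snd (snd z)))"
        using continuous_on_subset[OF contw sub] by (simp add: case_prod_beta)
      show ?thesis unfolding M_def case_prod_beta
        by (intro continuous_intros c1 c2)
    qed
    obtain z0 where z0: "z0 \<in> Q" "\<And>z. z \<in> Q \<Longrightarrow> (\<lambda>(x, t, p). M x t p) z \<le> (\<lambda>(x, t, p). M x t p) z0"
      using continuous_attains_sup[OF cQ _ cont] in1 by blast
    obtain x0 t0 p0 where zz: "z0 = (x0, t0, p0)" by (cases z0) auto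
    have q0: "t0 \<in> {0..t1}" "p0 \<in> P" using z0(1) unfolding zz Q_def by auto
    have M0: "M x0 t0 p0 > 0" using z0(2)[OF in1] M1 unfolding zz by simp
    have mx: "M x t p \<le> M x0 t0 p0" if "t \<in> {0..t1}" "p \<in> P" for x t p
    proof (cases "norm x > \<rho>")
      case True thus ?thesis using far[OF True that] M0 by simp
    next
      case False thus ?thesis using z0(2)[of "(x, t, p)"] that unfolding zz Q_def by auto
    qed
    have t0: "t0 > 0"
    proof (rule ccontr)
      assume "\<not> t0 > 0"
      hence "t0 = 0" using q0 by auto
      moreover have "0 \<le> \<eta> * (norm x0)\<^sup>2" using eta by simp
      ultimately show False using M0 init[OF q0(2), of x0] unfolding M_def by auto
    qed
    have t0T: "t0 \<in> {0<..<T}" "t0 \<in> {0..T}" using t0 q0 t1 by auto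
    have pm: "w x0 t0 p0 \<le> w x0 t0 p'" if "p' \<in> P" for p'
      using mx[OF q0(1) that, of x0] unfolding M_def by simp
    obtain V Vt lV where V: "V x0 t0 = w x0 t0 p0" "\<forall>\<^sub>F (y, s) in nhds (x0, t0). w y s p0 \<le> V y s"
      "parabolic_jet V x0 t0 Vt lV" "Vt \<ge> lV + f x0 t0 (V x0 t0)"
      using wsup[OF t0T(1) q0(2) pm] by auto
    obtain ut lu where U: "parabolic_jet u x0 t0 ut lu" "ut \<le> lu + f x0 t0 (u x0 t0)"
      using usub[OF t0T(1)] by blast
    define E where "E = exp (- L' * t0)"
    have E: "E > 0" unfolding E_def by simp
    define G where "G = (\<lambda>y s. (u y s - V y s) * exp (- L' * s) - \<eta> * ((norm y)\<^sup>2 + K * s))"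
    have G0: "G x0 t0 = M x0 t0 p0" unfolding G_def M_def V(1) ..
    have GM: "\<forall>\<^sub>F (y, s) in nhds (x0, t0). s \<in> {0..t1} \<longrightarrow> G y s \<le> G x0 t0"
      using V(2)
    proof eventually_elim
      case (elim z)
      obtain y s where z: "z = (y, s)" by (cases z)
      have le: "w y s p0 \<le> V y s" using elim z by simp
      have "G y s \<le> M y s p0" unfolding G_def M_def using le by (simp add: mult_right_mono)
      thus ?case unfolding z G0 using mx[OF _ q0(2), of s y] by auto
    qed
    have t0t1: "t0 \<in> {0..t1}" by (rule q0)
    \<comment> \<open>\<open>G (\<cdot>) t0\<close> has a local maximum at \<open>x0\<close>, so its second derivative along each basis line is nonpositive.\<close>
    obtain Du1 Du2 where Du: "\<And>b. b \<in> Basis \<Longrightarrow> line_derivs (\<lambda>y. u y t0) x0 b (Du1 b) (Du2 b)" "lu = (\<Sum>b\<in>Basis. Du2 b)"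
      "((\<lambda>s. u x0 s) has_real_derivative ut) (at t0)"
      using U(1) unfolding parabolic_jet_def by blast
    obtain DV1 DV2 where DV: "\<And>b. b \<in> Basis \<Longrightarrow> line_derivs (\<lambda>y. V y t0) x0 b (DV1 b) (DV2 b)" "lV = (\<Sum>b\<in>Basis. DV2 b)"
      "((\<lambda>s. V x0 s) has_real_derivative Vt) (at t0)"
      using V(3) unfolding parabolic_jet_def by blast
    have each: "E * (Du2 b - DV2 b) \<le> 2 * \<eta>" if b: "b \<in> Basis" for b
    proof -
      have l1: "line_derivs (\<lambda>y. E * u y t0 + (- E) * V y t0) x0 b (E * Du1 b + (-E) * DV1 b) (E * Du2 b + (-E) * DV2 b)"
        by (rule line_derivs_lincomb[OF Du(1)[OF b] DV(1)[OF b]])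
      have l2: "line_derivs (\<lambda>y. 1 * (E * u y t0 + (- E) * V y t0) + (-\<eta>) * (norm (y - 0))\<^sup>2) x0 b
          (1 * (E * Du1 b + (-E) * DV1 b) + (-\<eta>) * (2 * ((x0 - 0) \<bullet> b))) (1 * (E * Du2 b + (-E) * DV2 b) + (-\<eta>) * (2 * (b \<bullet> b)))"
        by (rule line_derivs_lincomb[OF l1 line_derivs_norm_sq])
      have lim: "((\<lambda>s. (x0 + s *\<^sub>R b, t0)) \<longlongrightarrow> (x0, t0)) (nhds (0::real))"
        by (rule tendsto_eq_rhs[OF tendsto_Pair[OF tendsto_add[OF tendsto_const tendsto_scaleR[OF filterlim_ident tendsto_const]] tendsto_const]]) simp
      have "\<forall>\<^sub>F s in nhds 0. G (x0 + s *\<^sub>R b) t0 \<le> G x0 t0"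
        using eventually_compose_filterlim[OF GM lim] q0(1) by simp
      hence ev: "\<forall>\<^sub>F s in nhds 0. 1 * (E * u (x0 + s *\<^sub>R b) t0 + (- E) * V (x0 + s *\<^sub>R b) t0) + (-\<eta>) * (norm (x0 + s *\<^sub>R b - 0))\<^sup>2
         \<le> 1 * (E * u x0 t0 + (- E) * V x0 t0) + (-\<eta>) * (norm (x0 - 0))\<^sup>2"
        by eventually_elim (simp add: G_def E_def algebra_simps)
      have "1 * (E * Du2 b + (-E) * DV2 b) + (-\<eta>) * (2 * (b \<bullet> b)) \<le> 0"
        by (rule line_derivs_max[OF l2 ev])
      thus ?thesis using b by (simp add: algebra_simps)
    qed
    have lap: "E * (lu - lV) \<le> 2 * \<eta> * n"
    proof -
      have "E * (lu - lV) = (\<Sum>b\<in>Basis. E * (Du2 b - DV2 b))"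
        unfolding Du(2) DV(2) by (simp add: sum_subtractf sum_distrib_left right_diff_distrib)
      also have "\<dots> \<le> (\<Sum>b\<in>(Basis::'a set). 2 * \<eta>)" by (rule sum_mono[OF each])
      finally show ?thesis by (simp add: n_def algebra_simps)
    qed
    \<comment> \<open>The maximum is over times up to \<open>t1\<close>, which \<open>t0\<close> may equal; looking to the left of \<open>t0\<close> still gives one sign.\<close>
    have dG: "((\<lambda>s. G x0 s) has_real_derivative (ut - Vt - L' * (u x0 t0 - V x0 t0)) * E - \<eta> * K) (at t0)"
      unfolding G_def E_def by (rule derivative_eq_intros Du(3) DV(3) refl | simp add: algebra_simps)+
    have limt: "((\<lambda>s. (x0, s)) \<longlongrightarrow> (x0, t0)) (nhds t0)"
      by (intro tendsto_intros filterlim_ident)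
    have "\<forall>\<^sub>F s in nhds t0. s \<in> {0..t1} \<longrightarrow> G x0 s \<le> G x0 t0"
      using eventually_compose_filterlim[OF GM limt] by simp
    then obtain h where h: "h > 0" "\<And>s. \<bar>s - t0\<bar> < h \<Longrightarrow> s \<in> {0..t1} \<Longrightarrow> G x0 s \<le> G x0 t0"
      unfolding eventually_nhds_metric dist_real_def by auto
    have time: "(ut - Vt - L' * (u x0 t0 - V x0 t0)) * E - \<eta> * K \<ge> 0"
    proof (rule ccontr)
      assume "\<not> ?thesis"
      hence "(ut - Vt - L' * (u x0 t0 - V x0 t0)) * E - \<eta> * K < 0" by simp
      from DERIV_neg_dec_left[OF dG this] obtain d where d: "d > 0" "\<And>k. 0 < k \<Longrightarrow> k < d \<Longrightarrow> G x0 t0 < G x0 (t0 - k)" by auto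
      define k where "k = min (min d h) t0 / 2"
      have k: "0 < k" "k < d" "k < h" "k < t0" unfolding k_def using d h t0 by auto
      show False using d(2)[OF k(1,2)] h(2)[of "t0 - k"] k q0 by auto
    qed
    have pos: "u x0 t0 - V x0 t0 > 0"
    proof (rule ccontr)
      assume "\<not> ?thesis"
      hence "(u x0 t0 - V x0 t0) * exp (- L' * t0) \<le> 0" by (intro mult_nonpos_nonneg) auto
      moreover have "\<eta> * ((norm x0)\<^sup>2 + K * t0) \<ge> 0" using eta n0 t0 by simp
      ultimately have "G x0 t0 \<le> 0" unfolding G_def by linarith
      thus False using M0 G0 by simp
    qed
    have "f x0 t0 (u x0 t0) - f x0 t0 (V x0 t0) \<le> L * (u x0 t0 - V x0 t0)"
      using lip[OF t0T(2) bdu[OF t0T(2)], of "V x0 t0" x0 x0] bdw[OF t0T(2) q0(2), of x0] pos unfolding V(1) by auto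
    hence "ut - Vt \<le> (lu - lV) + L * (u x0 t0 - V x0 t0)" using U(2) V(4) by linarith
    hence "(ut - Vt) * E \<le> ((lu - lV) + L * (u x0 t0 - V x0 t0)) * E" using E by (intro mult_right_mono) auto
    hence "(ut - Vt) * E \<le> 2 * \<eta> * n + L * (u x0 t0 - V x0 t0) * E" using lap by (simp add: algebra_simps)
    hence "0 \<le> 2 * \<eta> * n + L * (u x0 t0 - V x0 t0) * E - L' * (u x0 t0 - V x0 t0) * E - \<eta> * K"
      using time by (simp add: algebra_simps)
    also have "\<dots> = (L - L') * ((u x0 t0 - V x0 t0) * E) - \<eta>" unfolding K_def by (simp add: algebra_simps)
    also have "\<dots> < 0"
    proof -
      have "L - L' < 0" unfolding L'_def by simp
      hence "(L - L') * ((u x0 t0 - V x0 t0) * E) \<le> 0" using pos E by (intro mult_nonpos_nonneg) auto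
      thus ?thesis using eta by simp
    qed
    finally show False by simp
  qed
  show ?thesis
  proof (cases "t < T")
    case True thus ?thesis using main[of t p x] tp by auto
  next
    case False
    hence tT: "t = T" using tp by auto
    have c1: "continuous_on {0..T} (\<lambda>s. u x s)"
    proof -
      have "continuous_on {0..T} ((\<lambda>(x, t). u x t) \<circ> (\<lambda>s. (x, s)))"
        by (intro continuous_on_compose continuous_intros continuous_on_subset[OF contu]) auto
      thus ?thesis by (simp add: comp_def)
    qed
    have c2: "continuous_on {0..T} (\<lambda>s. w x s p)"
    proof -
      have "continuous_on {0..T} ((\<lambda>(x, t, p). w x t p) \<circ> (\<lambda>s. (x, s, p)))"
        by (intro continuous_on_compose continuous_intros continuous_on_subset[OF contw]) (use tp in auto)
      thus ?thesis by (simp add: comp_def)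
    qed
    have cl: "closure {0..<T} = {0..T}" using T by simp
    have "(\<lambda>s. u x s - w x s p) T \<le> 0"
    proof (rule continuous_le_on_closure[of "{0..<T}" "\<lambda>s. u x s - w x s p"])
      show "continuous_on (closure {0..<T}) (\<lambda>s. u x s - w x s p)" unfolding cl by (intro continuous_intros c1 c2)
      show "T \<in> closure {0..<T}" unfolding cl using T by simp
    qed (use main[of _ p x] tp in auto)
    thus ?thesis using tT by simp
  qed
qed

section \<open>The corrector profile\<close>

lemma nonneg_if_antimono_to_zero:
  fixes f f' :: "real \<Rightarrow> real"
  assumes "\<And>x. x \<ge> a \<Longrightarrow> (f has_real_derivative f' x) (at x)" "\<And>x. x \<ge> a \<Longrightarrow> f' x \<le> 0"
    and "(f \<longlongrightarrow> 0) at_top" "x \<ge> a"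
  shows "f x \<ge> 0"
proof (rule tendsto_upperbound[OF assms(3)])
  show "\<forall>\<^sub>F y in at_top. f y \<le> f x"
    using eventually_ge_at_top[of x]
  proof eventually_elim
    case (elim y)
    show ?case
      by (rule DERIV_nonpos_imp_nonincreasing[OF elim]) (use assms(1,2,4) in \<open>meson order_trans\<close>)
  qed
qed simp

text \<open>The function \<open>y \<mapsto> \<integral>\<^sub>y\<^sup>\<infinity> s / cosh\<^sup>4 s
  ds\<close> in closed form.\<close>

definition profile_tail :: "real \<Rightarrow> real" where
  "profile_tail y = (2/3) * ln 2 - 1/6 - y * (tanh y - tanh y ^ 3 / 3) + (2/3) * ln (cosh y) + (tanh y)\<^sup>2 / 6"

lemma cosh_sech: "1 - (tanh y)\<^sup>2 = 1 / (cosh y)\<^sup>2" for y :: real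
proof -
  have "(cosh y)\<^sup>2 - (sinh y)\<^sup>2 = 1" by (rule hyperbolic_pythagoras)
  moreover have "1 - (tanh y)\<^sup>2 = ((cosh y)\<^sup>2 - (sinh y)\<^sup>2) / (cosh y)\<^sup>2"
    unfolding tanh_def by (simp add: power_divide diff_divide_distrib)
  ultimately show ?thesis by simp
qed

lemma profile_tail_deriv: "(profile_tail has_real_derivative - y * (1 - (tanh y)\<^sup>2)\<^sup>2) (at y)"
proof -
  have l: "((\<lambda>y. ln (cosh y)) has_real_derivative tanh y) (at y)" for y :: real
    unfolding tanh_def by (rule derivative_eq_intros refl | simp)+
  have "((\<lambda>y. (2/3) * ln 2 - 1/6 - y * (tanh y - tanh y ^ 3 / 3) + (2/3) * f y + (tanh y)\<^sup>2 / 6) has_real_derivative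
      - (1 * (tanh y - tanh y ^ 3 / 3) + ((1 - (tanh y)\<^sup>2) - (3 * (tanh y)\<^sup>2 * (1 - (tanh y)\<^sup>2)) / 3) * y)
      + (2/3) * tanh y + (2 * tanh y * (1 - (tanh y)\<^sup>2)) / 6) (at y)"
    if "(f has_real_derivative tanh y) (at y)" for f
    by (rule derivative_eq_intros that refl | simp)+
  from this[OF l] have "(profile_tail has_real_derivative
      - (1 * (tanh y - tanh y ^ 3 / 3) + ((1 - (tanh y)\<^sup>2) - (3 * (tanh y)\<^sup>2 * (1 - (tanh y)\<^sup>2)) / 3) * y)
      + (2/3) * tanh y + (2 * tanh y * (1 - (tanh y)\<^sup>2)) / 6) (at y)"
    unfolding profile_tail_def .
  moreover have "- (1 * (t - t ^ 3 / 3) + ((1 - t\<^sup>2) - (3 * t\<^sup>2 * (1 - t\<^sup>2)) / 3) * y)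
      + (2/3) * t + (2 * t * (1 - t\<^sup>2)) / 6 = - y * (1 - t\<^sup>2)\<^sup>2" for t
    by (simp add: power2_eq_square power3_eq_cube field_simps)
  ultimately show ?thesis by simp
qed

lemma profile_tail_limit: "(profile_tail \<longlongrightarrow> 0) at_top"
proof -
  have "profile_tail y = (2/3) * ln (1 + exp (-2*y)) + (tanh y)\<^sup>2 / 6 - 1/6 + y * (2/3 - tanh y + tanh y ^ 3 / 3)" for y
  proof -
    have "cosh y = exp y * ((1 + exp (-2*y)) / 2)"
      unfolding cosh_def by (simp add: field_simps flip: exp_add)
    hence "ln (cosh y) = ln (exp y * ((1 + exp (-2*y)) / 2))" by (rule arg_cong)
    also have "\<dots> = ln (exp y) + ln ((1 + exp (-2*y)) / 2)"
      by (rule ln_mult_pos) (auto intro!: divide_pos_pos add_pos_pos)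
    also have "ln ((1 + exp (-2*y)) / 2) = ln (1 + exp (-2*y)) - ln 2"
      by (rule ln_divide_pos) (auto intro!: add_pos_pos)
    finally have "ln (cosh y) = y + ln (1 + exp (-2*y)) - ln 2" by simp
    thus ?thesis unfolding profile_tail_def by (simp add: algebra_simps)
  qed
  hence eq: "profile_tail = (\<lambda>y. (2/3) * ln (1 + exp (-2*y)) + (tanh y)\<^sup>2 / 6 - 1/6 + y * (2/3 - tanh y + tanh y ^ 3 / 3))" by blast
  have th: "tanh y = (1 - exp (-2*y)) / (1 + exp (-2*y))" for y :: real
    by (rule tanh_real_altdef)
  show ?thesis unfolding eq th by real_asymp
qed

text \<open>Solutions of the linear equation \<open>\<psi>' y = 4 * tanh y * \<psi> y + y\<close> differ by
  multiples of \<open>cosh\<^sup>4\<close>. The one with integrating factor started at infinity, \<open>\<psi>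
  = - cosh\<^sup>4 profile_tail\<close>, grows only linearly to the right; it is even, so also to the left.\<close>

lemma corrector_profile:
  obtains \<psi> \<phi> :: "real \<Rightarrow> real" and C where "C \<ge> 1"
    "\<And>y. (\<psi> has_real_derivative 4 * tanh y * \<psi> y + y) (at y)"
    "\<And>y. (\<phi> has_real_derivative \<psi> y) (at y)"
    "\<And>y. \<bar>\<psi> y\<bar> \<le> C * (1 + \<bar>y\<bar>)"
    "\<And>y. \<bar>\<phi> y\<bar> \<le> C * (1 + y\<^sup>2)"
proof -
  define \<psi> where "\<psi> = (\<lambda>y. - (cosh y ^ 4) * profile_tail y)"
  have d\<psi>: "(\<psi> has_real_derivative 4 * tanh y * \<psi> y + y) (at y)" for y
  proof -
    have e: "cosh y ^ 4 * (1 - (tanh y)\<^sup>2)\<^sup>2 = 1"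
      unfolding cosh_sech by (simp add: power_divide)
    have c3: "cosh y ^ 3 * sinh y = cosh y ^ 4 * tanh y"
      by (simp add: tanh_def power_numeral_reduce)
    have "(\<psi> has_real_derivative - (4 * (cosh y ^ 3 * sinh y)) * profile_tail y + (- (- y * (1 - (tanh y)\<^sup>2)\<^sup>2)) * cosh y ^ 4) (at y)"
      unfolding \<psi>_def by (rule derivative_eq_intros profile_tail_deriv refl | simp)+
    also have "- (4 * (cosh y ^ 3 * sinh y)) * profile_tail y + (- (- y * (1 - (tanh y)\<^sup>2)\<^sup>2)) * cosh y ^ 4
       = 4 * tanh y * \<psi> y + y * (cosh y ^ 4 * (1 - (tanh y)\<^sup>2)\<^sup>2)"
      unfolding c3 \<psi>_def by (simp add: algebra_simps)
    finally show ?thesis unfolding e by simp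
  qed
  have cont: "continuous_on A \<psi>" for A
    using d\<psi> by (meson DERIV_continuous continuous_at_imp_continuous_on)
  have tail0: "profile_tail y \<ge> 0" if "y \<ge> 0" for y
    by (rule nonneg_if_antimono_to_zero[OF profile_tail_deriv _ profile_tail_limit that]) simp
  define U where "U = (\<lambda>y::real. (1 + y) * (1 - (tanh y)\<^sup>2)\<^sup>2)"
  have tail1: "profile_tail y \<le> U y" if y: "y \<ge> 1" for y
  proof -
    have th: "tanh y = (1 - exp (-2*y)) / (1 + exp (-2*y))" for y :: real
      by (rule tanh_real_altdef)
    have lim: "((\<lambda>y. U y - profile_tail y) \<longlongrightarrow> 0) at_top"
    proof -
      have "(U \<longlongrightarrow> 0) at_top" unfolding U_def th by real_asymp
      from tendsto_diff[OF this profile_tail_limit] show ?thesis by simp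
    qed
    have e2: "exp (2::real) \<ge> 3" using exp_ge_add_one_self[of "2::real"] by simp
    have "exp (-2::real) \<le> 1/3" unfolding exp_minus using le_imp_inverse_le[OF e2] by simp
    hence t1: "tanh 1 \<ge> (1/2::real)"
      unfolding th by (simp add: field_simps add_pos_pos)
    have "U y - profile_tail y \<ge> 0"
    proof (rule nonneg_if_antimono_to_zero[OF _ _ lim y])
      fix y :: real assume y: "y \<ge> 1"
      have t: "tanh y \<ge> 1/2" using t1 y by (meson order_trans tanh_real_le_iff)
      define S where "S = 1 - (tanh y)\<^sup>2"
      show "((\<lambda>y. U y - profile_tail y) has_real_derivative S\<^sup>2 + (1 + y) * (2 * S * (- (2 * tanh y * S))) - (- y * S\<^sup>2)) (at y)"
        unfolding U_def S_def
        by (rule derivative_eq_intros profile_tail_deriv refl | simp)+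
      have "S\<^sup>2 + (1 + y) * (2 * S * (- (2 * tanh y * S))) - (- y * S\<^sup>2) = S\<^sup>2 * ((1 + y) * (1 - 4 * tanh y))"
        by (simp add: power2_eq_square algebra_simps)
      also have "\<dots> \<le> 0" using t y by (intro mult_nonneg_nonpos) auto
      finally show "S\<^sup>2 + (1 + y) * (2 * S * (- (2 * tanh y * S))) - (- y * S\<^sup>2) \<le> 0" .
    qed
    thus ?thesis by simp
  qed
  obtain C1 where C1: "\<And>y. y \<in> {0..1} \<Longrightarrow> \<bar>\<psi> y\<bar> \<le> C1"
  proof -
    have "compact (\<psi> ` {0..1})" by (intro compact_continuous_image cont compact_Icc)
    hence "bounded (\<psi> ` {0..1})" by (rule compact_imp_bounded)
    then obtain a where "\<forall>x\<in>{0..1}. \<bar>\<psi> x\<bar> \<le> a" unfolding bounded_iff by auto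
    thus ?thesis using that[of a] by blast
  qed
  define C where "C = \<bar>C1\<bar> + 1"
  have C: "C \<ge> 1" unfolding C_def by simp
  have bpos: "\<bar>\<psi> y\<bar> \<le> C * (1 + y)" if y: "y \<ge> 0" for y
  proof (cases "y \<le> 1")
    case True
    have "\<bar>\<psi> y\<bar> \<le> C * 1" using C1[of y] True y unfolding C_def by auto
    also have "\<dots> \<le> C * (1 + y)" using C y by (intro mult_left_mono) auto
    finally show ?thesis .
  next
    case False
    have e: "cosh y ^ 4 * (1 - (tanh y)\<^sup>2)\<^sup>2 = 1"
      unfolding cosh_sech by (simp add: power_divide)
    have "\<bar>\<psi> y\<bar> = cosh y ^ 4 * profile_tail y" unfolding \<psi>_def using tail0[OF y] by (simp add: abs_mult)
    also have "\<dots> \<le> cosh y ^ 4 * U y" using tail1 False by (intro mult_left_mono) auto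
    also have "\<dots> = (1 + y) * (cosh y ^ 4 * (1 - (tanh y)\<^sup>2)\<^sup>2)" unfolding U_def by simp
    also have "\<dots> = 1 * (1 + y)" unfolding e by simp
    also have "\<dots> \<le> C * (1 + y)" using C y by (intro mult_right_mono) auto
    finally show ?thesis .
  qed
  have even: "\<psi> (- y) = \<psi> y" for y unfolding \<psi>_def profile_tail_def by (simp add: algebra_simps)
  have b\<psi>: "\<bar>\<psi> y\<bar> \<le> C * (1 + \<bar>y\<bar>)" for y
    using bpos[of y] bpos[of "-y"] even[of y] by (cases "y \<ge> 0") auto
  define \<phi> where "\<phi> = (\<lambda>u. LBINT y=0..ereal u. \<psi> y)"
  have d\<phi>: "(\<phi> has_real_derivative \<psi> y) (at y)" for y
  proof -
    have "(\<phi> has_vector_derivative \<psi> y) (at y within {-\<bar>y\<bar>-1..\<bar>y\<bar>+1})"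
      unfolding \<phi>_def zero_ereal_def
      by (rule interval_integral_FTC2) (auto intro: cont)
    moreover have "at y within {-\<bar>y\<bar>-1..\<bar>y\<bar>+1} = at y"
      by (rule at_within_interior) auto
    ultimately show ?thesis by (simp add: has_real_derivative_iff_has_vector_derivative)
  qed
  have \<phi>0: "\<phi> 0 = 0" unfolding \<phi>_def by (simp add: zero_ereal_def)
  have b\<phi>: "\<bar>\<phi> y\<bar> \<le> (2 * C) * (1 + y\<^sup>2)" for y
  proof -
    have "norm (\<phi> y - \<phi> 0) \<le> (C * (1 + \<bar>y\<bar>)) * norm (y - 0)"
    proof (rule field_differentiable_bound[of "{-\<bar>y\<bar>..\<bar>y\<bar>}" \<phi> \<psi>])
      fix x assume "x \<in> {-\<bar>y\<bar>..\<bar>y\<bar>}"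
      hence "\<bar>x\<bar> \<le> \<bar>y\<bar>" by auto
      hence "C * (1 + \<bar>x\<bar>) \<le> C * (1 + \<bar>y\<bar>)" using C by (intro mult_left_mono) auto
      thus "norm (\<psi> x) \<le> C * (1 + \<bar>y\<bar>)" using b\<psi>[of x] by simp
    qed (use d\<phi> in \<open>auto intro: has_field_derivative_at_within\<close>)
    hence "\<bar>\<phi> y\<bar> \<le> C * ((1 + \<bar>y\<bar>) * \<bar>y\<bar>)" unfolding \<phi>0 by (simp add: mult.assoc)
    also have "(1 + \<bar>y\<bar>) * \<bar>y\<bar> \<le> 2 * (1 + y\<^sup>2)"
    proof -
      have "0 \<le> (\<bar>y\<bar> - 1)\<^sup>2" by simp
      thus ?thesis by (simp add: power2_eq_square algebra_simps)
    qed
    finally show ?thesis using C by (simp add: mult_left_mono algebra_simps)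
  qed
  show ?thesis
  proof (rule that[of "2 * C" \<psi> \<phi>])
    fix y :: real
    have "C * (1 + \<bar>y\<bar>) \<le> (2*C) * (1 + \<bar>y\<bar>)" using C by (intro mult_right_mono) auto
    thus "\<bar>\<psi> y\<bar> \<le> 2 * C * (1 + \<bar>y\<bar>)" using b\<psi>[of y] by linarith
  qed (use C d\<psi> d\<phi> b\<phi> in auto)
qed

section \<open>Bending the distance\<close>

text \<open>One minus the slope of \<open>r \<mapsto> r - R s\<^sup>4 / (1 + s)\<close>, where \<open>s = r /
  R\<close>.\<close>

definition bent_slope :: "real \<Rightarrow> real" where "bent_slope s = s ^ 3 * (4 + 3 * s) / (1 + s)\<^sup>2"

text \<open>The quantity \<open>\<bar>bent_slope s\<bar> * \<bar>2 - bent_slope s\<bar>\<close> is the modulus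
  of the square of the slope minus 1. It has to control the slope defect and the second derivative, uniformly
  up to the singularity at \<open>s = -1\<close>; the number \<open>7/4\<close>, the value at \<open>s =
  1\<close>, keeps it away from the degenerate value 2.\<close>

lemma bent_slope_bounds:
  assumes s: "-1 < s" "s \<le> 1"
  shows "\<bar>bent_slope s\<bar> \<le> 4 * (\<bar>bent_slope s\<bar> * \<bar>2 - bent_slope s\<bar>)"
    and "\<bar>s\<bar> ^ 3 \<le> \<bar>bent_slope s\<bar>"
    and "\<bar>s\<bar> ^ 3 / (1 + s) \<le> \<bar>bent_slope s\<bar>"
    and "s \<ge> 0 \<Longrightarrow> 0 \<le> bent_slope s \<and> bent_slope s \<le> 7 / 4"
    and "s \<le> 0 \<Longrightarrow> bent_slope s \<le> 0"
    and "\<bar>s\<bar> ^ 3 * (12 + 16 * s + 6 * s\<^sup>2) / (1 + s) ^ 3 \<le> 12 * (\<bar>bent_slope s\<bar> * \<bar>2 - bent_slope s\<bar>)"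
    and "\<bar>s\<bar> \<le> 1/2 \<Longrightarrow> \<bar>bent_slope s\<bar> \<le> 22 * \<bar>s\<bar> ^ 3"
    and "\<bar>s\<bar> \<le> 1/2 \<Longrightarrow> \<bar>bent_slope s\<bar> * \<bar>2 - bent_slope s\<bar> \<le> 110 * \<bar>s\<bar> ^ 3"
    and "\<bar>s\<bar> \<le> 1/2 \<Longrightarrow> \<bar>s\<bar> ^ 3 * (12 + 16 * s + 6 * s\<^sup>2) / (1 + s) ^ 3 \<le> 172 * \<bar>s\<bar> ^ 3"
proof -
  define v where "v = 1 + s"
  have v: "v > 0" "v \<le> 2" using s by (auto simp: v_def)
  have sv: "s = v - 1" by (simp add: v_def)
  have abs: "\<bar>bent_slope s\<bar> = \<bar>s\<bar> ^ 3 * ((4 + 3 * s) / v\<^sup>2)"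
    unfolding bent_slope_def v_def using s by (simp add: abs_mult power_abs)
  have k1: "(4 + 3 * s) / v\<^sup>2 \<ge> 1"
  proof -
    have "v * v \<le> 2 * v" using v by (intro mult_right_mono) auto
    also have "2 * v \<le> 4 + 3 * s" unfolding sv using v by simp
    finally have "v\<^sup>2 \<le> 4 + 3 * s" unfolding power2_eq_square .
    thus ?thesis using v by simp
  qed
  have k2: "(4 + 3 * s) / v\<^sup>2 \<ge> 1 / v"
  proof -
    have "v \<le> 4 + 3 * s" using s by (simp add: v_def)
    hence "v / v\<^sup>2 \<le> (4 + 3 * s) / v\<^sup>2" by (intro divide_right_mono) auto
    thus ?thesis using v by (simp add: power2_eq_square)
  qed
  show cube: "\<bar>s\<bar> ^ 3 \<le> \<bar>bent_slope s\<bar>" unfolding abs using mult_left_mono[OF k1, of "\<bar>s\<bar>^3"] by simp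
  show "\<bar>s\<bar> ^ 3 / (1 + s) \<le> \<bar>bent_slope s\<bar>" unfolding abs v_def[symmetric]
    using mult_left_mono[OF k2, of "\<bar>s\<bar>^3"] by simp
  show pos: "0 \<le> bent_slope s \<and> bent_slope s \<le> 7 / 4" if s0: "s \<ge> 0"
  proof
    show "0 \<le> bent_slope s" unfolding bent_slope_def using s0 by simp
    have a: "s ^ 3 \<le> s * 1" using s0 s by (simp add: power3_eq_cube mult_le_one mult.assoc mult_left_le)
    have "s\<^sup>2 * (1 - s) \<ge> 0" "s * (1 - s) \<ge> 0" "s\<^sup>2*(1 - s\<^sup>2) \<ge> 0" using s0 s by (auto simp: power_le_one)
    hence "4 * (s ^ 3 * (4 + 3 * s)) \<le> 7 * v\<^sup>2" unfolding v_def using s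
      by (simp add: power_numeral_reduce algebra_simps)
    thus "bent_slope s \<le> 7 / 4" unfolding bent_slope_def v_def[symmetric] using v by (simp add: field_simps)
  qed
  show neg: "bent_slope s \<le> 0" if "s \<le> 0"
  proof -
    have "s ^ 3 \<le> 0" using that by (simp add: power_le_zero_eq)
    thus ?thesis unfolding bent_slope_def using s by (intro divide_nonpos_nonneg mult_nonpos_nonneg) auto
  qed
  have d: "\<bar>2 - bent_slope s\<bar> \<ge> 1/4" using pos neg by (cases "s \<ge> 0") auto
  from mult_left_mono[OF d, of "\<bar>bent_slope s\<bar>"]
  show G: "\<bar>bent_slope s\<bar> \<le> 4 * (\<bar>bent_slope s\<bar> * \<bar>2 - bent_slope s\<bar>)" by simp
  show "\<bar>s\<bar> ^ 3 * (12 + 16 * s + 6 * s\<^sup>2) / (1 + s) ^ 3 \<le> 12 * (\<bar>bent_slope s\<bar> * \<bar>2 - bent_slope s\<bar>)"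
  proof (cases "s \<ge> 0")
    case True
    have "12 + 16 * s + 6 * s\<^sup>2 \<le> 3 * ((1 + s) * (4 + 3 * s))" using True by (simp add: power2_eq_square algebra_simps)
    hence "(12 + 16 * s + 6 * s\<^sup>2) / (1 + s) ^ 3 \<le> 3 * ((1 + s) * (4 + 3 * s)) / (1 + s) ^ 3"
      using True by (intro divide_right_mono) auto
    also have "\<dots> = 3 * ((4 + 3 * s) / v\<^sup>2)" using True by (simp add: v_def power3_eq_cube power2_eq_square)
    finally have "\<bar>s\<bar> ^ 3 * ((12 + 16 * s + 6 * s\<^sup>2) / (1 + s) ^ 3) \<le> \<bar>s\<bar> ^ 3 * (3 * ((4 + 3 * s) / v\<^sup>2))"
      by (intro mult_left_mono) auto
    also have "\<dots> = 3 * \<bar>bent_slope s\<bar>" unfolding abs by simp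
    finally show ?thesis using G by simp
  next
    case False
    define A where "A = \<bar>s\<bar> ^ 3"
    have A: "A \<ge> 0" "A = (1 - v) ^ 3" unfolding A_def sv using False by (auto simp: v_def)
    have v1: "v < 1" using False by (simp add: v_def)
    define b where "b = \<bar>bent_slope s\<bar>"
    have bv: "b = A * (1 + 3 * v) / v\<^sup>2" 
    proof -
      have "4 + 3 * s = 1 + 3 * v" by (simp add: v_def)
      thus ?thesis unfolding b_def abs A_def by simp
    qed
    have b0: "b \<ge> 0" unfolding b_def by simp
    have G2: "\<bar>bent_slope s\<bar> * \<bar>2 - bent_slope s\<bar> = 2 * b + b\<^sup>2"
      unfolding b_def using neg False by (simp add: power2_eq_square algebra_simps)
    have num: "12 + 16 * s + 6 * s\<^sup>2 = 2 + 4 * v + 6 * v\<^sup>2" unfolding sv by (simp add: power2_eq_square algebra_simps)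
    have split: "A * (2 + 4 * v + 6 * v\<^sup>2) / v ^ 3 = A * (4 + 6 * v) / v\<^sup>2 + 2 * A / v ^ 3"
      using v by (simp add: field_simps power2_eq_square power3_eq_cube)
    have p1: "A * (4 + 6 * v) / v\<^sup>2 \<le> 4 * b"
    proof -
      have "A * (4 + 6 * v) \<le> 4 * (A * (1 + 3 * v))" using A v by (simp add: algebra_simps)
      hence "A * (4 + 6 * v) / v\<^sup>2 \<le> 4 * (A * (1 + 3 * v)) / v\<^sup>2" by (intro divide_right_mono) auto
      thus ?thesis unfolding bv by simp
    qed
    have p2: "2 * A / v ^ 3 \<le> 4 * b + 8 * b\<^sup>2"
    proof (cases "v \<ge> 1/2")
      case True
      have "2 * A \<le> 4 * (A * (1 + 3 * v) * v)"
      proof -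
        have "1 \<le> 2 * v + 6 * v\<^sup>2" using True by (auto simp: add_increasing2)
        hence "A * 1 \<le> A * (2 * v + 6 * v\<^sup>2)" using A by (intro mult_left_mono) auto
        thus ?thesis by (simp add: algebra_simps power2_eq_square)
      qed
      hence "2 * A / v ^ 3 \<le> 4 * (A * (1 + 3 * v) * v) / v ^ 3" using v by (intro divide_right_mono) auto
      also have "\<dots> = 4 * b" unfolding bv using v by (simp add: power3_eq_cube power2_eq_square)
      also have "\<dots> \<le> 4 * b + 8 * b\<^sup>2" by simp
      finally show ?thesis .
    next
      case False
      have A8: "A \<ge> 1/8" 
      proof -
        have "(1/2) ^ 3 \<le> (1 - v) ^ 3" using False v by (intro power_mono) auto
        thus ?thesis using A(2) by (simp add: power3_eq_cube)
      qed
      have "2 * A * v \<le> 8 * (A * (1 + 3 * v))\<^sup>2"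
      proof -
        have "2 * A * v \<le> A * 1" using False A v by (simp add: mult_le_cancel_left1 algebra_simps)
        also have "\<dots> \<le> 8 * (A * A)" using A8 A mult_left_mono[of "1" "8 * A" A] by (simp add: algebra_simps)
        also have "\<dots> \<le> 8 * (A * (1 + 3 * v))\<^sup>2"
        proof -
          have "A \<le> A * (1 + 3 * v)" using mult_left_mono[of 1 "1 + 3 * v" A] A(1) v by simp
          from power_mono[OF this A(1), of 2] show ?thesis by (simp add: power2_eq_square)
        qed
        finally show ?thesis .
      qed
      hence "2 * A * v / v ^ 4 \<le> 8 * (A * (1 + 3 * v))\<^sup>2 / v ^ 4" by (intro divide_right_mono) auto
      moreover have "2 * A * v / v ^ 4 = 2 * A / v ^ 3" using v by (simp add: power_numeral_reduce)
      moreover have "8 * (A * (1 + 3 * v))\<^sup>2 / v ^ 4 = 8 * b\<^sup>2" unfolding bv by (simp add: power_divide flip: power_mult)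
      ultimately show ?thesis using b0 by simp
    qed
    show ?thesis unfolding G2 num A_def[symmetric] v_def[symmetric] split
      by (rule order_trans[OF add_mono[OF p1 p2]]) (use b0 in simp)
  qed
  {
    assume h: "\<bar>s\<bar> \<le> 1/2"
    have v2: "v \<ge> 1/2" using h by (auto simp: v_def)
    have vv: "v\<^sup>2 \<ge> 1/4" using power_mono[OF v2, of 2] by (simp add: power2_eq_square)
    have v3: "v ^ 3 \<ge> 1/8" using power_mono[OF v2, of 3] by (simp add: power3_eq_cube)
    have "(4 + 3 * s) / v\<^sup>2 \<le> 22"
    proof -
      have "4 + 3 * s \<le> 22 * v\<^sup>2" using h vv by auto
      thus ?thesis using v by (simp add: field_simps)
    qed
    from mult_left_mono[OF this, of "\<bar>s\<bar>^3"] show e: "\<bar>bent_slope s\<bar> \<le> 22 * \<bar>s\<bar> ^ 3" unfolding abs by simp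
    have "\<bar>s\<bar> ^ 3 \<le> (1/2) ^ 3" using h by (intro power_mono) auto
    hence "\<bar>2 - bent_slope s\<bar> \<le> 5" using e by (simp add: power3_eq_cube)
    from mult_mono[OF e this] show "\<bar>bent_slope s\<bar> * \<bar>2 - bent_slope s\<bar> \<le> 110 * \<bar>s\<bar> ^ 3" by simp
    have "s\<^sup>2 \<le> (1/2)\<^sup>2" using h by (subst abs_le_square_iff[symmetric]) auto
    hence "12 + 16 * s + 6 * s\<^sup>2 \<le> 172 * v ^ 3" using h v3 by (simp add: power2_eq_square)
    hence "(12 + 16 * s + 6 * s\<^sup>2) / v ^ 3 \<le> 172" using v by (simp add: field_simps)
    from mult_left_mono[OF this, of "\<bar>s\<bar>^3"]
    show "\<bar>s\<bar> ^ 3 * (12 + 16 * s + 6 * s\<^sup>2) / (1 + s) ^ 3 \<le> 172 * \<bar>s\<bar> ^ 3" unfolding v_def[symmetric] by simp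
  }
qed

text \<open>Equals \<open>r\<close> up to fourth order at 0, tends to \<open>-\<infinity>\<close> as
  \<open>r\<close> decreases to \<open>-R\<close>, so that a barrier built on it reaches the constant 1 at
  \<open>r = -R\<close>. At \<open>r = R\<close> it is only \<open>R / 2\<close>, less than shortly before;
  hence a constant can take over there.\<close>

definition bent :: "real \<Rightarrow> real \<Rightarrow> real" where "bent R r = r - r ^ 4 / (R\<^sup>2 * (R + r))"
definition bent'' :: "real \<Rightarrow> real \<Rightarrow> real" where
  "bent'' R r = - (r\<^sup>2 * (12 * R\<^sup>2 + 16 * R * r + 6 * r\<^sup>2) / (R\<^sup>2 * (R + r) ^ 3))"

lemma bent_derivs:
  assumes R: "R > 0" and r: "r > - R"
  shows "(bent R has_real_derivative 1 - bent_slope (r / R)) (at r)"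
    and "((\<lambda>r. 1 - bent_slope (r / R)) has_real_derivative bent'' R r) (at r)"
proof -
  have nz: "R + r \<noteq> 0" "R \<noteq> 0" using R r by auto
  have b: "bent_slope (r / R) = r ^ 3 * (4 * R + 3 * r) / (R\<^sup>2 * (R + r)\<^sup>2)" if "R + r > 0" for r
  proof -
    have "1 + r / R = (R + r) / R" "4 + 3 * (r / R) = (4 * R + 3 * r) / R" using R by (auto simp: field_simps)
    thus ?thesis unfolding bent_slope_def using R that by (simp add: power_divide power_numeral_reduce)
  qed
  have "(bent R has_real_derivative 1 - (4 * r ^ 3 * (R\<^sup>2 * (R + r)) - r ^ 4 * R\<^sup>2) / (R\<^sup>2 * (R + r))\<^sup>2) (at r)"
    unfolding bent_def using nz by (auto intro!: derivative_eq_intros simp: power2_eq_square)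
  moreover have "(4 * r ^ 3 * (R\<^sup>2 * (R + r)) - r ^ 4 * R\<^sup>2) / (R\<^sup>2 * (R + r))\<^sup>2 = bent_slope (r / R)"
  proof -
    have "4 * r ^ 3 * (R\<^sup>2 * (R + r)) - r ^ 4 * R\<^sup>2 = R\<^sup>2 * (r ^ 3 * (4 * R + 3 * r))" by algebra
    thus ?thesis using b r nz by (simp add: power_mult_distrib power2_eq_square)
  qed
  ultimately show "(bent R has_real_derivative 1 - bent_slope (r / R)) (at r)" by simp
  have "((\<lambda>r. 1 - r ^ 3 * (4 * R + 3 * r) / (R\<^sup>2 * (R + r)\<^sup>2)) has_real_derivative
     - (((3 * r\<^sup>2 * (4 * R + 3 * r) + r ^ 3 * 3) * (R\<^sup>2 * (R + r)\<^sup>2) - r ^ 3 * (4 * R + 3 * r) * (R\<^sup>2 * (2 * (R + r)))) / (R\<^sup>2 * (R + r)\<^sup>2)\<^sup>2)) (at r)"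
    using nz by (auto intro!: derivative_eq_intros) (simp add: power2_eq_square algebra_simps)
  moreover have "((3 * r\<^sup>2 * (4 * R + 3 * r) + r ^ 3 * 3) * (R\<^sup>2 * (R + r)\<^sup>2) - r ^ 3 * (4 * R + 3 * r) * (R\<^sup>2 * (2 * (R + r)))) / (R\<^sup>2 * (R + r)\<^sup>2)\<^sup>2
     = r\<^sup>2 * (12 * R\<^sup>2 + 16 * R * r + 6 * r\<^sup>2) / (R\<^sup>2 * (R + r) ^ 3)"
  proof -
    have "(3 * r\<^sup>2 * (4 * R + 3 * r) + r ^ 3 * 3) * (R\<^sup>2 * (R + r)\<^sup>2) - r ^ 3 * (4 * R + 3 * r) * (R\<^sup>2 * (2 * (R + r)))
       = (R\<^sup>2 * (R + r)) * (r\<^sup>2 * (12 * R\<^sup>2 + 16 * R * r + 6 * r\<^sup>2))" by algebra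
    moreover have "(R\<^sup>2 * (R + r)\<^sup>2)\<^sup>2 = (R\<^sup>2 * (R + r)) * (R\<^sup>2 * (R + r) ^ 3)" by algebra
    ultimately show ?thesis using nz by simp
  qed
  ultimately have "((\<lambda>r. 1 - r ^ 3 * (4 * R + 3 * r) / (R\<^sup>2 * (R + r)\<^sup>2)) has_real_derivative bent'' R r) (at r)"
    unfolding bent''_def by simp
  moreover have "\<forall>\<^sub>F x in nhds r. 1 - r ^ 3 * (4 * R + 3 * r) / (R\<^sup>2 * (R + r)\<^sup>2) = 1 - r ^ 3 * (4 * R + 3 * r) / (R\<^sup>2 * (R + r)\<^sup>2)" by simp
  moreover have "\<forall>\<^sub>F x in nhds r. 1 - bent_slope (x / R) = 1 - x ^ 3 * (4 * R + 3 * x) / (R\<^sup>2 * (R + x)\<^sup>2)"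
    using eventually_nhds_in_open[of "{-R<..}" r] r by (auto elim!: eventually_mono simp: b)
  ultimately show "((\<lambda>r. 1 - bent_slope (r / R)) has_real_derivative bent'' R r) (at r)"
    by (subst DERIV_cong_ev[OF refl _ refl]) auto
qed

text \<open>Every error made by bending is measured by \<open>G\<close>, the modulus of \<open>m\<^sup>2 -
  1\<close> for the slope \<open>m\<close>, because \<open>G / \<epsilon>\<close> is the good term of the
  residual; the sign statements say that it is indeed good on both sides. The estimates for
  \<open>\<bar>r\<bar> \<le> R / 2\<close> serve the layer, where no good term is available.\<close>

lemma bent_facts:
  fixes R r :: real
  assumes R: "R > 0" and r: "-R < r" "r \<le> R"
  defines "a \<equiv> \<bar>bent_slope (r / R)\<bar>" and "G \<equiv> \<bar>(1 - bent_slope (r / R))\<^sup>2 - 1\<bar>"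
  shows "\<bar>bent R r - r\<bar> \<le> \<bar>r\<bar> * a" "a \<le> 4 * G" "\<bar>r\<bar> ^ 3 \<le> R ^ 3 * a" "\<bar>bent'' R r\<bar> * \<bar>r\<bar> \<le> 12 * G"
    "r \<ge> 0 \<Longrightarrow> (1 - bent_slope (r / R))\<^sup>2 - 1 = - G" "r \<le> 0 \<Longrightarrow> (1 - bent_slope (r / R))\<^sup>2 - 1 = G"
    "r \<ge> 0 \<Longrightarrow> bent R r \<ge> r / 2" "bent R r \<le> r - r ^ 4 / (2 * R ^ 3)" "bent R r \<le> r"
    "\<bar>r\<bar> \<le> R / 2 \<Longrightarrow> a \<le> 22 * (\<bar>r\<bar> ^ 3 / R ^ 3)" "\<bar>r\<bar> \<le> R / 2 \<Longrightarrow> G \<le> 110 * (\<bar>r\<bar> ^ 3 / R ^ 3)"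
    "\<bar>r\<bar> \<le> R / 2 \<Longrightarrow> \<bar>bent'' R r\<bar> \<le> 172 * (r\<^sup>2 / R ^ 3)"
proof -
  define s where "s = r / R"
  have s: "-1 < s" "s \<le> 1" using R r by (auto simp: s_def field_simps)
  have rs: "r = R * s" using R by (simp add: s_def)
  have ars: "\<bar>r\<bar> = R * \<bar>s\<bar>" unfolding rs using R by (simp add: abs_mult)
  note B = bent_slope_bounds[OF s]
  have Ga: "G = \<bar>bent_slope s\<bar> * \<bar>2 - bent_slope s\<bar>"
  proof -
    have "(1 - bent_slope s)\<^sup>2 - 1 = - (bent_slope s * (2 - bent_slope s))" by (simp add: power2_eq_square algebra_simps)
    thus ?thesis unfolding G_def s_def[symmetric] by (simp add: abs_mult)
  qed
  have aa: "a = \<bar>bent_slope s\<bar>" unfolding a_def s_def ..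
  have v: "1 + s > 0" using s by simp
  have bentd: "bent R r = r - R * (s ^ 4 / (1 + s))"
  proof -
    have "R + r = R * (1 + s)" unfolding rs by (simp add: algebra_simps)
    hence "bent R r = r - (R * s) ^ 4 / (R\<^sup>2 * (R * (1 + s)))" unfolding bent_def rs by simp
    also have "(R * s) ^ 4 / (R\<^sup>2 * (R * D)) = R * (s ^ 4 / D)" if "D > 0" for D
      using R that by (simp add: field_simps power_numeral_reduce)
    finally show ?thesis using v by simp
  qed
  have s4: "s ^ 4 = \<bar>s\<bar> * \<bar>s\<bar> ^ 3"
  proof -
    have "\<bar>s\<bar> * \<bar>s\<bar> ^ 3 = \<bar>s\<bar> ^ 4" by (simp add: power_numeral_reduce)
    thus ?thesis by (simp add: power_even_abs)
  qed
  show "\<bar>bent R r - r\<bar> \<le> \<bar>r\<bar> * a"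
  proof -
    have "\<bar>bent R r - r\<bar> = \<bar>r\<bar> * (\<bar>s\<bar> ^ 3 / (1 + s))"
      unfolding bentd ars using R v by (simp add: abs_mult s4)
    also have "\<dots> \<le> \<bar>r\<bar> * a" unfolding aa by (intro mult_left_mono B) auto
    finally show ?thesis .
  qed
  show "a \<le> 4 * G" unfolding aa Ga by (rule B)
  show "\<bar>r\<bar> ^ 3 \<le> R ^ 3 * a" unfolding aa ars using mult_left_mono[OF B(2), of "R^3"] R by (simp add: power_mult_distrib)
  have b2: "\<bar>bent'' R r\<bar> * \<bar>r\<bar> = \<bar>s\<bar> ^ 3 * (12 + 16 * s + 6 * s\<^sup>2) / (1 + s) ^ 3"
  proof -
    have nn: "12 + 16 * s + 6 * s\<^sup>2 \<ge> 0"
    proof -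
      have "12 + 16 * s + 6 * s\<^sup>2 = 6 * (s + 4/3)\<^sup>2 + 4/3" by (simp add: power2_eq_square algebra_simps)
      thus ?thesis by simp
    qed
    have "R + r = R * (1 + s)" unfolding rs by (simp add: algebra_simps)
    have "12 * R\<^sup>2 + 16 * R * r + 6 * r\<^sup>2 = R\<^sup>2 * (12 + 16 * s + 6 * s\<^sup>2)"
      unfolding rs by (simp add: power2_eq_square algebra_simps)
    have e: "bent'' R r = - (s\<^sup>2 * (12 + 16 * s + 6 * s\<^sup>2) / (R * (1 + s) ^ 3))"
    proof -
      have "(R * s)\<^sup>2 * (R\<^sup>2 * X) / (R\<^sup>2 * (R * D) ^ 3) = s\<^sup>2 * X / (R * D ^ 3)" if "D > 0" for X D
        using R that by (simp add: field_simps power_numeral_reduce)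
      thus ?thesis using v \<open>R + r = R * (1 + s)\<close>
          \<open>12 * R\<^sup>2 + 16 * R * r + 6 * r\<^sup>2 = R\<^sup>2 * (12 + 16 * s + 6 * s\<^sup>2)\<close>
        unfolding bent''_def by (simp add: rs)
    qed
    have "\<bar>bent'' R r\<bar> = s\<^sup>2 * (12 + 16 * s + 6 * s\<^sup>2) / (R * (1 + s) ^ 3)"
      unfolding e abs_minus_cancel using nn R v by (intro abs_of_nonneg) auto
    thus ?thesis unfolding ars using R v by (simp add: power3_eq_cube power2_eq_square abs_mult ac_simps)
  qed
  show "\<bar>bent'' R r\<bar> * \<bar>r\<bar> \<le> 12 * G" unfolding b2 Ga by (rule B)
  show "(1 - bent_slope (r / R))\<^sup>2 - 1 = - G" if "r \<ge> 0"
  proof -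
    have "s \<ge> 0" using that R by (simp add: s_def)
    hence "0 \<le> bent_slope s" "bent_slope s \<le> 7/4" using B(4) by auto
    thus ?thesis unfolding Ga s_def[symmetric] by (simp add: power2_eq_square algebra_simps)
  qed
  show "(1 - bent_slope (r / R))\<^sup>2 - 1 = G" if "r \<le> 0"
  proof -
    have "s \<le> 0" using that R by (simp add: s_def divide_nonpos_pos)
    hence "bent_slope s \<le> 0" using B(5) by auto
    thus ?thesis unfolding Ga s_def[symmetric] by (simp add: power2_eq_square algebra_simps)
  qed
  show "bent R r \<ge> r / 2" if "r \<ge> 0"
  proof -
    have s0: "s \<ge> 0" using that R by (simp add: s_def)
    have "s ^ 3 \<le> s" using power_decreasing[of 1 3 s] s s0 by simp
    hence "2 * s ^ 3 \<le> 1 + s" using s by linarith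
    hence "s * (2 * s ^ 3) \<le> s * (1 + s)" using s0 by (intro mult_left_mono) auto
    hence "s ^ 4 / (1 + s) \<le> s / 2" using v by (simp add: field_simps power_numeral_reduce)
    hence "R * (s ^ 4 / (1 + s)) \<le> R * (s / 2)" using R by (intro mult_left_mono) auto
    thus ?thesis unfolding bentd unfolding rs by simp
  qed
  have "s ^ 4 / 2 \<le> s ^ 4 / (1 + s)" using s v by (intro divide_left_mono) auto
  hence "R * (s ^ 4 / 2) \<le> R * (s ^ 4 / (1 + s))" using R by (intro mult_left_mono) auto
  moreover have "R * (s ^ 4 / 2) = r ^ 4 / (2 * R ^ 3)" unfolding rs using R by (simp add: power_mult_distrib field_simps power_numeral_reduce)
  ultimately show le: "bent R r \<le> r - r ^ 4 / (2 * R ^ 3)" unfolding bentd by linarith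
  have "r ^ 4 / (2 * R ^ 3) \<ge> 0" using R by simp
  thus "bent R r \<le> r" using le by linarith
  {
    assume "\<bar>r\<bar> \<le> R / 2"
    hence h: "\<bar>s\<bar> \<le> 1/2" unfolding ars using R by (simp add: field_simps)
    have q3: "\<bar>r\<bar> ^ 3 / R ^ 3 = \<bar>s\<bar> ^ 3" unfolding ars using R by (simp add: power_mult_distrib)
    show "a \<le> 22 * (\<bar>r\<bar> ^ 3 / R ^ 3)" unfolding q3 aa by (rule B(7)[OF h])
    show "G \<le> 110 * (\<bar>r\<bar> ^ 3 / R ^ 3)" unfolding q3 Ga by (rule B(8)[OF h])
    show "\<bar>bent'' R r\<bar> \<le> 172 * (r\<^sup>2 / R ^ 3)"
    proof (cases "r = 0")
      case True thus ?thesis by (simp add: bent''_def)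
    next
      case False
      have "\<bar>bent'' R r\<bar> * \<bar>r\<bar> \<le> 172 * (\<bar>r\<bar> ^ 3 / R ^ 3)" unfolding b2 q3 by (rule B(9)[OF h])
      also have "\<dots> = 172 * (r\<^sup>2 / R ^ 3) * \<bar>r\<bar>" by (simp add: power3_eq_cube power2_eq_square)
      finally show ?thesis by (rule mult_right_le_imp_le) (use False in simp)
    qed
  }
qed

section \<open>The sign of the barrier residual\<close>

lemma abs_tanh_lt_1: "\<bar>tanh x\<bar> < 1" for x :: real
  using tanh_real_lt_1[of x] tanh_real_gt_neg1[of x] by linarith

lemma tanh_lipschitz: "\<bar>tanh a - tanh b\<bar> \<le> \<bar>a - b\<bar>" for a b :: real
proof -
  have "norm (tanh a - tanh b) \<le> 1 * norm (a - b)"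
  proof (rule field_differentiable_bound[of UNIV tanh "\<lambda>x. 1 - (tanh x)\<^sup>2"])
    fix x :: real
    show "(tanh has_field_derivative 1 - (tanh x)\<^sup>2) (at x within UNIV)"
      by (auto intro!: derivative_eq_intros)
    have "\<bar>tanh x\<bar> < 1" by (rule abs_tanh_lt_1) 
    hence "(tanh x)\<^sup>2 \<le> 1" by (simp add: abs_square_le_1)
    thus "norm (1 - (tanh x)\<^sup>2) \<le> 1" by simp
  qed auto
  thus ?thesis by simp
qed

lemma tanh_ge_third: "tanh x \<ge> 1/3" if "x \<ge> 1" for x :: real
proof -
  have e2: "exp (2::real) \<ge> 3" using exp_ge_add_one_self[of "2::real"] by simp
  have "tanh (1::real) = (1 - exp (-2)) / (1 + exp (-2))" using tanh_real_altdef[of 1] by simp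
  moreover have "exp (-2::real) \<le> 1/3" unfolding exp_minus using e2 le_imp_inverse_le[OF e2] by simp
  ultimately have "tanh 1 \<ge> (1/3::real)" by (simp add: field_simps add_pos_pos)
  thus ?thesis using that by (meson order_trans tanh_real_le_iff)
qed

lemma mult_abs_le: "\<bar>a\<bar> \<le> A \<Longrightarrow> \<bar>b\<bar> \<le> B \<Longrightarrow> \<bar>a * b\<bar> \<le> A * B" for a b :: real
  unfolding abs_mult by (intro mult_mono) auto

text \<open>All terms of the residual of \<open>z = bent R r + \<epsilon>\<^sup>3 h \<phi> (r / \<epsilon>) -
  \<epsilon>\<^sup>2 X\<^sup>2\<close> in terms of real numbers: \<open>\<rho>t\<close>, \<open>L\<close>
  stand for the time derivative and the Laplacian of the distance \<open>r + \<kappa>\<close>,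
  \<open>n\<close> for the dimension, \<open>X\<close> for the distance to the frozen point, \<open>s\<close>,
  \<open>\<nu>\<close>, \<open>Y\<close> for what the derivatives of its square contribute. The equation of
  \<open>\<psi>\<close> cancels \<open>r h\<close>. The result separates the bending term from errors of size
  \<open>\<epsilon>\<^sup>2 + \<bar>r\<bar>\<^sup>3 / \<epsilon>\<close>, errors proportional to the slope
  defect \<open>a\<close>, and the gain \<open>- \<kappa>' / 2\<close>.\<close>

lemma residual_estimate:
  fixes C r R \<epsilon> :: real
  assumes C: "C \<ge> 1" and eps: "0 < \<epsilon>" "4 * C\<^sup>2 * \<epsilon> \<le> 1" and R: "0 < R" "R \<le> 1" and r: "-R < r" "r \<le> R"
    and kap: "0 \<le> \<kappa>" "\<kappa> \<le> \<epsilon>" "0 \<le> \<kappa>'" "\<kappa>' \<le> 1"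
    and h: "\<bar>h\<bar> \<le> C"
    and psi: "\<psi>' = 4 * tanh (r / \<epsilon>) * \<psi> + r / \<epsilon>" "\<bar>\<psi>\<bar> \<le> C * (1 + \<bar>r / \<epsilon>\<bar>)" "\<bar>\<phi>\<bar> \<le> C * (1 + (r / \<epsilon>)\<^sup>2)"
    and X: "0 \<le> X" "X \<le> C" "X \<le> C * (\<epsilon> + r\<^sup>2 / \<epsilon>)"
    and z: "z = bent R r + \<epsilon> ^ 3 * h * \<phi> - \<epsilon>\<^sup>2 * X\<^sup>2"
    and F: "\<bar>\<rho>t - L + g - (r + \<kappa>) * h\<bar> \<le> C * \<bar>r + \<kappa>\<bar> * (\<bar>r + \<kappa>\<bar> + X + \<epsilon>)"
    and bd: "\<bar>\<rho>t\<bar> \<le> C" "\<bar>L\<bar> \<le> C" "0 \<le> n" "n \<le> C" "\<bar>s\<bar> \<le> C" "\<bar>\<nu>\<bar> \<le> X" "0 \<le> Y" "Y \<le> X\<^sup>2"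
    and Phi: "\<Phi>1 = (1 - bent_slope (r / R)) + \<epsilon>\<^sup>2 * h * \<psi>" "\<Phi>2 = bent'' R r + \<epsilon> * h * \<psi>'"
  defines "a \<equiv> \<bar>bent_slope (r / R)\<bar>" and "\<Lambda> \<equiv> \<epsilon>\<^sup>2 + \<bar>r\<bar> ^ 3 / \<epsilon>"
  shows "\<Phi>1 * (\<rho>t - \<kappa>') - 2 * \<epsilon>\<^sup>2 * s - (\<Phi>1 * L + \<Phi>2 - 2 * \<epsilon>\<^sup>2 * n) + g
       + (2 / \<epsilon>) * tanh (z / \<epsilon>) * (\<Phi>1\<^sup>2 - 4 * \<epsilon>\<^sup>2 * \<Phi>1 * \<nu> + 4 * \<epsilon> ^ 4 * Y - 1)
     \<le> 200 * C ^ 4 * (\<Lambda> + a + R\<^sup>2 * a / \<epsilon>) + 200 * C ^ 4 * \<kappa> - \<kappa>' / 2 + \<bar>bent'' R r\<bar>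
       + (2 / \<epsilon>) * tanh (z / \<epsilon>) * ((1 - bent_slope (r / R))\<^sup>2 - 1)"
proof -
  define m1 where "m1 = 1 - bent_slope (r / R)"
  define \<tau> where "\<tau> = tanh (z / \<epsilon>)"
  define y where "y = r / \<epsilon>"
  define \<Delta> where "\<Delta> = \<epsilon> + r\<^sup>2 / \<epsilon>"
  have ry: "r = \<epsilon> * y" using eps by (simp add: y_def)
  have C2: "C\<^sup>2 \<ge> 1" using C by (simp add: one_le_power)
  have Cle: "C \<le> C ^ 4" "C\<^sup>2 \<le> C ^ 4" "C ^ 3 \<le> C ^ 4" "1 \<le> C ^ 4"
    using C power_increasing[of 1 4 C] power_increasing[of 2 4 C] power_increasing[of 3 4 C] one_le_power[of C 4] by auto
  have e1: "\<epsilon> \<le> 1/4" using mult_right_mono[OF C2, of \<epsilon>] eps by linarith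
  have r1: "\<bar>r\<bar> \<le> R" "\<bar>r\<bar> \<le> 1" using r R by auto
  have a0: "a \<ge> 0" "a = \<bar>m1 - 1\<bar>" by (auto simp: a_def m1_def)
  have tau: "\<bar>\<tau>\<bar> \<le> 1" unfolding \<tau>_def using abs_tanh_lt_1[of "z/\<epsilon>"] by linarith
  have r3: "\<bar>r\<bar> ^ 3 / \<epsilon> \<ge> 0" using eps by simp
  have b1: "r\<^sup>2 \<le> \<Lambda>"
  proof (cases "\<bar>r\<bar> \<le> \<epsilon>")
    case True
    hence "\<bar>r\<bar>\<^sup>2 \<le> \<epsilon>\<^sup>2" by (intro power_mono) auto
    thus ?thesis unfolding \<Lambda>_def using r3 by simp
  next
    case False
    hence "\<epsilon> * \<bar>r\<bar>\<^sup>2 \<le> \<bar>r\<bar> * \<bar>r\<bar>\<^sup>2" by (intro mult_right_mono) auto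
    hence "\<bar>r\<bar>\<^sup>2 \<le> \<bar>r\<bar> ^ 3 / \<epsilon>" using eps by (simp add: field_simps power3_eq_cube power2_eq_square)
    thus ?thesis unfolding \<Lambda>_def by (simp add: add_increasing)
  qed
  have Lam0: "\<Lambda> \<ge> 0" "\<epsilon>\<^sup>2 \<le> \<Lambda>" using b1 r3 unfolding \<Lambda>_def by (auto simp: add_nonneg_nonneg)
  have b2: "\<epsilon> * \<bar>r\<bar> \<le> \<Lambda>"
  proof (cases "\<bar>r\<bar> \<le> \<epsilon>")
    case True
    hence "\<epsilon> * \<bar>r\<bar> \<le> \<epsilon>\<^sup>2" using eps by (simp add: power2_eq_square)
    thus ?thesis using Lam0 by linarith
  next
    case False
    hence "\<epsilon> * \<bar>r\<bar> \<le> \<bar>r\<bar> * \<bar>r\<bar>" by (intro mult_right_mono) auto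
    thus ?thesis using b1 by (simp add: power2_eq_square)
  qed
  have eD: "\<epsilon> * \<Delta> = \<epsilon>\<^sup>2 + r\<^sup>2" unfolding \<Delta>_def using eps by (simp add: power2_eq_square distrib_left)
  have b3: "\<epsilon> * \<Delta> \<le> 2 * \<Lambda>" unfolding eD using b1 Lam0 by linarith
  have rD: "\<bar>r\<bar> * \<Delta> = \<epsilon> * \<bar>r\<bar> + \<bar>r\<bar> ^ 3 / \<epsilon>" unfolding \<Delta>_def by (simp add: distrib_left power3_eq_cube power2_eq_square)
  have b4: "\<bar>r\<bar> * \<Delta> \<le> 2 * \<Lambda>" 
  proof -
    have "\<bar>r\<bar> ^ 3 / \<epsilon> \<le> \<Lambda>" unfolding \<Lambda>_def by simp
    thus ?thesis unfolding rD using b2 by simp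
  qed
  have D0: "\<epsilon> \<le> \<Delta>" "0 \<le> \<Delta>" "\<bar>r\<bar> \<le> \<Delta>"
  proof -
    show 1: "\<epsilon> \<le> \<Delta>" unfolding \<Delta>_def using eps by simp
    thus "0 \<le> \<Delta>" using eps by linarith
    show "\<bar>r\<bar> \<le> \<Delta>"
    proof (cases "\<bar>r\<bar> \<le> \<epsilon>")
      case True thus ?thesis using 1 by linarith
    next
      case False
      hence "\<epsilon> * \<bar>r\<bar> \<le> \<bar>r\<bar> * \<bar>r\<bar>" by (intro mult_right_mono) auto
      hence "\<bar>r\<bar> \<le> r\<^sup>2 / \<epsilon>" using eps by (simp add: field_simps power2_eq_square)
      thus ?thesis unfolding \<Delta>_def using eps by linarith
    qed
  qed
  have er: "\<epsilon> + \<bar>r\<bar> \<le> 2" using e1 r1 by linarith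
  have psi_e: "\<epsilon> * \<bar>\<psi>\<bar> \<le> C * (\<epsilon> + \<bar>r\<bar>)"
  proof -
    have "\<epsilon> * \<bar>\<psi>\<bar> \<le> \<epsilon> * (C * (1 + \<bar>r / \<epsilon>\<bar>))" using psi(2) eps by (intro mult_left_mono) auto
    also have "\<dots> = C * (\<epsilon> + \<bar>r\<bar>)" using eps by (simp add: field_simps)
    finally show ?thesis .
  qed
  have hpsi: "\<bar>\<epsilon> * h * \<psi>\<bar> \<le> C\<^sup>2 * (\<epsilon> + \<bar>r\<bar>)"
  proof -
    have "\<bar>\<epsilon> * h * \<psi>\<bar> = \<bar>h\<bar> * (\<epsilon> * \<bar>\<psi>\<bar>)" using eps by (simp add: abs_mult)
    also have "\<dots> \<le> C * (C * (\<epsilon> + \<bar>r\<bar>))" by (rule mult_mono[OF h psi_e]) (use C eps in auto)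
    finally show ?thesis by (simp add: power2_eq_square)
  qed
  define P where "P = \<epsilon> * h * \<psi>"
  have P2: "\<bar>P\<bar> \<le> C\<^sup>2 * (\<epsilon> + \<bar>r\<bar>)" using hpsi by (simp add: P_def)
  have eP: "\<bar>\<epsilon> * P\<bar> \<le> 2 * C\<^sup>2 * \<Lambda>" "\<bar>\<epsilon> * P\<bar> \<le> 2 * C\<^sup>2 * \<epsilon>"
  proof -
    have "\<bar>\<epsilon> * P\<bar> \<le> \<epsilon> * (C\<^sup>2 * (\<epsilon> + \<bar>r\<bar>))" using P2 eps by (simp add: abs_mult)
    also have "\<dots> = C\<^sup>2 * (\<epsilon>\<^sup>2 + \<epsilon> * \<bar>r\<bar>)" by (simp add: power2_eq_square algebra_simps)
    also have "\<dots> \<le> C\<^sup>2 * (2 * \<Lambda>)" using b2 Lam0 C2 by (intro mult_left_mono) auto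
    finally show "\<bar>\<epsilon> * P\<bar> \<le> 2 * C\<^sup>2 * \<Lambda>" by (simp only: mult_ac)
    have "\<bar>\<epsilon> * P\<bar> \<le> \<epsilon> * (C\<^sup>2 * (\<epsilon> + \<bar>r\<bar>))" using P2 eps by (simp add: abs_mult)
    also have "\<dots> \<le> \<epsilon> * (C\<^sup>2 * 2)" using er C2 eps by (intro mult_left_mono) auto
    finally show "\<bar>\<epsilon> * P\<bar> \<le> 2 * C\<^sup>2 * \<epsilon>" by (simp only: mult_ac)
  qed
  have Phi1: "\<Phi>1 = m1 + \<epsilon> * P" unfolding Phi m1_def P_def by (simp add: power2_eq_square)
  have Phi1': "\<bar>\<Phi>1 - 1\<bar> \<le> a + 2 * C\<^sup>2 * \<Lambda>" "\<bar>\<Phi>1\<bar> \<le> 2 + a"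
    using eP eps unfolding Phi1 a0(2) by linarith+
  \<comment> \<open>The bound \<open>F\<close> speaks of \<open>r + \<kappa>\<close>; replacing it by \<open>r\<close> in front of \<open>h\<close> costs a multiple of \<open>\<kappa>\<close>.\<close>
  have T1: "\<rho>t - L + g - r * h \<le> 12 * C\<^sup>2 * \<Lambda> + 5 * C\<^sup>2 * \<kappa>"
  proof -
    have q: "\<bar>r + \<kappa>\<bar> + X + \<epsilon> \<le> 4 * C * \<Delta>"
    proof -
      have "X \<le> C * \<Delta>" using X by (simp add: \<Delta>_def)
      moreover have "\<bar>r + \<kappa>\<bar> \<le> \<Delta> + \<Delta>" using D0 kap by linarith
      moreover have "\<Delta> \<le> C * \<Delta>" using C D0 mult_right_mono[of 1 C \<Delta>] by simp
      ultimately show ?thesis using D0 by linarith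
    qed
    have "C * \<bar>r + \<kappa>\<bar> * (\<bar>r + \<kappa>\<bar> + X + \<epsilon>) \<le> C * \<bar>r + \<kappa>\<bar> * (4 * C * \<Delta>)" using q C by (intro mult_left_mono) auto
    also have "\<dots> = 4 * C\<^sup>2 * (\<bar>r + \<kappa>\<bar> * \<Delta>)" by (simp add: power2_eq_square)
    also have "\<bar>r + \<kappa>\<bar> * \<Delta> \<le> 3 * \<Lambda> + \<kappa>"
    proof -
      have "\<bar>r + \<kappa>\<bar> * \<Delta> \<le> (\<bar>r\<bar> + \<kappa>) * \<Delta>" using kap D0 by (intro mult_right_mono) auto
      also have "\<dots> = \<bar>r\<bar> * \<Delta> + \<kappa> * \<epsilon> + \<kappa> * (r\<^sup>2 / \<epsilon>)"
        by (simp only: \<Delta>_def distrib_left distrib_right add.assoc)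
      also have "\<kappa> * (r\<^sup>2 / \<epsilon>) \<le> \<epsilon> * (r\<^sup>2 / \<epsilon>)" using kap eps by (intro mult_right_mono) auto
      also have "\<epsilon> * (r\<^sup>2 / \<epsilon>) = r\<^sup>2" using eps by simp
      also have "\<kappa> * \<epsilon> \<le> \<kappa> * 1" using kap e1 by (intro mult_left_mono) auto
      finally show ?thesis using b4 b1 by linarith
    qed
    finally have "C * \<bar>r + \<kappa>\<bar> * (\<bar>r + \<kappa>\<bar> + X + \<epsilon>) \<le> 4 * C\<^sup>2 * (3 * \<Lambda> + \<kappa>)" using C by simp
    moreover have "\<kappa> * h \<le> C\<^sup>2 * \<kappa>"
    proof -
      have "\<kappa> * h \<le> \<kappa> * C\<^sup>2" using h kap C power_increasing[of 1 2 C] by (intro mult_left_mono) auto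
      thus ?thesis by (simp add: mult.commute)
    qed
    ultimately show ?thesis using F by (simp add: algebra_simps)
  qed
  \<comment> \<open>The equation for \<open>\<psi>\<close> contains \<open>tanh (r / \<epsilon>)\<close> but the residual \<open>tanh (z / \<epsilon>)\<close>, so the cancellation of \<open>r * h\<close> leaves this difference.\<close>
  have T2: "4 * P * (\<tau> - tanh y) \<le> 32 * C ^ 4 * (a + R\<^sup>2 * a / \<epsilon> + \<Lambda>)"
  proof -
    have b: "\<bar>bent R r - r\<bar> \<le> \<bar>r\<bar> * a" unfolding a_def by (rule bent_facts(1)) (use R r in auto)
    have ph: "\<bar>\<epsilon> ^ 3 * h * \<phi>\<bar> \<le> C\<^sup>2 * \<epsilon> * (\<epsilon>\<^sup>2 + r\<^sup>2)"
    proof -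
      have "\<bar>\<epsilon> ^ 3 * h * \<phi>\<bar> = \<epsilon> ^ 3 * (\<bar>h\<bar> * \<bar>\<phi>\<bar>)" using eps by (simp add: abs_mult)
      also have "\<dots> \<le> \<epsilon> ^ 3 * (C * (C * (1 + (r / \<epsilon>)\<^sup>2)))" using h psi(3) C eps by (intro mult_left_mono mult_mono) auto
      also have "\<dots> = C\<^sup>2 * \<epsilon> * (\<epsilon>\<^sup>2 + r\<^sup>2)" using eps by (simp add: field_simps power3_eq_cube power2_eq_square)
      finally show ?thesis .
    qed
    have "\<bar>z - r\<bar> \<le> \<bar>r\<bar> * a + C\<^sup>2 * \<epsilon> * (\<epsilon>\<^sup>2 + r\<^sup>2) + \<epsilon>\<^sup>2 * X\<^sup>2"
    proof -
      have "0 \<le> \<epsilon>\<^sup>2 * X\<^sup>2" by simp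
      thus ?thesis unfolding z using b ph by linarith
    qed
    moreover have "\<bar>\<tau> - tanh y\<bar> \<le> \<bar>z - r\<bar> / \<epsilon>"
      using tanh_lipschitz[of "z/\<epsilon>" "r/\<epsilon>"] eps unfolding \<tau>_def y_def by (simp add: diff_divide_distrib[symmetric])
    ultimately have t: "\<bar>\<tau> - tanh y\<bar> \<le> (\<bar>r\<bar> * a + C\<^sup>2 * \<epsilon> * (\<epsilon>\<^sup>2 + r\<^sup>2) + \<epsilon>\<^sup>2 * X\<^sup>2) / \<epsilon>"
      using eps by (meson divide_right_mono less_imp_le order_trans)
    also have "\<dots> = \<bar>r\<bar> * a / \<epsilon> + C\<^sup>2 * (\<epsilon>\<^sup>2 + r\<^sup>2) + \<epsilon> * X\<^sup>2" using eps by (simp add: add_divide_distrib power2_eq_square)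
    finally have t: "\<bar>\<tau> - tanh y\<bar> \<le> \<bar>r\<bar> * a / \<epsilon> + C\<^sup>2 * (\<epsilon>\<^sup>2 + r\<^sup>2) + \<epsilon> * X\<^sup>2" .
    have eX: "\<epsilon> * X\<^sup>2 \<le> 2 * C\<^sup>2 * \<Lambda>"
    proof -
      have "X * X \<le> C * (C * \<Delta>)" using X C D0 by (intro mult_mono) (auto simp: \<Delta>_def)
      hence "\<epsilon> * (X * X) \<le> \<epsilon> * (C * (C * \<Delta>))" using eps by (intro mult_left_mono) auto
      also have "\<dots> = C\<^sup>2 * (\<epsilon> * \<Delta>)" by (simp add: power2_eq_square)
      also have "\<dots> \<le> C\<^sup>2 * (2 * \<Lambda>)" using b3 by (intro mult_left_mono) auto
      finally show ?thesis by (simp add: power2_eq_square)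
    qed
    have "4 * P * (\<tau> - tanh y) \<le> 4 * (\<bar>P\<bar> * \<bar>\<tau> - tanh y\<bar>)" using abs_ge_self[of "P * (\<tau> - tanh y)"] by (simp add: abs_mult)
    also have "\<bar>P\<bar> * \<bar>\<tau> - tanh y\<bar> \<le> (C\<^sup>2 * (\<epsilon> + \<bar>r\<bar>)) * (\<bar>r\<bar> * a / \<epsilon> + C\<^sup>2 * (\<epsilon>\<^sup>2 + r\<^sup>2) + \<epsilon> * X\<^sup>2)"
      by (rule mult_mono[OF P2 t]) (use eps in auto)
    also have "\<dots> = C\<^sup>2 * ((\<epsilon> + \<bar>r\<bar>) * (\<bar>r\<bar> * a / \<epsilon>) + (\<epsilon> + \<bar>r\<bar>) * (C\<^sup>2 * (\<epsilon>\<^sup>2 + r\<^sup>2) + \<epsilon> * X\<^sup>2))"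
    proof -
      have "(c * e) * (x + y + z) = c * (e * x + e * (y + z))" for c e x y z :: real by (simp add: algebra_simps)
      thus ?thesis .
    qed
    also have "\<dots> \<le> C\<^sup>2 * ((a + R\<^sup>2 * a / \<epsilon>) + 2 * (C\<^sup>2 * (2 * \<Lambda>) + 2 * C\<^sup>2 * \<Lambda>))"
    proof (intro mult_left_mono add_mono)
      have "(\<epsilon> + \<bar>r\<bar>) * (\<bar>r\<bar> * a / \<epsilon>) = \<bar>r\<bar> * a + r\<^sup>2 * a / \<epsilon>" using eps by (simp add: field_simps power2_eq_square)
      moreover have "\<bar>r\<bar> * a \<le> 1 * a" using r1 a0 by (intro mult_right_mono) auto
      moreover have "r\<^sup>2 * a / \<epsilon> \<le> R\<^sup>2 * a / \<epsilon>"
        using r1 a0 eps power_mono[OF r1(1), of 2] by (intro divide_right_mono mult_right_mono) auto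
      ultimately show "(\<epsilon> + \<bar>r\<bar>) * (\<bar>r\<bar> * a / \<epsilon>) \<le> a + R\<^sup>2 * a / \<epsilon>" by linarith
      have "C\<^sup>2 * (\<epsilon>\<^sup>2 + r\<^sup>2) \<le> C\<^sup>2 * (2 * \<Lambda>)" using b1 Lam0 by (intro mult_left_mono) auto
      hence "C\<^sup>2 * (\<epsilon>\<^sup>2 + r\<^sup>2) + \<epsilon> * X\<^sup>2 \<le> C\<^sup>2 * (2 * \<Lambda>) + 2 * C\<^sup>2 * \<Lambda>" using eX by linarith
      moreover have "0 \<le> C\<^sup>2 * (\<epsilon>\<^sup>2 + r\<^sup>2) + \<epsilon> * X\<^sup>2" using eps by (intro add_nonneg_nonneg) auto
      ultimately show "(\<epsilon> + \<bar>r\<bar>) * (C\<^sup>2 * (\<epsilon>\<^sup>2 + r\<^sup>2) + \<epsilon> * X\<^sup>2) \<le> 2 * (C\<^sup>2 * (2 * \<Lambda>) + 2 * C\<^sup>2 * \<Lambda>)"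
        using er eps by (intro mult_mono) auto
    qed simp
    also have "\<dots> = C\<^sup>2 * (a + R\<^sup>2 * a / \<epsilon>) + 8 * C ^ 4 * \<Lambda>" by (simp add: power_numeral_reduce algebra_simps)
    finally have "4 * P * (\<tau> - tanh y) \<le> 4 * (C\<^sup>2 * (a + R\<^sup>2 * a / \<epsilon>) + 8 * C ^ 4 * \<Lambda>)" by simp
    also have "C\<^sup>2 * (a + R\<^sup>2 * a / \<epsilon>) \<le> C ^ 4 * (a + R\<^sup>2 * a / \<epsilon>)" using Cle a0 eps R by (intro mult_right_mono add_nonneg_nonneg) auto
    finally have "4 * P * (\<tau> - tanh y) \<le> 4 * (C ^ 4 * (a + R\<^sup>2 * a / \<epsilon>) + 8 * C ^ 4 * \<Lambda>)" by simp
    moreover have "0 \<le> C ^ 4 * (a + R\<^sup>2 * a / \<epsilon>)" using a0 C eps R by (intro mult_nonneg_nonneg add_nonneg_nonneg) auto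
    moreover have "p \<le> 32 * c * (B + l)" if "p \<le> 4 * (c * B + 8 * c * l)" "0 \<le> c * B" for p c B l :: real
      using that unfolding distrib_left mult.assoc by linarith
    ultimately show ?thesis by blast
  qed
  have T4: "(\<Phi>1 - 1) * (\<rho>t - L) \<le> 4 * C ^ 3 * (a + \<Lambda>)"
  proof -
    have "\<bar>(\<Phi>1 - 1) * (\<rho>t - L)\<bar> \<le> (a + 2 * C\<^sup>2 * \<Lambda>) * (2 * C)"
      using Phi1'(1) bd by (intro mult_abs_le) auto
    also have "\<dots> = 2 * C * a + 4 * C ^ 3 * \<Lambda>" by (simp add: power_numeral_reduce algebra_simps)
    also have "2 * C * a \<le> 4 * C ^ 3 * a" using a0 C power_increasing[of 1 3 C] by (intro mult_right_mono) auto
    finally show ?thesis by (simp add: distrib_left)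
  qed
  have T5: "- \<Phi>1 * \<kappa>' \<le> - \<kappa>' / 2 + a"
  proof -
    have "1 - \<Phi>1 \<le> a + 2 * C\<^sup>2 * \<epsilon>" using eP(2) unfolding Phi1 a0(2) by linarith
    hence "1 - \<Phi>1 \<le> a + 1/2" using eps by linarith
    hence "(1 - \<Phi>1) * \<kappa>' \<le> (a + 1/2) * \<kappa>'" using kap by (intro mult_right_mono) auto
    moreover have "a * \<kappa>' \<le> a" using a0 kap by (simp add: mult_left_le)
    ultimately show ?thesis by (simp add: algebra_simps)
  qed
  have T6: "- 2 * \<epsilon>\<^sup>2 * s + 2 * \<epsilon>\<^sup>2 * n \<le> 4 * C * \<Lambda>"
  proof -
    have "- s + n \<le> 2 * C" using bd by linarith
    hence "\<epsilon>\<^sup>2 * (- s + n) \<le> \<epsilon>\<^sup>2 * (2 * C)" by (intro mult_left_mono) auto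
    also have "\<dots> \<le> \<Lambda> * (2 * C)" using Lam0 C by (intro mult_right_mono) auto
    finally show ?thesis by (simp add: algebra_simps)
  qed
  have T8: "(2 / \<epsilon>) * \<tau> * (\<Phi>1\<^sup>2 - m1\<^sup>2 - 2 * (\<epsilon> * P)) \<le> 8 * C\<^sup>2 * a + 8 * C ^ 4 * \<Lambda>"
  proof -
    have "\<Phi>1\<^sup>2 - m1\<^sup>2 - 2 * (\<epsilon> * P) = \<epsilon> * (2 * (m1 - 1) * P + \<epsilon> * P\<^sup>2)"
      unfolding Phi1 by (simp add: power2_eq_square algebra_simps)
    hence "(2 / \<epsilon>) * \<tau> * (\<Phi>1\<^sup>2 - m1\<^sup>2 - 2 * (\<epsilon> * P)) = \<tau> * (4 * (m1 - 1) * P + 2 * \<epsilon> * P\<^sup>2)"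
      using eps by (simp add: field_simps)
    also have "\<dots> \<le> 1 * \<bar>4 * (m1 - 1) * P + 2 * \<epsilon> * P\<^sup>2\<bar>"
      using mult_abs_le[OF tau order_refl, of "4 * (m1 - 1) * P + 2 * \<epsilon> * P\<^sup>2"] by linarith
    also have "\<dots> \<le> 4 * (a * \<bar>P\<bar>) + 2 * \<epsilon> * P\<^sup>2"
    proof -
      have e1: "\<bar>4 * (m1 - 1) * P\<bar> = 4 * (a * \<bar>P\<bar>)" unfolding a0(2) by (simp only: abs_mult mult.assoc abs_numeral)
      have e2: "\<bar>2 * \<epsilon> * P\<^sup>2\<bar> = 2 * \<epsilon> * P\<^sup>2" using eps by (simp add: abs_mult)
      show ?thesis using abs_triangle_ineq[of "4 * (m1 - 1) * P" "2 * \<epsilon> * P\<^sup>2"] unfolding e1 e2 mult_1_left .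
    qed
    also have "a * \<bar>P\<bar> \<le> a * (2 * C\<^sup>2)"
    proof -
      have "\<bar>P\<bar> \<le> C\<^sup>2 * 2" using P2 er mult_left_mono[OF er, of "C\<^sup>2"] by simp
      thus ?thesis using a0 by (intro mult_left_mono) auto
    qed
    also have "2 * \<epsilon> * P\<^sup>2 \<le> 8 * C ^ 4 * \<Lambda>"
    proof -
      have "P\<^sup>2 \<le> (C\<^sup>2 * (\<epsilon> + \<bar>r\<bar>))\<^sup>2" using power_mono[OF P2, of 2] by simp
      also have "\<dots> = C ^ 4 * (\<epsilon> + \<bar>r\<bar>)\<^sup>2" by (simp add: power_mult_distrib)
      also have "(\<epsilon> + \<bar>r\<bar>)\<^sup>2 \<le> 4 * \<Lambda>" using b1 b2 Lam0 by (simp add: power2_sum)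
      finally have "P\<^sup>2 \<le> C ^ 4 * (4 * \<Lambda>)" using C by simp
      moreover have "2 * \<epsilon> * P\<^sup>2 \<le> 1 * P\<^sup>2" using e1 by (intro mult_right_mono) auto
      ultimately have "2 * \<epsilon> * P\<^sup>2 \<le> C ^ 4 * (4 * \<Lambda>)" by linarith
      moreover have "C ^ 4 * (4 * \<Lambda>) \<le> C ^ 4 * (8 * \<Lambda>)" using C Lam0 by (intro mult_left_mono) auto
      ultimately show ?thesis by simp
    qed
    finally show ?thesis by (simp add: mult_ac)
  qed
  have T9: "(2 / \<epsilon>) * \<tau> * (4 * \<epsilon> ^ 4 * Y - 4 * \<epsilon>\<^sup>2 * \<Phi>1 * \<nu>) \<le> 48 * C\<^sup>2 * \<Lambda> + 8 * C * a"
  proof -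
    have "(2 / \<epsilon>) * \<tau> * (4 * \<epsilon> ^ 4 * Y - 4 * \<epsilon>\<^sup>2 * \<Phi>1 * \<nu>) = \<tau> * (8 * \<epsilon> ^ 3 * Y - 8 * \<epsilon> * \<Phi>1 * \<nu>)"
      using eps by (simp add: field_simps power_numeral_reduce)
    also have "\<dots> \<le> 1 * \<bar>8 * \<epsilon> ^ 3 * Y - 8 * \<epsilon> * \<Phi>1 * \<nu>\<bar>"
      using mult_abs_le[OF tau order_refl, of "8 * \<epsilon> ^ 3 * Y - 8 * \<epsilon> * \<Phi>1 * \<nu>"] by linarith
    also have "\<dots> \<le> 8 * \<epsilon> ^ 3 * X\<^sup>2 + 8 * \<epsilon> * ((2 + a) * X)"
    proof -
      have "\<bar>8 * \<epsilon> ^ 3 * Y\<bar> = 8 * \<epsilon> ^ 3 * Y" using eps bd by (simp add: abs_mult)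
      also have "\<dots> \<le> 8 * \<epsilon> ^ 3 * X\<^sup>2" using eps bd by (intro mult_left_mono) auto
      finally have y: "\<bar>8 * \<epsilon> ^ 3 * Y\<bar> \<le> 8 * \<epsilon> ^ 3 * X\<^sup>2" .
      have "\<bar>8 * \<epsilon> * \<Phi>1 * \<nu>\<bar> = 8 * \<epsilon> * \<bar>\<Phi>1 * \<nu>\<bar>" using eps by (simp add: abs_mult)
      also have "\<dots> \<le> 8 * \<epsilon> * ((2 + a) * X)" using Phi1'(2) bd eps by (intro mult_left_mono mult_abs_le) auto
      finally have n: "\<bar>8 * \<epsilon> * \<Phi>1 * \<nu>\<bar> \<le> 8 * \<epsilon> * ((2 + a) * X)" .
      show ?thesis using order_trans[OF abs_triangle_ineq4 add_mono[OF y n]] by simp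
    qed
    also have "\<dots> = 8 * \<epsilon>\<^sup>2 * ((\<epsilon> * X) * X) + 16 * (\<epsilon> * X) + 8 * a * (\<epsilon> * X)"
      by (simp add: power_numeral_reduce algebra_simps)
    also have "\<dots> \<le> 8 * 1 * ((2 * C * \<Lambda>) * C) + 16 * (2 * C * \<Lambda>) + 8 * a * C"
    proof -
      have "\<epsilon> * X \<le> \<epsilon> * (C * \<Delta>)" using X eps by (intro mult_left_mono) (auto simp: \<Delta>_def)
      also have "\<dots> = C * (\<epsilon> * \<Delta>)" by simp
      also have "\<dots> \<le> C * (2 * \<Lambda>)" using b3 C by (intro mult_left_mono) auto
      finally have l: "\<epsilon> * X \<le> 2 * C * \<Lambda>" by simp
      have l2: "\<epsilon> * X \<le> 1 * C" using X e1 eps by (intro mult_mono) auto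
      have e2: "\<epsilon>\<^sup>2 \<le> 1" using eps e1 by (simp add: power_le_one)
      define S where "S = \<epsilon> * X"
      have S: "S \<le> 2 * C * \<Lambda>" "S \<le> C" "0 \<le> S" using l l2 X eps by (auto simp: S_def)
      have "S * X \<le> (2 * C * \<Lambda>) * C" using S X C Lam0 by (intro mult_mono) auto
      hence "8 * \<epsilon>\<^sup>2 * (S * X) \<le> 8 * 1 * ((2 * C * \<Lambda>) * C)" using e2 S X by (intro mult_mono) auto
      moreover have "8 * a * S \<le> 8 * a * C" using S a0(1) by (intro mult_left_mono) auto
      moreover have "16 * S \<le> 16 * (2 * C * \<Lambda>)" using S by simp
      ultimately show ?thesis unfolding S_def[symmetric] by (intro add_mono)
    qed
    also have "\<dots> \<le> 48 * C\<^sup>2 * \<Lambda> + 8 * C * a"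
    proof -
      have "C * \<Lambda> \<le> C\<^sup>2 * \<Lambda>" using C Lam0 power_increasing[of 1 2 C] by (intro mult_right_mono) auto
      thus ?thesis by (simp add: power2_eq_square algebra_simps)
    qed
    finally show ?thesis .
  qed
  have "\<Phi>1 * (\<rho>t - \<kappa>') - 2 * \<epsilon>\<^sup>2 * s - (\<Phi>1 * L + \<Phi>2 - 2 * \<epsilon>\<^sup>2 * n) + g
       + (2 / \<epsilon>) * \<tau> * (\<Phi>1\<^sup>2 - 4 * \<epsilon>\<^sup>2 * \<Phi>1 * \<nu> + 4 * \<epsilon> ^ 4 * Y - 1)
     = (\<rho>t - L + g - r * h) + 4 * P * (\<tau> - tanh y) + (\<Phi>1 - 1) * (\<rho>t - L) + (- \<Phi>1 * \<kappa>')
       + (- 2 * \<epsilon>\<^sup>2 * s + 2 * \<epsilon>\<^sup>2 * n) + (- bent'' R r) + (2 / \<epsilon>) * \<tau> * (m1\<^sup>2 - 1)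
       + (2 / \<epsilon>) * \<tau> * (\<Phi>1\<^sup>2 - m1\<^sup>2 - 2 * (\<epsilon> * P))
       + (2 / \<epsilon>) * \<tau> * (4 * \<epsilon> ^ 4 * Y - 4 * \<epsilon>\<^sup>2 * \<Phi>1 * \<nu>)"
  proof -
    have p2: "\<Phi>2 = bent'' R r + 4 * tanh y * P + r * h"
      unfolding Phi(2) psi(1) P_def y_def using eps by (simp add: field_simps)
    have e1: "(2 / \<epsilon>) * \<tau> * (\<Phi>1\<^sup>2 - 4 * \<epsilon>\<^sup>2 * \<Phi>1 * \<nu> + 4 * \<epsilon> ^ 4 * Y - 1)
      = (2 / \<epsilon>) * \<tau> * (m1\<^sup>2 - 1) + (2 / \<epsilon>) * \<tau> * (\<Phi>1\<^sup>2 - m1\<^sup>2 - 2 * (\<epsilon> * P))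
       + (2 / \<epsilon>) * \<tau> * (4 * \<epsilon> ^ 4 * Y - 4 * \<epsilon>\<^sup>2 * \<Phi>1 * \<nu>) + (2 / \<epsilon>) * \<tau> * (2 * (\<epsilon> * P))"
    proof -
      have "K * (F - x + y - 1) = K * (m - 1) + K * (F - m - p) + K * (y - x) + K * p" for K F x y m p :: real
        by (simp add: algebra_simps)
      thus ?thesis .
    qed
    have e2: "(2 / \<epsilon>) * \<tau> * (2 * (\<epsilon> * P)) = 4 * P * \<tau>" using eps by simp
    show ?thesis unfolding e1 e2 p2 by (simp add: algebra_simps)
  qed
  also have "\<dots> \<le> (12 * C\<^sup>2 * \<Lambda> + 5 * C\<^sup>2 * \<kappa>) + 32 * C ^ 4 * (a + R\<^sup>2 * a / \<epsilon> + \<Lambda>) + 4 * C ^ 3 * (a + \<Lambda>)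
     + (- \<kappa>' / 2 + a) + 4 * C * \<Lambda> + \<bar>bent'' R r\<bar> + (2 / \<epsilon>) * \<tau> * (m1\<^sup>2 - 1) + (8 * C\<^sup>2 * a + 8 * C ^ 4 * \<Lambda>)
     + (48 * C\<^sup>2 * \<Lambda> + 8 * C * a)"
    by (intro add_mono T1 T2 T4 T5 T6 T8 T9 order_refl) auto
  also have "\<dots> \<le> 200 * C ^ 4 * (\<Lambda> + a + R\<^sup>2 * a / \<epsilon>) + 200 * C ^ 4 * \<kappa> - \<kappa>' / 2 + \<bar>bent'' R r\<bar> + (2 / \<epsilon>) * \<tau> * (m1\<^sup>2 - 1)"
  proof -
    have k: "c * x \<le> C ^ 4 * x" if "c \<le> C ^ 4" "x \<ge> 0" for c x using that by (intro mult_right_mono)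
    note kk = k[OF Cle(1) Lam0(1)] k[OF Cle(2) Lam0(1)] k[OF Cle(3) Lam0(1)]
      k[OF Cle(1) a0(1)] k[OF Cle(2) a0(1)] k[OF Cle(3) a0(1)] k[OF Cle(4) a0(1)] k[OF Cle(2) kap(1)]
    have n1: "0 \<le> C ^ 4 * \<Lambda>" "0 \<le> C ^ 4 * a" "0 \<le> C ^ 4 * (R\<^sup>2 * a / \<epsilon>)" "0 \<le> C ^ 4 * \<kappa>"
      using C Lam0 a0 kap eps R by auto
    define Q where "Q = R\<^sup>2 * a / \<epsilon>"
    show ?thesis using kk n1 unfolding Q_def[symmetric] distrib_left mult.assoc by linarith
  qed
  finally show ?thesis unfolding \<tau>_def m1_def .
qed

text \<open>Outside the layer, \<open>\<bar>r\<bar> \<ge> 100 \<epsilon>\<close>, the bending term is at most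
  \<open>- 2 G / (3 \<epsilon>)\<close> and dominates everything else once \<open>R\<close> and
  \<open>\<epsilon>\<close> are small; the factor 100 makes it dominate the second derivative of
  \<open>bent\<close>. Inside the layer all errors are \<open>O(\<epsilon>\<^sup>2)\<close> with a constant of
  the form \<open>10\<^sup>9 A / R\<^sup>3\<close>, and \<open>\<kappa>'\<close> absorbs them.\<close>

lemma residual_negative:
  fixes C A r R \<epsilon> :: real
  assumes A: "A = 200 * C ^ 4" and C: "C \<ge> 1" and eps: "0 < \<epsilon>" and R: "0 < R" "R \<le> 1" and r: "-R < r" "r \<le> R"
    and small: "8 * A * R\<^sup>2 \<le> 1/6" "4 * A * \<epsilon> \<le> 1/6" "100 * \<epsilon> \<le> R / 2"
    and kap: "\<epsilon>\<^sup>2 \<le> \<kappa>" "\<kappa>' \<ge> 2 * (A + 10 ^ 9 * A / R ^ 3) * \<kappa>"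
    and sgn: "100 * \<epsilon> \<le> r \<Longrightarrow> z \<ge> r / 4" "r \<le> - 100 * \<epsilon> \<Longrightarrow> z \<le> r / 4"
  defines "a \<equiv> \<bar>bent_slope (r / R)\<bar>" and "\<Lambda> \<equiv> \<epsilon>\<^sup>2 + \<bar>r\<bar> ^ 3 / \<epsilon>"
  shows "A * (\<Lambda> + a + R\<^sup>2 * a / \<epsilon>) + A * \<kappa> - \<kappa>' / 2 + \<bar>bent'' R r\<bar>
       + (2 / \<epsilon>) * tanh (z / \<epsilon>) * ((1 - bent_slope (r / R))\<^sup>2 - 1) \<le> 0"
proof -
  define G where "G = \<bar>(1 - bent_slope (r / R))\<^sup>2 - 1\<bar>"
  define T7 where "T7 = (2 / \<epsilon>) * tanh (z / \<epsilon>) * ((1 - bent_slope (r / R))\<^sup>2 - 1)"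
  note bf = bent_facts[OF R(1) r, folded a_def G_def]
  have A1: "A \<ge> 200" using C one_le_power[of C 4] unfolding A by simp
  have a0: "a \<ge> 0" "G \<ge> 0" by (auto simp: a_def G_def)
  have R3: "0 < R ^ 3" "R ^ 3 \<le> 1" using R by (auto simp: power_le_one)
  have main: "A * (\<Lambda> + a + R\<^sup>2 * a / \<epsilon>) + \<bar>bent'' R r\<bar> + T7 \<le> (10 ^ 9 * A / R ^ 3) * \<epsilon>\<^sup>2"
  proof (cases "\<bar>r\<bar> \<ge> 100 * \<epsilon>")
    case True
    have T7: "T7 \<le> - (2 / (3 * \<epsilon>)) * G"
    proof (cases "r \<ge> 0")
      case r0: True
      have "z / \<epsilon> \<ge> 1" using sgn(1) True r0 eps by simp
      hence t: "tanh (z / \<epsilon>) \<ge> 1/3" by (rule tanh_ge_third)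
      have "T7 = - ((2 / \<epsilon>) * G * tanh (z / \<epsilon>))" unfolding T7_def bf(5)[OF r0] by simp
      also have "\<dots> \<le> - ((2 / \<epsilon>) * G * (1/3))" using t a0 eps by (intro le_imp_neg_le mult_left_mono) auto
      finally show ?thesis by simp
    next
      case r0: False
      have "- z / \<epsilon> \<ge> 1" using sgn(2) True r0 eps by (simp add: field_simps)
      hence "tanh (- z / \<epsilon>) \<ge> 1/3" by (rule tanh_ge_third)
      hence t: "tanh (z / \<epsilon>) \<le> - 1/3" by simp
      have "T7 = (2 / \<epsilon>) * G * tanh (z / \<epsilon>)" unfolding T7_def bf(6)[OF less_imp_le[OF r0[unfolded not_le]]] by simp
      also have "\<dots> \<le> (2 / \<epsilon>) * G * (- 1/3)" using t a0 eps by (intro mult_left_mono) auto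
      finally show ?thesis by simp
    qed
    have b: "\<bar>bent'' R r\<bar> \<le> (12/100) * (G / \<epsilon>)"
    proof -
      have "\<bar>bent'' R r\<bar> * (100 * \<epsilon>) \<le> \<bar>bent'' R r\<bar> * \<bar>r\<bar>" using True by (intro mult_left_mono) auto
      hence "\<bar>bent'' R r\<bar> * (100 * \<epsilon>) \<le> 12 * G" using bf(4) by linarith
      thus ?thesis using eps by (simp add: field_simps)
    qed
    have L: "\<bar>r\<bar> ^ 3 / \<epsilon> \<le> R\<^sup>2 * a / \<epsilon>"
    proof -
      have "R ^ 3 * a \<le> R\<^sup>2 * a" using R a0 by (intro mult_right_mono power_decreasing) auto
      hence "\<bar>r\<bar> ^ 3 \<le> R\<^sup>2 * a" using bf(3) by linarith
      thus ?thesis using eps by (intro divide_right_mono) auto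
    qed
    define Q where "Q = R\<^sup>2 * a / \<epsilon>"
    have "\<Lambda> + a + Q \<le> \<epsilon>\<^sup>2 + a + 2 * Q" unfolding \<Lambda>_def using L[folded Q_def] by simp
    hence "A * (\<Lambda> + a + Q) \<le> A * (\<epsilon>\<^sup>2 + a + 2 * Q)" using A1 by (intro mult_left_mono) auto
    also have "\<dots> = A * \<epsilon>\<^sup>2 + A * a + 2 * A * Q" by (simp add: algebra_simps)
    finally have 1: "A * (\<Lambda> + a + Q) \<le> A * \<epsilon>\<^sup>2 + A * a + 2 * A * Q" .
    have 2: "A * a \<le> (1/6) * (G / \<epsilon>)"
    proof -
      have "A * a \<le> A * (4 * G)" using bf(2) A1 by (intro mult_left_mono) auto
      also have "\<dots> = (4 * A * \<epsilon>) * (G / \<epsilon>)" using eps by simp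
      also have "\<dots> \<le> (1/6) * (G / \<epsilon>)" using small a0 eps by (intro mult_right_mono) auto
      finally show ?thesis .
    qed
    have 3: "2 * A * Q \<le> (1/6) * (G / \<epsilon>)"
    proof -
      have "Q \<le> R\<^sup>2 * (4 * G) / \<epsilon>" unfolding Q_def using bf(2) eps by (intro divide_right_mono mult_left_mono) auto
      hence "2 * A * Q \<le> 2 * A * (R\<^sup>2 * (4 * G) / \<epsilon>)" using A1 by (intro mult_left_mono) auto
      also have "\<dots> = (8 * A * R\<^sup>2) * (G / \<epsilon>)" by simp
      also have "\<dots> \<le> (1/6) * (G / \<epsilon>)" using small a0 eps by (intro mult_right_mono) auto
      finally show ?thesis .
    qed
    have 4: "T7 \<le> - (2/3) * (G / \<epsilon>)" using T7 by simp
    have g0: "G / \<epsilon> \<ge> 0" using a0 eps by simp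
    have 5: "A * \<epsilon>\<^sup>2 \<le> (10 ^ 9 * A / R ^ 3) * \<epsilon>\<^sup>2"
    proof (rule mult_right_mono)
      have "A * R ^ 3 \<le> A * 10 ^ 9" using A1 R3 by (intro mult_left_mono) auto
      thus "A \<le> 10 ^ 9 * A / R ^ 3" using R3 by (simp add: field_simps)
    qed simp
    show ?thesis unfolding Q_def[symmetric] using 1 2 3 4 5 b g0 by linarith
  next
    case False
    hence r100: "\<bar>r\<bar> \<le> 100 * \<epsilon>" by simp
    hence rh: "\<bar>r\<bar> \<le> R / 2" using small by linarith
    define E where "E = \<epsilon>\<^sup>2 / R ^ 3"
    have E: "\<epsilon>\<^sup>2 \<le> E" "E \<ge> 0" unfolding E_def using R3 mult_right_mono[OF R3(2), of "\<epsilon>\<^sup>2"] by (auto simp: field_simps)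
    have r3: "\<bar>r\<bar> ^ 3 \<le> 10 ^ 6 * \<epsilon> ^ 3" using power_mono[OF r100, of 3] by (simp add: power_mult_distrib)
    have q: "\<bar>r\<bar> ^ 3 / R ^ 3 \<le> 10 ^ 6 * (\<epsilon> * E)"
    proof -
      have "\<bar>r\<bar> ^ 3 / R ^ 3 \<le> 10 ^ 6 * \<epsilon> ^ 3 / R ^ 3" using r3 R3 by (intro divide_right_mono) auto
      thus ?thesis unfolding E_def by (simp add: power_numeral_reduce)
    qed
    have L: "\<Lambda> \<le> (1 + 10 ^ 6) * E"
    proof -
      have "\<bar>r\<bar> ^ 3 / \<epsilon> \<le> 10 ^ 6 * \<epsilon> ^ 3 / \<epsilon>" using r3 eps by (intro divide_right_mono) auto
      also have "\<dots> = 10 ^ 6 * \<epsilon>\<^sup>2" using eps by (simp add: power_numeral_reduce)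
      finally show ?thesis unfolding \<Lambda>_def using E by simp
    qed
    have e1: "\<epsilon> \<le> 1" using small(3) R eps by linarith
    have ae: "a / \<epsilon> \<le> 22 * 10 ^ 6 * E"
    proof -
      have "a \<le> 22 * (10 ^ 6 * (\<epsilon> * E))" by (rule order_trans[OF bf(10)[OF rh]]) (use q in simp)
      thus ?thesis using eps by (simp add: field_simps)
    qed
    have aa: "a \<le> 22 * 10 ^ 6 * E"
    proof -
      have "a \<le> a / \<epsilon>" using mult_right_mono[OF e1 a0(1)] eps by (simp add: field_simps)
      thus ?thesis using ae by linarith
    qed
    have ra: "R\<^sup>2 * a / \<epsilon> \<le> 22 * 10 ^ 6 * E"
    proof -
      have "R\<^sup>2 * (a / \<epsilon>) \<le> 1 * (a / \<epsilon>)" using R a0 eps by (intro mult_right_mono) (auto simp: power_le_one)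
      thus ?thesis using ae by simp
    qed
    have Ge: "G / \<epsilon> \<le> 110 * 10 ^ 6 * E"
    proof -
      have "G \<le> 110 * (10 ^ 6 * (\<epsilon> * E))" by (rule order_trans[OF bf(11)[OF rh]]) (use q in simp)
      thus ?thesis using eps by (simp add: field_simps)
    qed
    have t7: "T7 \<le> 220 * 10 ^ 6 * E"
    proof -
      have "T7 = (2 / \<epsilon>) * (tanh (z / \<epsilon>) * ((1 - bent_slope (r / R))\<^sup>2 - 1))" unfolding T7_def by simp
      also have "\<dots> \<le> (2 / \<epsilon>) * (1 * G)"
      proof (rule mult_left_mono)
        show "tanh (z / \<epsilon>) * ((1 - bent_slope (r / R))\<^sup>2 - 1) \<le> 1 * G"
          using mult_abs_le[of "tanh (z / \<epsilon>)" 1 "(1 - bent_slope (r / R))\<^sup>2 - 1" G] abs_tanh_lt_1[of "z / \<epsilon>"] unfolding G_def by simp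
      qed (use eps in simp)
      finally have "T7 \<le> 2 * (G / \<epsilon>)" by simp
      thus ?thesis using Ge by linarith
    qed
    have b: "\<bar>bent'' R r\<bar> \<le> 172 * 10 ^ 4 * E"
    proof -
      have "r\<^sup>2 \<le> 10 ^ 4 * \<epsilon>\<^sup>2" using power_mono[OF r100, of 2] by (simp add: power_mult_distrib)
      hence "r\<^sup>2 / R ^ 3 \<le> 10 ^ 4 * \<epsilon>\<^sup>2 / R ^ 3" using R3 by (intro divide_right_mono) auto
      hence "r\<^sup>2 / R ^ 3 \<le> 10 ^ 4 * E" unfolding E_def by simp
      thus ?thesis using bf(12)[OF rh] by linarith
    qed
    have "A * (\<Lambda> + a + R\<^sup>2 * a / \<epsilon>) \<le> A * (46 * 10 ^ 6 * E)"
      using L aa ra E A1 by (intro mult_left_mono) auto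
    moreover have "E \<le> A * E" using A1 E mult_right_mono[of 1 A E] by simp
    ultimately have "A * (\<Lambda> + a + R\<^sup>2 * a / \<epsilon>) + \<bar>bent'' R r\<bar> + T7 \<le> 10 ^ 9 * (A * E)"
      using t7 b E by simp
    thus ?thesis unfolding E_def by simp
  qed
  have "(10 ^ 9 * A / R ^ 3) * \<epsilon>\<^sup>2 \<le> (10 ^ 9 * A / R ^ 3) * \<kappa>" using kap A1 R3 by (intro mult_left_mono) auto
  moreover have "Z * \<epsilon>\<^sup>2 + A * \<kappa> \<le> \<kappa>' / 2" if "Z * \<epsilon>\<^sup>2 \<le> Z * \<kappa>" "\<kappa>' \<ge> 2 * (A + Z) * \<kappa>" for Z
    using that by (simp add: algebra_simps)
  ultimately have "(10 ^ 9 * A / R ^ 3) * \<epsilon>\<^sup>2 + A * \<kappa> \<le> \<kappa>' / 2" using kap(2) by blast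
  thus ?thesis using main unfolding T7_def by linarith
qed

section \<open>Reaction term and tracked distances\<close>

definition ac_reaction :: "real \<Rightarrow> real \<Rightarrow> real \<Rightarrow> real" where
  "ac_reaction \<epsilon> \<gamma> v = - (1 / \<epsilon>\<^sup>2) * deriv W v + 1 / \<epsilon> * sqrt (2 * W v) * \<gamma>"

text \<open>The part of being a solution that comparison uses. The second derivatives enter only through
  derivatives along the coordinate lines.\<close>

definition ac_flow :: "real \<Rightarrow> real \<Rightarrow> ('a::euclidean_space \<Rightarrow> real \<Rightarrow> real) \<Rightarrow> ('a \<Rightarrow> real \<Rightarrow> real) \<Rightarrow> bool" where
  "ac_flow T \<epsilon> g u \<longleftrightarrow> continuous_on (UNIV \<times> {0..T}) (\<lambda>(x, t). u x t) \<and>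
     (\<exists>B. \<forall>x. \<forall>t\<in>{0..T}. \<bar>u x t\<bar> \<le> B) \<and>
     (\<forall>x. \<forall>t\<in>{0<..<T}. \<exists>lap. parabolic_jet u x t (lap + ac_reaction \<epsilon> (g x t) (u x t)) lap)"

text \<open>The properties of a distance function to a moving boundary at one point of space-time: unit
  gradient, bounded derivatives, and the law of motion in the form \<open>\<rho>\<^sub>t - \<Delta>\<rho> + g
  = \<rho> h + O(\<rho>\<^sup>2)\<close>, where \<open>h\<close> may be evaluated at any boundary point
  \<open>p\<close> at the price of its distance from \<open>(x, t)\<close>.\<close>

definition distance_jet ::
  "real \<Rightarrow> real \<Rightarrow> ('a::euclidean_space \<times> real) set \<Rightarrow> ('a \<Rightarrow> real \<Rightarrow> real) \<Rightarrow> ('a \<Rightarrow> real \<Rightarrow> real) \<Rightarrow> ('a \<times> real \<Rightarrow> real) \<Rightarrow> 'a \<Rightarrow> real \<Rightarrow> bool" where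
  "distance_jet C \<epsilon> S \<rho> g h x t \<longleftrightarrow>
     (\<exists>\<rho>t D1 D2. ((\<lambda>s. \<rho> x s) has_real_derivative \<rho>t) (at t) \<and>
        (\<forall>b\<in>Basis. line_derivs (\<lambda>y. \<rho> y t) x b (D1 b) (D2 b)) \<and>
        (\<Sum>b\<in>Basis. (D1 b)\<^sup>2) = 1 \<and> \<bar>\<rho>t\<bar> \<le> C \<and> \<bar>\<Sum>b\<in>Basis. D2 b\<bar> \<le> C \<and>
        (\<forall>p\<in>S. \<bar>\<rho>t - (\<Sum>b\<in>Basis. D2 b) + g x t - \<rho> x t * h p\<bar>
              \<le> C * \<bar>\<rho> x t\<bar> * (\<bar>\<rho> x t\<bar> + dist (x, t) p + \<epsilon>)))"

text \<open>An abstraction of the signed distance that retains what the barrier needs and is symmetric under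
  \<open>\<rho> \<mapsto> - \<rho>\<close>. \<open>S\<close> is the space-time boundary. The function
  \<open>h\<close> may depend on \<open>\<epsilon>\<close> and is allowed to be Lipschitz only up to an error
  \<open>\<epsilon>\<close>, since it will contain difference quotients of step \<open>\<epsilon>\<close>.\<close>

definition tracked_distance ::
  "real \<Rightarrow> real \<Rightarrow> real \<Rightarrow> real \<Rightarrow> ('a::euclidean_space \<times> real) set \<Rightarrow> ('a \<Rightarrow> real \<Rightarrow> real) \<Rightarrow> ('a \<Rightarrow> real \<Rightarrow> real) \<Rightarrow> ('a \<times> real \<Rightarrow> real) \<Rightarrow> bool" where
  "tracked_distance T C \<delta> \<epsilon> S \<rho> g h \<longleftrightarrow>
     continuous_on (UNIV \<times> {0..T}) (\<lambda>(x, t). \<rho> x t) \<and>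
     compact S \<and> S \<noteq> {} \<and> continuous_on S h \<and>
     (\<forall>p\<in>S. \<bar>h p\<bar> \<le> C) \<and> (\<forall>p\<in>S. \<forall>p'\<in>S. \<bar>h p - h p'\<bar> \<le> C * (dist p p' + \<epsilon>) \<and> dist p p' \<le> C) \<and>
     (\<forall>x. \<forall>t\<in>{0..T}. \<bar>g x t\<bar> \<le> C) \<and>
     (\<forall>x. \<forall>t\<in>{0..T}. \<bar>\<rho> x t\<bar> < \<delta> \<longrightarrow> (\<exists>p\<in>S. dist (x, t) p \<le> \<bar>\<rho> x t\<bar>)) \<and>
     (\<forall>x. \<forall>t\<in>{0<..<T}. \<bar>\<rho> x t\<bar> < \<delta> \<longrightarrow>
        distance_jet C \<epsilon> S \<rho> g h x t)"

lemma deriv_W: "deriv W v = - 2 * v * (1 - v\<^sup>2)"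
proof (rule DERIV_imp_deriv)
  have "((\<lambda>s. (1 - s\<^sup>2)\<^sup>2 / 2) has_real_derivative (2 * (1 - v\<^sup>2) * (0 - 2 * v)) / 2) (at v)"
    by (auto intro!: derivative_eq_intros)
  moreover have "(2 * (1 - v\<^sup>2) * (0 - 2 * v)) / 2 = - 2 * v * (1 - v\<^sup>2)" by simp
  ultimately show "(W has_real_derivative - 2 * v * (1 - v\<^sup>2)) (at v)" unfolding W_def[abs_def] by (simp only:)
qed

lemma sqrt_2W: "sqrt (2 * W v) = \<bar>1 - v\<^sup>2\<bar>"
  unfolding W_def by simp

lemma ac_reaction_eq: "ac_reaction \<epsilon> \<gamma> v = 2 * v * (1 - v\<^sup>2) / \<epsilon>\<^sup>2 + \<bar>1 - v\<^sup>2\<bar> * \<gamma> / \<epsilon>"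
  
proof -
  have "- (1 / \<epsilon>\<^sup>2) * (- 2 * v * (1 - v\<^sup>2)) = 2 * v * (1 - v\<^sup>2) / \<epsilon>\<^sup>2" by simp
  moreover have "1 / \<epsilon> * \<bar>1 - v\<^sup>2\<bar> * \<gamma> = \<bar>1 - v\<^sup>2\<bar> * \<gamma> / \<epsilon>" by simp
  ultimately show ?thesis unfolding ac_reaction_def deriv_W sqrt_2W by (simp only:)
qed

lemma ac_reaction_odd: "ac_reaction \<epsilon> (- \<gamma>) (- v) = - ac_reaction \<epsilon> \<gamma> v"
  unfolding ac_reaction_eq by simp

lemma line_derivs_uminus: "line_derivs f x b D1 D2 \<Longrightarrow> line_derivs (\<lambda>y. - f y) x b (- D1) (- D2)"
  using line_derivs_lincomb[of f x b D1 D2 f D1 D2 "-1" 0] by simp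

lemma parabolic_jet_uminus:
  assumes "parabolic_jet u x t ut lap" shows "parabolic_jet (\<lambda>x t. - u x t) x t (- ut) (- lap)"
proof -
  obtain D1 D2 where D: "((\<lambda>s. u x s) has_real_derivative ut) (at t)"
    "\<forall>b\<in>Basis. line_derivs (\<lambda>y. u y t) x b (D1 b) (D2 b)" "lap = (\<Sum>b\<in>Basis. D2 b)"
    using assms unfolding parabolic_jet_def by blast
  show ?thesis unfolding parabolic_jet_def
    by (intro conjI exI[of _ "\<lambda>b. - D1 b"] exI[of _ "\<lambda>b. - D2 b"])
       (use D in \<open>auto intro: line_derivs_uminus DERIV_minus simp: sum_negf\<close>)
qed

lemma ac_flow_uminus:
  assumes "ac_flow T \<epsilon> g u" shows "ac_flow T \<epsilon> (\<lambda>x t. - g x t) (\<lambda>x t. - u x t)"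
proof -
  have "\<exists>lap. parabolic_jet (\<lambda>x t. - u x t) x t (lap + ac_reaction \<epsilon> (- g x t) (- u x t)) lap"
    if t: "t \<in> {0<..<T}" for x t
  proof -
    obtain lap where "parabolic_jet u x t (lap + ac_reaction \<epsilon> (g x t) (u x t)) lap"
      using assms t unfolding ac_flow_def by blast
    from parabolic_jet_uminus[OF this] show ?thesis
      by (intro exI[of _ "- lap"]) (simp add: ac_reaction_odd)
  qed
  moreover have "continuous_on (UNIV \<times> {0..T}) (\<lambda>(x, t). - u x t)"
    using assms unfolding ac_flow_def case_prod_beta by (intro continuous_intros) auto
  ultimately show ?thesis using assms unfolding ac_flow_def by auto
qed

text \<open>The residual \<open>\<rho>\<^sub>t - \<Delta>\<rho> + g - \<rho> h\<close> is odd in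
  \<open>(\<rho>, g)\<close> for fixed \<open>h\<close>; therefore a single barrier controls both sides of the
  boundary.\<close>

lemma tracked_distance_uminus:
  assumes "tracked_distance T C \<delta> \<epsilon> S \<rho> g h"
  shows "tracked_distance T C \<delta> \<epsilon> S (\<lambda>x t. - \<rho> x t) (\<lambda>x t. - g x t) h"
proof -
  have "continuous_on (UNIV \<times> {0..T}) (\<lambda>(x, t). - \<rho> x t)"
    using assms unfolding tracked_distance_def case_prod_beta by (intro continuous_intros) auto
  moreover have "distance_jet C \<epsilon> S (\<lambda>x t. - \<rho> x t) (\<lambda>x t. - g x t) h x t"
    if t: "t \<in> {0<..<T}" and d: "\<bar>- \<rho> x t\<bar> < \<delta>" for x t
  proof -
    have d': "\<bar>\<rho> x t\<bar> < \<delta>" using d by simp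
    have "distance_jet C \<epsilon> S \<rho> g h x t"
      using assms t d' unfolding tracked_distance_def by blast
    then obtain \<rho>t D1 D2 where *: "((\<lambda>s. \<rho> x s) has_real_derivative \<rho>t) (at t)"
           "\<forall>b\<in>Basis. line_derivs (\<lambda>y. \<rho> y t) x b (D1 b) (D2 b)"
           "(\<Sum>b\<in>Basis. (D1 b)\<^sup>2) = 1" "\<bar>\<rho>t\<bar> \<le> C" "\<bar>\<Sum>b\<in>Basis. D2 b\<bar> \<le> C"
           "\<forall>p\<in>S. \<bar>\<rho>t - (\<Sum>b\<in>Basis. D2 b) + g x t - \<rho> x t * h p\<bar>
                 \<le> C * \<bar>\<rho> x t\<bar> * (\<bar>\<rho> x t\<bar> + dist (x, t) p + \<epsilon>)"
      unfolding distance_jet_def by blast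
    have "\<bar>- \<rho>t - (\<Sum>b\<in>Basis. - D2 b) + - g x t - - \<rho> x t * h p\<bar>
        \<le> C * \<bar>- \<rho> x t\<bar> * (\<bar>- \<rho> x t\<bar> + dist (x, t) p + \<epsilon>)" if "p \<in> S" for p
    proof -
      have "- \<rho>t - (\<Sum>b\<in>Basis. - D2 b) + - g x t - - \<rho> x t * h p = - (\<rho>t - (\<Sum>b\<in>Basis. D2 b) + g x t - \<rho> x t * h p)"
        by (simp add: sum_negf)
      thus ?thesis using bspec[OF *(6) that] by (simp only: abs_minus_cancel)
    qed
    thus ?thesis using *(1-5) unfolding distance_jet_def
      by (intro exI[of _ "- \<rho>t"] exI[of _ "\<lambda>b. - D1 b"] exI[of _ "\<lambda>b. - D2 b"])
         (auto intro: line_derivs_uminus DERIV_minus simp: sum_negf)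
  qed
  ultimately show ?thesis using assms unfolding tracked_distance_def by auto
qed

lemma ac_reaction_lipschitz:
  assumes "\<epsilon> > 0" "B \<ge> 0"
  obtains L where "\<And>\<gamma> a b. \<bar>\<gamma>\<bar> \<le> C \<Longrightarrow> \<bar>a\<bar> \<le> B \<Longrightarrow> \<bar>b\<bar> \<le> B \<Longrightarrow> \<bar>ac_reaction \<epsilon> \<gamma> a - ac_reaction \<epsilon> \<gamma> b\<bar> \<le> L * \<bar>a - b\<bar>"
proof
  fix \<gamma> a b :: real assume g: "\<bar>\<gamma>\<bar> \<le> C" and ab: "\<bar>a\<bar> \<le> B" "\<bar>b\<bar> \<le> B"
  have sq: "\<bar>a * a\<bar> \<le> B * B" "\<bar>a * b\<bar> \<le> B * B" "\<bar>b * b\<bar> \<le> B * B" by (intro mult_abs_le ab)+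
  have "2 * a * (1 - a\<^sup>2) - 2 * b * (1 - b\<^sup>2) = (2 * (1 - (a * a + a * b + b * b))) * (a - b)"
    by (simp add: power2_eq_square algebra_simps)
  moreover have "\<bar>2 * (1 - (a * a + a * b + b * b))\<bar> \<le> 2 + 6 * (B * B)"
  proof -
    have "\<bar>2 * (1 - (x + y + z))\<bar> \<le> 2 + 6 * c" if "\<bar>x\<bar> \<le> c" "\<bar>y\<bar> \<le> c" "\<bar>z\<bar> \<le> c" for x y z c :: real
      using that unfolding abs_le_iff by auto
    from this[OF sq] show ?thesis .
  qed
  ultimately have 1: "\<bar>2 * a * (1 - a\<^sup>2) - 2 * b * (1 - b\<^sup>2)\<bar> \<le> (2 + 6 * (B * B)) * \<bar>a - b\<bar>"
    by (metis abs_ge_zero abs_mult mult_right_mono)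
  have "\<bar>\<bar>1 - a\<^sup>2\<bar> - \<bar>1 - b\<^sup>2\<bar>\<bar> \<le> \<bar>(1 - a\<^sup>2) - (1 - b\<^sup>2)\<bar>" by (rule abs_triangle_ineq3)
  also have "(1 - a\<^sup>2) - (1 - b\<^sup>2) = - (a + b) * (a - b)" by (simp add: power2_eq_square algebra_simps)
  also have "\<bar>\<dots>\<bar> \<le> (2 * B) * \<bar>a - b\<bar>" using ab by (intro mult_abs_le) auto
  finally have 2: "\<bar>\<bar>1 - a\<^sup>2\<bar> - \<bar>1 - b\<^sup>2\<bar>\<bar> \<le> (2 * B) * \<bar>a - b\<bar>" .
  have "ac_reaction \<epsilon> \<gamma> a - ac_reaction \<epsilon> \<gamma> b = (2 * a * (1 - a\<^sup>2) - 2 * b * (1 - b\<^sup>2)) * (1 / \<epsilon>\<^sup>2) + (\<bar>1 - a\<^sup>2\<bar> - \<bar>1 - b\<^sup>2\<bar>) * (\<gamma> / \<epsilon>)"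
    unfolding ac_reaction_eq by (simp add: algebra_simps diff_divide_distrib)
  also have "\<bar>\<dots>\<bar> \<le> ((2 + 6 * (B * B)) * \<bar>a - b\<bar>) * (1 / \<epsilon>\<^sup>2) + ((2 * B) * \<bar>a - b\<bar>) * (C / \<epsilon>)"
  proof (rule order_trans[OF abs_triangle_ineq add_mono])
    show "\<bar>(2 * a * (1 - a\<^sup>2) - 2 * b * (1 - b\<^sup>2)) * (1 / \<epsilon>\<^sup>2)\<bar> \<le> ((2 + 6 * (B * B)) * \<bar>a - b\<bar>) * (1 / \<epsilon>\<^sup>2)"
      using 1 by (intro mult_abs_le) auto
    show "\<bar>(\<bar>1 - a\<^sup>2\<bar> - \<bar>1 - b\<^sup>2\<bar>) * (\<gamma> / \<epsilon>)\<bar> \<le> ((2 * B) * \<bar>a - b\<bar>) * (C / \<epsilon>)"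
      using 2 g assms by (intro mult_abs_le) (auto simp: divide_right_mono)
  qed
  also have "\<dots> = ((2 + 6 * (B * B)) * (1 / \<epsilon>\<^sup>2) + (2 * B) * (C / \<epsilon>)) * \<bar>a - b\<bar>"
  proof -
    have "(p * d) * x + (q * d) * y = (p * x + q * y) * d" for p q x y d :: real by (simp add: algebra_simps)
    thus ?thesis .
  qed
  finally show "\<bar>ac_reaction \<epsilon> \<gamma> a - ac_reaction \<epsilon> \<gamma> b\<bar> \<le> ((2 + 6 * (B * B)) * (1 / \<epsilon>\<^sup>2) + (2 * B) * (C / \<epsilon>)) * \<bar>a - b\<bar>" .
qed

text \<open>Passing from the frozen point to the nearby boundary point changes the corrector by at most the
  Lipschitz bound of \<open>h\<close>, hence an optimal frozen point cannot have a large penalty. The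
  resulting distance \<open>\<epsilon> + r\<^sup>2 / \<epsilon>\<close> is what
  \<open>residual_estimate\<close> tolerates.\<close>

lemma optimal_point_close:
  fixes X X0 \<rho> \<epsilon> r h h0 \<phi> :: real
  assumes eps: "\<epsilon> > 0" and C: "C \<ge> 0" "C' \<ge> 0" and X: "0 \<le> X" "0 \<le> X0" "X0 \<le> \<bar>\<rho>\<bar>"
    and opt: "\<epsilon> ^ 3 * h0 * \<phi> - \<epsilon>\<^sup>2 * X0\<^sup>2 \<le> \<epsilon> ^ 3 * h * \<phi> - \<epsilon>\<^sup>2 * X\<^sup>2"
    and h: "\<bar>h - h0\<bar> \<le> C * (D + \<epsilon>)" "D \<le> X + X0"
    and phi: "\<bar>\<phi>\<bar> \<le> C' * (1 + (r / \<epsilon>)\<^sup>2)"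
  shows "X \<le> \<bar>\<rho>\<bar> + \<epsilon> + 2 * C * C' * (\<epsilon> + r\<^sup>2 / \<epsilon>)"
proof (cases "X \<le> \<bar>\<rho>\<bar> + \<epsilon>")
  case True
  have "0 \<le> 2 * C * C' * (\<epsilon> + r\<^sup>2 / \<epsilon>)" using C eps by (intro mult_nonneg_nonneg add_nonneg_nonneg) auto
  thus ?thesis using True by linarith
next
  case False
  define E where "E = C' * (\<epsilon> + r\<^sup>2 / \<epsilon>)"
  have E: "\<epsilon> * \<bar>\<phi>\<bar> \<le> E"
  proof -
    have "\<epsilon> * \<bar>\<phi>\<bar> \<le> \<epsilon> * (C' * (1 + (r / \<epsilon>)\<^sup>2))" using phi eps by (intro mult_left_mono) auto
    also have "\<dots> = E" unfolding E_def using eps by (simp add: field_simps power2_eq_square)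
    finally show ?thesis .
  qed
  have E0: "E \<ge> 0" unfolding E_def using C eps by (intro mult_nonneg_nonneg add_nonneg_nonneg) auto
  have "\<epsilon>\<^sup>2 * X\<^sup>2 \<le> \<epsilon>\<^sup>2 * (X0\<^sup>2 + \<epsilon> * (\<phi> * (h - h0)))"
    using opt by (simp add: algebra_simps power_numeral_reduce)
  hence "X\<^sup>2 \<le> X0\<^sup>2 + \<epsilon> * (\<phi> * (h - h0))" using eps by simp
  also have "X0\<^sup>2 \<le> \<bar>\<rho>\<bar> * X" unfolding power2_eq_square using X False eps by (intro mult_mono) auto
  also have "\<epsilon> * (\<phi> * (h - h0)) \<le> E * (C * (2 * X))"
  proof -
    have "\<epsilon> * (\<phi> * (h - h0)) \<le> (\<epsilon> * \<bar>\<phi>\<bar>) * \<bar>h - h0\<bar>"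
      using abs_ge_self[of "\<phi> * (h - h0)"] eps by (simp add: abs_mult mult.assoc mult_left_mono)
    also have "\<dots> \<le> E * (C * (2 * X))"
    proof (rule mult_mono[OF E])
      have "D + \<epsilon> \<le> 2 * X" using h(2) X False by linarith
      hence "C * (D + \<epsilon>) \<le> C * (2 * X)" using C by (intro mult_left_mono)
      thus "\<bar>h - h0\<bar> \<le> C * (2 * X)" using h(1) by linarith
    qed (use E0 in auto)
    finally show ?thesis .
  qed
  finally have "X * X \<le> (\<bar>\<rho>\<bar> + 2 * C * E) * X" by (simp add: power2_eq_square algebra_simps)
  hence "X \<le> \<bar>\<rho>\<bar> + 2 * C * E" by (rule mult_right_le_imp_le) (use False eps in linarith)
  moreover have "2 * C * C' * (\<epsilon> + r\<^sup>2 / \<epsilon>) = 2 * C * E" by (simp only: E_def mult.assoc)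
  ultimately show ?thesis using eps by linarith
qed

text \<open>The computation that turns the supersolution inequality for \<open>- tanh (z / \<epsilon>)\<close>
  into the sign of the residual of \<open>z\<close>, for \<open>z\<close> a function \<open>\<Phi>\<close> of
  the shifted distance minus the penalty. Here \<open>\<bar>\<nabla>z\<bar>\<^sup>2 = F1\<^sup>2 - 4
  \<epsilon>\<^sup>2 F1 \<nu> + 4 \<epsilon>\<^sup>4 Y\<close> because \<open>\<rho>\<close> has unit
  gradient.\<close>

lemma transported_profile_jet:
  fixes \<rho> :: "'a::euclidean_space \<Rightarrow> real \<Rightarrow> real" and \<kappa> \<Phi> \<Phi>1 :: "real \<Rightarrow> real" and p :: "'a \<times> real"
  assumes eps: "\<epsilon> > 0"
    and rt: "((\<lambda>s. \<rho> x s) has_real_derivative \<rho>t) (at t)"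
    and rx: "\<forall>b\<in>Basis. line_derivs (\<lambda>y. \<rho> y t) x b (D1 b) (D2 b)"
    and unit: "(\<Sum>b\<in>Basis. (D1 b)\<^sup>2) = 1"
    and kap: "(\<kappa> has_real_derivative \<kappa>') (at t)"
    and Phi: "\<forall>\<^sub>F v in nhds (\<rho> x t - \<kappa> t). (\<Phi> has_real_derivative \<Phi>1 v) (at v)"
      "(\<Phi>1 has_real_derivative \<Phi>2) (at (\<rho> x t - \<kappa> t))"
  defines "z \<equiv> (\<lambda>y s. \<Phi> (\<rho> y s - \<kappa> s) - \<epsilon>\<^sup>2 * (dist (y, s) p)\<^sup>2)"
    and "\<nu> \<equiv> (\<Sum>b\<in>Basis. D1 b * ((x - fst p) \<bullet> b))" and "Y \<equiv> (norm (x - fst p))\<^sup>2"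
    and "F1 \<equiv> \<Phi>1 (\<rho> x t - \<kappa> t)"
  assumes res: "F1 * (\<rho>t - \<kappa>') - 2 * \<epsilon>\<^sup>2 * (t - snd p) - (F1 * (\<Sum>b\<in>Basis. D2 b) + \<Phi>2 - 2 * \<epsilon>\<^sup>2 * real DIM('a)) + \<gamma>
       + (2 / \<epsilon>) * tanh (z x t / \<epsilon>) * (F1\<^sup>2 - 4 * \<epsilon>\<^sup>2 * F1 * \<nu> + 4 * \<epsilon> ^ 4 * Y - 1) \<le> 0"
  shows "\<exists>Vt lap. parabolic_jet (\<lambda>y s. - tanh (z y s / \<epsilon>)) x t Vt lap \<and> Vt \<ge> lap + ac_reaction \<epsilon> \<gamma> (- tanh (z x t / \<epsilon>))"
    and "\<bar>\<nu>\<bar> \<le> norm (x - fst p)"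
proof -
  define n where "n = real DIM('a)"
  define px pt where "px = fst p" and "pt = snd p"
  have dist2: "(dist (y, s) p)\<^sup>2 = (norm (y - px))\<^sup>2 + (s - pt)\<^sup>2" for y s
    unfolding dist_prod_def px_def pt_def by (simp add: dist_norm)
  define \<tau> where "\<tau> = tanh (z x t / \<epsilon>)"
  define \<sigma> where "\<sigma> = 1 - \<tau>\<^sup>2"
  have "\<bar>\<tau>\<bar> \<le> 1" unfolding \<tau>_def using abs_tanh_lt_1[of "z x t / \<epsilon>"] by linarith
  hence sig: "\<sigma> \<ge> 0" unfolding \<sigma>_def using abs_square_le_1[of \<tau>] by linarith
  define r where "r = \<rho> x t - \<kappa> t"
  have Y: "Y = (\<Sum>b\<in>Basis. ((x - px) \<bullet> b)\<^sup>2)"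
    unfolding Y_def px_def power2_norm_eq_inner by (subst euclidean_inner) (simp only: power2_eq_square)
  have "\<nu>\<^sup>2 \<le> (\<Sum>b\<in>Basis. (D1 b)\<^sup>2) * (\<Sum>b\<in>Basis. ((x - px) \<bullet> b)\<^sup>2)"
    unfolding \<nu>_def px_def by (rule Cauchy_Schwarz_ineq_sum)
  hence "\<nu>\<^sup>2 \<le> (norm (x - fst p))\<^sup>2" unfolding unit Y[symmetric] Y_def by simp
  thus "\<bar>\<nu>\<bar> \<le> norm (x - fst p)" using abs_le_square_iff[of \<nu> "norm (x - fst p)"] by simp
  define z1 where "z1 b = F1 * D1 b - 2 * \<epsilon>\<^sup>2 * ((x - px) \<bullet> b)" for b
  define z2 where "z2 b = \<Phi>2 * (D1 b)\<^sup>2 + F1 * D2 b - 2 * \<epsilon>\<^sup>2" for b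
  define f2 where "f2 v = - tanh ((v - \<epsilon>\<^sup>2 * (t - pt)\<^sup>2) / \<epsilon>)" for v
  define f21 where "f21 v = - (1 - (tanh ((v - \<epsilon>\<^sup>2 * (t - pt)\<^sup>2) / \<epsilon>))\<^sup>2) / \<epsilon>" for v
  have df2: "(f2 has_real_derivative f21 v) (at v)" for v
    unfolding f2_def f21_def using eps by (auto intro!: derivative_eq_intros simp: diff_divide_distrib)
  have df21: "(f21 has_real_derivative 2 * \<tau> * \<sigma> / \<epsilon>\<^sup>2) (at v)" if "v - \<epsilon>\<^sup>2 * (t - pt)\<^sup>2 = z x t" for v
  proof -
    have "(f21 has_real_derivative 2 * tanh ((v - \<epsilon>\<^sup>2 * (t - pt)\<^sup>2) / \<epsilon>) * (1 - (tanh ((v - \<epsilon>\<^sup>2 * (t - pt)\<^sup>2) / \<epsilon>))\<^sup>2) / \<epsilon>\<^sup>2) (at v)"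
      unfolding f21_def using eps by (auto intro!: derivative_eq_intros simp: power2_eq_square)
    thus ?thesis unfolding that \<tau>_def \<sigma>_def .
  qed
  have space: "line_derivs (\<lambda>y. - tanh (z y t / \<epsilon>)) x b (- (\<sigma> / \<epsilon>) * z1 b) (2 * \<tau> * \<sigma> / \<epsilon>\<^sup>2 * (z1 b)\<^sup>2 - (\<sigma> / \<epsilon>) * z2 b)"
    if b: "b \<in> Basis" for b
  proof -
    have c1: "line_derivs (\<lambda>y. \<Phi> (\<rho> y t - \<kappa> t)) x b (F1 * D1 b) (\<Phi>2 * (D1 b)\<^sup>2 + F1 * D2 b)"
      unfolding F1_def
    proof (rule line_derivs_compose[where F="\<lambda>v. \<Phi> (v - \<kappa> t)" and ?F1.0="\<lambda>v. \<Phi>1 (v - \<kappa> t)"])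
      show "line_derivs (\<lambda>y. \<rho> y t) x b (D1 b) (D2 b)" using rx b by blast
      have "((\<lambda>v. v - \<kappa> t) \<longlongrightarrow> \<rho> x t - \<kappa> t) (nhds (\<rho> x t))" by (intro tendsto_intros filterlim_ident)
      from eventually_compose_filterlim[OF Phi(1) this]
      show "\<forall>\<^sub>F v in nhds (\<rho> x t). ((\<lambda>v. \<Phi> (v - \<kappa> t)) has_real_derivative \<Phi>1 (v - \<kappa> t)) (at v)"
      proof eventually_elim
        case (elim v)
        have "((\<lambda>v. v - \<kappa> t) has_real_derivative 1) (at v)" by (auto intro!: derivative_eq_intros)
        thus ?case using DERIV_chain2[where f=\<Phi> and g="\<lambda>v. v - \<kappa> t" and x=v and Db=1 and s=UNIV] elim by fastforce
      qed
      show "((\<lambda>v. \<Phi>1 (v - \<kappa> t)) has_real_derivative \<Phi>2) (at (\<rho> x t))"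
      proof -
        have "((\<lambda>v. v - \<kappa> t) has_real_derivative 1) (at (\<rho> x t))" by (auto intro!: derivative_eq_intros)
        thus ?thesis using DERIV_chain2[where f=\<Phi>1 and g="\<lambda>v. v - \<kappa> t" and x="\<rho> x t" and Db=1 and s=UNIV] Phi(2) by fastforce
      qed
    qed
    have bb: "b \<bullet> b = 1" using b by simp
    have c2: "line_derivs (\<lambda>y. \<Phi> (\<rho> y t - \<kappa> t) - \<epsilon>\<^sup>2 * (norm (y - px))\<^sup>2) x b (z1 b) (z2 b)"
      using line_derivs_lincomb[OF c1 line_derivs_norm_sq[of px x b], of 1 "- \<epsilon>\<^sup>2"] unfolding bb z1_def z2_def
      by (simp add: algebra_simps)
    have at: "\<Phi> (\<rho> x t - \<kappa> t) - \<epsilon>\<^sup>2 * (norm (x - px))\<^sup>2 - \<epsilon>\<^sup>2 * (t - pt)\<^sup>2 = z x t"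
      unfolding z_def dist2 by (simp add: algebra_simps)
    have c3: "line_derivs (\<lambda>y. f2 (\<Phi> (\<rho> y t - \<kappa> t) - \<epsilon>\<^sup>2 * (norm (y - px))\<^sup>2)) x b
        (f21 (\<Phi> (\<rho> x t - \<kappa> t) - \<epsilon>\<^sup>2 * (norm (x - px))\<^sup>2) * z1 b)
        (2 * \<tau> * \<sigma> / \<epsilon>\<^sup>2 * (z1 b)\<^sup>2 + f21 (\<Phi> (\<rho> x t - \<kappa> t) - \<epsilon>\<^sup>2 * (norm (x - px))\<^sup>2) * z2 b)"
      by (rule line_derivs_compose[OF c2]) (use df2 df21[OF at] in auto)
    have f1: "f21 (\<Phi> (\<rho> x t - \<kappa> t) - \<epsilon>\<^sup>2 * (norm (x - px))\<^sup>2) = - (\<sigma> / \<epsilon>)"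
      unfolding f21_def at \<sigma>_def \<tau>_def by (simp add: diff_divide_distrib)
    have f0: "f2 (\<Phi> (\<rho> y t - \<kappa> t) - \<epsilon>\<^sup>2 * (norm (y - px))\<^sup>2) = - tanh (z y t / \<epsilon>)" for y
      unfolding f2_def z_def dist2 by (simp add: algebra_simps)
    show ?thesis using c3 unfolding f1 f0 by simp
  qed
  define zt where "zt = F1 * (\<rho>t - \<kappa>') - 2 * \<epsilon>\<^sup>2 * (t - pt)"
  have time: "((\<lambda>s. - tanh (z x s / \<epsilon>)) has_real_derivative - (\<sigma> / \<epsilon>) * zt) (at t)"
  proof -
    have P0: "(\<Phi> has_real_derivative F1) (at (\<rho> x t - \<kappa> t))"
      using eventually_nhds_x_imp_x[OF Phi(1)] unfolding F1_def .
    have a: "((\<lambda>s. \<Phi> (\<rho> x s - \<kappa> s)) has_real_derivative F1 * (\<rho>t - \<kappa>')) (at t)"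
      by (rule DERIV_chain2[where f=\<Phi> and g="\<lambda>s. \<rho> x s - \<kappa> s"]) (intro P0 DERIV_diff rt kap)+
    have "((\<lambda>s. z x s) has_real_derivative zt) (at t)"
      unfolding z_def dist2 zt_def by (rule derivative_eq_intros a refl | simp add: algebra_simps)+
    thus ?thesis unfolding \<sigma>_def \<tau>_def using eps by (auto intro!: derivative_eq_intros)
  qed
  define lap where "lap = (\<Sum>b\<in>Basis. 2 * \<tau> * \<sigma> / \<epsilon>\<^sup>2 * (z1 b)\<^sup>2 - (\<sigma> / \<epsilon>) * z2 b)"
  have jet: "parabolic_jet (\<lambda>y s. - tanh (z y s / \<epsilon>)) x t (- (\<sigma> / \<epsilon>) * zt) lap"
    unfolding parabolic_jet_def lap_def
    by (intro conjI time exI[of _ "\<lambda>b. - (\<sigma> / \<epsilon>) * z1 b"] exI[of _ "\<lambda>b. 2 * \<tau> * \<sigma> / \<epsilon>\<^sup>2 * (z1 b)\<^sup>2 - (\<sigma> / \<epsilon>) * z2 b"] ballI space refl)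
  have s1: "(\<Sum>b\<in>Basis. (z1 b)\<^sup>2) = F1\<^sup>2 - 4 * \<epsilon>\<^sup>2 * F1 * \<nu> + 4 * \<epsilon> ^ 4 * Y"
  proof -
    have "(z1 b)\<^sup>2 = F1\<^sup>2 * (D1 b)\<^sup>2 - (4 * \<epsilon>\<^sup>2 * F1) * (D1 b * ((x - px) \<bullet> b)) + (4 * \<epsilon> ^ 4) * ((x - px) \<bullet> b)\<^sup>2" for b
      unfolding z1_def by (simp add: power2_eq_square power_numeral_reduce algebra_simps)
    hence "(\<Sum>b\<in>Basis. (z1 b)\<^sup>2) = F1\<^sup>2 * (\<Sum>b\<in>Basis. (D1 b)\<^sup>2) - (4 * \<epsilon>\<^sup>2 * F1) * \<nu> + (4 * \<epsilon> ^ 4) * Y"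
      unfolding Y \<nu>_def px_def by (simp only: sum.distrib sum_subtractf sum_distrib_left)
    thus ?thesis unfolding unit by simp
  qed
  have s2: "(\<Sum>b\<in>Basis. z2 b) = F1 * (\<Sum>b\<in>Basis. D2 b) + \<Phi>2 - 2 * \<epsilon>\<^sup>2 * n"
  proof -
    have "(\<Sum>b\<in>Basis. z2 b) = \<Phi>2 * (\<Sum>b\<in>Basis. (D1 b)\<^sup>2) + F1 * (\<Sum>b\<in>Basis. D2 b) - (\<Sum>b\<in>(Basis::'a set). 2 * \<epsilon>\<^sup>2)"
      unfolding z2_def by (simp only: sum.distrib sum_subtractf sum_distrib_left)
    thus ?thesis unfolding unit n_def by simp
  qed
  have lap: "lap = 2 * \<tau> * \<sigma> / \<epsilon>\<^sup>2 * (\<Sum>b\<in>Basis. (z1 b)\<^sup>2) - (\<sigma> / \<epsilon>) * (\<Sum>b\<in>Basis. z2 b)"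
    unfolding lap_def by (simp only: sum_subtractf sum_distrib_left)
  have re: "ac_reaction \<epsilon> \<gamma> (- tanh (z x t / \<epsilon>)) = - 2 * \<tau> * \<sigma> / \<epsilon>\<^sup>2 + \<sigma> * \<gamma> / \<epsilon>"
    unfolding ac_reaction_eq using sig unfolding \<tau>_def[symmetric] \<sigma>_def by simp
  define Q where "Q = (\<Sum>b\<in>Basis. (z1 b)\<^sup>2)"
  define Z where "Z = (\<Sum>b\<in>Basis. z2 b)"
  have "lap + ac_reaction \<epsilon> \<gamma> (- tanh (z x t / \<epsilon>)) - (- (\<sigma> / \<epsilon>) * zt)
     = (\<sigma> / \<epsilon>) * (zt - Z + \<gamma> + (2 / \<epsilon>) * \<tau> * (Q - 1))"
    unfolding lap re Q_def[symmetric] Z_def[symmetric] using eps by (simp add: field_simps power2_eq_square)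
  also have "\<dots> \<le> 0"
    using res sig eps unfolding Q_def Z_def s1 s2 zt_def \<tau>_def n_def pt_def by (intro mult_nonneg_nonpos) auto
  finally have "lap + ac_reaction \<epsilon> \<gamma> (- tanh (z x t / \<epsilon>)) \<le> - (\<sigma> / \<epsilon>) * zt" by simp
  thus "\<exists>Vt lap. parabolic_jet (\<lambda>y s. - tanh (z y s / \<epsilon>)) x t Vt lap \<and> Vt \<ge> lap + ac_reaction \<epsilon> \<gamma> (- tanh (z x t / \<epsilon>))"
    using jet by blast
qed

section \<open>One-sided control of the zero level\<close>

lemma neg_tanh_exp: "- tanh (z / \<epsilon>) = (1 - exp (2 * z / \<epsilon>)) / (1 + exp (2 * z / \<epsilon>))" for z \<epsilon> :: real
proof -
  have "- tanh (z / \<epsilon>) = tanh (- (z / \<epsilon>))" by simp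
  also have "\<dots> = (1 - exp (- 2 * (- (z / \<epsilon>)))) / (1 + exp (- 2 * (- (z / \<epsilon>))))" by (rule tanh_real_altdef)
  finally show ?thesis by simp
qed

lemma exp_scale_iff:
  fixes a b \<epsilon> :: real
  assumes "\<epsilon> > 0"
  shows "exp (2 * a / \<epsilon>) \<le> exp (2 * b / \<epsilon>) \<longleftrightarrow> a \<le> b" "exp (2 * a / \<epsilon>) < exp (2 * b / \<epsilon>) \<longleftrightarrow> a < b"
  using assms by (auto simp: divide_le_cancel divide_less_cancel)

lemma mobius_antimono: "a \<ge> 0 \<Longrightarrow> b \<ge> 0 \<Longrightarrow> (1 - a) / (1 + a) \<le> (1 - b) / (1 + b) \<longleftrightarrow> b \<le> (a::real)"
  by (simp add: field_simps)

lemma parabolic_jet_const: "parabolic_jet (\<lambda>_ _. c) x t 0 0"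
proof -
  have "line_derivs (\<lambda>y. c) x b 0 0" for b :: 'a
    unfolding line_derivs_def by (intro exI[of _ "\<lambda>_. 0"]) auto
  thus ?thesis unfolding parabolic_jet_def by (auto intro!: exI[of _ "\<lambda>_. 0"])
qed

text \<open>In the variable \<open>Y = exp (2 z / \<epsilon>)\<close> the profile \<open>- tanh (z /
  \<epsilon>)\<close> is \<open>(1 - Y) / (1 + Y)\<close>, and \<open>z \<rightarrow> -\<infinity>\<close> is
  the regular value \<open>Y = 0\<close>; so the barrier extends continuously by 1 beyond \<open>r =
  -R\<close>.\<close>

definition bent_exp :: "real \<Rightarrow> real \<Rightarrow> real \<Rightarrow> real" where
  "bent_exp R \<epsilon> v = (if v \<le> - R then 0 else exp (2 * bent R v / \<epsilon>))"

lemma bent_exp_nonneg: "bent_exp R \<epsilon> v \<ge> 0"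
  unfolding bent_exp_def by simp

lemma continuous_bent_exp:
  assumes R: "R > 0" and eps: "\<epsilon> > 0"
  shows "continuous_on UNIV (bent_exp R \<epsilon>)"
proof -
  have small: "\<bar>bent_exp R \<epsilon> v\<bar> \<le> (8 * \<epsilon> / R\<^sup>2) * \<bar>v + R\<bar>" if v: "\<bar>v + R\<bar> < R / 2" for v
  proof (cases "v \<le> - R")
    case True thus ?thesis using R eps by (simp add: bent_exp_def)
  next
    case False
    define d where "d = v + R"
    have d: "0 < d" "v \<le> - R / 2" using False v unfolding d_def by linarith+
    have "(R / 2) ^ 4 \<le> (- v) ^ 4" using d R by (intro power_mono) auto
    hence v4: "R ^ 4 / 16 \<le> v ^ 4" by (simp add: power_divide)
    have "R\<^sup>2 / (16 * d) = (R ^ 4 / 16) / (R\<^sup>2 * d)" using R d by (simp add: field_simps power_numeral_reduce)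
    also have "\<dots> \<le> v ^ 4 / (R\<^sup>2 * d)" using v4 R d by (intro divide_right_mono) auto
    finally have "bent R v \<le> - (R\<^sup>2 / (16 * d))" unfolding bent_def using d R by (simp add: d_def add.commute)
    hence "2 * bent R v / \<epsilon> \<le> 2 * (- (R\<^sup>2 / (16 * d))) / \<epsilon>" using eps by (intro divide_right_mono) auto
    also have "\<dots> = - (R\<^sup>2 / (8 * \<epsilon> * d))" using eps d by (simp add: field_simps)
    finally have "exp (2 * bent R v / \<epsilon>) \<le> exp (- (R\<^sup>2 / (8 * \<epsilon> * d)))" by simp
    also have "\<dots> \<le> 1 / (R\<^sup>2 / (8 * \<epsilon> * d))"
    proof -
      have p: "R\<^sup>2 / (8 * \<epsilon> * d) > 0" using R eps d by simp
      have "R\<^sup>2 / (8 * \<epsilon> * d) \<le> exp (R\<^sup>2 / (8 * \<epsilon> * d))" using exp_ge_add_one_self[of "R\<^sup>2 / (8 * \<epsilon> * d)"] by linarith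
      from le_imp_inverse_le[OF this p] show ?thesis unfolding exp_minus by (simp only: inverse_eq_divide)
    qed
    also have "\<dots> = (8 * \<epsilon> / R\<^sup>2) * \<bar>v + R\<bar>" using d by (simp add: d_def)
    finally show ?thesis using False by (simp add: bent_exp_def)
  qed
  have "isCont (bent_exp R \<epsilon>) v" for v
  proof -
    consider "v < - R" | "v = - R" | "v > - R" by linarith
    thus ?thesis
    proof cases
      case 1
      have "\<forall>\<^sub>F x in nhds v. bent_exp R \<epsilon> x = 0"
        using eventually_nhds_in_open[of "{..<-R}" v] 1 by (auto elim!: eventually_mono simp: bent_exp_def)
      thus ?thesis by (subst isCont_cong[where g="\<lambda>_. 0"]) auto
    next
      case 2
      have "((\<lambda>x. (8 * \<epsilon> / R\<^sup>2) * \<bar>x + R\<bar>) \<longlongrightarrow> (8 * \<epsilon> / R\<^sup>2) * \<bar>- R + R\<bar>) (at (- R))" by (intro tendsto_intros)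
      hence l: "((\<lambda>x. (8 * \<epsilon> / R\<^sup>2) * \<bar>x + R\<bar>) \<longlongrightarrow> 0) (at (- R))" by simp
      have "\<forall>\<^sub>F x in at (-R). norm (bent_exp R \<epsilon> x) \<le> (8 * \<epsilon> / R\<^sup>2) * \<bar>x + R\<bar>"
        unfolding eventually_at
      proof (intro exI[of _ "R/2"] conjI ballI impI)
        fix x assume "x \<noteq> - R \<and> dist x (- R) < R / 2"
        hence "\<bar>x + R\<bar> < R / 2" by (simp add: dist_real_def)
        from small[OF this] show "norm (bent_exp R \<epsilon> x) \<le> (8 * \<epsilon> / R\<^sup>2) * \<bar>x + R\<bar>" by simp
      qed (use R in simp)
      from Lim_null_comparison[OF this l] have "bent_exp R \<epsilon> \<midarrow>-R\<rightarrow> 0" .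
      moreover have "bent_exp R \<epsilon> (- R) = 0" by (simp add: bent_exp_def)
      ultimately show ?thesis unfolding isCont_def 2 by simp
    next
      case 3
      have ev: "\<forall>\<^sub>F x in nhds v. bent_exp R \<epsilon> x = exp (2 * bent R x / \<epsilon>)"
        using eventually_nhds_in_open[of "{-R<..}" v] 3 by (auto elim!: eventually_mono simp: bent_exp_def)
      have "isCont (\<lambda>x. exp (2 * bent R x / \<epsilon>)) v"
        using DERIV_isCont[OF bent_derivs(1)[OF R 3]] eps by (intro continuous_intros) auto
      thus ?thesis by (subst isCont_cong[OF ev])
    qed
  qed
  thus ?thesis by (simp add: continuous_at_imp_continuous_on)
qed

text \<open>The barrier is \<open>(1 - Y) / (1 + Y)\<close> with \<open>Y\<close> the maximum of \<open>exp (2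
  z / \<epsilon>)\<close> and a ramp \<open>L\<close> that ends at the constant \<open>Y0\<close>; thus it is
  the minimum of the profile and a constant on the far side. The constants are chosen in the order
  \<open>B\<close>, \<open>A\<close>, \<open>R\<close>, \<open>K\<close>, \<open>lm\<close>, and finally
  \<open>\<epsilon>\<close>: \<open>R\<close> is small so that the bending term wins outside the layer,
  \<open>K\<close> is large so that the initial data lie below the barrier, \<open>lm\<close> is large so that
  \<open>\<kappa>' = lm \<kappa>\<close> absorbs the errors inside the layer.\<close>

lemma zero_level_core:
  fixes \<rho> g u :: "'a::euclidean_space \<Rightarrow> real \<Rightarrow> real" and \<psi> \<phi> :: "real \<Rightarrow> real"
  assumes T: "T > 0" and C: "C \<ge> 1"
    and tr: "tracked_distance T C \<delta> \<epsilon> S \<rho> g h"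
    and fl: "ac_flow T \<epsilon> g u"
    and init: "\<And>x. u x 0 = q (\<rho> x 0 / \<epsilon>)"
    and psi: "C' \<ge> 1" "\<And>y. (\<psi> has_real_derivative 4 * tanh y * \<psi> y + y) (at y)"
      "\<And>y. (\<phi> has_real_derivative \<psi> y) (at y)"
      "\<And>y. \<bar>\<psi> y\<bar> \<le> C' * (1 + \<bar>y\<bar>)" "\<And>y. \<bar>\<phi> y\<bar> \<le> C' * (1 + y\<^sup>2)"
    and B: "B = C + C' + real DIM('a) + 3 + 2 * C * C'" and A: "A = 200 * B ^ 4"
    and R: "0 < R" "R \<le> 1" "R \<le> \<delta> / 4" "8 * A * R\<^sup>2 \<le> 1/6"
    and K: "K = B\<^sup>2 + B ^ 4" and lam: "lm = 2 * (A + 10 ^ 9 * A / R ^ 3)" and K': "K' = K * exp (lm * T)"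
    and eps: "0 < \<epsilon>" "300 * B\<^sup>2 * \<epsilon> \<le> R" "K' * \<epsilon> \<le> 1" "lm * K' * \<epsilon> \<le> 1" "4 * A * \<epsilon> \<le> 1/6" "\<epsilon> \<le> \<delta> / 4"
    and xt: "t1 \<in> {0..T}" "u x1 t1 = 0"
  shows "\<rho> x1 t1 \<le> (3 * B\<^sup>2 + 6 + K') * \<epsilon>\<^sup>2"
proof -
  note Rpos = R(1)
  have B1: "B \<ge> 1" "C \<le> B" "C' \<le> B" "real DIM('a) \<le> B" "C + 3 \<le> B" "3 + 2 * C * C' \<le> B"
    using C psi(1) unfolding B by (auto simp: add_increasing add_increasing2)
  have B2: "B\<^sup>2 \<ge> 1" "B ^ 4 \<ge> 1" using B1 by (auto simp: one_le_power)
  have A1: "A \<ge> 200" unfolding A using B2 by simp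
  have K1: "K \<ge> 1" "K \<ge> 0" unfolding K using B2 by auto
  have lam0: "lm > 0" unfolding lam using A1 R by (auto intro!: add_pos_nonneg)
  have K'1: "K' \<ge> 0" "K' \<ge> K" unfolding K' using K1 lam0 T mult_left_mono[of 1 "exp (lm * T)" K] by auto
  have Be: "B\<^sup>2 * \<epsilon> \<le> R / 300" using eps(2) by simp
  have eB: "\<epsilon> \<le> B\<^sup>2 * \<epsilon>" using B2 eps(1) mult_right_mono[of 1 "B\<^sup>2" \<epsilon>] by simp
  have e300: "\<epsilon> \<le> R / 300" "\<epsilon> \<le> 1" using Be eB R by linarith+
  define \<kappa> where "\<kappa> s = K * \<epsilon>\<^sup>2 * exp (lm * s)" for s
  have kap: "\<epsilon>\<^sup>2 \<le> \<kappa> s" "\<kappa> s \<le> K' * \<epsilon>\<^sup>2" "\<kappa> s \<le> \<epsilon>" "0 \<le> \<kappa> s" "K * \<epsilon>\<^sup>2 \<le> \<kappa> s" if "s \<in> {0..T}" for s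
  proof -
    have "1 \<le> exp (lm * s)" using that lam0 by simp
    from mult_left_mono[OF this, of "K * \<epsilon>\<^sup>2"] show 1: "K * \<epsilon>\<^sup>2 \<le> \<kappa> s" unfolding \<kappa>_def using K1 by simp
    moreover have "1 * \<epsilon>\<^sup>2 \<le> K * \<epsilon>\<^sup>2" using K1 by (intro mult_right_mono) auto
    ultimately show "\<epsilon>\<^sup>2 \<le> \<kappa> s" by linarith
    thus "0 \<le> \<kappa> s" using zero_le_power2[of \<epsilon>] by linarith
    have "exp (lm * s) \<le> exp (lm * T)" using that lam0 by simp
    hence "K * \<epsilon>\<^sup>2 * exp (lm * s) \<le> K * \<epsilon>\<^sup>2 * exp (lm * T)" using K1 by (intro mult_left_mono) auto
    thus 2: "\<kappa> s \<le> K' * \<epsilon>\<^sup>2" unfolding \<kappa>_def K' by (simp add: mult_ac)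
    have "K' * \<epsilon> * \<epsilon> \<le> 1 * \<epsilon>" using eps by (intro mult_right_mono) auto
    thus "\<kappa> s \<le> \<epsilon>" using 2 by (simp add: power2_eq_square mult_ac)
  qed
  have dkap: "(\<kappa> has_real_derivative lm * \<kappa> s) (at s)" for s
    unfolding \<kappa>_def[abs_def] by (auto intro!: derivative_eq_intros)
  have lkap: "lm * \<kappa> s \<le> 1" "0 \<le> lm * \<kappa> s" if "s \<in> {0..T}" for s
  proof -
    have "lm * \<kappa> s \<le> lm * (K' * \<epsilon>\<^sup>2)" using kap(2)[OF that] lam0 by (intro mult_left_mono) auto
    also have "\<dots> = (lm * K' * \<epsilon>) * \<epsilon>" by (simp add: power2_eq_square)
    also have "\<dots> \<le> 1 * 1" using eps e300 lam0 K'1 by (intro mult_mono) auto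
    finally show "lm * \<kappa> s \<le> 1" by simp
    show "0 \<le> lm * \<kappa> s" using kap(4)[OF that] lam0 by simp
  qed
  note trd = tr[unfolded tracked_distance_def]
  have cS: "compact S" "S \<noteq> {}" "continuous_on S h" using trd by blast+
  have hB: "\<bar>h p\<bar> \<le> B" if "p \<in> S" for p using trd that B1(2) by (meson order_trans)
  have hL: "\<bar>h p - h p'\<bar> \<le> C * (dist p p' + \<epsilon>)" "dist p p' \<le> C" if "p \<in> S" "p' \<in> S" for p p' using trd that by blast+
  have gC: "\<bar>g x t\<bar> \<le> C" if "t \<in> {0..T}" for x t using trd that by blast
  have near: "\<exists>p\<in>S. dist (x, t) p \<le> \<bar>\<rho> x t\<bar>" if "t \<in> {0..T}" "\<bar>\<rho> x t\<bar> < \<delta>" for x t using trd that by blast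
  have jet: "distance_jet C \<epsilon> S \<rho> g h x t" if "t \<in> {0<..<T}" "\<bar>\<rho> x t\<bar> < \<delta>" for x t using trd that by blast
  define r where "r x s = \<rho> x s - \<kappa> s" for x s
  have cr: "continuous_on (UNIV \<times> {0..T}) (\<lambda>z. r (fst z) (snd z))"
  proof -
    have "continuous_on (UNIV \<times> {0..T}) (\<lambda>z. \<rho> (fst z) (snd z))" using trd by (simp add: case_prod_beta)
    thus ?thesis unfolding r_def \<kappa>_def by (intro continuous_intros)
  qed
  have rlim: "((\<lambda>z. r (fst z) (snd z)) \<longlongrightarrow> r x t) (nhds (x, t))" if t: "t \<in> {0<..<T}" for x t
  proof -
    have "continuous_on (UNIV \<times> {0<..<T}) (\<lambda>z. r (fst z) (snd z))"
      by (rule continuous_on_subset[OF cr]) auto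
    moreover have "open (UNIV \<times> {0<..<T} :: ('a \<times> real) set)" by (intro open_Times) auto
    ultimately have "isCont (\<lambda>z. r (fst z) (snd z)) (x, t)"
      using t by (subst (asm) continuous_on_eq_continuous_at) auto
    thus ?thesis unfolding isCont_def using tendsto_at_iff_tendsto_nhds[of "\<lambda>z. r (fst z) (snd z)" "(x, t)"] by simp
  qed
  \<comment> \<open>\<open>27/50 * R\<close> lies between \<open>bent R R = R / 2\<close> and the values of \<open>bent R\<close> on \<open>[79/100 * R, 4/5 * R]\<close>, with room for the correction.\<close>
  define Y0 where "Y0 = exp (2 * ((27/50) * R) / \<epsilon>)"
  have Y0: "Y0 > 1" unfolding Y0_def using R eps by simp
  define L where "L v = Y0 * max 0 (min 1 ((v - (79/100) * R) / ((1/100) * R)))" for v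
  have L: "0 \<le> L v" "L v \<le> Y0" "v \<ge> (4/5) * R \<Longrightarrow> L v = Y0" "v \<le> (79/100) * R \<Longrightarrow> L v = 0" for v
  proof -
    show "0 \<le> L v" unfolding L_def using Y0 by simp
    show "L v \<le> Y0" unfolding L_def using Y0 mult_left_mono[of "max 0 (min 1 ((v - (79/100) * R) / ((1/100) * R)))" 1 Y0] by simp
    show "L v = Y0" if "v \<ge> (4/5) * R"
    proof -
      have "1 \<le> (v - (79/100) * R) / ((1/100) * R)" using that R by (simp add: le_divide_eq)
      thus ?thesis unfolding L_def by simp
    qed
    show "L v = 0" if "v \<le> (79/100) * R"
    proof -
      have "(v - (79/100) * R) / ((1/100) * R) \<le> 0" using that R by (intro divide_nonpos_pos) auto
      thus ?thesis unfolding L_def by simp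
    qed
  qed
  define rh where "rh x s = min (r x s) R" for x s
  define cor where "cor x s p = \<epsilon> ^ 3 * h p * \<phi> (rh x s / \<epsilon>) - \<epsilon>\<^sup>2 * (dist (x, s) p)\<^sup>2" for x s p
  define Yi where "Yi x s p = bent_exp R \<epsilon> (rh x s) * exp (2 * cor x s p / \<epsilon>)" for x s p
  define Y where "Y x s p = max (Yi x s p) (L (r x s))" for x s p
  define w where "w x s p = (1 - Y x s p) / (1 + Y x s p)" for x s p
  have Ynn: "0 \<le> Yi x s p" "0 \<le> Y x s p" for x s p unfolding Y_def Yi_def using L(1) bent_exp_nonneg by (auto simp: le_max_iff_disj)
  have w1: "\<bar>w x s p\<bar> \<le> 1" for x s p
    unfolding w_def using Ynn(2)[of x s p] by (simp add: abs_le_iff field_simps)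
  have phB: "\<bar>\<epsilon> ^ 3 * h p * \<phi> (v / \<epsilon>)\<bar> \<le> B\<^sup>2 * \<epsilon> * (\<epsilon>\<^sup>2 + v\<^sup>2)" if "p \<in> S" for p v
  proof -
    have "\<bar>\<phi> (v / \<epsilon>)\<bar> \<le> B * (1 + (v / \<epsilon>)\<^sup>2)"
      using psi(5)[of "v/\<epsilon>"] B1(3) mult_right_mono[of C' B "1 + (v / \<epsilon>)\<^sup>2"] by simp
    hence "\<bar>h p\<bar> * \<bar>\<phi> (v / \<epsilon>)\<bar> \<le> B * (B * (1 + (v / \<epsilon>)\<^sup>2))" by (intro mult_mono hB that) (use B1 in auto)
    hence "\<epsilon> ^ 3 * (\<bar>h p\<bar> * \<bar>\<phi> (v / \<epsilon>)\<bar>) \<le> \<epsilon> ^ 3 * (B * (B * (1 + (v / \<epsilon>)\<^sup>2)))" using eps by (intro mult_left_mono) auto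
    moreover have "\<bar>\<epsilon> ^ 3 * h p * \<phi> (v / \<epsilon>)\<bar> = \<epsilon> ^ 3 * (\<bar>h p\<bar> * \<bar>\<phi> (v / \<epsilon>)\<bar>)" using eps by (simp add: abs_mult)
    moreover have "\<epsilon> ^ 3 * (B * (B * (1 + (v / \<epsilon>)\<^sup>2))) = B\<^sup>2 * \<epsilon> * (\<epsilon>\<^sup>2 + v\<^sup>2)"
      using eps by (simp add: field_simps power_numeral_reduce)
    ultimately show ?thesis by simp
  qed
  have small2: "B\<^sup>2 * \<epsilon> * (\<epsilon>\<^sup>2 + v\<^sup>2) \<le> R / 150" if "\<bar>v\<bar> \<le> R" for v
  proof -
    have "v\<^sup>2 \<le> 1" using that R by (simp add: abs_square_le_1)
    moreover have "\<epsilon>\<^sup>2 \<le> 1" using e300 eps by (simp add: power_le_one)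
    ultimately have "B\<^sup>2 * \<epsilon> * (\<epsilon>\<^sup>2 + v\<^sup>2) \<le> (R / 300) * 2" using Be B2 eps R by (intro mult_mono) auto
    thus ?thesis by simp
  qed
  have distB: "dist (x, s) p \<le> B" if a: "s \<in> {0..T}" "\<bar>\<rho> x s\<bar> \<le> R + \<epsilon>" "p \<in> S" for x s p
  proof -
    have "\<bar>\<rho> x s\<bar> < \<delta>" using a R eps by linarith
    then obtain p0 where p0: "p0 \<in> S" "dist (x, s) p0 \<le> \<bar>\<rho> x s\<bar>" using near[OF a(1)] by blast
    have "dist (x, s) p \<le> dist (x, s) p0 + dist p0 p" by (rule dist_triangle)
    also have "\<dots> \<le> 2 + C" using p0 hL(2)[OF p0(1) a(3)] a(2) R e300 by linarith
    finally show ?thesis using B1 by linarith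
  qed
  have pen: "\<epsilon>\<^sup>2 * (dist (x, s) p)\<^sup>2 \<le> R / 300" if "s \<in> {0..T}" "\<bar>\<rho> x s\<bar> \<le> R + \<epsilon>" "p \<in> S" for x s p
  proof -
    have "(dist (x, s) p)\<^sup>2 \<le> B\<^sup>2" using distB[OF that] by (intro power_mono) auto
    hence "\<epsilon>\<^sup>2 * (dist (x, s) p)\<^sup>2 \<le> \<epsilon>\<^sup>2 * B\<^sup>2" by (intro mult_left_mono) auto
    also have "\<dots> = \<epsilon> * (B\<^sup>2 * \<epsilon>)" by (simp add: power2_eq_square)
    also have "\<dots> \<le> 1 * (R / 300)" using Be e300 eps R B2 by (intro mult_mono) auto
    finally show ?thesis by simp
  qed
  have rrho: "\<bar>\<rho> x s\<bar> \<le> R + \<epsilon>" if "s \<in> {0..T}" "- R \<le> r x s" "r x s \<le> R" for x s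
    using kap[OF that(1)] that unfolding r_def by linarith
  have corlow: "cor x s p \<ge> - (R / 100)" if "s \<in> {0..T}" "- R < r x s" "r x s \<le> R" "p \<in> S" for x s p
  proof -
    have rh: "rh x s = r x s" unfolding rh_def using that by simp
    have "\<bar>r x s\<bar> \<le> R" using that by linarith
    from small2[OF this] phB[OF that(4), of "r x s"] pen[OF that(1) rrho[OF that(1) less_imp_le[OF that(2)] that(3)] that(4)]
    show ?thesis unfolding cor_def rh by linarith
  qed
  have corup: "cor x s p \<le> B\<^sup>2 * \<epsilon> * (\<epsilon>\<^sup>2 + (rh x s)\<^sup>2)" if "p \<in> S" for x s p
  proof -
    have "0 \<le> \<epsilon>\<^sup>2 * (dist (x, s) p)\<^sup>2" by simp
    thus ?thesis using phB[OF that, of "rh x s"] unfolding cor_def by linarith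
  qed
  have Yi_exp: "Yi x s p = exp (2 * (bent R (rh x s) + cor x s p) / \<epsilon>)" if "- R < r x s" for x s p
    using that Rpos unfolding Yi_def bent_exp_def rh_def by (auto simp: add_divide_distrib distrib_left simp flip: exp_add)
  \<comment> \<open>On the ramp the profile is the larger branch of \<open>Y\<close>, and from \<open>R\<close> on it is the smaller one: the branches switch only where \<open>L\<close> is the constant \<open>Y0\<close>.\<close>
  have ramp: "Yi x s p > Y0" if "s \<in> {0..T}" "(79/100) * R \<le> r x s" "r x s \<le> (4/5) * R" "p \<in> S" for x s p
  proof -
    have rr: "- R < r x s" "r x s \<le> R" using that R by linarith+
    have rh: "rh x s = r x s" unfolding rh_def using that R by simp
    have "bent R (r x s) \<ge> (561/1000) * R"
    proof -
      define v where "v = r x s"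
      have v: "(79/100) * R \<le> v" "v \<le> (4/5) * R" using that by (auto simp: v_def)
      have "v ^ 4 \<le> ((4/5) * R) ^ 4" using v R by (intro power_mono) auto
      also have "\<dots> = (4096/10000) * R ^ 4" by (simp add: power_mult_distrib power_numeral_reduce)
      finally have "v ^ 4 / (R\<^sup>2 * (R + v)) \<le> ((4096/10000) * R ^ 4) / (R\<^sup>2 * ((179/100) * R))"
        using v R by (intro frac_le mult_left_mono) auto
      also have "\<dots> = ((4096/10000) / (179/100)) * R" using R by (simp add: field_simps power_numeral_reduce)
      also have "\<dots> \<le> (229/1000) * R" using R by (intro mult_right_mono) auto
      finally show ?thesis unfolding bent_def v_def[symmetric] using v by linarith
    qed
    hence "(27/50) * R < bent R (rh x s) + cor x s p" using corlow[OF that(1) rr that(4)] R unfolding rh by linarith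
    thus ?thesis unfolding Yi_exp[OF rr(1)] Y0_def exp_scale_iff[OF eps(1)] .
  qed
  have top: "Yi x s p < Y0" if "r x s \<ge> R" "p \<in> S" for x s p
  proof -
    have rh: "rh x s = R" unfolding rh_def using that by simp
    have "bent R R = R / 2" unfolding bent_def using R by (simp add: field_simps power_numeral_reduce)
    moreover have "cor x s p \<le> R / 150" using corup[OF that(2), of x s] small2[of R] R unfolding rh by simp
    ultimately have "bent R (rh x s) + cor x s p < (27/50) * R" unfolding rh using R by linarith
    moreover have "- R < r x s" using that R by linarith
    ultimately show ?thesis unfolding Y0_def by (simp only: Yi_exp exp_scale_iff[OF eps(1)])
  qed
  obtain Bu where Bu: "\<And>x t. t \<in> {0..T} \<Longrightarrow> \<bar>u x t\<bar> \<le> Bu" using fl unfolding ac_flow_def by blast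
  define Bb where "Bb = max Bu 1"
  have Bb0: "Bb \<ge> 0" unfolding Bb_def by simp
  obtain Lf where Lf: "\<And>\<gamma> a b. \<bar>\<gamma>\<bar> \<le> C \<Longrightarrow> \<bar>a\<bar> \<le> Bb \<Longrightarrow> \<bar>b\<bar> \<le> Bb \<Longrightarrow> \<bar>ac_reaction \<epsilon> \<gamma> a - ac_reaction \<epsilon> \<gamma> b\<bar> \<le> Lf * \<bar>a - b\<bar>"
    using ac_reaction_lipschitz[OF eps(1) Bb0] by metis
  have le: "u x1 t1 \<le> w x1 t1 p" if p: "p \<in> S" for p
  proof (rule family_comparison[where T=T and B=Bb and P=S and u=u and w=w and f="\<lambda>x t. ac_reaction \<epsilon> (g x t)" and L=Lf])
    show "continuous_on (UNIV \<times> {0..T}) (\<lambda>(x, t). u x t)" using fl unfolding ac_flow_def by blast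
    show "\<bar>u x t\<bar> \<le> Bb" if "t \<in> {0..T}" for x t using Bu[OF that, of x] unfolding Bb_def by simp
    show "\<bar>w x t p\<bar> \<le> Bb" for x t p using w1[of x t p] unfolding Bb_def by simp
    show "continuous_on (UNIV \<times> {0..T} \<times> S) (\<lambda>(x, t, p). w x t p)"
    proof -
      let ?Q = "UNIV \<times> {0..T} \<times> S :: ('a \<times> real \<times> 'a \<times> real) set"
      have c1: "continuous_on ?Q (\<lambda>z. r (fst z) (fst (snd z)))"
      proof -
        have "continuous_on ?Q ((\<lambda>z. r (fst z) (snd z)) \<circ> (\<lambda>z. (fst z, fst (snd z))))"
          by (intro continuous_on_compose continuous_intros continuous_on_subset[OF cr]) auto
        thus ?thesis by (simp add: comp_def)
      qed
      have c2: "continuous_on ?Q (\<lambda>z. h (snd (snd z)))"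
        by (rule continuous_on_compose2[OF cS(3)]) (auto intro!: continuous_intros)
      have c3: "continuous_on ?Q (\<lambda>z. rh (fst z) (fst (snd z)))"
        unfolding rh_def by (intro continuous_intros c1)
      have cphi: "continuous_on UNIV \<phi>" using psi(3) by (meson DERIV_isCont continuous_at_imp_continuous_on)
      have c4: "continuous_on ?Q (\<lambda>z. \<phi> (rh (fst z) (fst (snd z)) / \<epsilon>))"
        by (rule continuous_on_compose2[OF cphi]) (use eps c3 in \<open>auto intro!: continuous_intros\<close>)
      have c5: "continuous_on ?Q (\<lambda>z. bent_exp R \<epsilon> (rh (fst z) (fst (snd z))))"
        by (rule continuous_on_compose2[OF continuous_bent_exp[OF Rpos eps(1)] c3]) auto
      have "continuous_on ?Q (\<lambda>z. w (fst z) (fst (snd z)) (snd (snd z)))"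
      proof -
        have "1 + Y x s p \<noteq> 0" for x s p using Ynn(2)[of x s p] by linarith
        thus ?thesis unfolding w_def
          unfolding Y_def Yi_def cor_def L_def
          by (intro continuous_intros c1 c2 c3 c4 c5) (use eps R in auto)
      qed
      thus ?thesis by (simp add: case_prod_beta)
    qed
    show "\<bar>ac_reaction \<epsilon> (g x t) a - ac_reaction \<epsilon> (g x t) b\<bar> \<le> Lf * \<bar>a - b\<bar>" if "t \<in> {0..T}" "\<bar>a\<bar> \<le> Bb" "\<bar>b\<bar> \<le> Bb" for x t a b
      using Lf gC that by blast
    show "\<exists>ut lap. parabolic_jet u x t ut lap \<and> ut \<le> lap + ac_reaction \<epsilon> (g x t) (u x t)" if "t \<in> {0<..<T}" for x t
      using fl that unfolding ac_flow_def by blast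
    show "u x 0 \<le> w x 0 p" if p: "p \<in> S" for x p
    proof -
      have t0: "(0::real) \<in> {0..T}" using T by simp
      have rr: "r x 0 + K * \<epsilon>\<^sup>2 = \<rho> x 0" unfolding r_def \<kappa>_def by simp
      have "Y x 0 p \<le> exp (2 * \<rho> x 0 / \<epsilon>)"
        unfolding Y_def
      proof (rule max.boundedI)
        show "L (r x 0) \<le> exp (2 * \<rho> x 0 / \<epsilon>)"
        proof (cases "r x 0 \<le> (79/100) * R")
          case True thus ?thesis using L(4) by simp
        next
          case False
          have "0 \<le> K * \<epsilon>\<^sup>2" using K1 by simp
          hence "(27/50) * R \<le> \<rho> x 0" using False rr R by linarith
          hence "Y0 \<le> exp (2 * \<rho> x 0 / \<epsilon>)" unfolding Y0_def exp_scale_iff[OF eps(1)] .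
          thus ?thesis using L(2)[of "r x 0"] by linarith
        qed
        show "Yi x 0 p \<le> exp (2 * \<rho> x 0 / \<epsilon>)"
        proof (cases "r x 0 \<le> - R")
          case True thus ?thesis using R by (simp add: Yi_def bent_exp_def rh_def)
        next
          case False
          define v where "v = rh x 0"
          have v: "- R < v" "v \<le> R" "v \<le> r x 0" using False R unfolding v_def rh_def by auto
          have "B\<^sup>2 * \<epsilon> * v\<^sup>2 \<le> v ^ 4 / (2 * R ^ 3) + B ^ 4 * \<epsilon>\<^sup>2"
          proof -
            have R3: "R ^ 3 \<le> 1" "0 < R ^ 3" using R by (auto simp: power_le_one)
            have "0 \<le> (v\<^sup>2 - B\<^sup>2 * \<epsilon>)\<^sup>2" by simp
            hence "2 * (B\<^sup>2 * \<epsilon> * v\<^sup>2) \<le> v ^ 4 + B ^ 4 * \<epsilon>\<^sup>2" by (simp add: power2_diff power_mult_distrib mult_ac flip: power_mult)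
            moreover have "v ^ 4 / 2 \<le> v ^ 4 / (2 * R ^ 3)" using R3 by (intro divide_left_mono) auto
            moreover have "0 \<le> B ^ 4 * \<epsilon>\<^sup>2" by simp
            ultimately show ?thesis by linarith
          qed
          moreover have "bent R v \<le> v - v ^ 4 / (2 * R ^ 3)" by (rule bent_facts(8)[OF Rpos v(1,2)])
          moreover have "B\<^sup>2 * \<epsilon> * \<epsilon>\<^sup>2 \<le> B\<^sup>2 * \<epsilon>\<^sup>2"
          proof -
            have "(B\<^sup>2 * \<epsilon>\<^sup>2) * \<epsilon> \<le> (B\<^sup>2 * \<epsilon>\<^sup>2) * 1" using e300 by (intro mult_left_mono) auto
            thus ?thesis by (simp add: mult_ac)
          qed
          moreover have "cor x 0 p \<le> B\<^sup>2 * \<epsilon> * \<epsilon>\<^sup>2 + B\<^sup>2 * \<epsilon> * v\<^sup>2" using corup[OF p, of x 0] unfolding v_def by (simp add: distrib_left)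
          moreover have "K * \<epsilon>\<^sup>2 = B\<^sup>2 * \<epsilon>\<^sup>2 + B ^ 4 * \<epsilon>\<^sup>2" unfolding K by (simp add: distrib_right)
          ultimately have "bent R v + cor x 0 p \<le> \<rho> x 0" using v rr by linarith
          moreover have "- R < r x 0" using False by simp
          ultimately show ?thesis unfolding v_def by (simp only: Yi_exp exp_scale_iff[OF eps(1)])
        qed
      qed
      hence "(1 - exp (2 * \<rho> x 0 / \<epsilon>)) / (1 + exp (2 * \<rho> x 0 / \<epsilon>)) \<le> w x 0 p"
        unfolding w_def by (subst mobius_antimono) (auto simp: Ynn)
      thus ?thesis unfolding init q_def neg_tanh_exp .
    qed
    show "\<exists>V Vt lap. V x t = w x t p \<and> (\<forall>\<^sub>F (y, s) in nhds (x, t). w y s p \<le> V y s) \<and>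
         parabolic_jet V x t Vt lap \<and> Vt \<ge> lap + ac_reaction \<epsilon> (g x t) (V x t)"
      if t: "t \<in> {0<..<T}" and p: "p \<in> S" and opt: "\<And>p'. p' \<in> S \<Longrightarrow> w x t p \<le> w x t p'" for x t p
    proof -
      have tT: "t \<in> {0..T}" using t by auto
      define v where "v = r x t"
      consider "v \<le> - R" | "v > - R" "Yi x t p < L v" | "v > - R" "Yi x t p \<ge> L v" by linarith
      thus ?thesis
      proof cases
        case 1
        have "Y x t p = 0" unfolding Y_def Yi_def rh_def using 1 R L(4)[of v] unfolding v_def by (simp add: bent_exp_def)
        hence "w x t p = 1" unfolding w_def by simp
        moreover have "\<forall>\<^sub>F (y, s) in nhds (x, t). w y s p \<le> 1"
        proof (rule always_eventually, safe)
          fix y s show "w y s p \<le> 1" using w1[of y s p] by linarith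
        qed
        moreover have "ac_reaction \<epsilon> (g x t) 1 = 0" unfolding ac_reaction_eq by simp
        ultimately show ?thesis using parabolic_jet_const[of 1 x t] by (intro exI[of _ "\<lambda>_ _. 1"] exI[of _ 0] conjI) simp_all
      next
        case 2
        have v8: "v > (4/5) * R"
        proof (rule ccontr)
          assume n: "\<not> v > (4/5) * R"
          show False
          proof (cases "v \<le> (79/100) * R")
            case True thus False using 2 L(4) Ynn(1)[of x t p] by simp
          next
            case False
            hence "Yi x t p > Y0" using ramp[OF tT _ _ p, of x] n unfolding v_def by simp
            thus False using 2 L(2)[of v] by linarith
          qed
        qed
        define c where "c = (1 - Y0) / (1 + Y0)"
        have "Y x t p = Y0" unfolding Y_def using 2 L(3)[of v] v8 unfolding v_def by simp
        hence wc: "w x t p = c" unfolding w_def c_def by simp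
        have "\<forall>\<^sub>F z in nhds (x, t). (4/5) * R < r (fst z) (snd z)"
          by (rule order_tendstoD(1)[OF rlim[OF t]]) (use v8 in \<open>simp add: v_def\<close>)
        hence ev: "\<forall>\<^sub>F (y, s) in nhds (x, t). w y s p \<le> c"
        proof eventually_elim
          case (elim z)
          obtain y s where z: "z = (y, s)" by (cases z)
          have "Y0 \<le> Y y s p" unfolding Y_def using L(3)[of "r y s"] elim z by simp
          thus ?case unfolding z w_def c_def using Y0 Ynn(2)[of y s p] by (simp add: mobius_antimono)
        qed
        have ct: "c = - tanh ((27/50) * R / \<epsilon>)" unfolding c_def Y0_def neg_tanh_exp ..
        have "(27/50) * R / \<epsilon> \<ge> 1" using e300 eps R by (simp add: le_divide_eq)
        hence c3: "c \<le> - (1/3)" unfolding ct using tanh_ge_third by simp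
        have c2: "c\<^sup>2 \<le> 1" unfolding ct using abs_tanh_lt_1[of "(27/50) * R / \<epsilon>"] by (simp add: abs_square_le_1)
        have "ac_reaction \<epsilon> (g x t) c = ((1 - c\<^sup>2) / \<epsilon>\<^sup>2) * (2 * c + \<epsilon> * g x t)"
          unfolding ac_reaction_eq using c2 eps by (simp add: field_simps power2_eq_square)
        also have "\<dots> \<le> 0"
        proof (rule mult_nonneg_nonpos)
          have "\<epsilon> * g x t \<le> \<epsilon> * B" using gC[OF tT, of x] B1 eps by (intro mult_left_mono) auto
          also have "\<dots> \<le> \<epsilon> * B\<^sup>2" using B1 eps power_increasing[of 1 2 B] by (intro mult_left_mono) auto
          also have "\<dots> \<le> 2/3" using Be R by (simp add: mult.commute)
          finally show "2 * c + \<epsilon> * g x t \<le> 0" using c3 by linarith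
        qed (use c2 eps in auto)
        finally have "ac_reaction \<epsilon> (g x t) c \<le> 0" .
        thus ?thesis using wc ev parabolic_jet_const[of c x t] by (intro exI[of _ "\<lambda>_ _. c"] exI[of _ 0] conjI) simp_all
      next
        case 3
        have vR: "v < R"
        proof (rule ccontr)
          assume "\<not> v < R"
          hence "Yi x t p < Y0" "L v = Y0" using top[OF _ p, of x t] L(3)[of v] R unfolding v_def by auto
          thus False using 3 by simp
        qed
        have va: "\<bar>v\<bar> \<le> R" using 3 vR by linarith
        have rh: "rh x t = v" unfolding rh_def v_def[symmetric] using vR by simp
        have rhoR: "\<bar>\<rho> x t\<bar> \<le> R + \<epsilon>" using rrho[OF tT] 3 vR unfolding v_def by simp
        have rhod: "\<bar>\<rho> x t\<bar> < \<delta>" using rhoR R eps by linarith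
        have rhov: "\<rho> x t = v + \<kappa> t" unfolding v_def r_def by simp
        obtain p0 where p0: "p0 \<in> S" "dist (x, t) p0 \<le> \<bar>\<rho> x t\<bar>" using near[OF tT rhod] by blast
        define X where "X = dist (x, t) p"
        have Yp: "Y x t p = Yi x t p" unfolding Y_def using 3 by (simp add: v_def)
        have "Y x t p0 \<le> Y x t p" using opt[OF p0(1)] unfolding w_def by (subst (asm) mobius_antimono) (auto simp: Ynn)
        hence "Yi x t p0 \<le> Yi x t p" unfolding Yp by (simp add: Y_def)
        hence cors: "cor x t p0 \<le> cor x t p" using 3(1)[unfolded v_def] by (simp only: Yi_exp exp_scale_iff[OF eps(1)] add_le_cancel_left)
        have X1: "X \<le> \<bar>\<rho> x t\<bar> + \<epsilon> + 2 * C * C' * (\<epsilon> + v\<^sup>2 / \<epsilon>)"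
        proof (rule optimal_point_close[where h="h p" and h0="h p0" and \<phi>="\<phi> (v / \<epsilon>)" and D="dist p p0" and ?X0.0="dist (x, t) p0"])
          show "\<epsilon> ^ 3 * h p0 * \<phi> (v / \<epsilon>) - \<epsilon>\<^sup>2 * (dist (x, t) p0)\<^sup>2 \<le> \<epsilon> ^ 3 * h p * \<phi> (v / \<epsilon>) - \<epsilon>\<^sup>2 * X\<^sup>2"
            using cors unfolding cor_def rh X_def .
          show "dist p p0 \<le> X + dist (x, t) p0" unfolding X_def by (rule dist_triangle3)
        qed (use eps C psi p0 hL[OF p p0(1)] in \<open>auto simp: X_def\<close>)
        have vD: "\<bar>v\<bar> \<le> \<epsilon> + v\<^sup>2 / \<epsilon>"
        proof -
          have "0 \<le> (\<bar>v\<bar> - \<epsilon>)\<^sup>2" by simp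
          hence "2 * (\<epsilon> * \<bar>v\<bar>) \<le> \<epsilon>\<^sup>2 + v\<^sup>2" by (simp add: power2_diff mult_ac add_ac)
          moreover have "0 \<le> \<epsilon> * \<bar>v\<bar>" using eps by simp
          ultimately have "\<epsilon> * \<bar>v\<bar> \<le> \<epsilon>\<^sup>2 + v\<^sup>2" by linarith
          thus ?thesis using eps by (simp add: field_simps power2_eq_square)
        qed
        have X2: "X \<le> B * (\<epsilon> + v\<^sup>2 / \<epsilon>)"
        proof -
          define D where "D = \<epsilon> + v\<^sup>2 / \<epsilon>"
          have D: "\<epsilon> \<le> D" "\<bar>v\<bar> \<le> D" using vD eps unfolding D_def by auto
          have "\<bar>\<rho> x t\<bar> \<le> \<bar>v\<bar> + \<epsilon>" unfolding rhov using kap[OF tT] by linarith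
          hence "X \<le> (3 + 2 * C * C') * D" using X1 D unfolding D_def[symmetric] by (simp add: distrib_right)
          also have "\<dots> \<le> B * D" using B1 D eps by (intro mult_right_mono) auto
          finally show ?thesis unfolding D_def .
        qed
        have X3: "X \<le> B" unfolding X_def by (rule distB[OF tT rhoR p])
        have X0: "0 \<le> X" unfolding X_def by simp
        obtain \<rho>t D1 D2 where J: "((\<lambda>s. \<rho> x s) has_real_derivative \<rho>t) (at t)"
            "\<forall>b\<in>Basis. line_derivs (\<lambda>y. \<rho> y t) x b (D1 b) (D2 b)"
            "(\<Sum>b\<in>Basis. (D1 b)\<^sup>2) = 1" "\<bar>\<rho>t\<bar> \<le> C" "\<bar>\<Sum>b\<in>Basis. D2 b\<bar> \<le> C"
            "\<forall>p\<in>S. \<bar>\<rho>t - (\<Sum>b\<in>Basis. D2 b) + g x t - \<rho> x t * h p\<bar>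
              \<le> C * \<bar>\<rho> x t\<bar> * (\<bar>\<rho> x t\<bar> + dist (x, t) p + \<epsilon>)"
          using jet[OF t rhod] unfolding distance_jet_def by blast
        define \<Phi> where "\<Phi> y = bent R y + \<epsilon> ^ 3 * h p * \<phi> (y / \<epsilon>)" for y
        define \<Phi>1 where "\<Phi>1 y = (1 - bent_slope (y / R)) + \<epsilon>\<^sup>2 * h p * \<psi> (y / \<epsilon>)" for y
        define \<psi>' where "\<psi>' = 4 * tanh (v / \<epsilon>) * \<psi> (v / \<epsilon>) + v / \<epsilon>"
        define \<Phi>2 where "\<Phi>2 = bent'' R v + \<epsilon> * h p * \<psi>'"
        have dPhi: "(\<Phi> has_real_derivative \<Phi>1 y) (at y)" if "y > - R" for y
        proof -
          have c: "((\<lambda>y. \<phi> (y / \<epsilon>)) has_real_derivative \<psi> (y / \<epsilon>) * (1 / \<epsilon>)) (at y)"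
            by (rule DERIV_chain2[where f=\<phi> and g="\<lambda>y. y / \<epsilon>", OF psi(3)]) (use eps in \<open>auto intro!: derivative_eq_intros\<close>)
          have "(\<Phi> has_real_derivative (1 - bent_slope (y / R)) + \<epsilon> ^ 3 * h p * (\<psi> (y / \<epsilon>) * (1 / \<epsilon>))) (at y)"
            unfolding \<Phi>_def by (intro DERIV_add DERIV_cmult bent_derivs(1)[OF Rpos that] c)
          moreover have "\<epsilon> ^ 3 * h p * (\<psi> (y / \<epsilon>) * (1 / \<epsilon>)) = \<epsilon>\<^sup>2 * h p * \<psi> (y / \<epsilon>)"
            using eps by (simp add: power_numeral_reduce)
          ultimately show ?thesis unfolding \<Phi>1_def by simp
        qed
        have dPhi1: "(\<Phi>1 has_real_derivative \<Phi>2) (at v)"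
        proof -
          have c: "((\<lambda>y. \<psi> (y / \<epsilon>)) has_real_derivative \<psi>' * (1 / \<epsilon>)) (at v)"
            unfolding \<psi>'_def
            by (rule DERIV_chain2[where f=\<psi> and g="\<lambda>y. y / \<epsilon>", OF psi(2)]) (use eps in \<open>auto intro!: derivative_eq_intros\<close>)
          have "(\<Phi>1 has_real_derivative bent'' R v + \<epsilon>\<^sup>2 * h p * (\<psi>' * (1 / \<epsilon>))) (at v)"
            unfolding \<Phi>1_def by (intro DERIV_add DERIV_cmult bent_derivs(2)[OF Rpos 3(1)] c)
          moreover have "\<epsilon>\<^sup>2 * h p * (\<psi>' * (1 / \<epsilon>)) = \<epsilon> * h p * \<psi>'"
            using eps by (simp add: power_numeral_reduce)
          ultimately show ?thesis unfolding \<Phi>2_def by simp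
        qed
        define z where "z = (\<lambda>y s. \<Phi> (\<rho> y s - \<kappa> s) - \<epsilon>\<^sup>2 * (dist (y, s) p)\<^sup>2)"
        have zr: "z y s = bent R (r y s) + cor y s p" if "r y s \<le> R" for y s
          unfolding z_def \<Phi>_def cor_def rh_def using that by (simp add: r_def min_absorb1)
        have zx: "z x t = bent R v + \<epsilon> ^ 3 * h p * \<phi> (v / \<epsilon>) - \<epsilon>\<^sup>2 * X\<^sup>2"
          using zr[of x t] vR rh unfolding cor_def X_def v_def by simp
        define L\<rho> where "L\<rho> = (\<Sum>b\<in>Basis. D2 b)"
        define \<nu> where "\<nu> = (\<Sum>b\<in>Basis. D1 b * ((x - fst p) \<bullet> b))"
        define Yn where "Yn = (norm (x - fst p))\<^sup>2"
        have nX: "norm (x - fst p) \<le> X" unfolding X_def dist_prod_def by (simp add: dist_norm real_le_rsqrt)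
        have sX: "\<bar>t - snd p\<bar> \<le> X" unfolding X_def dist_prod_def by (simp add: dist_real_def real_le_rsqrt)
        have nuX: "\<bar>\<nu>\<bar> \<le> X"
        proof -
          have "\<nu>\<^sup>2 \<le> (\<Sum>b\<in>Basis. (D1 b)\<^sup>2) * (\<Sum>b\<in>Basis. ((x - fst p) \<bullet> b)\<^sup>2)"
            unfolding \<nu>_def by (rule Cauchy_Schwarz_ineq_sum)
          also have "\<dots> = (norm (x - fst p))\<^sup>2"
          proof -
            have "(norm (x - fst p))\<^sup>2 = (\<Sum>b\<in>Basis. ((x - fst p) \<bullet> b)\<^sup>2)"
              unfolding power2_norm_eq_inner by (subst euclidean_inner) (simp only: power2_eq_square)
            thus ?thesis unfolding J(3) by simp
          qed
          finally have "\<bar>\<nu>\<bar> \<le> norm (x - fst p)" using abs_le_square_iff[of \<nu> "norm (x - fst p)"] by simp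
          thus ?thesis using nX by linarith
        qed
        have sgn1: "\<bar>\<epsilon> ^ 3 * h p * \<phi> (v / \<epsilon>) - \<epsilon>\<^sup>2 * X\<^sup>2\<bar> \<le> \<bar>v\<bar> / 4" if big: "100 * \<epsilon> \<le> \<bar>v\<bar>"
        proof -
          have eX: "\<epsilon>\<^sup>2 * X\<^sup>2 \<le> B\<^sup>2 * \<epsilon> * (\<epsilon>\<^sup>2 + v\<^sup>2)"
          proof -
            have "X * X \<le> (B * (\<epsilon> + v\<^sup>2 / \<epsilon>)) * B" using X2 X3 X0 by (intro mult_mono) auto
            hence "\<epsilon>\<^sup>2 * X\<^sup>2 \<le> \<epsilon>\<^sup>2 * ((B * (\<epsilon> + v\<^sup>2 / \<epsilon>)) * B)" by (intro mult_left_mono) (auto simp: power2_eq_square)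
            also have "\<dots> = B\<^sup>2 * \<epsilon> * (\<epsilon>\<^sup>2 + v\<^sup>2)" using eps by (simp add: field_simps power2_eq_square)
            finally show ?thesis .
          qed
          have "\<epsilon>\<^sup>2 \<le> \<bar>v\<bar>\<^sup>2" using big eps by (intro power_mono) auto
          hence "B\<^sup>2 * \<epsilon> * (\<epsilon>\<^sup>2 + v\<^sup>2) \<le> B\<^sup>2 * \<epsilon> * (2 * v\<^sup>2)" using eps by (intro mult_left_mono) auto
          also have "\<dots> = (2 * (B\<^sup>2 * \<epsilon>)) * (\<bar>v\<bar> * \<bar>v\<bar>)" by (simp add: power2_eq_square)
          also have "\<dots> \<le> (2 * (R / 300)) * (1 * \<bar>v\<bar>)" using Be va R B2 eps by (intro mult_mono) auto
          also have "\<dots> \<le> \<bar>v\<bar> / 8" using R mult_right_mono[of R 1 "\<bar>v\<bar>"] by simp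
          finally have s: "B\<^sup>2 * \<epsilon> * (\<epsilon>\<^sup>2 + v\<^sup>2) \<le> \<bar>v\<bar> / 8" .
          have "0 \<le> \<epsilon>\<^sup>2 * X\<^sup>2" by simp
          thus ?thesis using phB[OF p, of v] eX s by linarith
        qed
        have zpos: "z x t \<ge> v / 4" if "100 * \<epsilon> \<le> v"
        proof -
          have "v \<ge> 0" using that eps by linarith
          thus ?thesis using sgn1 that bent_facts(7)[OF Rpos 3(1) less_imp_le[OF vR]] unfolding zx by linarith
        qed
        have zneg: "z x t \<le> v / 4" if "v \<le> - 100 * \<epsilon>"
        proof -
          have "v \<le> 0" using that eps by linarith
          thus ?thesis using sgn1 that bent_facts(9)[OF Rpos 3(1) less_imp_le[OF vR]] unfolding zx by linarith
        qed
        have neg: "A * ((\<epsilon>\<^sup>2 + \<bar>v\<bar> ^ 3 / \<epsilon>) + \<bar>bent_slope (v / R)\<bar> + R\<^sup>2 * \<bar>bent_slope (v / R)\<bar> / \<epsilon>) + A * \<kappa> t - (lm * \<kappa> t) / 2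
            + \<bar>bent'' R v\<bar> + (2 / \<epsilon>) * tanh (z x t / \<epsilon>) * ((1 - bent_slope (v / R))\<^sup>2 - 1) \<le> 0"
        proof (rule residual_negative[OF A B1(1) eps(1) Rpos R(2) 3(1) less_imp_le[OF vR] R(4) eps(5)])
          show "100 * \<epsilon> \<le> R / 2" using e300 Rpos by linarith
          show "lm * \<kappa> t \<ge> 2 * (A + 10 ^ 9 * A / R ^ 3) * \<kappa> t" unfolding lam by simp
        qed (use kap[OF tT] zpos zneg in auto)
        have res: "\<Phi>1 v * (\<rho>t - lm * \<kappa> t) - 2 * \<epsilon>\<^sup>2 * (t - snd p) - (\<Phi>1 v * L\<rho> + \<Phi>2 - 2 * \<epsilon>\<^sup>2 * real DIM('a)) + g x t
           + (2 / \<epsilon>) * tanh (z x t / \<epsilon>) * ((\<Phi>1 v)\<^sup>2 - 4 * \<epsilon>\<^sup>2 * \<Phi>1 v * \<nu> + 4 * \<epsilon> ^ 4 * Yn - 1) \<le> 0"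
        proof (rule order_trans[OF _ neg], unfold A, rule residual_estimate[where \<psi>'=\<psi>' and h="h p" and \<psi>="\<psi> (v / \<epsilon>)" and \<phi>="\<phi> (v / \<epsilon>)" and X=X])
          show "\<bar>\<rho>t - L\<rho> + g x t - (v + \<kappa> t) * h p\<bar> \<le> B * \<bar>v + \<kappa> t\<bar> * (\<bar>v + \<kappa> t\<bar> + X + \<epsilon>)"
          proof -
            have "\<bar>\<rho>t - L\<rho> + g x t - (v + \<kappa> t) * h p\<bar> \<le> C * \<bar>v + \<kappa> t\<bar> * (\<bar>v + \<kappa> t\<bar> + X + \<epsilon>)"
              using bspec[OF J(6) p] unfolding rhov L\<rho>_def X_def .
            also have "\<dots> \<le> B * \<bar>v + \<kappa> t\<bar> * (\<bar>v + \<kappa> t\<bar> + X + \<epsilon>)" using B1 X0 eps by (intro mult_right_mono) auto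
            finally show ?thesis .
          qed
          show "4 * B\<^sup>2 * \<epsilon> \<le> 1" using Be R by linarith
          show "z x t = bent R v + \<epsilon> ^ 3 * h p * \<phi> (v / \<epsilon>) - \<epsilon>\<^sup>2 * X\<^sup>2" by (rule zx)
          show "Yn \<le> X\<^sup>2" unfolding Yn_def using nX by (intro power_mono) auto
          show "\<psi>' = 4 * tanh (v / \<epsilon>) * \<psi> (v / \<epsilon>) + v / \<epsilon>" by (rule \<psi>'_def)
          show "\<bar>\<psi> (v / \<epsilon>)\<bar> \<le> B * (1 + \<bar>v / \<epsilon>\<bar>)"
            using psi(4)[of "v / \<epsilon>"] B1(3) mult_right_mono[of C' B "1 + \<bar>v / \<epsilon>\<bar>"] by linarith
          show "\<bar>\<phi> (v / \<epsilon>)\<bar> \<le> B * (1 + (v / \<epsilon>)\<^sup>2)"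
            using psi(5)[of "v / \<epsilon>"] B1(3) mult_right_mono[of C' B "1 + (v / \<epsilon>)\<^sup>2"] by (simp add: add_nonneg_nonneg)
        qed (use B1 eps R 3 vR kap[OF tT] lkap[OF tT] hB[OF p] X0 X2 X3 J(4,5) sX nuX in
             \<open>auto simp: Yn_def \<Phi>1_def \<Phi>2_def L\<rho>_def\<close>)
        have evR: "\<forall>\<^sub>F y in nhds (\<rho> x t - \<kappa> t). (\<Phi> has_real_derivative \<Phi>1 y) (at y)"
          using eventually_nhds_in_open[of "{-R<..}" "\<rho> x t - \<kappa> t"] 3(1) unfolding v_def r_def
          by (auto elim!: eventually_mono intro!: dPhi)
        have vv: "\<rho> x t - \<kappa> t = v" unfolding v_def r_def ..
        obtain Vt lap where V: "parabolic_jet (\<lambda>y s. - tanh (z y s / \<epsilon>)) x t Vt lap"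
          "Vt \<ge> lap + ac_reaction \<epsilon> (g x t) (- tanh (z x t / \<epsilon>))"
          using transported_profile_jet(1)[OF eps(1) J(1,2,3) dkap evR, of \<Phi>2 p "g x t"] dPhi1 res
          unfolding vv z_def L\<rho>_def \<nu>_def Yn_def by blast
        have Vx: "- tanh (z x t / \<epsilon>) = w x t p"
          unfolding neg_tanh_exp w_def Yp Yi_exp[OF 3(1)[unfolded v_def]] rh v_def[symmetric]
          using zr[of x t] vR unfolding v_def by simp
        have "\<forall>\<^sub>F z in nhds (x, t). - R < r (fst z) (snd z) \<and> r (fst z) (snd z) < R"
          using order_tendstoD[OF rlim[OF t]] 3(1) vR unfolding v_def by (auto simp: eventually_conj_iff)
        hence ev: "\<forall>\<^sub>F (y, s) in nhds (x, t). w y s p \<le> - tanh (z y s / \<epsilon>)"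
        proof eventually_elim
          case (elim a)
          obtain y s where a: "a = (y, s)" by (cases a)
          have ys: "- R < r y s" "r y s < R" using elim a by auto
          have "exp (2 * z y s / \<epsilon>) = Yi y s p" unfolding Yi_exp[OF ys(1)] zr[OF less_imp_le[OF ys(2)]]
            using ys by (simp add: rh_def min_absorb1)
          also have "\<dots> \<le> Y y s p" unfolding Y_def by simp
          finally show ?case unfolding a w_def neg_tanh_exp by (simp add: mobius_antimono Ynn)
        qed
        show ?thesis
          by (rule exI[of _ "\<lambda>y s. - tanh (z y s / \<epsilon>)"], rule exI[of _ Vt], rule exI[of _ lap])
             (intro conjI Vx ev V)
      qed
    qed
  qed (use T cS xt p in auto)
  \<comment> \<open>At a zero of \<open>u\<close> the barrier is nonnegative, so the argument \<open>bent R v + cor\<close> of the profile is nonpositive; as \<open>bent R v\<close> is at least \<open>v / 2\<close>, the value \<open>v\<close> is no larger than the correction.\<close>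
  have Yle: "Y x1 t1 p \<le> 1" if "p \<in> S" for p
  proof -
    have "0 \<le> (1 - Y x1 t1 p) / (1 + Y x1 t1 p)" using le[OF that] xt(2) unfolding w_def by simp
    thus ?thesis using Ynn(2)[of x1 t1 p] by (simp add: zero_le_divide_iff)
  qed
  define v where "v = r x1 t1"
  have rhov: "\<rho> x1 t1 = v + \<kappa> t1" unfolding v_def r_def by simp
  have k: "\<kappa> t1 \<le> K' * \<epsilon>\<^sup>2" "\<kappa> t1 \<le> \<epsilon>" "0 \<le> \<kappa> t1" using kap[OF xt(1)] by auto
  have "v \<le> (3 * B\<^sup>2 + 6) * \<epsilon>\<^sup>2"
  proof (cases "v \<le> 0")
    case True
    moreover have "0 \<le> (3 * B\<^sup>2 + 6) * \<epsilon>\<^sup>2" by simp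
    ultimately show ?thesis by linarith
  next
    case False
    obtain p1 where p1: "p1 \<in> S" using cS by blast
    have v8: "v < (4/5) * R"
    proof (rule ccontr)
      assume "\<not> v < (4/5) * R"
      hence "Y x1 t1 p1 \<ge> Y0" unfolding Y_def using L(3)[of v] by (simp add: v_def)
      thus False using Yle[OF p1] Y0 by simp
    qed
    have vR: "- R < v" "v \<le> R" using False v8 R by linarith+
    have "\<bar>\<rho> x1 t1\<bar> \<le> R + \<epsilon>" using rrho[OF xt(1)] vR unfolding v_def by simp
    hence "\<bar>\<rho> x1 t1\<bar> < \<delta>" using R eps by linarith
    then obtain p where p: "p \<in> S" "dist (x1, t1) p \<le> \<bar>\<rho> x1 t1\<bar>" using near[OF xt(1)] by blast
    have rh: "rh x1 t1 = v" unfolding rh_def v_def[symmetric] using vR by simp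
    have "exp (2 * (bent R v + cor x1 t1 p) / \<epsilon>) \<le> 1"
      using Yle[OF p(1)] Yi_exp[of x1 t1 p] vR unfolding Y_def v_def[symmetric] rh by simp
    hence "bent R v + cor x1 t1 p \<le> 0" using eps by (simp add: divide_le_0_iff)
    moreover have "bent R v \<ge> v / 2" by (rule bent_facts(7)[OF Rpos vR]) (use False in simp)
    ultimately have 1: "v / 2 \<le> - cor x1 t1 p" by linarith
    have rho: "\<bar>\<rho> x1 t1\<bar> \<le> v + \<epsilon>" unfolding rhov using k False by linarith
    have pe: "\<epsilon>\<^sup>2 * (dist (x1, t1) p)\<^sup>2 \<le> 2 * \<epsilon>\<^sup>2 * v\<^sup>2 + 2 * \<epsilon>\<^sup>2"
    proof -
      have "(dist (x1, t1) p)\<^sup>2 \<le> (v + \<epsilon>)\<^sup>2" using p(2) rho by (intro power_mono) auto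
      also have "\<dots> \<le> 2 * v\<^sup>2 + 2 * \<epsilon>\<^sup>2" using zero_le_power2[of "v - \<epsilon>"] by (simp add: power2_eq_square algebra_simps)
      also have "\<epsilon>\<^sup>2 \<le> 1" using e300 eps by (simp add: power_le_one)
      finally have "(dist (x1, t1) p)\<^sup>2 \<le> 2 * v\<^sup>2 + 2" by simp
      from mult_left_mono[OF this, of "\<epsilon>\<^sup>2"] show ?thesis by (simp add: algebra_simps)
    qed
    have ph: "\<bar>\<epsilon> ^ 3 * h p * \<phi> (v / \<epsilon>)\<bar> \<le> B\<^sup>2 * \<epsilon> * \<epsilon>\<^sup>2 + B\<^sup>2 * \<epsilon> * v\<^sup>2" using phB[OF p(1), of v] by (simp add: distrib_left)
    have b1: "B\<^sup>2 * \<epsilon> * \<epsilon>\<^sup>2 \<le> B\<^sup>2 * \<epsilon>\<^sup>2"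
    proof -
      have "(B\<^sup>2 * \<epsilon>\<^sup>2) * \<epsilon> \<le> (B\<^sup>2 * \<epsilon>\<^sup>2) * 1" using e300 by (intro mult_left_mono) auto
      thus ?thesis by (simp add: mult_ac)
    qed
    have vv: "v\<^sup>2 \<le> v" using False vR R by (simp add: power2_eq_square mult_left_le)
    have b2: "B\<^sup>2 * \<epsilon> * v\<^sup>2 \<le> (1/300) * v" using Be R B2 eps vv by (intro mult_mono) auto
    have b3: "\<epsilon>\<^sup>2 * v\<^sup>2 \<le> (1/300) * v"
    proof (rule mult_mono[OF _ vv])
      have "\<epsilon>\<^sup>2 \<le> \<epsilon> * 1" unfolding power2_eq_square using e300 eps by (intro mult_left_mono) auto
      thus "\<epsilon>\<^sup>2 \<le> 1/300" using e300 R by linarith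
    qed auto
    have "v / 2 \<le> (B\<^sup>2 * \<epsilon>\<^sup>2 + (1/300) * v) + (2 * ((1/300) * v) + 2 * \<epsilon>\<^sup>2)"
      using 1 ph pe b1 b2 b3 unfolding cor_def rh by linarith
    hence "v \<le> 3 * (B\<^sup>2 * \<epsilon>\<^sup>2) + 6 * \<epsilon>\<^sup>2"
    proof -
      assume h: "v / 2 \<le> (B\<^sup>2 * \<epsilon>\<^sup>2 + (1/300) * v) + (2 * ((1/300) * v) + 2 * \<epsilon>\<^sup>2)"
      have "0 \<le> B\<^sup>2 * \<epsilon>\<^sup>2" "0 \<le> \<epsilon>\<^sup>2" by auto
      thus ?thesis using h by linarith
    qed
    thus ?thesis by (simp add: distrib_right)
  qed
  thus ?thesis unfolding rhov using k by (simp add: distrib_right)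
qed

theorem zero_level_upper_bound:
  assumes T: "T > 0" and C: "C \<ge> 1" and \<delta>: "\<delta> > 0"
  shows "\<exists>\<epsilon>\<^sub>0>0. \<exists>M. \<forall>\<epsilon> S (\<rho> :: 'a::euclidean_space \<Rightarrow> real \<Rightarrow> real) g h u.
    0 < \<epsilon> \<and> \<epsilon> \<le> \<epsilon>\<^sub>0 \<longrightarrow> tracked_distance T C \<delta> \<epsilon> S \<rho> g h \<longrightarrow> ac_flow T \<epsilon> g u \<longrightarrow>
    (\<forall>x. u x 0 = q (\<rho> x 0 / \<epsilon>)) \<longrightarrow> (\<forall>x. \<forall>t\<in>{0..T}. u x t = 0 \<longrightarrow> \<rho> x t \<le> M * \<epsilon>\<^sup>2)"
proof -
  obtain \<psi> \<phi> :: "real \<Rightarrow> real" and C' where psi: "C' \<ge> 1"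
    "\<And>y. (\<psi> has_real_derivative 4 * tanh y * \<psi> y + y) (at y)"
    "\<And>y. (\<phi> has_real_derivative \<psi> y) (at y)"
    "\<And>y. \<bar>\<psi> y\<bar> \<le> C' * (1 + \<bar>y\<bar>)"
    "\<And>y. \<bar>\<phi> y\<bar> \<le> C' * (1 + y\<^sup>2)"
    by (rule corrector_profile) (rule that)
  define B where "B = C + C' + real DIM('a) + 3 + 2 * C * C'"
  have B1: "B \<ge> 1" unfolding B_def using C psi(1) by (simp add: add_increasing add_increasing2)
  define A where "A = 200 * B ^ 4"
  have A0: "A > 0" unfolding A_def using B1 by simp
  define R where "R = min (min 1 (\<delta> / 4)) (1 / (48 * A))"
  have R: "0 < R" "R \<le> 1" "R \<le> \<delta> / 4" "R \<le> 1 / (48 * A)" unfolding R_def using \<delta> A0 by auto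
  have R2: "8 * A * R\<^sup>2 \<le> 1/6"
  proof -
    have "R\<^sup>2 \<le> R * 1" unfolding power2_eq_square using R by (intro mult_left_mono) auto
    hence "R\<^sup>2 \<le> 1 / (48 * A)" using R(4) by linarith
    hence "8 * A * R\<^sup>2 \<le> 8 * A * (1 / (48 * A))" using A0 by (intro mult_left_mono) auto
    thus ?thesis using A0 by simp
  qed
  define K where "K = B\<^sup>2 + B ^ 4"
  define lm where "lm = 2 * (A + 10 ^ 9 * A / R ^ 3)"
  define K' where "K' = K * exp (lm * T)"
  have K0: "K > 0" unfolding K_def using B1 by (auto intro!: add_pos_pos)
  have K'0: "K' > 0" unfolding K'_def using K0 by simp
  have lm0: "lm > 0" unfolding lm_def using A0 R by (auto intro!: add_pos_pos)
  define e0 where "e0 = Min {R / (300 * B\<^sup>2), 1 / K', 1 / (lm * K'), 1 / (24 * A), \<delta> / 4}"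
  have e0: "e0 > 0" unfolding e0_def using R B1 K'0 lm0 A0 \<delta> by simp
  have le: "e0 \<le> R / (300 * B\<^sup>2)" "e0 \<le> 1 / K'" "e0 \<le> 1 / (lm * K')" "e0 \<le> 1 / (24 * A)" "e0 \<le> \<delta> / 4"
    unfolding e0_def by auto
  have scale: "c * \<epsilon> \<le> d" if "\<epsilon> \<le> d / c" "c > 0" for c d \<epsilon> :: real
    using that by (simp add: field_simps)
  show ?thesis
  proof (rule exI[of _ e0], rule conjI[OF e0], rule exI[of _ "3 * B\<^sup>2 + 6 + K'"], intro allI impI ballI)
    fix \<epsilon> S g h u and \<rho> :: "'a \<Rightarrow> real \<Rightarrow> real" and x t
    assume e: "0 < \<epsilon> \<and> \<epsilon> \<le> e0" and tr: "tracked_distance T C \<delta> \<epsilon> S \<rho> g h" and fl: "ac_flow T \<epsilon> g u"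
      and init: "\<forall>x. u x 0 = q (\<rho> x 0 / \<epsilon>)" and t: "t \<in> {0..T}" and ux: "u x t = 0"
    have s: "\<epsilon> \<le> R / (300 * B\<^sup>2)" "\<epsilon> \<le> 1 / K'" "\<epsilon> \<le> 1 / (lm * K')" "\<epsilon> \<le> 1 / (24 * A)" "\<epsilon> \<le> \<delta> / 4"
      using e le by linarith+
    have s1: "300 * B\<^sup>2 * \<epsilon> \<le> R" using scale[OF s(1)] B1 by simp
    have s2: "K' * \<epsilon> \<le> 1" using scale[OF s(2) K'0] .
    have s3: "lm * K' * \<epsilon> \<le> 1" using scale[OF s(3)] lm0 K'0 by simp
    have s4: "4 * A * \<epsilon> \<le> 1/6" using scale[OF s(4)] A0 by simp
    show "\<rho> x t \<le> (3 * B\<^sup>2 + 6 + K') * \<epsilon>\<^sup>2"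
      by (rule zero_level_core[OF T C tr fl _ psi B_def A_def R(1-3) R2 K_def lm_def K'_def _ s1 s2 s3 s4 s(5) t ux])
         (use init e in auto)
  qed
qed

section \<open>Calculus of smooth functions\<close>

lemma frechet_derivative_local:
  assumes "open U" "x \<in> U" "\<And>y. y \<in> U \<Longrightarrow> f y = g y"
  shows "frechet_derivative f (at x) = frechet_derivative g (at x)" "f differentiable (at x) \<longleftrightarrow> g differentiable (at x)"
proof -
  have e: "(f has_derivative D) (at x) \<longleftrightarrow> (g has_derivative D) (at x)" for D
    using has_derivative_transform_within_open[of f D x UNIV U g] has_derivative_transform_within_open[of g D x UNIV U f] assms by auto
  show "frechet_derivative f (at x) = frechet_derivative g (at x)" unfolding frechet_derivative_def e ..
  show "f differentiable (at x) \<longleftrightarrow> g differentiable (at x)" unfolding differentiable_def e ..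
qed

lemma dir_deriv_local:
  assumes "open U" "x \<in> U" "\<And>y. y \<in> U \<Longrightarrow> f y = g y"
  shows "dir_deriv f b x = dir_deriv g b x"
  using frechet_derivative_local(1)[of U x f g] assms by (simp add: dir_deriv_def)

lemma dir_derivI: "(f has_derivative D) (at x) \<Longrightarrow> dir_deriv f b x = D b"
  unfolding dir_deriv_def using frechet_derivative_at by metis

lemma Ck_on_cong:
  assumes "open U" "\<And>y. y \<in> U \<Longrightarrow> f y = g y" "Ck_on k U f"
  shows "Ck_on k U g"
  using assms(2,3)
proof (induction k arbitrary: f g)
  case 0 thus ?case using continuous_on_cong[of U U f g] by simp
next
  case (Suc k)
  have "Ck_on k U (dir_deriv g b)" if b: "b \<in> Basis" for b
  proof (rule Suc.IH)
    show "Ck_on k U (dir_deriv f b)" using Suc.prems(2) b by simp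
    show "dir_deriv f b y = dir_deriv g b y" if "y \<in> U" for y
      using dir_deriv_local[of U y f g b] assms(1) that Suc.prems(1) by blast
  qed
  moreover have "\<forall>x\<in>U. g differentiable (at x)"
  proof
    fix x assume x: "x \<in> U"
    have "f differentiable (at x)" using Suc.prems(2) x by simp
    thus "g differentiable (at x)" using frechet_derivative_local(2)[of U x f g] assms(1) x Suc.prems(1) by blast
  qed
  ultimately show ?case unfolding Ck_on.simps by blast
qed

lemma Ck_on_subset: "Ck_on k U f \<Longrightarrow> V \<subseteq> U \<Longrightarrow> Ck_on k V f"
  by (induction k arbitrary: f) (auto intro: continuous_on_subset)

lemma Ck_on_SucD: "Ck_on (Suc k) U f \<Longrightarrow> Ck_on k U f"
proof (induction k arbitrary: f)
  case 0 thus ?case by (auto intro!: continuous_at_imp_continuous_on differentiable_imp_continuous_within)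
qed auto

lemma Ck_on_const: "Ck_on k U (\<lambda>x. c)"
proof (induction k arbitrary: c)
  case (Suc k)
  have "dir_deriv (\<lambda>x. c) b = (\<lambda>x. 0)" for b :: 'a
    by (rule ext, rule dir_derivI) (auto intro!: derivative_eq_intros)
  thus ?case using Suc by auto
qed simp

lemma Ck_on_inner: "Ck_on k U (\<lambda>x. x \<bullet> c)"
proof (cases k)
  case (Suc m)
  have "dir_deriv (\<lambda>x. x \<bullet> c) b = (\<lambda>x. b \<bullet> c)" for b :: 'a
    by (rule ext, rule dir_derivI) (auto intro!: derivative_eq_intros)
  moreover have "(\<lambda>x. x \<bullet> c) differentiable (at x)" for x :: 'a
    unfolding differentiable_def by (auto intro!: derivative_eq_intros)
  ultimately show ?thesis unfolding Suc by (auto intro: Ck_on_const)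
qed (auto intro!: continuous_intros)

lemma Ck_on_add:
  assumes "open U" "Ck_on k U f" "Ck_on k U g"
  shows "Ck_on k U (\<lambda>x. f x + g x)"
  using assms(2,3)
proof (induction k arbitrary: f g)
  case 0 thus ?case unfolding Ck_on.simps by (intro continuous_intros)
next
  case (Suc k)
  have "Ck_on k U (dir_deriv (\<lambda>x. f x + g x) b)" if b: "b \<in> Basis" for b
  proof (rule Ck_on_cong[OF assms(1)])
    have "Ck_on k U (dir_deriv f b)" "Ck_on k U (dir_deriv g b)" using Suc.prems b by simp_all
    thus "Ck_on k U (\<lambda>x. dir_deriv f b x + dir_deriv g b x)" by (rule Suc.IH)
    fix x assume "x \<in> U"
    hence "f differentiable (at x)" "g differentiable (at x)" using Suc.prems by simp_all
    hence "(f has_derivative frechet_derivative f (at x)) (at x)" "(g has_derivative frechet_derivative g (at x)) (at x)"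
      by (simp_all only: frechet_derivative_works[symmetric])
    from dir_derivI[OF has_derivative_add[OF this]]
    show "dir_deriv f b x + dir_deriv g b x = dir_deriv (\<lambda>x. f x + g x) b x" by (simp add: dir_deriv_def)
  qed
  moreover have "\<forall>x\<in>U. (\<lambda>x. f x + g x) differentiable (at x)" using Suc.prems by (simp add: differentiable_add)
  ultimately show ?case unfolding Ck_on.simps by blast
qed

lemma Ck_on_mult:
  assumes "open U" "Ck_on k U f" "Ck_on k U g"
  shows "Ck_on k U (\<lambda>x. f x * g x)"
  using assms(2,3)
proof (induction k arbitrary: f g)
  case 0 thus ?case unfolding Ck_on.simps by (intro continuous_intros)
next
  case (Suc k)
  have "Ck_on k U (dir_deriv (\<lambda>x. f x * g x) b)" if b: "b \<in> Basis" for b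
  proof (rule Ck_on_cong[OF assms(1)])
    have fg: "Ck_on k U f" "Ck_on k U g" using Suc.prems Ck_on_SucD by blast+
    have "Ck_on k U (dir_deriv f b)" "Ck_on k U (dir_deriv g b)" using Suc.prems b by auto
    thus "Ck_on k U (\<lambda>x. f x * dir_deriv g b x + dir_deriv f b x * g x)"
      using Suc.IH[OF fg(1)] Suc.IH[OF _ fg(2)] by (intro Ck_on_add[OF assms(1)])
    fix x assume "x \<in> U"
    hence "f differentiable (at x)" "g differentiable (at x)" using Suc.prems by simp_all
    hence "(f has_derivative frechet_derivative f (at x)) (at x)" "(g has_derivative frechet_derivative g (at x)) (at x)"
      by (simp_all only: frechet_derivative_works[symmetric])
    from dir_derivI[OF has_derivative_mult[OF this]]
    show "f x * dir_deriv g b x + dir_deriv f b x * g x = dir_deriv (\<lambda>x. f x * g x) b x" by (simp add: dir_deriv_def)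
  qed
  moreover have "\<forall>x\<in>U. (\<lambda>x. f x * g x) differentiable (at x)" using Suc.prems by (simp add: differentiable_mult)
  ultimately show ?case unfolding Ck_on.simps by blast
qed

lemma Ck_on_sum:
  assumes "open U" "\<And>i. i \<in> I \<Longrightarrow> Ck_on k U (f i)"
  shows "Ck_on k U (\<lambda>x. \<Sum>i\<in>I. f i x)"
  using assms(2)
proof (induction I rule: infinite_finite_induct)
  case (insert i I)
  thus ?case using Ck_on_add[OF assms(1), of k "f i" "\<lambda>x. \<Sum>i\<in>I. f i x"] by simp
qed (auto intro: Ck_on_const)

lemma dir_deriv_compose:
  fixes f :: "'a::euclidean_space \<Rightarrow> real"
  assumes "f differentiable (at x)" "(F has_real_derivative F') (at (f x))"
  shows "dir_deriv (\<lambda>x. F (f x)) b x = F' * dir_deriv f b x" "(\<lambda>x. F (f x)) differentiable (at x)"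
proof -
  have "(f has_derivative frechet_derivative f (at x)) (at x)" using assms(1) frechet_derivative_works by blast
  from has_derivative_compose[OF this assms(2)[unfolded has_field_derivative_def]]
  have d: "((\<lambda>x. F (f x)) has_derivative (\<lambda>h. F' * frechet_derivative f (at x) h)) (at x)" .
  show "dir_deriv (\<lambda>x. F (f x)) b x = F' * dir_deriv f b x" using dir_derivI[OF d] by (simp add: dir_deriv_def)
  show "(\<lambda>x. F (f x)) differentiable (at x)" using d unfolding differentiable_def by blast
qed

text \<open>Since \<open>Ck_on\<close> speaks of iterated directional derivatives, the outer function is given
  together with all its derivatives, as a sequence.\<close>

lemma Ck_on_compose:
  fixes G :: "nat \<Rightarrow> real \<Rightarrow> real"
  assumes "open U" "\<And>n v. v \<in> I \<Longrightarrow> (G n has_real_derivative G (Suc n) v) (at v)"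
    and "\<And>x. x \<in> U \<Longrightarrow> f x \<in> I" "Ck_on k U f"
  shows "Ck_on k U (\<lambda>x. G n (f x))"
  using assms(4)
proof (induction k arbitrary: n)
  case 0
  have "continuous_on I (G n)" by (intro continuous_at_imp_continuous_on ballI DERIV_isCont[OF assms(2)])
  thus ?case unfolding Ck_on.simps by (rule continuous_on_compose2) (use 0 assms(3) in auto)
next
  case (Suc k)
  have "Ck_on k U (dir_deriv (\<lambda>x. G n (f x)) b)" if b: "b \<in> Basis" for b
  proof (rule Ck_on_cong[OF assms(1)])
    have "Ck_on k U (dir_deriv f b)" using Suc.prems b by simp
    with Suc.IH[OF Ck_on_SucD[OF Suc.prems]]
    show "Ck_on k U (\<lambda>x. G (Suc n) (f x) * dir_deriv f b x)" by (rule Ck_on_mult[OF assms(1)])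
    fix x assume x: "x \<in> U"
    have "f differentiable (at x)" using Suc.prems x by simp
    from dir_deriv_compose(1)[OF this assms(2)[OF assms(3)[OF x]]]
    show "G (Suc n) (f x) * dir_deriv f b x = dir_deriv (\<lambda>x. G n (f x)) b x" by (rule sym)
  qed
  moreover have "(\<lambda>x. G n (f x)) differentiable (at x)" if x: "x \<in> U" for x
  proof -
    have "f differentiable (at x)" using Suc.prems x by simp
    from dir_deriv_compose(2)[OF this assms(2)[OF assms(3)[OF x]]] show ?thesis .
  qed
  ultimately show ?case unfolding Ck_on.simps by blast
qed

text \<open>Functions of the shape \<open>p (1 / v) exp (- 1 / v)\<close> are closed under differentiation,
  which makes the smoothness of the bump function at 0 an induction over polynomials.\<close>

definition flat_exp :: "real poly \<Rightarrow> real \<Rightarrow> real" where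
  "flat_exp p v = (if v \<le> 0 then 0 else poly p (1 / v) * exp (- 1 / v))"

lemma poly_exp_limit: "((\<lambda>y. poly p y * exp (- y)) \<longlongrightarrow> 0) at_top" for p :: "real poly"
proof -
  have "((\<lambda>y. \<Sum>i\<le>degree p. coeff p i * (y ^ i / exp y)) \<longlongrightarrow> (\<Sum>i\<le>degree p. coeff p i * 0)) at_top"
    by (intro tendsto_sum tendsto_mult tendsto_const tendsto_power_div_exp_0)
  thus ?thesis by (simp add: poly_altdef sum_distrib_right exp_minus field_simps sum_divide_distrib)
qed

lemma flat_exp_deriv:
  "(flat_exp p has_real_derivative flat_exp ([:0, 0, 1:] * (p - pderiv p)) v) (at v)"
proof -
  consider "v < 0" | "v = 0" | "v > 0" by linarith
  thus ?thesis
  proof cases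
    case 1
    have "\<forall>\<^sub>F x in nhds v. flat_exp p x = 0"
      using eventually_nhds_in_open[of "{..<0}" v] 1 by (auto elim!: eventually_mono simp: flat_exp_def)
    thus ?thesis using 1 by (subst DERIV_cong_ev[OF refl _ refl, where g="\<lambda>_. 0"]) (auto simp: flat_exp_def)
  next
    case 3
    have ev: "\<forall>\<^sub>F x in nhds v. flat_exp p x = poly p (1 / x) * exp (- 1 / x)"
      using eventually_nhds_in_open[of "{0<..}" v] 3 by (auto elim!: eventually_mono simp: flat_exp_def)
    have "((\<lambda>x. poly p (1 / x) * exp (- 1 / x)) has_real_derivative
        (poly (pderiv p) (1 / v) * (- 1 / v\<^sup>2)) * exp (- 1 / v) + (exp (- 1 / v) * (1 / v\<^sup>2)) * poly p (1 / v)) (at v)"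
    proof (rule DERIV_mult)
      have i: "((\<lambda>x. 1 / x) has_real_derivative - 1 / v\<^sup>2) (at v)"
        using 3 by (auto intro!: derivative_eq_intros simp: power2_eq_square)
      show "((\<lambda>x. poly p (1 / x)) has_real_derivative poly (pderiv p) (1 / v) * (- 1 / v\<^sup>2)) (at v)"
        by (rule DERIV_chain2[where f="poly p" and g="\<lambda>x. 1 / x", OF poly_DERIV i])
      show "((\<lambda>x. exp (- 1 / x)) has_real_derivative exp (- 1 / v) * (1 / v\<^sup>2)) (at v)"
        using 3 by (auto intro!: derivative_eq_intros simp: power2_eq_square)
    qed
    moreover have "(poly (pderiv p) (1 / v) * (- 1 / v\<^sup>2)) * exp (- 1 / v) + (exp (- 1 / v) * (1 / v\<^sup>2)) * poly p (1 / v)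
       = flat_exp ([:0, 0, 1:] * (p - pderiv p)) v"
      using 3 by (simp add: flat_exp_def power2_eq_square algebra_simps)
    ultimately show ?thesis by (subst DERIV_cong_ev[OF refl ev refl]) simp
  next
    case 2
    have "((\<lambda>h. flat_exp p h / h) \<longlongrightarrow> 0) (at 0)"
    proof (rule filterlim_split_at)
      have "\<forall>\<^sub>F h in at_left (0::real). flat_exp p h / h = 0"
        unfolding eventually_at_filter by (auto simp: flat_exp_def)
      thus "((\<lambda>h. flat_exp p h / h) \<longlongrightarrow> 0) (at_left 0)" by (rule tendsto_eventually)
      have "((\<lambda>h. poly (pCons 0 p) (inverse h) * exp (- inverse h)) \<longlongrightarrow> 0) (at_right (0::real))"
        by (rule filterlim_compose[OF poly_exp_limit filterlim_inverse_at_top_right])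
      moreover have "\<forall>\<^sub>F h in at_right (0::real). poly (pCons 0 p) (inverse h) * exp (- inverse h) = flat_exp p h / h"
        unfolding eventually_at_filter by (auto simp: flat_exp_def field_simps)
      ultimately show "((\<lambda>h. flat_exp p h / h) \<longlongrightarrow> 0) (at_right 0)" by (rule Lim_transform_eventually)
    qed
    thus ?thesis unfolding 2 DERIV_def by (simp add: flat_exp_def)
  qed
qed

text \<open>The \<open>n\<close>-th derivative of \<open>exp (- 1 / v)\<close>, extended by 0.\<close>

definition cutoff :: "nat \<Rightarrow> real \<Rightarrow> real" where
  "cutoff n = flat_exp (((\<lambda>p. [:0, 0, 1:] * (p - pderiv p)) ^^ n) 1)"

lemma cutoff_deriv: "(cutoff n has_real_derivative cutoff (Suc n) v) (at v)"
  unfolding cutoff_def funpow.simps comp_def by (rule flat_exp_deriv)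

lemma cutoff_zero: "v \<le> 0 \<Longrightarrow> cutoff n v = 0"
  by (simp add: cutoff_def flat_exp_def)

lemma cutoff_pos: "v > 0 \<Longrightarrow> cutoff 0 v > 0" and cutoff_nonneg: "cutoff 0 v \<ge> 0"
  by (auto simp: cutoff_def flat_exp_def)

lemma continuous_cutoff: "continuous_on A (cutoff n)"
  by (intro continuous_at_imp_continuous_on ballI DERIV_isCont[OF cutoff_deriv])

lemma cutoff_bounded: "\<exists>C\<ge>0. \<forall>v\<le>a. \<bar>cutoff n v\<bar> \<le> C"
proof -
  have "bounded (cutoff n ` {0..a})"
    by (intro compact_imp_bounded compact_continuous_image continuous_cutoff compact_Icc)
  then obtain C where "\<forall>v\<in>{0..a}. \<bar>cutoff n v\<bar> \<le> C" unfolding bounded_iff by auto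
  hence C: "\<bar>cutoff n v\<bar> \<le> C" if "v \<in> {0..a}" for v using that by blast
  have "\<bar>cutoff n v\<bar> \<le> \<bar>C\<bar>" if "v \<le> a" for v
    using C[of v] that cutoff_zero[of v n] by (cases "v \<ge> 0") auto
  thus ?thesis by (intro exI[of _ "\<bar>C\<bar>"]) auto
qed

section \<open>Difference bounds for Sobolev functions by mollification\<close>

definition bump :: "real \<Rightarrow> 'a::euclidean_space \<Rightarrow> real" where
  "bump \<delta> v = cutoff 0 (\<delta>\<^sup>2 - v \<bullet> v)"

definition bump_deriv :: "real \<Rightarrow> 'a::euclidean_space \<Rightarrow> 'a \<Rightarrow> real" where
  "bump_deriv \<delta> b v = cutoff 1 (\<delta>\<^sup>2 - v \<bullet> v) * (- 2 * (v \<bullet> b))"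

lemma bump_outside: "\<delta> \<ge> 0 \<Longrightarrow> \<delta> \<le> norm v \<Longrightarrow> bump \<delta> v = 0" "\<delta> \<ge> 0 \<Longrightarrow> \<delta> \<le> norm v \<Longrightarrow> bump_deriv \<delta> b v = 0"
  unfolding bump_def bump_deriv_def
  by (simp_all add: cutoff_zero power_mono flip: power2_norm_eq_inner)

lemma bump_nonneg: "bump \<delta> v \<ge> 0"
  by (simp add: bump_def cutoff_nonneg)

lemma continuous_bump: "continuous_on A (\<lambda>y. bump \<delta> (x - y))" "continuous_on A (\<lambda>y. bump_deriv \<delta> b (x - y))"
  unfolding bump_def bump_deriv_def
  by (intro continuous_intros continuous_on_compose2[OF continuous_cutoff[of UNIV]]; auto)+

lemma bump_bounded:
  fixes b :: "'a::euclidean_space"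
  assumes "\<delta> > 0" "norm b = 1"
  obtains C where "C \<ge> 0" "\<And>v :: 'a. \<bar>bump \<delta> v\<bar> \<le> C" "\<And>v. \<bar>bump_deriv \<delta> b v\<bar> \<le> C"
    "\<And>v s. \<bar>bump \<delta> (v + s *\<^sub>R b) - bump \<delta> v - s * bump_deriv \<delta> b v\<bar> \<le> C * s\<^sup>2"
proof -
  obtain C0 where C0: "C0 \<ge> 0" "\<And>v. v \<le> \<delta>\<^sup>2 \<Longrightarrow> \<bar>cutoff 0 v\<bar> \<le> C0" using cutoff_bounded by blast
  obtain C1 where C1: "C1 \<ge> 0" "\<And>v. v \<le> \<delta>\<^sup>2 \<Longrightarrow> \<bar>cutoff 1 v\<bar> \<le> C1" using cutoff_bounded by blast
  obtain C2 where C2: "C2 \<ge> 0" "\<And>v. v \<le> \<delta>\<^sup>2 \<Longrightarrow> \<bar>cutoff 2 v\<bar> \<le> C2" using cutoff_bounded by blast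
  define D where "D = C2 * (2 * \<delta>)\<^sup>2 + C1 * 2"
  have D0: "D \<ge> 0" unfolding D_def using C1 C2 by simp
  have le: "\<delta>\<^sup>2 - v \<bullet> v \<le> \<delta>\<^sup>2" for v :: 'a by simp
  have inner: "\<bar>v \<bullet> b\<bar> \<le> \<delta>" if "\<delta>\<^sup>2 - v \<bullet> v > 0" for v
  proof -
    have "(norm v)\<^sup>2 \<le> \<delta>\<^sup>2" unfolding power2_norm_eq_inner using that by linarith
    hence "norm v \<le> \<delta>" by (rule power2_le_imp_le) (use assms(1) in simp)
    thus ?thesis using Cauchy_Schwarz_ineq2[of v b] assms(2) by simp
  qed
  have b1: "\<bar>bump_deriv \<delta> b v\<bar> \<le> C1 * (2 * \<delta>)" for v
  proof (cases "\<delta>\<^sup>2 - v \<bullet> v > 0")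
    case True
    have "\<bar>cutoff 1 (\<delta>\<^sup>2 - v \<bullet> v)\<bar> * \<bar>- 2 * (v \<bullet> b)\<bar> \<le> C1 * (2 * \<delta>)"
      using C1(2)[OF le] inner[OF True] C1(1) by (intro mult_mono) auto
    thus ?thesis unfolding bump_deriv_def abs_mult by simp
  next
    case False
    thus ?thesis using C1(1) assms(1) by (simp add: bump_deriv_def cutoff_zero)
  qed
  have taylor: "\<bar>bump \<delta> (v + s *\<^sub>R b) - bump \<delta> v - s * bump_deriv \<delta> b v\<bar> \<le> D * s\<^sup>2" for v :: 'a and s
  proof -
    define p where "p r = \<delta>\<^sup>2 - (v + r *\<^sub>R b) \<bullet> (v + r *\<^sub>R b)" for r
    define q1 where "q1 r = - 2 * ((v + r *\<^sub>R b) \<bullet> b)" for r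
    have bb: "b \<bullet> b = 1" using assms(2) by (simp add: norm_eq_1)
    have dp: "(p has_real_derivative q1 r) (at r)" for r
    proof -
      have e: "p = (\<lambda>r. \<delta>\<^sup>2 - (v \<bullet> v + 2 * r * (v \<bullet> b) + r\<^sup>2))"
        unfolding p_def by (rule ext) (simp add: inner_add_left inner_add_right inner_commute bb power2_eq_square algebra_simps)
      have q: "q1 r = - (2 * (v \<bullet> b) + 2 * r)" unfolding q1_def by (simp add: inner_add_left bb)
      show ?thesis unfolding e q by (auto intro!: derivative_eq_intros)
    qed
    have dq: "(q1 has_real_derivative - 2) (at r)" for r
    proof -
      have e: "q1 = (\<lambda>r. - 2 * (v \<bullet> b) - 2 * r)" unfolding q1_def by (rule ext) (simp add: inner_add_left bb)
      show ?thesis unfolding e by (auto intro!: derivative_eq_intros)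
    qed
    define k where "k r = cutoff 0 (p r)" for r
    define k1 where "k1 r = cutoff 1 (p r) * q1 r" for r
    define k2 where "k2 r = (cutoff 2 (p r) * q1 r) * q1 r + (- 2) * cutoff 1 (p r)" for r
    have dk: "(k has_real_derivative k1 r) (at r)" for r
      unfolding k_def[abs_def] k1_def using DERIV_chain2[OF cutoff_deriv dp, of 0] by simp
    have dk1: "(k1 has_real_derivative k2 r) (at r)" for r
    proof -
      have "((\<lambda>r. cutoff 1 (p r)) has_real_derivative cutoff 2 (p r) * q1 r) (at r)"
        using DERIV_chain2[OF cutoff_deriv dp, of 1] by (simp add: numeral_2_eq_2)
      from DERIV_mult[OF this dq] show ?thesis unfolding k1_def[abs_def] k2_def .
    qed
    have k2b: "\<bar>k2 r\<bar> \<le> D" for r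
    proof (cases "p r > 0")
      case True
      have q: "\<bar>q1 r\<bar> \<le> 2 * \<delta>" unfolding q1_def using inner[of "v + r *\<^sub>R b"] True unfolding p_def by (simp add: abs_mult)
      have pl: "p r \<le> \<delta>\<^sup>2" unfolding p_def by simp
      have "\<bar>(cutoff 2 (p r) * q1 r) * q1 r\<bar> \<le> (C2 * (2 * \<delta>)) * (2 * \<delta>)"
        unfolding abs_mult using C2(2)[OF pl] C2(1) q assms(1) by (intro mult_mono mult_nonneg_nonneg) auto
      moreover have "\<bar>(- 2) * cutoff 1 (p r)\<bar> \<le> C1 * 2" using C1(2)[OF pl] by (simp add: abs_mult)
      ultimately show ?thesis unfolding k2_def D_def power2_eq_square by (simp only: mult.assoc)
    next
      case False
      thus ?thesis using D0 by (simp add: k2_def cutoff_zero)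
    qed
    have k1lip: "\<bar>k1 r - k1 0\<bar> \<le> D * \<bar>s\<bar>" if r: "r \<in> closed_segment 0 s" for r
    proof -
      have "norm (k1 r - k1 0) \<le> D * norm (r - 0)"
        by (rule field_differentiable_bound[of UNIV k1 k2]) (use dk1 k2b in auto)
      moreover have "\<bar>r\<bar> \<le> \<bar>s\<bar>" using r by (auto simp: closed_segment_eq_real_ivl split: if_splits)
      hence "D * \<bar>r\<bar> \<le> D * \<bar>s\<bar>" using D0 by (intro mult_left_mono)
      ultimately show ?thesis by simp
    qed
    have "norm ((k s - s * k1 0) - (k 0 - 0 * k1 0)) \<le> (D * \<bar>s\<bar>) * norm (s - 0)"
    proof (rule field_differentiable_bound[of "closed_segment 0 s" "\<lambda>r. k r - r * k1 0" "\<lambda>r. k1 r - k1 0"])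
      show "((\<lambda>r. k r - r * k1 0) has_field_derivative k1 r - k1 0) (at r within closed_segment 0 s)" for r
        by (rule has_field_derivative_at_within) (auto intro!: derivative_eq_intros dk)
    qed (use k1lip in auto)
    moreover have "k s = bump \<delta> (v + s *\<^sub>R b)" "k 0 = bump \<delta> v" "k1 0 = bump_deriv \<delta> b v"
      unfolding k_def k1_def p_def q1_def bump_def bump_deriv_def by auto
    ultimately show ?thesis by (simp add: power2_eq_square algebra_simps)
  qed
  define C where "C = C0 + C1 * (2 * \<delta>) + D"
  show ?thesis
  proof (rule that[of C])
    show "C \<ge> 0" unfolding C_def using C0 C1 D0 assms(1) by simp
    fix v :: 'a and s
    have nn: "C1 * (2 * \<delta>) \<ge> 0" using C1 assms(1) by simp
    show "\<bar>bump \<delta> v\<bar> \<le> C" using C0(2)[OF le, of v] nn D0 unfolding bump_def C_def by linarith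
    show "\<bar>bump_deriv \<delta> b v\<bar> \<le> C" using b1[of v] C0 D0 unfolding C_def by linarith
    have "D * s\<^sup>2 \<le> C * s\<^sup>2" unfolding C_def using C0 nn by (intro mult_right_mono) auto
    thus "\<bar>bump \<delta> (v + s *\<^sub>R b) - bump \<delta> v - s * bump_deriv \<delta> b v\<bar> \<le> C * s\<^sup>2" using taylor[of v s] by linarith
  qed
qed

lemma bump_test_function:
  fixes x :: "'a::euclidean_space"
  assumes "\<delta> \<ge> 0" "cball x \<delta> \<subseteq> U"
  shows "test_function U (\<lambda>y. bump \<delta> (x - y))" "dir_deriv (\<lambda>y. bump \<delta> (x - y)) b y = - bump_deriv \<delta> b (x - y)"
proof -
  have sq: "(x - y) \<bullet> (x - y) = (\<Sum>i\<in>Basis. (x \<bullet> i + (- 1) * (y \<bullet> i)) * (x \<bullet> i + (- 1) * (y \<bullet> i)))" for y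
    by (subst euclidean_inner) (simp add: inner_diff_left)
  have "Ck_on k UNIV (\<lambda>y. \<delta>\<^sup>2 + (- 1) * ((x - y) \<bullet> (x - y)))" for k
    unfolding sq by (intro Ck_on_add Ck_on_mult Ck_on_sum Ck_on_const Ck_on_inner open_UNIV)
  hence "Ck_on k UNIV (\<lambda>y. cutoff 0 (\<delta>\<^sup>2 + (- 1) * ((x - y) \<bullet> (x - y))))" for k
    by (intro Ck_on_compose[where I=UNIV and G=cutoff] open_UNIV cutoff_deriv UNIV_I)
  hence "smooth_on UNIV (\<lambda>y. bump \<delta> (x - y))" unfolding smooth_on_def bump_def by simp
  moreover have "bump \<delta> (x - y) = 0" if "y \<notin> cball x \<delta>" for y
    by (rule bump_outside) (use that assms in \<open>auto simp: dist_norm\<close>)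
  ultimately show "test_function U (\<lambda>y. bump \<delta> (x - y))"
    unfolding test_function_def using assms by (intro conjI exI[of _ "cball x \<delta>"]) auto
  have d: "((\<lambda>y. \<delta>\<^sup>2 - (x - y) \<bullet> (x - y)) has_derivative (\<lambda>h. 2 * ((x - y) \<bullet> h))) (at y)"
    by (auto intro!: derivative_eq_intros simp: inner_commute)
  have "((\<lambda>y. bump \<delta> (x - y)) has_derivative (\<lambda>h. cutoff (Suc 0) (\<delta>\<^sup>2 - (x - y) \<bullet> (x - y)) * (2 * ((x - y) \<bullet> h)))) (at y)"
    unfolding bump_def by (rule has_derivative_compose[OF d cutoff_deriv[unfolded has_field_derivative_def]])
  from dir_derivI[OF this] show "dir_deriv (\<lambda>y. bump \<delta> (x - y)) b y = - bump_deriv \<delta> b (x - y)"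
    unfolding bump_deriv_def by simp
qed

lemma norm_integral_le_AE:
  fixes f :: "'b \<Rightarrow> real"
  assumes "integrable N f" "integrable N g" "AE y in N. norm (f y) \<le> g y"
  shows "norm (integral\<^sup>L N f) \<le> integral\<^sup>L N g"
proof -
  have "norm (integral\<^sup>L N f) \<le> integral\<^sup>L N (\<lambda>y. norm (f y))" by (rule integral_norm_bound)
  also have "\<dots> \<le> integral\<^sup>L N g" by (rule integral_mono_AE) (use assms in auto)
  finally show ?thesis .
qed

lemma kernel_integral:
  fixes f k :: "'a::euclidean_space \<Rightarrow> real"
  assumes U: "open U" and f: "f \<in> borel_measurable (lebesgue_on U)" "AE y in lebesgue_on U. \<bar>f y\<bar> \<le> M"
    and k: "continuous_on UNIV k" "\<And>y. y \<notin> cball x r \<Longrightarrow> k y = 0" "\<And>y. \<bar>k y\<bar> \<le> K"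
  shows "integrable (lebesgue_on U) (\<lambda>y. f y * k y)"
    and "\<bar>integral\<^sup>L (lebesgue_on U) (\<lambda>y. f y * k y)\<bar> \<le> \<bar>M\<bar> * K * measure (lebesgue_on U) (cball x r \<inter> U)"
proof -
  have US: "U \<in> sets lebesgue" using U by simp
  have cs: "cball x r \<inter> U \<in> sets (lebesgue_on U)" using US by (auto simp: sets_restrict_space_iff)
  have "emeasure (lebesgue_on U) (cball x r \<inter> U) = emeasure lebesgue (cball x r \<inter> U)"
    by (rule emeasure_restrict_space) (use US in auto)
  also have "\<dots> \<le> emeasure lebesgue (cball x r)" by (intro emeasure_mono) auto
  also have "\<dots> < \<infinity>" using emeasure_bounded_finite[OF bounded_cball] by (simp add: less_top)
  finally have fin: "emeasure (lebesgue_on U) (cball x r \<inter> U) < \<infinity>" .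
  have int: "integrable (lebesgue_on U) (\<lambda>y. (\<bar>M\<bar> * K) * indicator (cball x r \<inter> U) y)"
    by (intro integrable_mult_right integrable_real_indicator cs fin)
  have km: "k \<in> borel_measurable (lebesgue_on U)"
    by (rule measurable_restrict_space1) (use borel_measurable_continuous_onI[OF k(1)] in \<open>auto intro: measurable_completion\<close>)
  have bd: "AE y in lebesgue_on U. norm (f y * k y) \<le> (\<bar>M\<bar> * K) * indicator (cball x r \<inter> U) y"
    using f(2) AE_space
  proof eventually_elim
    case (elim y)
    hence y: "y \<in> U" by (simp add: space_restrict_space)
    show ?case
    proof (cases "y \<in> cball x r")
      case True
      have "\<bar>f y\<bar> * \<bar>k y\<bar> \<le> \<bar>M\<bar> * K" using elim(1) k(3)[of y] by (intro mult_mono) auto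
      thus ?thesis using True y by (simp add: abs_mult)
    next
      case False thus ?thesis using k(2)[OF False] by simp
    qed
  qed
  show i: "integrable (lebesgue_on U) (\<lambda>y. f y * k y)"
    by (rule Bochner_Integration.integrable_bound[OF int]) (use f(1) km bd in \<open>auto elim!: eventually_mono\<close>)
  have "norm (integral\<^sup>L (lebesgue_on U) (\<lambda>y. f y * k y)) \<le> integral\<^sup>L (lebesgue_on U) (\<lambda>y. (\<bar>M\<bar> * K) * indicator (cball x r \<inter> U) y)"
    by (rule norm_integral_le_AE[OF i int bd])
  also have "\<dots> = \<bar>M\<bar> * K * measure (lebesgue_on U) (cball x r \<inter> U)"
    using cs by (simp add: space_restrict_space Int_absorb2)
  finally show "\<bar>integral\<^sup>L (lebesgue_on U) (\<lambda>y. f y * k y)\<bar> \<le> \<bar>M\<bar> * K * measure (lebesgue_on U) (cball x r \<inter> U)" by simp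
qed

lemma isCont_dist_less:
  fixes f :: "'b::metric_space \<Rightarrow> 'c::metric_space"
  assumes "isCont f x" "e > 0"
  shows "\<exists>r>0. \<forall>y. dist y x < r \<longrightarrow> dist (f y) (f x) < e"
proof -
  have "\<forall>\<^sub>F y in nhds x. dist (f y) (f x) < e"
    by (rule tendstoD[OF assms(1)[unfolded isCont_def tendsto_at_iff_tendsto_nhds[of f x]] assms(2)])
  thus ?thesis unfolding eventually_nhds_metric .
qed

lemma abs_quotient_le: "J > 0 \<Longrightarrow> \<bar>X\<bar> \<le> \<eta> * J \<Longrightarrow> \<bar>X / J\<bar> \<le> \<eta>" for J X \<eta> :: real
  unfolding abs_divide by (simp add: pos_divide_le_eq)

definition mollify :: "real \<Rightarrow> 'a set \<Rightarrow> ('a::euclidean_space \<Rightarrow> real) \<Rightarrow> 'a \<Rightarrow> real" where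
  "mollify \<delta> U f x = integral\<^sup>L (lebesgue_on U) (\<lambda>y. f y * bump \<delta> (x - y))"

text \<open>Differentiating under the integral falls on the kernel, where the definition of the weak
  derivative moves it to \<open>f\<close>. Thus every bound on a weak derivative becomes one on an honest
  derivative of the mollification.\<close>

lemma mollify_deriv:
  fixes f h :: "'a::euclidean_space \<Rightarrow> real"
  assumes U: "open U" and f: "f \<in> borel_measurable (lebesgue_on U)" "AE y in lebesgue_on U. \<bar>f y\<bar> \<le> M"
    and w: "has_weak_deriv U b f h" and b: "norm b = 1"
    and \<delta>: "\<delta> > 0" "cball (x + s *\<^sub>R b) \<delta> \<subseteq> U"
  shows "((\<lambda>s. mollify \<delta> U f (x + s *\<^sub>R b)) has_real_derivative mollify \<delta> U h (x + s *\<^sub>R b)) (at s)"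
proof -
  obtain C where C: "C \<ge> 0" "\<And>v :: 'a. \<bar>bump \<delta> v\<bar> \<le> C" "\<And>v. \<bar>bump_deriv \<delta> b v\<bar> \<le> C"
    "\<And>v s. \<bar>bump \<delta> (v + s *\<^sub>R b) - bump \<delta> v - s * bump_deriv \<delta> b v\<bar> \<le> C * s\<^sup>2"
    using bump_bounded[OF \<delta>(1) b] by blast
  define z where "z = x + s *\<^sub>R b"
  have d0: "\<delta> \<ge> 0" using \<delta> by simp
  have weak: "integral\<^sup>L (lebesgue_on U) (\<lambda>y. f y * bump_deriv \<delta> b (z - y)) = mollify \<delta> U h z"
  proof -
    have "integral\<^sup>L (lebesgue_on U) (\<lambda>y. f y * dir_deriv (\<lambda>y. bump \<delta> (z - y)) b y) = - integral\<^sup>L (lebesgue_on U) (\<lambda>y. h y * bump \<delta> (z - y))"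
      using w bump_test_function(1)[OF d0 \<delta>(2)[folded z_def]] unfolding has_weak_deriv_def by blast
    thus ?thesis unfolding mollify_def bump_test_function(2)[OF d0 \<delta>(2)[folded z_def]] by simp
  qed
  define V where "V = measure (lebesgue_on U) (cball z (\<delta> + 1) \<inter> U)"
  have est: "\<bar>mollify \<delta> U f (z + r *\<^sub>R b) - mollify \<delta> U f z - r * mollify \<delta> U h z\<bar> \<le> (\<bar>M\<bar> * C * V) * r\<^sup>2" if r: "\<bar>r\<bar> \<le> 1" for r
  proof -
    have out: "bump \<delta> (z + r *\<^sub>R b - y) = 0" "bump \<delta> (z - y) = 0" "bump_deriv \<delta> b (z - y) = 0" if "y \<notin> cball z (\<delta> + 1)" for y
    proof -
      have zy: "norm (z - y) > \<delta> + 1" using that by (simp add: dist_norm)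
      have rb: "norm (r *\<^sub>R b) \<le> 1" using r b by simp
      have "norm (z - y) \<le> norm (z + r *\<^sub>R b - y) + norm (r *\<^sub>R b)"
        using norm_triangle_ineq4[of "z + r *\<^sub>R b - y" "r *\<^sub>R b"] by (simp add: algebra_simps)
      hence "\<delta> \<le> norm (z + r *\<^sub>R b - y)" "\<delta> \<le> norm (z - y)" using zy rb by linarith+
      thus "bump \<delta> (z + r *\<^sub>R b - y) = 0" "bump \<delta> (z - y) = 0" "bump_deriv \<delta> b (z - y) = 0" using bump_outside d0 by blast+
    qed
    have i1: "integrable (lebesgue_on U) (\<lambda>y. f y * bump \<delta> (z + r *\<^sub>R b - y))"
      by (rule kernel_integral(1)[OF U f continuous_bump(1) out(1) C(2)])
    have i2: "integrable (lebesgue_on U) (\<lambda>y. f y * bump \<delta> (z - y))"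
      by (rule kernel_integral(1)[OF U f continuous_bump(1) out(2) C(2)])
    have i3: "integrable (lebesgue_on U) (\<lambda>y. f y * bump_deriv \<delta> b (z - y))"
      by (rule kernel_integral(1)[OF U f continuous_bump(2) out(3) C(3)])
    define k where "k y = bump \<delta> (z + r *\<^sub>R b - y) - bump \<delta> (z - y) - r * bump_deriv \<delta> b (z - y)" for y
    have "mollify \<delta> U f (z + r *\<^sub>R b) - mollify \<delta> U f z - r * mollify \<delta> U h z = integral\<^sup>L (lebesgue_on U) (\<lambda>y. f y * k y)"
    proof -
      have "integral\<^sup>L (lebesgue_on U) (\<lambda>y. f y * k y) = integral\<^sup>L (lebesgue_on U) (\<lambda>y. f y * bump \<delta> (z + r *\<^sub>R b - y) - f y * bump \<delta> (z - y) - r * (f y * bump_deriv \<delta> b (z - y)))"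
        unfolding k_def by (intro Bochner_Integration.integral_cong) (auto simp: algebra_simps)
      thus ?thesis using i1 i2 i3 unfolding weak[symmetric] by (simp add: mollify_def)
    qed
    moreover have "\<bar>integral\<^sup>L (lebesgue_on U) (\<lambda>y. f y * k y)\<bar> \<le> \<bar>M\<bar> * (C * r\<^sup>2) * measure (lebesgue_on U) (cball z (\<delta> + 1) \<inter> U)"
    proof (rule kernel_integral(2)[OF U f])
      show "continuous_on UNIV k" unfolding k_def by (intro continuous_intros continuous_bump)
      show "k y = 0" if "y \<notin> cball z (\<delta> + 1)" for y unfolding k_def using out[OF that] by simp
      show "\<bar>k y\<bar> \<le> C * r\<^sup>2" for y using C(4)[of "z - y" r] unfolding k_def by (simp add: algebra_simps)
    qed
    ultimately show ?thesis unfolding V_def by (simp add: mult_ac)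
  qed
  have "((\<lambda>r. (mollify \<delta> U f (z + r *\<^sub>R b) - mollify \<delta> U f z) / r - mollify \<delta> U h z) \<longlongrightarrow> 0) (at 0)"
  proof (rule Lim_null_comparison)
    have "((\<lambda>r. (\<bar>M\<bar> * C * V) * \<bar>r\<bar>) \<longlongrightarrow> (\<bar>M\<bar> * C * V) * \<bar>0\<bar>) (at (0::real))" by (intro tendsto_intros)
    thus "((\<lambda>r. (\<bar>M\<bar> * C * V) * \<bar>r\<bar>) \<longlongrightarrow> 0) (at (0::real))" by simp
    show "\<forall>\<^sub>F r in at 0. norm ((mollify \<delta> U f (z + r *\<^sub>R b) - mollify \<delta> U f z) / r - mollify \<delta> U h z) \<le> (\<bar>M\<bar> * C * V) * \<bar>r\<bar>"
      unfolding eventually_at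
    proof (intro exI[of _ 1] conjI ballI impI)
      fix r :: real assume r: "r \<noteq> 0 \<and> dist r 0 < 1"
      have "(mollify \<delta> U f (z + r *\<^sub>R b) - mollify \<delta> U f z) / r - mollify \<delta> U h z = (mollify \<delta> U f (z + r *\<^sub>R b) - mollify \<delta> U f z - r * mollify \<delta> U h z) / r"
        using r by (simp add: field_simps)
      also have "norm \<dots> \<le> (\<bar>M\<bar> * C * V) * r\<^sup>2 / \<bar>r\<bar>" using est[of r] r by (simp add: divide_right_mono)
      also have "\<dots> = (\<bar>M\<bar> * C * V) * \<bar>r\<bar>" 
      proof -
        have "K * (t * t) / t = K * t" if "t > 0" for K t :: real using that by simp
        from this[of "\<bar>r\<bar>" "\<bar>M\<bar> * C * V"] show ?thesis using r by (simp add: power2_eq_square)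
      qed
      finally show "norm ((mollify \<delta> U f (z + r *\<^sub>R b) - mollify \<delta> U f z) / r - mollify \<delta> U h z) \<le> (\<bar>M\<bar> * C * V) * \<bar>r\<bar>" .
    qed simp
  qed
  hence "((\<lambda>r. (mollify \<delta> U f (z + r *\<^sub>R b) - mollify \<delta> U f z) / r) \<longlongrightarrow> mollify \<delta> U h z) (at 0)"
    by (simp add: LIM_zero_iff)
  hence "((\<lambda>r. (mollify \<delta> U f (x + (s + r) *\<^sub>R b) - mollify \<delta> U f (x + s *\<^sub>R b)) / r) \<longlongrightarrow> mollify \<delta> U h z) (at 0)"
    unfolding z_def by (simp add: algebra_simps)
  thus ?thesis unfolding DERIV_def z_def .
qed

definition bump_mass :: "'a::euclidean_space itself \<Rightarrow> real \<Rightarrow> real" where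
  "bump_mass _ \<delta> = integral\<^sup>L lborel (bump \<delta> :: 'a \<Rightarrow> real)"

lemma continuous_bump_UNIV: "continuous_on A (bump \<delta>)"
  unfolding bump_def by (intro continuous_intros continuous_on_compose2[OF continuous_cutoff[of UNIV]]) auto

lemma bump_mass_eq:
  fixes x :: "'a::euclidean_space"
  assumes "open U" "\<delta> > 0" "cball x \<delta> \<subseteq> U"
  shows "integral\<^sup>L (lebesgue_on U) (\<lambda>y. bump \<delta> (x - y)) = bump_mass TYPE('a) \<delta>"
proof -
  have "integral\<^sup>L (lebesgue_on U) (\<lambda>y. bump \<delta> (x - y)) = integral\<^sup>L lebesgue (\<lambda>y. indicator U y *\<^sub>R bump \<delta> (x - y))"
    by (rule integral_restrict_space) (use assms in auto)
  also have "(\<lambda>y. indicator U y *\<^sub>R bump \<delta> (x - y)) = (\<lambda>y. bump \<delta> (x - y))"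
  proof
    fix y
    have "bump \<delta> (x - y) = 0" if "y \<notin> U"
    proof -
      have "y \<notin> cball x \<delta>" using that assms by blast
      thus ?thesis using assms by (intro bump_outside) (auto simp: dist_norm)
    qed
    thus "indicator U y *\<^sub>R bump \<delta> (x - y) = bump \<delta> (x - y)" by (auto simp: indicator_def)
  qed
  also have "integral\<^sup>L lebesgue (\<lambda>y. bump \<delta> (x - y)) = integral\<^sup>L lborel (\<lambda>y. bump \<delta> (x - y))"
    by (rule integral_completion) (use borel_measurable_continuous_onI[OF continuous_bump(1)] in simp)
  also have "integral\<^sup>L lborel (\<lambda>y. bump \<delta> (x - y)) = integral\<^sup>L lborel (\<lambda>y. bump \<delta> (- x + y))"
    by (intro Bochner_Integration.integral_cong refl) (simp add: bump_def inner_diff_left inner_diff_right inner_commute algebra_simps)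
  also have "integral\<^sup>L lborel (\<lambda>y. bump \<delta> (- x + y)) = integral\<^sup>L (distr lborel borel ((+) (- x))) (bump \<delta>)"
    by (subst integral_distr) (use borel_measurable_continuous_onI[OF continuous_bump_UNIV] in auto)
  also have "\<dots> = bump_mass TYPE('a) \<delta>" unfolding lborel_distr_plus bump_mass_def ..
  finally show ?thesis .
qed

lemma bump_mass_pos:
  assumes "\<delta> > 0" shows "bump_mass TYPE('a::euclidean_space) \<delta> > 0"
proof -
  define c where "c = bump \<delta> (0::'a)"
  have c: "c > 0" unfolding c_def bump_def using assms by (simp add: cutoff_pos)
  have "isCont (bump \<delta>) (0::'a)" using continuous_bump_UNIV[of UNIV \<delta>] continuous_on_eq_continuous_at[OF open_UNIV] by blast
  moreover have "c / 2 > 0" using c by simp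
  ultimately have "\<exists>r>0. \<forall>y :: 'a. dist y 0 < r \<longrightarrow> dist (bump \<delta> y) (bump \<delta> (0::'a)) < c / 2" by (rule isCont_dist_less)
  then obtain r where r0: "r > 0" "\<forall>y :: 'a. dist y 0 < r \<longrightarrow> dist (bump \<delta> y) (bump \<delta> (0::'a)) < c / 2" by (elim exE conjE)
  have r: "r > 0" "\<And>y :: 'a. dist y 0 < r \<Longrightarrow> dist (bump \<delta> y) (bump \<delta> (0::'a)) < c / 2"
    using r0 by simp_all
  have low: "c / 2 \<le> bump \<delta> y" if "y \<in> ball 0 r" for y :: 'a
  proof -
    have "dist y 0 < r" using that by simp
    hence "\<bar>bump \<delta> y - c\<bar> < c / 2" using r(2)[of y] unfolding c_def[symmetric] dist_real_def by simp
    thus ?thesis by linarith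
  qed
  obtain C where C: "C \<ge> 0" "\<And>v :: 'a. \<bar>bump \<delta> v\<bar> \<le> C"
  proof -
    obtain b :: 'a where "b \<in> Basis" using nonempty_Basis by blast
    hence "norm b = 1" by simp
    from bump_bounded[OF assms this] show ?thesis using that by metis
  qed
  have "integrable (lebesgue_on UNIV) (\<lambda>y::'a. (1::real) * bump \<delta> (0 - y))"
    by (rule kernel_integral(1)[where M=1 and x=0 and r=\<delta> and K=C])
       (use C assms continuous_bump(1)[of UNIV \<delta> 0] in \<open>auto intro!: bump_outside simp: dist_norm\<close>)
  hence "integrable lebesgue (\<lambda>y::'a. bump \<delta> (- y))" by (simp add: lebesgue_on_UNIV_eq)
  moreover have "bump \<delta> (- y) = bump \<delta> y" for y :: 'a by (simp add: bump_def)
  ultimately have "integrable lebesgue (bump \<delta> :: 'a \<Rightarrow> real)" by simp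
  hence int: "integrable lborel (bump \<delta> :: 'a \<Rightarrow> real)"
    by (subst (asm) integrable_completion) (use borel_measurable_continuous_onI[OF continuous_bump_UNIV] in auto)
  have fin: "emeasure lborel (ball (0::'a) r) < \<infinity>" using emeasure_bounded_finite[OF bounded_ball] by (simp add: less_top)
  have "0 < c / 2 * measure lborel (ball (0::'a) r)" using c content_ball_pos[OF r(1), of "0::'a"] by simp
  also have "\<dots> = integral\<^sup>L lborel (\<lambda>y::'a. c / 2 * indicator (ball 0 r) y)" by simp
  also have "\<dots> \<le> integral\<^sup>L lborel (bump \<delta> :: 'a \<Rightarrow> real)"
  proof (rule Bochner_Integration.integral_mono)
    show "integrable lborel (\<lambda>y::'a. c / 2 * indicator (ball 0 r) y)"
      using fin by (intro integrable_mult_right integrable_real_indicator) auto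
  qed (use int low bump_nonneg in \<open>auto simp: indicator_def\<close>)
  finally show ?thesis unfolding bump_mass_def .
qed

lemma mollify_bound:
  fixes h :: "'a::euclidean_space \<Rightarrow> real"
  assumes U: "open U" and h: "h \<in> borel_measurable (lebesgue_on U)" "AE y in lebesgue_on U. \<bar>h y\<bar> \<le> M"
    and \<delta>: "\<delta> > 0" "cball x \<delta> \<subseteq> U"
  shows "\<bar>mollify \<delta> U h x\<bar> \<le> M * bump_mass TYPE('a) \<delta>"
proof -
  obtain C where C: "C \<ge> 0" "\<And>v :: 'a. \<bar>bump \<delta> v\<bar> \<le> C"
  proof -
    obtain b :: 'a where "b \<in> Basis" using nonempty_Basis by blast
    hence "norm b = 1" by simp
    from bump_bounded[OF \<delta>(1) this] show ?thesis using that by metis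
  qed
  have out: "bump \<delta> (x - y) = 0" if "y \<notin> cball x \<delta>" for y
    by (rule bump_outside) (use that \<delta> in \<open>auto simp: dist_norm\<close>)
  have i: "integrable (lebesgue_on U) (\<lambda>y. h y * bump \<delta> (x - y))"
    by (rule kernel_integral(1)[OF U h continuous_bump(1) out C(2)])
  have i1: "integrable (lebesgue_on U) (\<lambda>y. M * bump \<delta> (x - y))"
    by (rule kernel_integral(1)[OF U _ _ continuous_bump(1) out C(2), of _ "\<bar>M\<bar>"]) auto
  have "norm (mollify \<delta> U h x) \<le> integral\<^sup>L (lebesgue_on U) (\<lambda>y. M * bump \<delta> (x - y))"
    unfolding mollify_def
  proof (rule norm_integral_le_AE[OF i i1])
    show "AE y in lebesgue_on U. norm (h y * bump \<delta> (x - y)) \<le> M * bump \<delta> (x - y)"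
      using h(2) by eventually_elim (simp add: abs_mult bump_nonneg mult_right_mono)
  qed
  thus ?thesis using bump_mass_eq[OF U \<delta>] by simp
qed

lemma mollify_approx:
  fixes f :: "'a::euclidean_space \<Rightarrow> real"
  assumes U: "open U" and f: "f \<in> borel_measurable (lebesgue_on U)" "AE y in lebesgue_on U. \<bar>f y\<bar> \<le> M"
    and \<delta>: "\<delta> > 0" "cball x \<delta> \<subseteq> U" and \<eta>: "\<And>y. y \<in> cball x \<delta> \<Longrightarrow> \<bar>f y - f x\<bar> \<le> \<eta>"
  shows "\<bar>mollify \<delta> U f x / bump_mass TYPE('a) \<delta> - f x\<bar> \<le> \<eta>"
proof -
  obtain C where C: "C \<ge> 0" "\<And>v :: 'a. \<bar>bump \<delta> v\<bar> \<le> C"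
  proof -
    obtain b :: 'a where "b \<in> Basis" using nonempty_Basis by blast
    hence "norm b = 1" by simp
    from bump_bounded[OF \<delta>(1) this] show ?thesis using that by metis
  qed
  define J where "J = bump_mass TYPE('a) \<delta>"
  have J: "J > 0" unfolding J_def by (rule bump_mass_pos[OF \<delta>(1)])
  have out: "bump \<delta> (x - y) = 0" if "y \<notin> cball x \<delta>" for y
    by (rule bump_outside) (use that \<delta> in \<open>auto simp: dist_norm\<close>)
  have i: "integrable (lebesgue_on U) (\<lambda>y. f y * bump \<delta> (x - y))"
    by (rule kernel_integral(1)[OF U f continuous_bump(1) out C(2)])
  have i1: "integrable (lebesgue_on U) (\<lambda>y. c * bump \<delta> (x - y))" for c
    by (rule kernel_integral(1)[OF U _ _ continuous_bump(1) out C(2), of _ "\<bar>c\<bar>"]) auto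
  have "norm (integral\<^sup>L (lebesgue_on U) (\<lambda>y. f y * bump \<delta> (x - y) - f x * bump \<delta> (x - y))) \<le> integral\<^sup>L (lebesgue_on U) (\<lambda>y. \<eta> * bump \<delta> (x - y))"
  proof (rule norm_integral_le_AE)
    show "AE y in lebesgue_on U. norm (f y * bump \<delta> (x - y) - f x * bump \<delta> (x - y)) \<le> \<eta> * bump \<delta> (x - y)"
    proof (rule AE_I2)
      fix y
      show "norm (f y * bump \<delta> (x - y) - f x * bump \<delta> (x - y)) \<le> \<eta> * bump \<delta> (x - y)"
      proof (cases "y \<in> cball x \<delta>")
        case True
        thus ?thesis using mult_right_mono[OF \<eta>[OF True] bump_nonneg[of \<delta> "x - y"]] bump_nonneg[of \<delta> "x - y"]
          by (simp add: abs_mult flip: left_diff_distrib)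
      next
        case False thus ?thesis using out[OF False] by simp
      qed
    qed
  qed (use i i1 in auto)
  hence "\<bar>mollify \<delta> U f x - f x * J\<bar> \<le> \<eta> * J"
    using i i1[of "f x"] bump_mass_eq[OF U \<delta>] unfolding mollify_def J_def by simp
  moreover have "mollify \<delta> U f x / J - f x = (mollify \<delta> U f x - f x * J) / J" using J by (simp add: diff_divide_distrib)
  ultimately show ?thesis unfolding J_def[symmetric] using abs_quotient_le[OF J] by simp
qed

lemma mollify_tendsto:
  fixes f :: "'a::euclidean_space \<Rightarrow> real"
  assumes U: "open U" and f: "f \<in> borel_measurable (lebesgue_on U)" "AE y in lebesgue_on U. \<bar>f y\<bar> \<le> M"
    and c: "continuous_on U f" and d: "d > 0" "cball x d \<subseteq> U"
  shows "(\<lambda>n. mollify (d / Suc n) U f x / bump_mass TYPE('a) (d / Suc n)) \<longlonglongrightarrow> f x"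
proof (rule LIMSEQ_I)
  fix \<eta> :: real assume \<eta>: "\<eta> > 0"
  have "x \<in> U" using d by auto
  hence "isCont f x" using c U by (simp add: continuous_on_eq_continuous_at)
  moreover have "\<eta> / 2 > 0" using \<eta> by simp
  ultimately have "\<exists>r>0. \<forall>y. dist y x < r \<longrightarrow> dist (f y) (f x) < \<eta> / 2" by (rule isCont_dist_less)
  then obtain r where r0: "r > 0" "\<forall>y. dist y x < r \<longrightarrow> dist (f y) (f x) < \<eta> / 2" by (elim exE conjE)
  have r: "r > 0" "\<And>y. dist y x < r \<Longrightarrow> dist (f y) (f x) < \<eta> / 2"
    using r0 by simp_all
  obtain N :: nat where N: "d / r < real N" using reals_Archimedean2 by blast
  show "\<exists>no. \<forall>n\<ge>no. norm (mollify (d / Suc n) U f x / bump_mass TYPE('a) (d / Suc n) - f x) < \<eta>"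
  proof (intro exI[of _ N] allI impI)
    fix n assume n: "n \<ge> N"
    have dn: "0 < d / Suc n" "d / Suc n \<le> d" using d by (auto simp: field_simps)
    have "d / Suc n < r"
    proof -
      have "d / r < real (Suc n)" using N n by linarith
      thus ?thesis using r d by (simp add: field_simps)
    qed
    hence "\<bar>f y - f x\<bar> \<le> \<eta> / 2" if "y \<in> cball x (d / Suc n)" for y
      using r(2)[of y] that by (auto simp: dist_commute dist_real_def abs_minus_commute)
    moreover have "cball x (d / Suc n) \<subseteq> U" using d(2) dn(2) by (meson dual_order.trans subset_cball)
    ultimately have "\<bar>mollify (d / Suc n) U f x / bump_mass TYPE('a) (d / Suc n) - f x\<bar> \<le> \<eta> / 2"
      by (intro mollify_approx[OF U f dn(1)])
    thus "norm (mollify (d / Suc n) U f x / bump_mass TYPE('a) (d / Suc n) - f x) < \<eta>" using \<eta> by simp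
  qed
qed


lemma mean_value_from_0:
  fixes P P' :: "real \<Rightarrow> real"
  assumes "\<And>r. r \<in> closed_segment 0 s \<Longrightarrow> (P has_real_derivative P' r) (at r)"
  shows "\<exists>\<xi>\<in>closed_segment 0 s. P s - P 0 = s * P' \<xi>"
proof -
  consider "s = 0" | "s > 0" | "s < 0" by linarith
  thus ?thesis
  proof cases
    case 1 thus ?thesis by auto
  next
    case 2
    then obtain z where "0 < z" "z < s" "P s - P 0 = (s - 0) * P' z"
      using MVT2[OF 2, of P P'] assms by (auto simp: closed_segment_eq_real_ivl)
    thus ?thesis using 2 by (intro bexI[of _ z]) (auto simp: closed_segment_eq_real_ivl)
  next
    case 3
    then obtain z where "s < z" "z < 0" "P 0 - P s = (0 - s) * P' z"
      using MVT2[OF 3, of P P'] assms by (auto simp: closed_segment_eq_real_ivl)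
    thus ?thesis using 3 by (intro bexI[of _ z]) (auto simp: closed_segment_eq_real_ivl)
  qed
qed

lemma coordinate_lipschitz:
  fixes G :: "'a::euclidean_space \<Rightarrow> real"
  assumes G: "\<And>x i s. i \<in> Basis \<Longrightarrow> \<bar>G (x + s *\<^sub>R i) - G x\<bar> \<le> M * \<bar>s\<bar>" and M: "M \<ge> 0"
  shows "\<bar>G x - G y\<bar> \<le> real DIM('a) * M * norm (x - y)"
proof -
  define w where "w = x - y"
  have "\<bar>G (y + (\<Sum>i\<in>B. (w \<bullet> i) *\<^sub>R i)) - G y\<bar> \<le> real (card B) * M * norm w" if "finite B" "B \<subseteq> Basis" for B
    using that
  proof (induction B)
    case (insert j B)
    define z where "z = y + (\<Sum>i\<in>B. (w \<bullet> i) *\<^sub>R i)"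
    have eq: "y + (\<Sum>i\<in>insert j B. (w \<bullet> i) *\<^sub>R i) = z + (w \<bullet> j) *\<^sub>R j" using insert by (simp add: z_def)
    have "\<bar>G (z + (w \<bullet> j) *\<^sub>R j) - G z\<bar> \<le> M * norm w"
    proof -
      have "\<bar>w \<bullet> j\<bar> \<le> norm w" using insert.prems by (simp add: Basis_le_norm)
      hence "M * \<bar>w \<bullet> j\<bar> \<le> M * norm w" using M by (intro mult_left_mono)
      thus ?thesis using G[of j z "w \<bullet> j"] insert.prems by simp
    qed
    moreover have "\<bar>G z - G y\<bar> \<le> real (card B) * M * norm w" using insert unfolding z_def by simp
    ultimately have "\<bar>G (y + (\<Sum>i\<in>insert j B. (w \<bullet> i) *\<^sub>R i)) - G y\<bar> \<le> real (card B) * M * norm w + M * norm w"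
      unfolding eq using abs_triangle_ineq[of "G (z + (w \<bullet> j) *\<^sub>R j) - G z" "G z - G y"] by simp
    thus ?case using insert by (simp add: algebra_simps)
  qed simp
  from this[of Basis] show ?thesis by (simp add: w_def euclidean_representation)
qed

text \<open>The second statement compares the slopes of \<open>f\<close> over two steps \<open>s\<close> and
  \<open>r\<close> in the same direction, multiplied out. It expresses that the first derivatives are
  Lipschitz without mentioning them, so it passes to the limit of mollifications pointwise.\<close>

lemma sobolev_slope_bounds:
  fixes f :: "'a::euclidean_space \<Rightarrow> real"
  assumes c: "continuous_on UNIV f" and sob: "sobolev_inf_le (Suc (Suc k)) M UNIV f"
  shows "\<bar>f x\<bar> \<le> M"
    and "i \<in> Basis \<Longrightarrow> \<bar>(f (x + s *\<^sub>R i) - f x) * r - s * (f (a + r *\<^sub>R i) - f a)\<bar>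
       \<le> real DIM('a) * M * \<bar>s\<bar> * \<bar>r\<bar> * (norm (x - a) + \<bar>s\<bar> + \<bar>r\<bar>)"
proof -
  have f: "f \<in> borel_measurable (lebesgue_on UNIV)" "AE y in lebesgue_on UNIV. \<bar>f y\<bar> \<le> M"
    and weak: "\<And>b. b \<in> Basis \<Longrightarrow> \<exists>h. has_weak_deriv UNIV b f h \<and> sobolev_inf_le (Suc k) M UNIV h"
    using sob by simp_all
  note U = open_UNIV
  define \<delta> where "\<delta> n = 1 / real (Suc n)" for n
  define J where "J n = bump_mass TYPE('a) (\<delta> n)" for n
  have \<delta>: "\<delta> n > 0" for n unfolding \<delta>_def by simp
  have J: "J n > 0" for n unfolding J_def by (rule bump_mass_pos[OF \<delta>])
  define F where "F n y = mollify (\<delta> n) UNIV f y / J n" for n y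
  have lim: "(\<lambda>n. F n y) \<longlonglongrightarrow> f y" for y
    unfolding F_def J_def \<delta>_def by (rule mollify_tendsto[OF U f c]) auto
  have scaled: "\<bar>mollify (\<delta> n) UNIV h y / J n\<bar> \<le> M"
    if "h \<in> borel_measurable (lebesgue_on UNIV)" "AE y in lebesgue_on UNIV. \<bar>h y\<bar> \<le> M" for h :: "'a \<Rightarrow> real" and n y
  proof (rule abs_quotient_le[OF J])
    show "\<bar>mollify (\<delta> n) UNIV h y\<bar> \<le> M * J n"
      unfolding J_def using mollify_bound[OF open_UNIV that \<delta>[of n], of y] by simp
  qed
  have "(\<lambda>n. \<bar>F n x\<bar>) \<longlonglongrightarrow> \<bar>f x\<bar>" for x by (intro tendsto_rabs lim)
  thus "\<bar>f x\<bar> \<le> M" for x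
  proof (rule tendsto_upperbound)
    show "\<forall>\<^sub>F n in sequentially. \<bar>F n x\<bar> \<le> M" unfolding F_def by (intro always_eventually allI scaled[OF f])
  qed simp
  hence M: "M \<ge> 0" using abs_ge_zero order_trans by blast
  assume i: "i \<in> Basis"
  obtain h where h: "has_weak_deriv UNIV i f h" "sobolev_inf_le (Suc k) M UNIV h" using weak[OF i] by blast
  have hm: "h \<in> borel_measurable (lebesgue_on UNIV)" "AE y in lebesgue_on UNIV. \<bar>h y\<bar> \<le> M"
    and weak2: "\<And>b. b \<in> Basis \<Longrightarrow> \<exists>h'. has_weak_deriv UNIV b h h' \<and> sobolev_inf_le k M UNIV h'"
    using h(2) by simp_all
  define D where "D n y = mollify (\<delta> n) UNIV h y / J n" for n y
  have dF: "((\<lambda>s. F n (y + s *\<^sub>R i)) has_real_derivative D n (y + s *\<^sub>R i)) (at s)" for n y s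
    unfolding F_def D_def by (rule DERIV_cdivide, rule mollify_deriv[OF U f h(1) _ \<delta>]) (use i in auto)
  have Dlip: "\<bar>D n u - D n v\<bar> \<le> real DIM('a) * M * norm (u - v)" for n u v
  proof (rule coordinate_lipschitz[OF _ M])
    fix y j :: 'a and s :: real assume j: "j \<in> Basis"
    obtain h' where h': "has_weak_deriv UNIV j h h'" "sobolev_inf_le k M UNIV h'" using weak2[OF j] by blast
    have hm': "h' \<in> borel_measurable (lebesgue_on UNIV)" "AE y in lebesgue_on UNIV. \<bar>h' y\<bar> \<le> M"
      using h'(2) by (cases k; simp)+
    have dD: "((\<lambda>s. D n (y + s *\<^sub>R j)) has_real_derivative mollify (\<delta> n) UNIV h' (y + s *\<^sub>R j) / J n) (at s)" for s
      unfolding D_def by (rule DERIV_cdivide, rule mollify_deriv[OF U hm h'(1) _ \<delta>]) (use j in auto)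
    obtain \<xi> where "D n (y + s *\<^sub>R j) - D n (y + 0 *\<^sub>R j) = s * (mollify (\<delta> n) UNIV h' (y + \<xi> *\<^sub>R j) / J n)"
      using mean_value_from_0[of s "\<lambda>s. D n (y + s *\<^sub>R j)" "\<lambda>s. mollify (\<delta> n) UNIV h' (y + s *\<^sub>R j) / J n"] dD by blast
    thus "\<bar>D n (y + s *\<^sub>R j) - D n y\<bar> \<le> M * \<bar>s\<bar>"
      using mult_right_mono[OF scaled[OF hm', of n "y + \<xi> *\<^sub>R j"], of "\<bar>s\<bar>"] by (simp add: abs_mult mult.commute)
  qed
  have step: "\<bar>(F n (x + s *\<^sub>R i) - F n x) * r - s * (F n (a + r *\<^sub>R i) - F n a)\<bar>
       \<le> real DIM('a) * M * \<bar>s\<bar> * \<bar>r\<bar> * (norm (x - a) + \<bar>s\<bar> + \<bar>r\<bar>)" for n x s r a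
  proof -
    obtain \<xi> where \<xi>: "\<xi> \<in> closed_segment 0 s" "F n (x + s *\<^sub>R i) - F n (x + 0 *\<^sub>R i) = s * D n (x + \<xi> *\<^sub>R i)"
      using mean_value_from_0[of s "\<lambda>s. F n (x + s *\<^sub>R i)" "\<lambda>s. D n (x + s *\<^sub>R i)"] dF by blast
    obtain \<zeta> where \<zeta>: "\<zeta> \<in> closed_segment 0 r" "F n (a + r *\<^sub>R i) - F n (a + 0 *\<^sub>R i) = r * D n (a + \<zeta> *\<^sub>R i)"
      using mean_value_from_0[of r "\<lambda>s. F n (a + s *\<^sub>R i)" "\<lambda>s. D n (a + s *\<^sub>R i)"] dF by blast
    have b: "\<bar>\<xi>\<bar> \<le> \<bar>s\<bar>" "\<bar>\<zeta>\<bar> \<le> \<bar>r\<bar>" using \<xi>(1) \<zeta>(1) by (auto simp: closed_segment_eq_real_ivl split: if_splits)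
    have "(F n (x + s *\<^sub>R i) - F n x) * r - s * (F n (a + r *\<^sub>R i) - F n a) = (s * r) * (D n (x + \<xi> *\<^sub>R i) - D n (a + \<zeta> *\<^sub>R i))"
      using \<xi>(2) \<zeta>(2) by (simp add: algebra_simps)
    also have "\<bar>\<dots>\<bar> \<le> (\<bar>s\<bar> * \<bar>r\<bar>) * (real DIM('a) * M * (norm (x - a) + \<bar>s\<bar> + \<bar>r\<bar>))"
    proof -
      have "norm ((x + \<xi> *\<^sub>R i) - (a + \<zeta> *\<^sub>R i)) \<le> norm (x - a) + \<bar>s\<bar> + \<bar>r\<bar>"
      proof -
        have eq: "(x + \<xi> *\<^sub>R i) - (a + \<zeta> *\<^sub>R i) = (x - a) + (\<xi> - \<zeta>) *\<^sub>R i" by (simp add: algebra_simps)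
        have "norm ((x + \<xi> *\<^sub>R i) - (a + \<zeta> *\<^sub>R i)) \<le> norm (x - a) + \<bar>\<xi> - \<zeta>\<bar>"
          unfolding eq using norm_triangle_ineq[of "x - a" "(\<xi> - \<zeta>) *\<^sub>R i"] i by simp
        thus ?thesis using b by linarith
      qed
      hence "real DIM('a) * M * norm ((x + \<xi> *\<^sub>R i) - (a + \<zeta> *\<^sub>R i)) \<le> real DIM('a) * M * (norm (x - a) + \<bar>s\<bar> + \<bar>r\<bar>)"
        using M by (intro mult_left_mono) auto
      hence "\<bar>D n (x + \<xi> *\<^sub>R i) - D n (a + \<zeta> *\<^sub>R i)\<bar> \<le> real DIM('a) * M * (norm (x - a) + \<bar>s\<bar> + \<bar>r\<bar>)"
        using Dlip[of n "x + \<xi> *\<^sub>R i" "a + \<zeta> *\<^sub>R i"] by linarith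
      thus ?thesis unfolding abs_mult by (intro mult_left_mono) auto
    qed
    finally show ?thesis by (simp add: mult_ac)
  qed
  have "(\<lambda>n. \<bar>(F n (x + s *\<^sub>R i) - F n x) * r - s * (F n (a + r *\<^sub>R i) - F n a)\<bar>) \<longlonglongrightarrow>
     \<bar>(f (x + s *\<^sub>R i) - f x) * r - s * (f (a + r *\<^sub>R i) - f a)\<bar>"
    by (intro tendsto_intros lim)
  thus "\<bar>(f (x + s *\<^sub>R i) - f x) * r - s * (f (a + r *\<^sub>R i) - f a)\<bar>
       \<le> real DIM('a) * M * \<bar>s\<bar> * \<bar>r\<bar> * (norm (x - a) + \<bar>s\<bar> + \<bar>r\<bar>)"
    by (rule tendsto_upperbound) (auto intro!: always_eventually step)
qed

text \<open>The mixed difference is the increment, in the direction \<open>i\<close>, of the integral of the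
  time derivative between the two times, and the time derivative is Lipschitz in space. Mollification in
  space-time gives this inside \<open>(0, T)\<close>, and continuity the end points.\<close>

lemma sobolev_mixed_difference:
  fixes g :: "'a::euclidean_space \<Rightarrow> real \<Rightarrow> real"
  assumes c: "continuous_on (UNIV \<times> {0..T}) (\<lambda>(x, t). g x t)" and gM: "\<And>x t. t \<in> {0..T} \<Longrightarrow> \<bar>g x t\<bar> \<le> M"
    and w: "has_weak_deriv (UNIV \<times> {0<..<T}) (0, 1) (\<lambda>(x, t). g x t) gt"
    and sob: "sobolev_inf_le 1 M' (UNIV \<times> {0<..<T}) gt"
    and i: "i \<in> Basis" and t: "t \<in> {0..T}" "t' \<in> {0..T}" and T: "T > 0"
  shows "\<bar>g (a + r *\<^sub>R i) t - g a t - g (a + r *\<^sub>R i) t' + g a t'\<bar> \<le> M' * \<bar>r\<bar> * \<bar>t - t'\<bar>"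
proof -
  define U where "U = (UNIV \<times> {0<..<T} :: ('a \<times> real) set)"
  have U: "open U" unfolding U_def by (intro open_Times) auto
  define f where "f = (\<lambda>(x, t). g x t)"
  have cf: "continuous_on U f" unfolding U_def f_def by (rule continuous_on_subset[OF c]) auto
  have f: "f \<in> borel_measurable (lebesgue_on U)" "AE y in lebesgue_on U. \<bar>f y\<bar> \<le> M"
  proof -
    show "f \<in> borel_measurable (lebesgue_on U)" by (rule continuous_imp_measurable_on_sets_lebesgue[OF cf]) (use U in simp)
    show "AE y in lebesgue_on U. \<bar>f y\<bar> \<le> M"
      by (rule AE_I2) (use gM in \<open>auto simp: space_restrict_space U_def f_def\<close>)
  qed
  have gt: "gt \<in> borel_measurable (lebesgue_on U)" "AE y in lebesgue_on U. \<bar>gt y\<bar> \<le> M'"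
    and weak: "\<And>b. b \<in> Basis \<Longrightarrow> \<exists>h. has_weak_deriv U b gt h \<and> sobolev_inf_le 0 M' U h"
    using sob unfolding U_def One_nat_def by simp_all
  have iB: "(i, 0::real) \<in> Basis" "norm (i, 0::real) = 1" using i by (auto simp: Basis_prod_def)
  have tB: "norm ((0::'a), 1::real) = 1" by simp
  obtain h where h: "has_weak_deriv U (i, 0) gt h" "h \<in> borel_measurable (lebesgue_on U)" "AE y in lebesgue_on U. \<bar>h y\<bar> \<le> M'"
    using weak[OF iB(1)] by auto
  have inner: "\<bar>g (a + r *\<^sub>R i) t - g a t - g (a + r *\<^sub>R i) t' + g a t'\<bar> \<le> M' * \<bar>r\<bar> * \<bar>t - t'\<bar>"
    if t: "t \<in> {0<..<T}" "t' \<in> {0<..<T}" for t t'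
  proof -
    define d where "d = min (min t t') (T - max t t') / 2"
    have d: "d > 0" unfolding d_def using t by auto
    have ball: "cball (y, \<tau>) e \<subseteq> U" if "e \<le> d" "\<tau> \<in> closed_segment t' t" for y \<tau> e
    proof
      fix z assume z: "z \<in> cball (y, \<tau>) e"
      have "\<bar>\<tau> - snd z\<bar> \<le> dist (y, \<tau>) z" using dist_snd_le[of "(y, \<tau>)" z] by (simp add: dist_real_def)
      hence "\<bar>\<tau> - snd z\<bar> \<le> d" using z that(1) by simp
      moreover have "min t t' \<le> \<tau>" "\<tau> \<le> max t t'" using that(2) by (auto simp: closed_segment_eq_real_ivl split: if_splits)
      moreover have "d < min t t'" "d < T - max t t'" unfolding d_def using t by auto
      ultimately show "z \<in> U" unfolding U_def by (auto simp: mem_Times_iff)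
    qed
    define \<delta> where "\<delta> n = d / real (Suc n)" for n
    define J where "J n = bump_mass TYPE('a \<times> real) (\<delta> n)" for n
    have \<delta>: "\<delta> n > 0" "\<delta> n \<le> d" for n unfolding \<delta>_def using d by (auto simp: field_simps)
    have J: "J n > 0" for n unfolding J_def by (rule bump_mass_pos[OF \<delta>(1)])
    define F where "F n y = mollify (\<delta> n) U f y / J n" for n y
    have lim: "(\<lambda>n. F n (y, \<tau>)) \<longlonglongrightarrow> f (y, \<tau>)" if "\<tau> \<in> closed_segment t' t" for y \<tau>
      unfolding F_def J_def \<delta>_def by (rule mollify_tendsto[OF U f cf d ball[OF order_refl that]])
    define D where "D n y = mollify (\<delta> n) U gt y / J n" for n y
    have dF: "((\<lambda>s. F n (y, s)) has_real_derivative D n (y, s)) (at s)" if s: "s \<in> closed_segment t' t" for n y s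
    proof -
      have "cball ((y, 0) + s *\<^sub>R (0, 1)) (\<delta> n) \<subseteq> U" using ball[OF \<delta>(2) s] by simp
      from DERIV_cdivide[OF mollify_deriv[OF U f w[folded U_def f_def] tB \<delta>(1) this], of "J n"]
      show ?thesis unfolding F_def D_def by simp
    qed
    have Db: "\<bar>D n (a + r *\<^sub>R i, s) - D n (a, s)\<bar> \<le> M' * \<bar>r\<bar>" if s: "s \<in> closed_segment t' t" for n s
    proof -
      define P' where "P' \<xi> = mollify (\<delta> n) U h (a + \<xi> *\<^sub>R i, s) / J n" for \<xi>
      have dD: "((\<lambda>\<xi>. D n (a + \<xi> *\<^sub>R i, s)) has_real_derivative P' \<xi>) (at \<xi>)" for \<xi>
      proof -
        have "cball ((a, s) + \<xi> *\<^sub>R (i, 0)) (\<delta> n) \<subseteq> U" using ball[OF \<delta>(2) s] by simp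
        from DERIV_cdivide[OF mollify_deriv[OF U gt h(1) iB(2) \<delta>(1) this], of "J n"]
        show ?thesis unfolding D_def P'_def by simp
      qed
      obtain \<xi> where x: "D n (a + r *\<^sub>R i, s) - D n (a + 0 *\<^sub>R i, s) = r * P' \<xi>"
        using mean_value_from_0[of r "\<lambda>\<xi>. D n (a + \<xi> *\<^sub>R i, s)" P'] dD by blast
      have "\<bar>P' \<xi>\<bar> \<le> M'"
        unfolding P'_def
      proof (rule abs_quotient_le[OF J])
        show "\<bar>mollify (\<delta> n) U h (a + \<xi> *\<^sub>R i, s)\<bar> \<le> M' * J n"
          unfolding J_def by (rule mollify_bound[OF U h(2,3) \<delta>(1) ball[OF \<delta>(2) s]])
      qed
      from mult_right_mono[OF this, of "\<bar>r\<bar>"] show ?thesis using x by (simp add: abs_mult mult.commute)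
    qed
    define P where "P n s = F n (a + r *\<^sub>R i, s) - F n (a, s)" for n s
    have "norm (P n t - P n t') \<le> (M' * \<bar>r\<bar>) * norm (t - t')" for n
    proof (rule field_differentiable_bound[of "closed_segment t' t" "P n" "\<lambda>s. D n (a + r *\<^sub>R i, s) - D n (a, s)"])
      show "(P n has_field_derivative D n (a + r *\<^sub>R i, s) - D n (a, s)) (at s within closed_segment t' t)"
        if "s \<in> closed_segment t' t" for s
        unfolding P_def[abs_def] by (rule has_field_derivative_at_within, rule DERIV_diff) (use dF that in auto)
    qed (use Db in auto)
    hence st: "\<bar>F n (a + r *\<^sub>R i, t) - F n (a, t) - F n (a + r *\<^sub>R i, t') + F n (a, t')\<bar> \<le> M' * \<bar>r\<bar> * \<bar>t - t'\<bar>" for n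
      unfolding P_def by (simp add: algebra_simps)
    have "(\<lambda>n. \<bar>F n (a + r *\<^sub>R i, t) - F n (a, t) - F n (a + r *\<^sub>R i, t') + F n (a, t')\<bar>) \<longlonglongrightarrow>
        \<bar>f (a + r *\<^sub>R i, t) - f (a, t) - f (a + r *\<^sub>R i, t') + f (a, t')\<bar>"
      by (intro tendsto_intros lim) auto
    hence "\<bar>f (a + r *\<^sub>R i, t) - f (a, t) - f (a + r *\<^sub>R i, t') + f (a, t')\<bar> \<le> M' * \<bar>r\<bar> * \<bar>t - t'\<bar>"
      by (rule tendsto_upperbound) (auto intro!: always_eventually st)
    thus ?thesis unfolding f_def by simp
  qed
  have cl: "closure ({0<..<T} \<times> {0<..<T}) = {0..T} \<times> {0..T}" using T by (simp add: closure_Times)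
  have cg: "continuous_on ({0..T} \<times> {0..T}) (\<lambda>z. g y (fst z))" "continuous_on ({0..T} \<times> {0..T}) (\<lambda>z. g y (snd z))" for y
  proof -
    have "continuous_on ({0..T} \<times> {0..T}) ((\<lambda>(x, t). g x t) \<circ> (\<lambda>z. (y, fst z)))"
      by (intro continuous_on_compose continuous_intros continuous_on_subset[OF c]) auto
    thus "continuous_on ({0..T} \<times> {0..T}) (\<lambda>z. g y (fst z))" by (simp add: comp_def)
    have "continuous_on ({0..T} \<times> {0..T}) ((\<lambda>(x, t). g x t) \<circ> (\<lambda>z. (y, snd z)))"
      by (intro continuous_on_compose continuous_intros continuous_on_subset[OF c]) auto
    thus "continuous_on ({0..T} \<times> {0..T}) (\<lambda>z. g y (snd z))" by (simp add: comp_def)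
  qed
  have "(\<lambda>z. \<bar>g (a + r *\<^sub>R i) (fst z) - g a (fst z) - g (a + r *\<^sub>R i) (snd z) + g a (snd z)\<bar> - M' * \<bar>r\<bar> * \<bar>fst z - snd z\<bar>) (t, t') \<le> 0"
  proof (rule continuous_le_on_closure[of "{0<..<T} \<times> {0<..<T}"])
    show "continuous_on (closure ({0<..<T} \<times> {0<..<T}))
       (\<lambda>z. \<bar>g (a + r *\<^sub>R i) (fst z) - g a (fst z) - g (a + r *\<^sub>R i) (snd z) + g a (snd z)\<bar> - M' * \<bar>r\<bar> * \<bar>fst z - snd z\<bar>)"
      unfolding cl by (intro continuous_intros cg)
    show "(t, t') \<in> closure ({0<..<T} \<times> {0<..<T})" unfolding cl using t by simp
  qed (use inner in auto)
  thus ?thesis by simp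
qed

section \<open>Signed distance to a smooth family of domains\<close>

lemma signed_dist_alt: "open \<Omega> \<Longrightarrow> signed_dist \<Omega> x = (if x \<in> \<Omega> then - infdist x (frontier \<Omega>) else infdist x (frontier \<Omega>))"
  unfolding signed_dist_def by (auto simp: infdist_zero)

lemma abs_signed_dist: "\<bar>signed_dist \<Omega> x\<bar> = infdist x (frontier \<Omega>)"
  unfolding signed_dist_def by (auto simp: infdist_zero infdist_nonneg)

lemma signed_dist_lipschitz:
  assumes "open \<Omega>"
  shows "\<bar>signed_dist \<Omega> x - signed_dist \<Omega> y\<bar> \<le> dist x y"
proof -
  have cross: "infdist x (frontier \<Omega>) + infdist y (frontier \<Omega>) \<le> dist x y" if "x \<in> \<Omega>" "y \<notin> \<Omega>" for x y
  proof -
    have "closed_segment x y \<inter> frontier \<Omega> \<noteq> {}"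
      by (rule connected_Int_frontier) (use that in auto)
    then obtain z where z: "z \<in> closed_segment x y" "z \<in> frontier \<Omega>" by blast
    have "infdist x (frontier \<Omega>) \<le> dist x z" "infdist y (frontier \<Omega>) \<le> dist y z" using z(2) by (auto intro: infdist_le)
    moreover have "dist x z + dist z y = dist x y"
      using z(1) by (metis between_mem_segment between)
    ultimately show ?thesis by (simp add: dist_commute)
  qed
  have same: "\<bar>infdist x (frontier \<Omega>) - infdist y (frontier \<Omega>)\<bar> \<le> dist x y" by (rule infdist_triangle_abs)
  show ?thesis using cross[of x y] cross[of y x] same infdist_nonneg[of x "frontier \<Omega>"] infdist_nonneg[of y "frontier \<Omega>"]
    unfolding signed_dist_alt[OF assms] by (auto simp: dist_commute)
qed

lemma frontier_nonempty_bounded: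
  fixes \<Omega> :: "'a::euclidean_space set"
  assumes "\<Omega> \<noteq> {}" "bounded \<Omega>" shows "frontier \<Omega> \<noteq> {}"
  using assms not_bounded_UNIV by (metis frontier_not_empty)

lemma signed_dist_zero_iff:
  assumes "frontier \<Omega> \<noteq> {}"
  shows "signed_dist \<Omega> x = 0 \<longleftrightarrow> x \<in> frontier \<Omega>"
proof -
  have "signed_dist \<Omega> x = 0 \<longleftrightarrow> infdist x (frontier \<Omega>) = 0" using abs_signed_dist[of \<Omega> x] by auto
  thus ?thesis using in_closed_iff_infdist_zero[OF frontier_closed assms] by blast
qed

lemma signed_dist_neg_iff:
  assumes "open \<Omega>" "frontier \<Omega> \<noteq> {}"
  shows "signed_dist \<Omega> x < 0 \<longleftrightarrow> x \<in> \<Omega>"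
proof
  assume "signed_dist \<Omega> x < 0"
  thus "x \<in> \<Omega>" unfolding signed_dist_alt[OF assms(1)] using infdist_nonneg[of x "frontier \<Omega>"] by (auto split: if_splits)
next
  assume x: "x \<in> \<Omega>"
  hence "x \<notin> frontier \<Omega>" using assms(1) by (simp add: frontier_def interior_open)
  hence "signed_dist \<Omega> x \<noteq> 0" using signed_dist_zero_iff[OF assms(2)] by blast
  moreover have "signed_dist \<Omega> x \<le> 0" unfolding signed_dist_alt[OF assms(1)] using x infdist_nonneg[of x "frontier \<Omega>"] by simp
  ultimately show "signed_dist \<Omega> x < 0" by simp
qed

lemma signed_dist_attained:
  fixes \<Omega> :: "'a::euclidean_space set"
  assumes "frontier \<Omega> \<noteq> {}"
  shows "\<exists>y\<in>frontier \<Omega>. dist x y = \<bar>signed_dist \<Omega> x\<bar>"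
  using infdist_attains_inf[OF frontier_closed assms, of x] abs_signed_dist[of \<Omega> x] by metis

lemma compact_persists:
  fixes P :: "'a::metric_space \<Rightarrow> 'b::metric_space \<Rightarrow> bool"
  assumes K: "compact K" and loc: "\<And>x. x \<in> K \<Longrightarrow> \<exists>e>0. \<forall>y s. dist (y, s) (x, t) < e \<longrightarrow> P y s"
  shows "\<exists>e>0. \<forall>s. dist s t < e \<longrightarrow> (\<forall>y\<in>K. P y s)"
proof -
  have "\<forall>x\<in>K. \<exists>e>0. \<forall>y s. dist (y, s) (x, t) < e \<longrightarrow> P y s" using loc by blast
  then obtain e where e: "\<And>x. x \<in> K \<Longrightarrow> e x > 0" "\<And>x y s. x \<in> K \<Longrightarrow> dist (y, s) (x, t) < e x \<Longrightarrow> P y s"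
    unfolding bchoice_iff by blast
  define \<G> where "\<G> = (\<lambda>x. ball (x, t) (e x)) ` K"
  have cK: "compact (K \<times> {t})" using K by (intro compact_Times) auto
  have cov: "K \<times> {t} \<subseteq> \<Union>\<G>" unfolding \<G>_def using e(1) by auto
  have op: "open G" if "G \<in> \<G>" for G using that unfolding \<G>_def by auto
  obtain d where d: "d > 0" "\<forall>z\<in>K \<times> {t}. \<exists>G\<in>\<G>. ball z d \<subseteq> G"
    by (rule Heine_Borel_lemma[OF cK cov op]) (assumption, metis that)
  have "P y s" if "dist s t < d" "y \<in> K" for y s
  proof -
    obtain x where x: "x \<in> K" "ball (y, t) d \<subseteq> ball (x, t) (e x)"
      using bspec[OF d(2), of "(y, t)"] \<open>y \<in> K\<close> unfolding \<G>_def by auto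
    have "(y, s) \<in> ball (y, t) d" using that(1) by (simp add: dist_Pair_Pair dist_commute)
    hence "(y, s) \<in> ball (x, t) (e x)" using x by blast
    thus ?thesis using e(2)[OF x(1), of y s] by (simp add: dist_commute)
  qed
  thus ?thesis using d(1) by (intro exI[of _ d] conjI allI impI ballI)
qed

text \<open>One half of the joint continuity of a signed distance. It is stated for a general family
  \<open>d\<close> so that it can be applied to \<open>d\<close> and to \<open>- d\<close>. For positive
  \<open>c\<close> a nearby point where \<open>d\<close> is negative keeps this sign for neighbouring times;
  for the other \<open>c\<close> a whole ball around \<open>x\<close> does, by compactness, and so contains no
  zero.\<close>

lemma sublevel_persists:
  fixes d :: "'a::euclidean_space \<Rightarrow> real \<Rightarrow> real"
  assumes lip: "\<And>x y s. s \<in> I \<Longrightarrow> \<bar>d x s - d y s\<bar> \<le> dist x y"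
    and neg: "\<And>x. d x t < 0 \<Longrightarrow> \<exists>e>0. \<forall>y s. dist (y, s) (x, t) < e \<longrightarrow> s \<in> I \<longrightarrow> d y s < 0"
    and zero: "\<And>x e. d x t = 0 \<Longrightarrow> e > 0 \<Longrightarrow> \<exists>z. dist x z < e \<and> d z t < 0"
    and att: "\<And>x s. s \<in> I \<Longrightarrow> \<exists>y. d y s = 0 \<and> dist x y = \<bar>d x s\<bar>"
    and t: "t \<in> I" and c: "d x t < c"
  shows "\<exists>e>0. \<forall>y s. dist (y, s) (x, t) < e \<longrightarrow> s \<in> I \<longrightarrow> d y s < c"
proof (cases "c > 0")
  case True
  obtain z where z: "d z t < 0" "dist x z < c"
  proof (cases "d x t < 0")
    case True thus ?thesis using that[of x] \<open>c > 0\<close> by simp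
  next
    case False
    obtain y where y: "d y t = 0" "dist x y = \<bar>d x t\<bar>" using att[OF t] by blast
    have "c - dist x y > 0" using False y c by simp
    then obtain z where z: "dist y z < c - dist x y" "d z t < 0" using zero[OF y(1)] by blast
    show ?thesis by (rule that[OF z(2)]) (use z(1) dist_triangle[of x z y] in linarith)
  qed
  obtain e where e: "e > 0" "\<And>y s. dist (y, s) (z, t) < e \<Longrightarrow> s \<in> I \<Longrightarrow> d y s < 0" using neg[OF z(1)] by blast
  define r where "r = min e (c - dist x z)"
  have "d y s < c" if ys: "dist (y, s) (x, t) < r" "s \<in> I" for y s
  proof -
    have "dist s t \<le> dist (y, s) (x, t)" "dist y x \<le> dist (y, s) (x, t)"
      using dist_snd_le[of "(y, s)" "(x, t)"] dist_fst_le[of "(y, s)" "(x, t)"] by auto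
    hence a: "dist s t < e" "dist y x < c - dist x z" using ys unfolding r_def by auto
    have "dist (z, s) (z, t) < e" using a(1) by (simp add: dist_Pair_Pair)
    hence "d z s < 0" using e(2) ys(2) by blast
    moreover have "d y s \<le> d z s + dist y z" using lip[OF ys(2), of y z] by linarith
    moreover have "dist y z \<le> dist y x + dist x z" by (rule dist_triangle)
    ultimately show ?thesis using a(2) by linarith
  qed
  moreover have "r > 0" unfolding r_def using e z by simp
  ultimately show ?thesis by blast
next
  case False
  define m where "m = (- c + - d x t) / 2"
  have m: "- c < m" "m < - d x t" using c unfolding m_def by auto
  have "d y t < 0" if "y \<in> cball x m" for y
    using lip[OF t, of y x] that m by (simp add: dist_commute)
  hence "\<And>y. y \<in> cball x m \<Longrightarrow> \<exists>e>0. \<forall>z s. dist (z, s) (y, t) < e \<longrightarrow> (s \<in> I \<longrightarrow> d z s < 0)" by (rule neg)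
  from compact_persists[OF compact_cball this]
  obtain e where e: "e > 0" "\<And>s y. dist s t < e \<Longrightarrow> y \<in> cball x m \<Longrightarrow> s \<in> I \<Longrightarrow> d y s < 0" by blast
  define r where "r = min e (c + m)"
  have "d y s < c" if ys: "dist (y, s) (x, t) < r" "s \<in> I" for y s
  proof -
    have "dist s t \<le> dist (y, s) (x, t)" "dist y x \<le> dist (y, s) (x, t)"
      using dist_snd_le[of "(y, s)" "(x, t)"] dist_fst_le[of "(y, s)" "(x, t)"] by auto
    hence a: "dist s t < e" "dist y x < c + m" using ys unfolding r_def by auto
    have x0: "d x s < 0" using e(2)[OF a(1) _ ys(2), of x] m False by simp
    obtain f where f: "d f s = 0" "dist x f = \<bar>d x s\<bar>" using att[OF ys(2)] by blast
    have "\<not> f \<in> cball x m" using e(2)[OF a(1) _ ys(2), of f] f(1) by auto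
    hence "d x s < - m" using f(2) x0 by simp
    moreover have "d y s \<le> d x s + dist y x" using lip[OF ys(2), of y x] by linarith
    ultimately show ?thesis using a(2) by linarith
  qed
  moreover have "r > 0" unfolding r_def using e m by simp
  ultimately show ?thesis by blast
qed

lemma slice_derivative:
  fixes \<phi> :: "'a::euclidean_space \<times> real \<Rightarrow> real"
  assumes "\<phi> differentiable (at (y, s))"
  shows "((\<lambda>z. \<phi> (z, s)) has_derivative (\<lambda>w. frechet_derivative \<phi> (at (y, s)) (w, 0))) (at y)"
    and "dir_deriv (\<lambda>z. \<phi> (z, s)) b y = dir_deriv \<phi> (b, 0) (y, s)"
proof -
  have "((\<lambda>z. (z, s)) has_derivative (\<lambda>w. (w, 0))) (at y)" by (auto intro!: derivative_eq_intros)
  moreover have "(\<phi> has_derivative frechet_derivative \<phi> (at (y, s))) (at (y, s))"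
    using assms frechet_derivative_works by blast
  ultimately show d: "((\<lambda>z. \<phi> (z, s)) has_derivative (\<lambda>w. frechet_derivative \<phi> (at (y, s)) (w, 0))) (at y)"
    by (rule has_derivative_compose)
  show "dir_deriv (\<lambda>z. \<phi> (z, s)) b y = dir_deriv \<phi> (b, 0) (y, s)"
    unfolding dir_derivI[OF d] unfolding dir_deriv_def ..
qed

lemma has_derivative_grad:
  assumes "f differentiable (at x)"
  shows "(f has_derivative (\<lambda>w. grad f x \<bullet> w)) (at x)"
proof -
  have d: "(f has_derivative frechet_derivative f (at x)) (at x)" using assms frechet_derivative_works by blast
  interpret linear "frechet_derivative f (at x)" by (rule has_derivative_linear[OF d])
  have "frechet_derivative f (at x) w = grad f x \<bullet> w" for w
  proof -
    have "frechet_derivative f (at x) w = frechet_derivative f (at x) (\<Sum>b\<in>Basis. (w \<bullet> b) *\<^sub>R b)" by (simp add: euclidean_representation)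
    also have "\<dots> = (\<Sum>b\<in>Basis. (w \<bullet> b) * frechet_derivative f (at x) b)" by (simp add: sum scale)
    also have "\<dots> = grad f x \<bullet> w" unfolding grad_def dir_deriv_def inner_sum_left inner_scaleR_left
      by (intro sum.cong refl) (simp only: inner_commute mult.commute)
    finally show ?thesis .
  qed
  hence "frechet_derivative f (at x) = (\<lambda>w. grad f x \<bullet> w)" by (rule ext)
  thus ?thesis using d by (simp only:)
qed

lemma line_real_derivative:
  assumes "(f has_derivative (\<lambda>w. n \<bullet> w)) (at x)"
  shows "((\<lambda>s. f (x + s *\<^sub>R w)) has_real_derivative n \<bullet> w) (at 0)"
proof -
  have "((\<lambda>s. x + s *\<^sub>R w) has_derivative (\<lambda>s. s *\<^sub>R w)) (at 0)" by (auto intro!: derivative_eq_intros)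
  from has_derivative_compose[OF this, of f "\<lambda>w. n \<bullet> w"] assms
  have "((\<lambda>s. f (x + s *\<^sub>R w)) has_derivative (\<lambda>s. n \<bullet> (s *\<^sub>R w))) (at 0)" by simp
  moreover have "(\<lambda>s. n \<bullet> (s *\<^sub>R w)) = (*) (n \<bullet> w)" by (rule ext) simp
  ultimately show ?thesis unfolding has_field_derivative_def by (simp only:)
qed

lemma right_derivative_unique:
  assumes "(f has_real_derivative D) (at 0)" "\<delta> > 0" "\<And>r. 0 < r \<Longrightarrow> r < \<delta> \<Longrightarrow> f r = f 0 + k * r"
  shows "D = k"
proof -
  have "((\<lambda>r. (f (0 + r) - f 0) / r) \<longlongrightarrow> D) (at_right 0)"
    using assms(1) unfolding DERIV_def by (rule filterlim_mono) (auto simp: at_within_le_at)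
  moreover have "\<forall>\<^sub>F r in at_right 0. (f (0 + r) - f 0) / r = k"
    unfolding eventually_at_right_field using assms(2,3) by (intro exI[of _ \<delta>]) auto
  hence "((\<lambda>r. (f (0 + r) - f 0) / r) \<longlongrightarrow> k) (at_right 0)" by (rule tendsto_eventually)
  ultimately show ?thesis using tendsto_unique trivial_limit_at_right_real by blast
qed

lemma smooth_familyE:
  assumes "smooth_family T \<Omega>" "t \<in> {0..T}"
  obtains N \<phi> where "open N" "(x, t) \<in> N" "smooth_on N \<phi>"
    "\<And>y s. (y, s) \<in> N \<Longrightarrow> s \<in> {0..T} \<Longrightarrow> y \<in> \<Omega> s \<longleftrightarrow> \<phi> (y, s) < 0"
    "\<And>y s. (y, s) \<in> N \<Longrightarrow> \<phi> (y, s) = 0 \<Longrightarrow> grad (\<lambda>z. \<phi> (z, s)) y \<noteq> 0"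
  using assms unfolding smooth_family_def by metis

lemma defining_function:
  fixes \<Omega> :: "real \<Rightarrow> 'a::euclidean_space set"
  assumes op: "open (\<Omega> s)" and N: "open N" "smooth_on N \<phi>" "(y, s) \<in> N" "s \<in> {0..T}"
    and sgn: "\<And>y s. (y, s) \<in> N \<Longrightarrow> s \<in> {0..T} \<Longrightarrow> y \<in> \<Omega> s \<longleftrightarrow> \<phi> (y, s) < 0"
    and gr: "\<And>y s. (y, s) \<in> N \<Longrightarrow> \<phi> (y, s) = 0 \<Longrightarrow> grad (\<lambda>z. \<phi> (z, s)) y \<noteq> 0"
  shows "y \<in> frontier (\<Omega> s) \<longleftrightarrow> \<phi> (y, s) = 0"
    and "\<phi> (y, s) = 0 \<Longrightarrow> e > 0 \<Longrightarrow> \<exists>z. dist y z < e \<and> (z, s) \<in> N \<and> \<phi> (z, s) > 0"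
    and "((\<lambda>z. \<phi> (z, s)) has_derivative (\<lambda>w. grad (\<lambda>z. \<phi> (z, s)) y \<bullet> w)) (at y)"
proof -
  have "Ck_on (Suc 0) N \<phi>" using N(2) unfolding smooth_on_def by blast
  hence df: "\<phi> differentiable (at (y, s))" using N(3) by simp
  have cont: "continuous_on N \<phi>" using N(2) unfolding smooth_on_def using Ck_on.simps(1) by blast
  have "(\<lambda>z. \<phi> (z, s)) differentiable (at y)" using slice_derivative(1)[OF df] unfolding differentiable_def by blast
  from has_derivative_grad[OF this] show d: "((\<lambda>z. \<phi> (z, s)) has_derivative (\<lambda>w. grad (\<lambda>z. \<phi> (z, s)) y \<bullet> w)) (at y)" .
  define v where "v = grad (\<lambda>z. \<phi> (z, s)) y"
  obtain e0 where e0: "e0 > 0" "ball (y, s) e0 \<subseteq> N" using N(1,3) open_contains_ball by blast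
  have inN: "(z, s) \<in> N" if "dist y z < e0" for z using e0(2) that by (auto simp: dist_Pair_Pair)
  have move: "\<exists>z. dist y z < e \<and> (z, s) \<in> N \<and> \<sigma> * \<phi> (z, s) > 0" if z: "\<phi> (y, s) = 0" and e: "e > 0" and \<sigma>: "\<bar>\<sigma>\<bar> = 1" for e \<sigma>
  proof -
    have v0: "v \<noteq> 0" unfolding v_def using gr[OF N(3) z] .
    have "((\<lambda>r. \<sigma> * \<phi> (y + r *\<^sub>R (\<sigma> *\<^sub>R v), s)) has_real_derivative \<sigma> * (v \<bullet> (\<sigma> *\<^sub>R v))) (at 0)"
      by (rule DERIV_cmult, rule line_real_derivative[OF d[folded v_def]])
    moreover have "\<sigma> * (v \<bullet> (\<sigma> *\<^sub>R v)) > 0"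
    proof -
      have "\<sigma> * \<sigma> = 1" using \<sigma> by (metis abs_mult_self_eq mult_1)
      moreover have "\<sigma> * (v \<bullet> (\<sigma> *\<^sub>R v)) = (\<sigma> * \<sigma>) * (v \<bullet> v)" by simp
      ultimately have "\<sigma> * (v \<bullet> (\<sigma> *\<^sub>R v)) = v \<bullet> v" by (simp only: mult_1)
      moreover have "v \<bullet> v > 0" using v0 by simp
      ultimately show ?thesis by (simp only:)
    qed
    ultimately obtain r0 where r0: "r0 > 0" "\<And>r. 0 < r \<Longrightarrow> r < r0 \<Longrightarrow> \<sigma> * \<phi> (y + r *\<^sub>R (\<sigma> *\<^sub>R v), s) > 0"
      using DERIV_pos_inc_right[of "\<lambda>r. \<sigma> * \<phi> (y + r *\<^sub>R (\<sigma> *\<^sub>R v), s)"] z by fastforce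
    define r where "r = min r0 (min e e0 / (norm v + 1)) / 2"
    have nv: "norm v + 1 > 0" by (simp add: add_nonneg_pos)
    have r: "0 < r" "r < r0" "r < min e e0 / (norm v + 1)"
    proof -
      define q0 where "q0 = min e e0 / (norm v + 1)"
      have "0 < q0" unfolding q0_def using e e0 nv by simp
      hence "0 < min r0 q0" "min r0 q0 \<le> r0" "min r0 q0 \<le> q0" using r0(1) by auto
      thus "0 < r" "r < r0" "r < min e e0 / (norm v + 1)" unfolding r_def q0_def[symmetric] by linarith+
    qed
    have "r * norm v < min e e0"
    proof -
      have "r * (norm v + 1) < min e e0" using r(3) nv by (simp add: pos_less_divide_eq)
      moreover have "r * norm v \<le> r * (norm v + 1)" using r(1) by simp
      ultimately show ?thesis by linarith
    qed
    hence "dist y (y + r *\<^sub>R (\<sigma> *\<^sub>R v)) < min e e0" using r(1) \<sigma> by (simp add: dist_norm abs_mult)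
    thus ?thesis using r0(2)[OF r(1,2)] inN by auto
  qed
  show "\<exists>z. dist y z < e \<and> (z, s) \<in> N \<and> \<phi> (z, s) > 0" if "\<phi> (y, s) = 0" "e > 0" for e
    using move[OF that, of 1] by simp
  show "y \<in> frontier (\<Omega> s) \<longleftrightarrow> \<phi> (y, s) = 0"
  proof
    assume f: "y \<in> frontier (\<Omega> s)"
    hence "y \<notin> \<Omega> s" using op by (simp add: frontier_def interior_open)
    hence ge: "\<phi> (y, s) \<ge> 0" using sgn[OF N(3,4)] by simp
    show "\<phi> (y, s) = 0"
    proof (rule ccontr)
      assume "\<phi> (y, s) \<noteq> 0"
      hence "\<phi> (y, s) > 0" using ge by simp
      have "isCont \<phi> (y, s)" using cont N(1,3) by (simp add: continuous_on_eq_continuous_at)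
      hence "\<forall>\<^sub>F z in nhds (y, s). \<phi> z > 0"
        unfolding isCont_def tendsto_at_iff_tendsto_nhds[of \<phi>] using \<open>\<phi> (y, s) > 0\<close> by (rule order_tendstoD)
      then obtain e where e: "e > 0" "\<forall>z. dist z (y, s) < e \<longrightarrow> \<phi> z > 0" unfolding eventually_nhds_metric by blast
      have "y \<in> closure (\<Omega> s)" using f by (simp add: frontier_def)
      then obtain z where z: "z \<in> \<Omega> s" "dist z y < min e e0" using closure_approachable e(1) e0(1) by (metis min_less_iff_conj)
      have "\<phi> (z, s) > 0" using e(2) z(2) by (simp add: dist_Pair_Pair)
      moreover have "\<phi> (z, s) < 0" using sgn[OF inN N(4)] z by (simp add: dist_commute)
      ultimately show False by simp
    qed
  next
    assume z: "\<phi> (y, s) = 0"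
    have "y \<notin> \<Omega> s" using sgn[OF N(3,4)] z by simp
    moreover have "y \<in> closure (\<Omega> s)"
      unfolding closure_approachable
    proof (intro allI impI)
      fix e :: real assume "e > 0"
      then obtain z where "dist y z < e" "(z, s) \<in> N" "\<phi> (z, s) < 0" using move[OF z, of e "-1"] by auto
      thus "\<exists>z\<in>\<Omega> s. dist z y < e" using sgn N(4) by (auto simp: dist_commute)
    qed
    ultimately show "y \<in> frontier (\<Omega> s)" using op by (simp add: frontier_def interior_open)
  qed
qed

text \<open>The boundary moves continuously: near a boundary point the local defining function takes both
  signs, and away from the boundary a compact set keeps its side for neighbouring times.\<close>

lemma signed_dist_continuous:
  fixes \<Omega> :: "real \<Rightarrow> 'a::euclidean_space set"
  assumes sf: "smooth_family T \<Omega>"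
  shows "continuous_on (UNIV \<times> {0..T}) (\<lambda>z. signed_dist (\<Omega> (snd z)) (fst z))"
proof -
  have \<Omega>: "open (\<Omega> s)" "frontier (\<Omega> s) \<noteq> {}" if "s \<in> {0..T}" for s
    using sf that frontier_nonempty_bounded unfolding smooth_family_def by blast+
  define d where "d x s = signed_dist (\<Omega> s) x" for x s
  have lip: "\<bar>d x s - d y s\<bar> \<le> dist x y" if "s \<in> {0..T}" for x y s
    unfolding d_def by (rule signed_dist_lipschitz[OF \<Omega>(1)[OF that]])
  have att: "\<exists>y. d y s = 0 \<and> dist x y = \<bar>d x s\<bar>" if "s \<in> {0..T}" for x s
    using signed_dist_attained[OF \<Omega>(2)[OF that], of x] signed_dist_zero_iff[OF \<Omega>(2)[OF that]] unfolding d_def by blast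
  have sign: "\<exists>e>0. \<forall>y s. dist (y, s) (x, t) < e \<longrightarrow> s \<in> {0..T} \<longrightarrow> (d x t < 0 \<longrightarrow> d y s < 0) \<and> (d x t > 0 \<longrightarrow> d y s > 0)"
    and zero: "d x t = 0 \<Longrightarrow> e > 0 \<Longrightarrow> (\<exists>z. dist x z < e \<and> d z t < 0) \<and> (\<exists>z. dist x z < e \<and> d z t > 0)"
    if t: "t \<in> {0..T}" for x t e
  proof -
    obtain N \<phi> where N: "open N" "(x, t) \<in> N" "smooth_on N \<phi>"
      and sg: "\<And>y s. (y, s) \<in> N \<Longrightarrow> s \<in> {0..T} \<Longrightarrow> y \<in> \<Omega> s \<longleftrightarrow> \<phi> (y, s) < 0"
      and gr: "\<And>y s. (y, s) \<in> N \<Longrightarrow> \<phi> (y, s) = 0 \<Longrightarrow> grad (\<lambda>z. \<phi> (z, s)) y \<noteq> 0"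
      by (rule smooth_familyE[OF sf t]) (rule that)
    have dneg: "d y s < 0 \<longleftrightarrow> \<phi> (y, s) < 0" and dzero: "d y s = 0 \<longleftrightarrow> \<phi> (y, s) = 0" if "(y, s) \<in> N" "s \<in> {0..T}" for y s
    proof -
      show "d y s < 0 \<longleftrightarrow> \<phi> (y, s) < 0" unfolding d_def using signed_dist_neg_iff[OF \<Omega>[OF that(2)]] sg[OF that] by blast
      show "d y s = 0 \<longleftrightarrow> \<phi> (y, s) = 0" unfolding d_def
        using signed_dist_zero_iff[OF \<Omega>(2)[OF that(2)]] defining_function(1)[OF \<Omega>(1)[OF that(2)] N(1,3) that sg gr] by blast
    qed
    have dpos: "d y s > 0 \<longleftrightarrow> \<phi> (y, s) > 0" if "(y, s) \<in> N" "s \<in> {0..T}" for y s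
      using dneg[OF that] dzero[OF that] by linarith
    have "continuous_on N \<phi>" using N(3) unfolding smooth_on_def using Ck_on.simps(1) by blast
    hence "isCont \<phi> (x, t)" using N(1,2) by (simp add: continuous_on_eq_continuous_at)
    hence lim: "(\<phi> \<longlongrightarrow> \<phi> (x, t)) (nhds (x, t))" unfolding isCont_def tendsto_at_iff_tendsto_nhds[of \<phi>] .
    have "\<forall>\<^sub>F z in nhds (x, t). z \<in> N \<and> (\<phi> (x, t) < 0 \<longrightarrow> \<phi> z < 0) \<and> (\<phi> (x, t) > 0 \<longrightarrow> \<phi> z > 0)"
    proof (intro eventually_conj)
      show "\<forall>\<^sub>F z in nhds (x, t). z \<in> N" by (rule eventually_nhds_in_open[OF N(1,2)])
      show "\<forall>\<^sub>F z in nhds (x, t). \<phi> (x, t) < 0 \<longrightarrow> \<phi> z < 0" using order_tendstoD(2)[OF lim, of 0] by (cases "\<phi> (x, t) < 0") auto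
      show "\<forall>\<^sub>F z in nhds (x, t). \<phi> (x, t) > 0 \<longrightarrow> \<phi> z > 0" using order_tendstoD(1)[OF lim, of 0] by (cases "\<phi> (x, t) > 0") auto
    qed
    then obtain e0 where e0: "e0 > 0" "\<And>z. dist z (x, t) < e0 \<Longrightarrow> z \<in> N \<and> (\<phi> (x, t) < 0 \<longrightarrow> \<phi> z < 0) \<and> (\<phi> (x, t) > 0 \<longrightarrow> \<phi> z > 0)"
      unfolding eventually_nhds_metric by blast
    have "(d x t < 0 \<longrightarrow> d y s < 0) \<and> (d x t > 0 \<longrightarrow> d y s > 0)" if "dist (y, s) (x, t) < e0" "s \<in> {0..T}" for y s
      using e0(2)[OF that(1)] dneg[OF _ that(2), of y] dpos[OF _ that(2), of y] dneg[OF N(2) t] dpos[OF N(2) t] by blast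
    thus "\<exists>e>0. \<forall>y s. dist (y, s) (x, t) < e \<longrightarrow> s \<in> {0..T} \<longrightarrow> (d x t < 0 \<longrightarrow> d y s < 0) \<and> (d x t > 0 \<longrightarrow> d y s > 0)"
      using e0(1) by blast
    assume z: "d x t = 0" and e: "e > 0"
    have "\<exists>z. dist x z < e \<and> d z t > 0"
      using defining_function(2)[OF \<Omega>(1)[OF t] N(1,3,2) t sg gr _ e] dzero[OF N(2) t] z dpos[OF _ t] by blast
    moreover have "x \<in> closure (\<Omega> t)" using z signed_dist_zero_iff[OF \<Omega>(2)[OF t]] unfolding d_def frontier_def by blast
    hence "\<exists>z. dist x z < e \<and> d z t < 0"
      using e signed_dist_neg_iff[OF \<Omega>[OF t]] unfolding closure_approachable d_def by (metis dist_commute)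
    ultimately show "(\<exists>z. dist x z < e \<and> d z t < 0) \<and> (\<exists>z. dist x z < e \<and> d z t > 0)" by blast
  qed
  have up: "\<exists>e>0. \<forall>y s. dist (y, s) (x, t) < e \<longrightarrow> s \<in> {0..T} \<longrightarrow> d y s < c" if t: "t \<in> {0..T}" and c: "d x t < c" for x t c
  proof (rule sublevel_persists[where d=d and I="{0..T}", OF _ _ _ _ t c])
    show "\<bar>d x s - d y s\<bar> \<le> dist x y" if "s \<in> {0..T}" for x y s by (rule lip[OF that])
    show "\<exists>y. d y s = 0 \<and> dist x y = \<bar>d x s\<bar>" if "s \<in> {0..T}" for x s by (rule att[OF that])
    show "\<exists>e>0. \<forall>y s. dist (y, s) (x, t) < e \<longrightarrow> s \<in> {0..T} \<longrightarrow> d y s < 0" if "d x t < 0" for x using sign[OF t, of x] that by blast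
    show "\<exists>z. dist x z < e \<and> d z t < 0" if "d x t = 0" "e > 0" for x e using zero[OF t that] by blast
  qed
  have lo: "\<exists>e>0. \<forall>y s. dist (y, s) (x, t) < e \<longrightarrow> s \<in> {0..T} \<longrightarrow> - d y s < - c" if t: "t \<in> {0..T}" and c: "- d x t < - c" for x t c
  proof (rule sublevel_persists[where d="\<lambda>x s. - d x s" and I="{0..T}", OF _ _ _ _ t c])
    show "\<bar>- d x s - - d y s\<bar> \<le> dist x y" if "s \<in> {0..T}" for x y s using lip[OF that, of x y] by linarith
    show "\<exists>e>0. \<forall>y s. dist (y, s) (x, t) < e \<longrightarrow> s \<in> {0..T} \<longrightarrow> - d y s < 0" if "- d x t < 0" for x
    proof -
      have "d x t > 0" using that by simp
      thus ?thesis using sign[OF t, of x] by simp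
    qed
    show "\<exists>z. dist x z < e \<and> - d z t < 0" if "- d x t = 0" "e > 0" for x e
    proof -
      have "d x t = 0" using that by simp
      thus ?thesis using zero[OF t _ that(2)] by simp
    qed
    show "\<exists>y. - d y s = 0 \<and> dist x y = \<bar>- d x s\<bar>" if "s \<in> {0..T}" for x s using att[OF that, of x] by simp
  qed
  show ?thesis unfolding d_def[symmetric] continuous_on_iff
  proof (intro ballI allI impI)
    fix z e assume z: "z \<in> (UNIV :: 'a set) \<times> {0..T}" and e: "(e::real) > 0"
    obtain x t where xt: "z = (x, t)" "t \<in> {0..T}" using z by auto
    obtain e1 where e1: "e1 > 0" "\<And>y s. dist (y, s) (x, t) < e1 \<Longrightarrow> s \<in> {0..T} \<Longrightarrow> d y s < d x t + e"
      using up[OF xt(2), of x "d x t + e"] e by auto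
    obtain e2 where e2: "e2 > 0" "\<And>y s. dist (y, s) (x, t) < e2 \<Longrightarrow> s \<in> {0..T} \<Longrightarrow> - d y s < - (d x t - e)"
      using lo[OF xt(2), of x "d x t - e"] e by auto
    show "\<exists>r>0. \<forall>z'\<in>UNIV \<times> {0..T}. dist z' z < r \<longrightarrow> dist (d (fst z') (snd z')) (d (fst z) (snd z)) < e"
    proof (intro exI[of _ "min e1 e2"] conjI ballI impI)
      fix z' assume z': "z' \<in> (UNIV :: 'a set) \<times> {0..T}" "dist z' z < min e1 e2"
      obtain y s where ys: "z' = (y, s)" "s \<in> {0..T}" using z'(1) by auto
      show "dist (d (fst z') (snd z')) (d (fst z) (snd z)) < e"
        using e1(2)[of y s] e2(2)[of y s] z'(2) ys xt by (simp add: dist_real_def abs_less_iff)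
    qed (use e1 e2 in simp)
  qed
qed

text \<open>Boundedness of each domain does not bound their union directly: a boundary piece could come in
  from infinity. At neighbouring times, however, the domain contains a fixed point and avoids a fixed large
  sphere; being connected, it stays inside.\<close>

lemma smooth_family_bounded:
  fixes \<Omega> :: "real \<Rightarrow> 'a::euclidean_space set"
  assumes sf: "smooth_family T \<Omega>"
  shows "\<exists>R. \<forall>t\<in>{0..T}. frontier (\<Omega> t) \<subseteq> cball 0 R"
proof -
  have \<Omega>: "open (\<Omega> s)" "frontier (\<Omega> s) \<noteq> {}" "\<Omega> s \<noteq> {}" "bounded (\<Omega> s)" "connected (\<Omega> s)" if "s \<in> {0..T}" for s
    using sf that frontier_nonempty_bounded unfolding smooth_family_def by blast+
  define d where "d x s = signed_dist (\<Omega> s) x" for x s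
  have cont: "continuous_on (UNIV \<times> {0..T}) (\<lambda>z. d (fst z) (snd z))"
    using signed_dist_continuous[OF sf] unfolding d_def .
  have neg: "d x s < 0 \<longleftrightarrow> x \<in> \<Omega> s" if "s \<in> {0..T}" for x s unfolding d_def by (rule signed_dist_neg_iff[OF \<Omega>(1,2)[OF that]])
  have loc: "\<exists>e>0. \<exists>R. \<forall>s\<in>{0..T}. dist s t < e \<longrightarrow> \<Omega> s \<subseteq> cball 0 R" if t: "t \<in> {0..T}" for t
  proof -
    obtain R1 where R1: "\<forall>x\<in>\<Omega> t. norm x \<le> R1" using \<Omega>(4)[OF t] unfolding bounded_iff by blast
    define R0 where "R0 = \<bar>R1\<bar> + 1"
    have R0: "R0 > 0" "\<Omega> t \<subseteq> cball 0 R0" unfolding R0_def using R1 by fastforce+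
    have R0c: "closure (\<Omega> t) \<subseteq> cball 0 R0" using R0(2) by (simp add: closure_minimal)
    define K where "K = sphere (0::'a) (R0 + 1)"
    have pos: "d x t > 0" if "x \<in> K" for x
    proof -
      have nx: "norm x = R0 + 1" using that unfolding K_def by simp
      have "x \<notin> closure (\<Omega> t)" using R0c nx by auto
      hence "d x t \<noteq> 0" "\<not> d x t < 0" using neg[OF t] signed_dist_zero_iff[OF \<Omega>(2)[OF t]] closure_subset unfolding d_def frontier_def by blast+
      thus ?thesis by linarith
    qed
    have near: "\<exists>e>0. \<forall>y s. dist (y, s) (x, t) < e \<longrightarrow> (s \<in> {0..T} \<longrightarrow> \<bar>d y s - d x t\<bar> < \<bar>d x t\<bar>)" if "d x t \<noteq> 0" for x
    proof -
      have "\<bar>d x t\<bar> > 0" using that by simp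
      then obtain e where "e > 0" "\<forall>z\<in>UNIV \<times> {0..T}. dist z (x, t) < e \<longrightarrow> dist (d (fst z) (snd z)) (d x t) < \<bar>d x t\<bar>"
        using cont t unfolding continuous_on_iff by (metis UNIV_I fst_conv mem_Sigma_iff snd_conv)
      thus ?thesis by (intro exI[of _ e]) (auto simp: dist_real_def)
    qed
    have "\<exists>e>0. \<forall>s. dist s t < e \<longrightarrow> (\<forall>y\<in>K. s \<in> {0..T} \<longrightarrow> d y s > 0)"
    proof (rule compact_persists)
      show "compact K" unfolding K_def by simp
      fix x assume x: "x \<in> K"
      hence "d x t > 0" by (rule pos)
      then obtain e where e: "e > 0" "\<And>y s. dist (y, s) (x, t) < e \<Longrightarrow> s \<in> {0..T} \<Longrightarrow> \<bar>d y s - d x t\<bar> < \<bar>d x t\<bar>"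
        using near[of x] by auto
      have "d y s > 0" if "dist (y, s) (x, t) < e" "s \<in> {0..T}" for y s using e(2)[OF that] \<open>d x t > 0\<close> by linarith
      thus "\<exists>e>0. \<forall>y s. dist (y, s) (x, t) < e \<longrightarrow> s \<in> {0..T} \<longrightarrow> d y s > 0" using e(1) by blast
    qed
    then obtain e1 where e1: "e1 > 0" "\<And>s y. dist s t < e1 \<Longrightarrow> y \<in> K \<Longrightarrow> s \<in> {0..T} \<Longrightarrow> d y s > 0" by blast
    obtain x0 where x0: "x0 \<in> \<Omega> t" using \<Omega>(3)[OF t] by blast
    hence x0n: "d x0 t < 0" using neg[OF t] by blast
    then obtain e2 where e2: "e2 > 0" "\<And>y s. dist (y, s) (x0, t) < e2 \<Longrightarrow> s \<in> {0..T} \<Longrightarrow> \<bar>d y s - d x0 t\<bar> < \<bar>d x0 t\<bar>"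
      using near[of x0] by auto
    have "\<Omega> s \<subseteq> cball 0 (R0 + 1)" if s: "s \<in> {0..T}" "dist s t < min e1 e2" for s
    proof (rule ccontr)
      assume "\<not> \<Omega> s \<subseteq> cball 0 (R0 + 1)"
      then obtain y where y: "y \<in> \<Omega> s" "norm y > R0 + 1" by (meson linorder_not_le mem_cball_0 subsetI)
      have "dist (x0, s) (x0, t) < e2" using s(2) by (simp add: dist_Pair_Pair)
      hence "d x0 s < 0" using e2(2)[OF _ s(1), of x0] x0n by linarith
      hence x0s: "x0 \<in> \<Omega> s" using neg[OF s(1)] by blast
      have "connected (norm ` \<Omega> s)" by (intro connected_continuous_image continuous_intros \<Omega>(5)[OF s(1)])
      moreover have "norm x0 \<in> norm ` \<Omega> s" "norm y \<in> norm ` \<Omega> s" using x0s y by auto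
      moreover have "norm x0 \<le> R0 + 1" using x0 R0 by auto
      ultimately have "R0 + 1 \<in> norm ` \<Omega> s" using y(2) by (meson connectedD_interval less_imp_le)
      then obtain z where z: "z \<in> \<Omega> s" "norm z = R0 + 1" by auto
      hence "z \<in> K" unfolding K_def by simp
      hence "d z s > 0" using e1(2)[OF _ _ s(1)] s(2) by simp
      thus False using z(1) neg[OF s(1), of z] by simp
    qed
    thus ?thesis using e1(1) e2(1) by (intro exI[of _ "min e1 e2"] conjI exI[of _ "R0 + 1"]) auto
  qed
  then obtain e R where eR: "\<And>t. t \<in> {0..T} \<Longrightarrow> e t > 0" "\<And>t s. t \<in> {0..T} \<Longrightarrow> s \<in> {0..T} \<Longrightarrow> dist s t < e t \<Longrightarrow> \<Omega> s \<subseteq> cball 0 (R t)"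
    by metis
  obtain C where C: "C \<subseteq> {0..T}" "finite C" "{0..T} \<subseteq> (\<Union>t\<in>C. ball t (e t))"
    by (rule compactE_image[of "{0..T}" "{0..T}" "\<lambda>t. ball t (e t)"]) (use eR(1) in auto)
  define M where "M = Max (insert 0 (R ` C))"
  have "frontier (\<Omega> s) \<subseteq> cball 0 M" if s: "s \<in> {0..T}" for s
  proof -
    obtain t where t: "t \<in> C" "dist t s < e t" using C(3) s by auto
    have tT: "t \<in> {0..T}" using t(1) C(1) by blast
    have "dist s t < e t" using t(2) by (simp add: dist_commute)
    from eR(2)[OF tT s this] have "\<Omega> s \<subseteq> cball 0 (R t)" .
    moreover have "R t \<le> M" unfolding M_def using t C(2) by (intro Max_ge) auto
    ultimately have "\<Omega> s \<subseteq> cball 0 M" by (meson order_trans subset_cball)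
    hence "closure (\<Omega> s) \<subseteq> cball 0 M" by (simp add: closure_minimal)
    thus ?thesis unfolding frontier_def by blast
  qed
  thus ?thesis by blast
qed

section \<open>Eikonal equation and Hessian in the tube\<close>

lemma linear_sum_basis:
  fixes L :: "'a::euclidean_space \<Rightarrow> 'b::real_vector"
  assumes "linear L" shows "L w = (\<Sum>b\<in>Basis. (w \<bullet> b) *\<^sub>R L b)"
proof -
  interpret linear L by (rule assms)
  have "L w = L (\<Sum>b\<in>Basis. (w \<bullet> b) *\<^sub>R b)" by (simp add: euclidean_representation)
  thus ?thesis by (simp add: sum scale)
qed

lemma lipschitz_gradient_le_1:
  assumes "(f has_derivative (\<lambda>w. n \<bullet> w)) (at x)" "\<And>y. \<bar>f y - f x\<bar> \<le> dist y x"
  shows "norm n \<le> 1"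
proof -
  have "((\<lambda>s. (f (x + (0 + s) *\<^sub>R n) - f (x + 0 *\<^sub>R n)) / s) \<longlongrightarrow> n \<bullet> n) (at 0)"
    using line_real_derivative[OF assms(1), of n] unfolding DERIV_def .
  moreover have "\<forall>\<^sub>F s in at 0. (f (x + (0 + s) *\<^sub>R n) - f (x + 0 *\<^sub>R n)) / s \<le> norm n"
    unfolding eventually_at
  proof (intro exI[of _ 1] conjI ballI impI)
    fix s :: real assume s: "s \<noteq> 0 \<and> dist s 0 < 1"
    have "\<bar>f (x + s *\<^sub>R n) - f x\<bar> \<le> norm n * \<bar>s\<bar>" using assms(2)[of "x + s *\<^sub>R n"] by (simp add: dist_norm mult.commute)
    hence "\<bar>(f (x + s *\<^sub>R n) - f x) / s\<bar> \<le> norm n" using s unfolding abs_divide by (simp add: pos_divide_le_eq)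
    from abs_le_D1[OF this] show "(f (x + (0 + s) *\<^sub>R n) - f (x + 0 *\<^sub>R n)) / s \<le> norm n" by simp
  qed simp
  ultimately have "n \<bullet> n \<le> norm n" by (rule tendsto_upperbound) simp
  hence "norm n * norm n \<le> norm n * 1" by (simp add: dot_square_norm power2_eq_square)
  thus ?thesis by (cases "norm n = 0") (auto simp: mult_le_cancel_left_pos)
qed

lemma unit_if_inner_1:
  fixes n e :: "'a::real_inner"
  assumes "norm n \<le> 1" "norm e = 1" "n \<bullet> e = 1" shows "n = e"
proof -
  have "(norm (n - e))\<^sup>2 = (norm n)\<^sup>2 - 2 * (n \<bullet> e) + (norm e)\<^sup>2"
    unfolding power2_norm_eq_inner by (simp add: inner_diff_left inner_diff_right inner_commute)
  moreover have "(norm n)\<^sup>2 \<le> 1" using assms(1) by (simp add: power_le_one)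
  ultimately have "(norm (n - e))\<^sup>2 \<le> 0" using assms by simp
  thus ?thesis by simp
qed

locale regular_tube =
  fixes T D :: real and \<Omega> :: "real \<Rightarrow> 'a::euclidean_space set"
  assumes T: "T > 0" and D: "D > 0" and smooth: "smooth_family T \<Omega>"
    and diff1: "\<And>x t. t \<in> {0..T} \<Longrightarrow> \<bar>signed_dist (\<Omega> t) x\<bar> \<le> D \<Longrightarrow> signed_dist (\<Omega> t) differentiable (at x)"
    and diff2: "\<And>x t i. t \<in> {0..T} \<Longrightarrow> \<bar>signed_dist (\<Omega> t) x\<bar> \<le> D \<Longrightarrow> i \<in> Basis \<Longrightarrow>
       dir_deriv (signed_dist (\<Omega> t)) i differentiable (at x)"
begin

definition d where "d x t = signed_dist (\<Omega> t) x"
definition N where "N x t = outer_normal (\<Omega> t) x"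
definition H where "H x t = frechet_derivative (outer_normal (\<Omega> t)) (at x)"
definition S where "S = {p. snd p \<in> {0..T} \<and> fst p \<in> frontier (\<Omega> (snd p))}"

lemma Omega: assumes "t \<in> {0..T}" shows "open (\<Omega> t)" "frontier (\<Omega> t) \<noteq> {}"
  using smooth assms frontier_nonempty_bounded unfolding smooth_family_def by blast+

lemma d_lip: "t \<in> {0..T} \<Longrightarrow> \<bar>d x t - d y t\<bar> \<le> dist x y"
  unfolding d_def by (rule signed_dist_lipschitz[OF Omega(1)])

lemma d_zero: "t \<in> {0..T} \<Longrightarrow> d x t = 0 \<longleftrightarrow> x \<in> frontier (\<Omega> t)"
  unfolding d_def by (rule signed_dist_zero_iff[OF Omega(2)])

lemma d_neg: "t \<in> {0..T} \<Longrightarrow> d x t < 0 \<longleftrightarrow> x \<in> \<Omega> t"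
  unfolding d_def by (rule signed_dist_neg_iff[OF Omega])

lemma d_deriv: assumes "t \<in> {0..T}" "\<bar>d x t\<bar> \<le> D"
  shows "((\<lambda>y. d y t) has_derivative (\<lambda>w. N x t \<bullet> w)) (at x)"
  unfolding d_def N_def outer_normal_def
  by (rule has_derivative_grad[OF diff1]) (use assms in \<open>auto simp: d_def\<close>)

lemma N_deriv: assumes "t \<in> {0..T}" "\<bar>d x t\<bar> \<le> D"
  shows "((\<lambda>y. N y t) has_derivative H x t) (at x)"
proof -
  have "(\<lambda>y. \<Sum>b\<in>Basis. dir_deriv (signed_dist (\<Omega> t)) b y *\<^sub>R b) differentiable (at x)"
    by (intro differentiable_sum ballI differentiable_scaleR diff2 differentiable_const finite_Basis) (use assms in \<open>auto simp: d_def\<close>)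
  hence "outer_normal (\<Omega> t) differentiable (at x)" unfolding outer_normal_def grad_def .
  thus ?thesis unfolding N_def H_def using frechet_derivative_works by blast
qed

lemma H_linear: "t \<in> {0..T} \<Longrightarrow> \<bar>d x t\<bar> \<le> D \<Longrightarrow> linear (H x t)"
  by (rule has_derivative_linear[OF N_deriv])

lemma N_le: assumes "t \<in> {0..T}" "\<bar>d x t\<bar> \<le> D" shows "norm (N x t) \<le> 1"
  by (rule lipschitz_gradient_le_1[OF d_deriv[OF assms]]) (use d_lip assms in auto)

text \<open>The distance is linear along the segment from \<open>x\<close> to a nearest boundary point, with
  slope 1; as gradients of 1-Lipschitz functions have norm at most 1, both end points have the segment
  direction as gradient.\<close>

lemma eikonal_off:
  assumes t: "t \<in> {0..T}" and x: "\<bar>d x t\<bar> \<le> D" "d x t \<noteq> 0"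
  shows "norm (N x t) = 1 \<and> x - d x t *\<^sub>R N x t \<in> frontier (\<Omega> t) \<and> N (x - d x t *\<^sub>R N x t) t = N x t"
proof -
  obtain y where y: "y \<in> frontier (\<Omega> t)" "dist x y = \<bar>d x t\<bar>"
    using signed_dist_attained[OF Omega(2)[OF t], of x] unfolding d_def by blast
  define L where "L = d x t"
  have L: "L \<noteq> 0" "\<bar>L\<bar> \<le> D" using x by (auto simp: L_def)
  define e where "e = (1 / L) *\<^sub>R (x - y)"
  have ne: "norm e = 1" unfolding e_def using y(2) L by (simp add: L_def dist_norm)
  have xe: "x = y + L *\<^sub>R e" unfolding e_def using L by simp
  have y0: "d y t = 0" using d_zero[OF t] y(1) by blast
  have line: "d (y + s *\<^sub>R e) t = s" if "0 \<le> s * sgn L" "\<bar>s\<bar> \<le> \<bar>L\<bar>" for s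
  proof -
    have a: "\<bar>d (y + s *\<^sub>R e) t - d y t\<bar> \<le> \<bar>s\<bar>" using d_lip[OF t, of "y + s *\<^sub>R e" y] ne by (simp add: dist_norm)
    have "dist x (y + s *\<^sub>R e) = \<bar>L - s\<bar>"
    proof -
      have "x - (y + s *\<^sub>R e) = (L - s) *\<^sub>R e" by (subst xe) (simp add: algebra_simps)
      thus ?thesis using ne by (simp add: dist_norm)
    qed
    hence b: "\<bar>L - d (y + s *\<^sub>R e) t\<bar> \<le> \<bar>L - s\<bar>" using d_lip[OF t, of x "y + s *\<^sub>R e"] by (simp add: L_def)
    show ?thesis using a b y0 that L by (cases "L > 0") (auto simp: abs_if split: if_splits)
  qed
  define \<sigma> where "\<sigma> = sgn L"
  have \<sigma>: "\<sigma> * \<sigma> = 1" "\<bar>\<sigma>\<bar> = 1" "L = \<sigma> * \<bar>L\<bar>" using L by (auto simp: \<sigma>_def sgn_if)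
  have Ny: "N y t \<bullet> e = 1"
  proof -
    have "N y t \<bullet> (\<sigma> *\<^sub>R e) = \<sigma>"
    proof (rule right_derivative_unique[OF line_real_derivative[OF d_deriv[OF t]], of _ "\<bar>L\<bar>"])
      show "\<bar>d y t\<bar> \<le> D" using y0 D by simp
      fix r assume r: "0 < r" "r < \<bar>L\<bar>"
      have "d (y + (r * \<sigma>) *\<^sub>R e) t = r * \<sigma>"
        by (rule line) (use r \<sigma> in \<open>auto simp: \<sigma>_def[symmetric] abs_mult mult.assoc\<close>)
      thus "d (y + r *\<^sub>R (\<sigma> *\<^sub>R e)) t = d (y + 0 *\<^sub>R (\<sigma> *\<^sub>R e)) t + \<sigma> * r" using y0 by (simp add: mult.commute)
    qed (use L in simp)
    hence "\<sigma> * (N y t \<bullet> e) = \<sigma> * 1" by simp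
    thus ?thesis using \<sigma> by (metis abs_0 mult_cancel_left zero_neq_one)
  qed
  have Nx: "N x t \<bullet> e = 1"
  proof -
    have "N x t \<bullet> (- \<sigma> *\<^sub>R e) = - \<sigma>"
    proof (rule right_derivative_unique[OF line_real_derivative[OF d_deriv[OF t x(1)]], of "\<bar>L\<bar>"])
      fix r assume r: "0 < r" "r < \<bar>L\<bar>"
      have "L - r * \<sigma> = \<sigma> * (\<bar>L\<bar> - r)" using \<sigma>(3) by (simp add: right_diff_distrib mult.commute)
      hence Lr: "L - r * \<sigma> = (\<bar>L\<bar> - r) * \<sigma>" by (simp only: mult.commute)
      have "(L - r * \<sigma>) * sgn L = \<bar>L\<bar> - r" unfolding Lr \<sigma>_def[symmetric] mult.assoc \<sigma>(1) by simp
      moreover have "\<bar>L - r * \<sigma>\<bar> = \<bar>L\<bar> - r" unfolding Lr abs_mult \<sigma>(2) using r by simp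
      ultimately have s: "0 \<le> (L - r * \<sigma>) * sgn L" "\<bar>L - r * \<sigma>\<bar> \<le> \<bar>L\<bar>" using r by simp_all
      have "x + r *\<^sub>R (- \<sigma> *\<^sub>R e) = y + (L - r * \<sigma>) *\<^sub>R e" by (subst xe) (simp add: algebra_simps)
      thus "d (x + r *\<^sub>R (- \<sigma> *\<^sub>R e)) t = d (x + 0 *\<^sub>R (- \<sigma> *\<^sub>R e)) t + - \<sigma> * r" using line[OF s] by (simp add: L_def mult.commute)
    qed (use L in simp)
    hence "\<sigma> * (N x t \<bullet> e) = \<sigma> * 1" by simp
    thus ?thesis using \<sigma> by (metis abs_0 mult_cancel_left zero_neq_one)
  qed
  have "N y t = e" by (rule unit_if_inner_1[OF N_le[OF t] ne Ny]) (use y0 D in simp)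
  moreover have Nxe: "N x t = e" by (rule unit_if_inner_1[OF N_le[OF t x(1)] ne Nx])
  moreover have "x - d x t *\<^sub>R N x t = y" unfolding Nxe using xe by (metis L_def add_diff_cancel_right')
  ultimately show ?thesis using ne y(1) by simp
qed

text \<open>On the boundary itself the statement is a limit of the case off the boundary.\<close>

lemma eikonal:
  assumes t: "t \<in> {0..T}" and x: "\<bar>d x t\<bar> \<le> D"
  shows "norm (N x t) = 1" "x - d x t *\<^sub>R N x t \<in> frontier (\<Omega> t)" "N (x - d x t *\<^sub>R N x t) t = N x t"
proof -
  have "norm (N x t) = 1 \<and> x - d x t *\<^sub>R N x t \<in> frontier (\<Omega> t) \<and> N (x - d x t *\<^sub>R N x t) t = N x t"
  proof (cases "d x t = 0")
    case False thus ?thesis using eikonal_off[OF t x] by blast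
  next
    case True
    hence xf: "x \<in> frontier (\<Omega> t)" using d_zero[OF t] by blast
    have "isCont (\<lambda>y. norm (N y t)) x"
      by (intro continuous_norm has_derivative_continuous[OF N_deriv[OF t x]])
    hence lim: "((\<lambda>y. norm (N y t)) \<longlongrightarrow> norm (N x t)) (nhds x)"
      unfolding isCont_def by (rule iffD1[OF tendsto_at_iff_tendsto_nhds[of "\<lambda>y. norm (N y t)"]])
    have "norm (N x t) = 1"
    proof (rule ccontr)
      assume "norm (N x t) \<noteq> 1"
      hence "norm (N x t) < 1" using N_le[OF t x] by simp
      from order_tendstoD(2)[OF lim this] obtain e where e: "e > 0" "\<And>y. dist y x < e \<Longrightarrow> norm (N y t) < 1"
        unfolding eventually_nhds_metric by blast
      have "x \<in> closure (\<Omega> t)" using xf by (simp add: frontier_def)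
      then obtain y where y: "y \<in> \<Omega> t" "dist y x < min e D" using closure_approachable e(1) D by (metis min_less_iff_conj)
      have "d y t \<noteq> 0" using d_neg[OF t, of y] y(1) by simp
      moreover have "\<bar>d y t\<bar> \<le> D" using d_lip[OF t, of y x] True y(2) by simp
      ultimately have "norm (N y t) = 1" using eikonal_off[OF t] by blast
      thus False using e(2)[of y] y(2) by simp
    qed
    thus ?thesis using True xf by simp
  qed
  thus "norm (N x t) = 1" "x - d x t *\<^sub>R N x t \<in> frontier (\<Omega> t)" "N (x - d x t *\<^sub>R N x t) t = N x t" by blast+
qed

definition proj where "proj x t = x - d x t *\<^sub>R N x t"

lemma proj_deriv:
  assumes "t \<in> {0..T}" "\<bar>d x t\<bar> \<le> D"
  shows "((\<lambda>y. proj y t) has_derivative (\<lambda>w. w - (d x t *\<^sub>R H x t w + (N x t \<bullet> w) *\<^sub>R N x t))) (at x)"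
  unfolding proj_def by (intro has_derivative_diff has_derivative_ident has_derivative_scaleR d_deriv N_deriv assms)

lemma d_nbhd:
  assumes "t \<in> {0..T}" "\<bar>d x t\<bar> < D"
  shows "\<exists>e>0. \<forall>y\<in>ball x e. \<bar>d y t\<bar> < D"
proof (intro exI[of _ "D - \<bar>d x t\<bar>"] conjI ballI)
  fix y assume "y \<in> ball x (D - \<bar>d x t\<bar>)"
  thus "\<bar>d y t\<bar> < D" using d_lip[OF assms(1), of y x] by (auto simp: dist_commute)
qed (use assms in simp)

text \<open>If the normal at \<open>y\<close> is known to be \<open>G\<close> at the foot point of
  \<open>y\<close>, the chain rule computes the Hessian. It is used with \<open>G\<close> the normal itself
  and with \<open>G\<close> a normalised gradient of a defining function.\<close>

lemma normal_through_projection: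
  assumes t: "t \<in> {0..T}" and x: "\<bar>d x t\<bar> < D"
    and G: "(G has_derivative L) (at (proj x t))"
    and eq: "\<And>e. e > 0 \<Longrightarrow> \<exists>r>0. \<forall>y\<in>ball x r. dist (proj y t) (proj x t) < e"
    and loc: "e0 > 0" "\<And>y. \<bar>d y t\<bar> < D \<Longrightarrow> dist (proj y t) (proj x t) < e0 \<Longrightarrow> G (proj y t) = N y t \<bullet> i"
  shows "H x t w \<bullet> i = L (w - (d x t *\<^sub>R H x t w + (N x t \<bullet> w) *\<^sub>R N x t))"
proof -
  have x': "\<bar>d x t\<bar> \<le> D" using x by simp
  obtain e1 where e1: "e1 > 0" "\<forall>y\<in>ball x e1. \<bar>d y t\<bar> < D" using d_nbhd[OF t x] by blast
  obtain r where r: "r > 0" "\<forall>y\<in>ball x r. dist (proj y t) (proj x t) < e0" using eq[OF loc(1)] by blast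
  have "((\<lambda>y. G (proj y t)) has_derivative (\<lambda>w. L (w - (d x t *\<^sub>R H x t w + (N x t \<bullet> w) *\<^sub>R N x t)))) (at x)"
    by (rule has_derivative_compose[OF proj_deriv[OF t x'] G])
  hence a: "((\<lambda>y. N y t \<bullet> i) has_derivative (\<lambda>w. L (w - (d x t *\<^sub>R H x t w + (N x t \<bullet> w) *\<^sub>R N x t)))) (at x)"
  proof (rule has_derivative_transform_within_open[of _ _ _ _ "ball x (min e1 r)"])
    fix y assume "y \<in> ball x (min e1 r)"
    thus "G (proj y t) = N y t \<bullet> i" using e1 r loc(2)[of y] by simp
  qed (use e1 r in auto)
  have b: "((\<lambda>y. N y t \<bullet> i) has_derivative (\<lambda>w. H x t w \<bullet> i)) (at x)"
    by (rule has_derivative_inner_left[OF N_deriv[OF t x']])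
  from has_derivative_unique[OF b a] show ?thesis by (rule fun_cong)
qed

lemma proj_continuous:
  assumes t: "t \<in> {0..T}" and x: "\<bar>d x t\<bar> \<le> D" and e: "e > 0"
  shows "\<exists>r>0. \<forall>y\<in>ball x r. dist (proj y t) (proj x t) < e"
proof -
  have c: "isCont (\<lambda>y. proj y t) x" by (rule has_derivative_continuous[OF proj_deriv[OF t x]])
  from c[unfolded continuous_at_eps_delta, rule_format, OF e]
  obtain r where r: "r > 0" "\<And>y. dist y x < r \<Longrightarrow> dist (proj y t) (proj x t) < e" by blast
  show ?thesis
  proof (intro exI[of _ r] conjI ballI)
    fix y assume "y \<in> ball x r"
    thus "dist (proj y t) (proj x t) < e" by (intro r(2)) (simp add: dist_commute)
  qed (rule r(1))
qed

text \<open>Differentiate \<open>N (proj x) = N x\<close>. On the boundary the same identity says that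
  \<open>H\<close> does not change when the normal component of its argument is removed, hence annihilates the
  normal.\<close>

lemma hessian_identity:
  assumes t: "t \<in> {0..T}" and x: "\<bar>d x t\<bar> < D"
  shows "H x t w = H (proj x t) t w - d x t *\<^sub>R H (proj x t) t (H x t w)"
    and "H (proj x t) t (N x t) = 0"
proof -
  have main: "H x t w = H (proj x t) t (w - (d x t *\<^sub>R H x t w + (N x t \<bullet> w) *\<^sub>R N x t))" if x: "\<bar>d x t\<bar> < D" for x w
  proof -
    have x': "\<bar>d x t\<bar> \<le> D" using x by simp
    define p where "p = proj x t"
    have p0: "d p t = 0" using d_zero[OF t] eikonal(2)[OF t x'] unfolding p_def proj_def by blast
    have pd: "\<bar>d p t\<bar> \<le> D" using p0 D by simp
    have "H x t w \<bullet> i = H p t (w - (d x t *\<^sub>R H x t w + (N x t \<bullet> w) *\<^sub>R N x t)) \<bullet> i" for i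
    proof (rule normal_through_projection[OF t x, where G="\<lambda>y. N y t \<bullet> i" and ?e0.0=1])
      show "((\<lambda>y. N y t \<bullet> i) has_derivative (\<lambda>w. H p t w \<bullet> i)) (at (proj x t))"
        using has_derivative_inner_left[OF N_deriv[OF t pd], of i] unfolding p_def .
      show "\<exists>r>0. \<forall>y\<in>ball x r. dist (proj y t) (proj x t) < e" if "e > 0" for e by (rule proj_continuous[OF t x' that])
      show "N (proj y t) t \<bullet> i = N y t \<bullet> i" if "\<bar>d y t\<bar> < D" for y
        using eikonal(3)[OF t less_imp_le[OF that]] unfolding proj_def by simp
    qed simp
    from euclidean_eqI[OF this] show ?thesis unfolding p_def .
  qed
  have x': "\<bar>d x t\<bar> \<le> D" using x by simp
  define p where "p = proj x t"
  have p0: "d p t = 0" using d_zero[OF t] eikonal(2)[OF t x'] unfolding p_def proj_def by blast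
  have pd: "\<bar>d p t\<bar> < D" "\<bar>d p t\<bar> \<le> D" using p0 D by auto
  have pp: "proj p t = p" unfolding proj_def p0 by simp
  have Np: "N p t = N x t" using eikonal(3)[OF t x'] unfolding p_def proj_def .
  interpret A: linear "H p t" by (rule H_linear[OF t pd(2)])
  have "H p t (N x t) = H p t (N x t - (0 + (N x t \<bullet> N x t) *\<^sub>R N x t))" using main[OF pd(1), of "N x t"] unfolding pp p0 Np by simp
  also have "N x t \<bullet> N x t = 1" using eikonal(1)[OF t x'] by (simp add: norm_eq_1)
  finally show AN: "H (proj x t) t (N x t) = 0" unfolding p_def[symmetric] by (simp add: A.zero)
  have "H x t w = H p t w - (d x t *\<^sub>R H p t (H x t w) + (N x t \<bullet> w) *\<^sub>R H p t (N x t))"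
    using main[OF x, of w] unfolding p_def[symmetric] by (simp add: A.diff A.add A.scale)
  thus "H x t w = H (proj x t) t w - d x t *\<^sub>R H (proj x t) t (H x t w)" using AN unfolding p_def[symmetric] by simp
qed

lemma S_iff: "(y, s) \<in> S \<longleftrightarrow> s \<in> {0..T} \<and> d y s = 0"
  unfolding S_def using d_zero by auto

text \<open>The assumptions on the distance alone do not bound how its Hessian varies along the boundary. The
  local defining functions do: on the boundary the normal is \<open>\<nabla>\<phi> /
  \<bar>\<nabla>\<phi>\<bar>\<close>, and the Hessian is its derivative along tangential directions.\<close>

lemma local_representation:
  assumes z0: "z0 \<in> S"
  shows "\<exists>V \<nu> a. open V \<and> z0 \<in> V \<and> (\<forall>i\<in>Basis. Ck_on 1 V (\<nu> i)) \<and> (\<forall>i\<in>Basis. \<forall>j\<in>Basis. Ck_on 1 V (a i j)) \<and>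
     (\<forall>y s. (y, s) \<in> V \<inter> S \<longrightarrow> (\<forall>i\<in>Basis. N y s \<bullet> i = \<nu> i (y, s) \<and> (\<forall>j\<in>Basis. H y s j \<bullet> i = a i j (y, s))))"
proof -
  obtain x0 t0 where z0e: "z0 = (x0, t0)" by (cases z0)
  have t0: "t0 \<in> {0..T}" and x0: "d x0 t0 = 0" using z0 unfolding z0e S_iff by auto
  obtain N0 \<phi> where N0: "open N0" "(x0, t0) \<in> N0" "smooth_on N0 \<phi>"
    and sg: "\<And>y s. (y, s) \<in> N0 \<Longrightarrow> s \<in> {0..T} \<Longrightarrow> y \<in> \<Omega> s \<longleftrightarrow> \<phi> (y, s) < 0"
    and gr: "\<And>y s. (y, s) \<in> N0 \<Longrightarrow> \<phi> (y, s) = 0 \<Longrightarrow> grad (\<lambda>z. \<phi> (z, s)) y \<noteq> 0"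
    by (rule smooth_familyE[OF smooth t0]) (rule that)
  define B where "B i = dir_deriv \<phi> (i, 0)" for i :: 'a
  have pb: "(i, 0::real) \<in> Basis" if "i \<in> Basis" for i :: 'a using that by (simp add: Basis_prod_def)
  have BCk: "Ck_on k N0 (B i)" if "i \<in> Basis" for k i
  proof -
    have "Ck_on (Suc k) N0 \<phi>" using N0(3) unfolding smooth_on_def by blast
    thus ?thesis unfolding B_def using pb[OF that] by simp
  qed
  have phid: "\<phi> differentiable (at z)" if "z \<in> N0" for z
  proof -
    have "Ck_on (Suc 0) N0 \<phi>" using N0(3) unfolding smooth_on_def by blast
    thus ?thesis using that by simp
  qed
  define b2 where "b2 z = (\<Sum>i\<in>Basis. B i z * B i z)" for z
  have b2Ck: "Ck_on k N0 b2" for k unfolding b2_def by (intro Ck_on_sum[OF N0(1)] Ck_on_mult[OF N0(1)] BCk)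
  have gradB: "grad (\<lambda>z. \<phi> (z, s)) y \<bullet> i = B i (y, s)" if "(y, s) \<in> N0" "i \<in> Basis" for y s i
    unfolding grad_def inner_sum_left_Basis[OF that(2)] slice_derivative(2)[OF phid[OF that(1)]] B_def ..
  have b2n: "b2 (y, s) = (norm (grad (\<lambda>z. \<phi> (z, s)) y))\<^sup>2" if "(y, s) \<in> N0" for y s
    unfolding power2_norm_eq_inner b2_def by (subst euclidean_inner) (simp add: gradB[OF that])
  define V where "V = {z \<in> N0. b2 z > 0}"
  have V: "open V" "V \<subseteq> N0"
  proof -
    have "continuous_on N0 b2" using b2Ck[of 0] by simp
    from continuous_open_preimage[OF this N0(1) open_greaterThan[of 0]] show "open V"
      unfolding V_def vimage_def Collect_conj_eq[symmetric] by (simp add: Int_def)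
    show "V \<subseteq> N0" unfolding V_def by blast
  qed
  have SV: "\<phi> (y, s) = 0" "s \<in> {0..T}" "(y, s) \<in> N0" "grad (\<lambda>z. \<phi> (z, s)) y \<noteq> 0" if "(y, s) \<in> S" "(y, s) \<in> N0" for y s
  proof -
    show s: "s \<in> {0..T}" "(y, s) \<in> N0" using that S_iff by auto
    have "y \<in> frontier (\<Omega> s)" using that unfolding S_def by simp
    thus z: "\<phi> (y, s) = 0" using defining_function(1)[OF Omega(1)[OF s(1)] N0(1,3) s(2,1) sg gr] by blast
    show "grad (\<lambda>z. \<phi> (z, s)) y \<noteq> 0" by (rule gr[OF s(2) z])
  qed
  have SinV: "(y, s) \<in> V" if "(y, s) \<in> S" "(y, s) \<in> N0" for y s
    unfolding V_def using SV(4)[OF that] b2n[OF that(2)] that(2) by simp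
  define G where "G n v = (\<Prod>k<n. (- 1/2 - real k)) * v powr (- 1/2 - real n)" for n and v :: real
  have dG: "(G n has_real_derivative G (Suc n) v) (at v)" if "v \<in> {0<..}" for n v
  proof -
    have "(G n has_real_derivative (\<Prod>k<n. (- 1/2 - real k)) * ((- 1/2 - real n) * v powr (- 1/2 - real n - 1))) (at v)"
      unfolding G_def[abs_def] by (intro DERIV_cmult has_real_derivative_powr) (use that in simp)
    thus ?thesis unfolding G_def by (simp add: mult.assoc diff_diff_eq add.commute)
  qed
  define \<nu> where "\<nu> i z = B i z * G 0 (b2 z)" for i z
  have nuCk: "Ck_on k V (\<nu> i)" if "i \<in> Basis" for k i
    unfolding \<nu>_def
  proof (intro Ck_on_mult[OF V(1)] Ck_on_subset[OF BCk[OF that] V(2)])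
    show "Ck_on k V (\<lambda>x. G 0 (b2 x))"
    proof (rule Ck_on_compose[where G=G and I="{0<..}", OF V(1) dG])
      show "b2 x \<in> {0<..}" if "x \<in> V" for x using that unfolding V_def by simp
      show "Ck_on k V b2" by (rule Ck_on_subset[OF b2Ck V(2)])
    qed
  qed
  define a where "a i j z = (\<Sum>k\<in>Basis. (j \<bullet> k + (- 1) * (\<nu> j z * \<nu> k z)) * dir_deriv (\<nu> i) (k, 0) z)" for i j z
  have aCk: "Ck_on 1 V (a i j)" if "i \<in> Basis" "j \<in> Basis" for i j
  proof -
    have "Ck_on 1 V (dir_deriv (\<nu> i) (k, 0))" if k: "k \<in> Basis" for k
      using nuCk[OF \<open>i \<in> Basis\<close>, of "Suc (Suc 0)"] pb[OF k] unfolding One_nat_def Ck_on.simps(2)[of "Suc 0"] by blast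
    thus ?thesis unfolding a_def using that
      by (intro Ck_on_sum[OF V(1)] Ck_on_mult[OF V(1)] Ck_on_add[OF V(1)] Ck_on_const nuCk) auto
  qed
  have Nnu: "N y s \<bullet> i = \<nu> i (y, s)" if yS: "(y, s) \<in> S" "(y, s) \<in> N0" and i: "i \<in> Basis" for y s i
  proof -
    note y = SV[OF yS]
    define v where "v = grad (\<lambda>z. \<phi> (z, s)) y"
    have d0: "d y s = 0" using yS S_iff by blast
    have dD: "\<bar>d y s\<bar> \<le> D" using d0 D by simp
    have n1: "norm (N y s) = 1" by (rule eikonal(1)[OF y(2) dD])
    have v0: "norm v > 0" using y(4) by (simp add: v_def)
    have dphi: "((\<lambda>z. \<phi> (z, s)) has_derivative (\<lambda>w. v \<bullet> w)) (at y)"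
      unfolding v_def by (rule defining_function(3)[OF Omega(1)[OF y(2)] N0(1,3) y(3,2) sg gr])
    have imp: "N y s \<bullet> w \<ge> 0" if w: "v \<bullet> w > 0" for w
    proof (rule ccontr)
      assume neg: "\<not> N y s \<bullet> w \<ge> 0"
      obtain r1 where r1: "r1 > 0" "\<And>r. 0 < r \<Longrightarrow> r < r1 \<Longrightarrow> \<phi> (y + r *\<^sub>R w, s) > 0"
        using DERIV_pos_inc_right[OF line_real_derivative[OF dphi, of w] w] y(1) by auto
      have "N y s \<bullet> w < 0" using neg by simp
      then obtain r2 where r2: "r2 > 0" "\<And>r. 0 < r \<Longrightarrow> r < r2 \<Longrightarrow> d (y + r *\<^sub>R w) s < 0"
        using DERIV_neg_dec_right[OF line_real_derivative[OF d_deriv[OF y(2) dD], of w]] d0 by auto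
      obtain e where e: "e > 0" "ball (y, s) e \<subseteq> N0" using N0(1) y(3) open_contains_ball by blast
      define e' where "e' = e / (norm w + 1)"
      define r where "r = min (min r1 r2) e' / 2"
      have nw: "norm w + 1 > 0" by (simp add: add_nonneg_pos)
      have "e' > 0" unfolding e'_def using e(1) nw by simp
      hence r: "0 < r" "r < r1" "r < r2" "r < e'" unfolding r_def using r1(1) r2(1) by (auto simp: min_def)
      have "r * (norm w + 1) < e" using r(4) nw unfolding e'_def by (simp add: pos_less_divide_eq)
      hence "r * norm w < e" using r(1) unfolding distrib_left by linarith
      hence "dist (y, s) (y + r *\<^sub>R w, s) < e" using r(1) by (simp add: dist_Pair_Pair dist_norm)
      hence "(y + r *\<^sub>R w, s) \<in> N0" using e(2) by auto
      from sg[OF this y(2)] show False using r1(2)[OF r(1,2)] r2(2)[OF r(1,3)] d_neg[OF y(2)] by force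
    qed
    have vN: "v \<bullet> N y s = norm v"
    proof (rule ccontr)
      assume ne: "v \<bullet> N y s \<noteq> norm v"
      have le: "v \<bullet> N y s \<le> norm v" using norm_cauchy_schwarz[of v "N y s"] n1 by simp
      define w where "w = (1 / norm v) *\<^sub>R v - N y s"
      have vw: "v \<bullet> w = norm v - v \<bullet> N y s" unfolding w_def using v0 by (simp add: inner_diff_right dot_square_norm power2_eq_square)
      hence "v \<bullet> w > 0" using le ne by simp
      hence "0 \<le> N y s \<bullet> w" by (rule imp)
      also have "N y s \<bullet> w = (v \<bullet> N y s) / norm v - 1" unfolding w_def using n1 by (simp add: inner_diff_right inner_commute norm_eq_1[symmetric])
      finally show False using le ne v0 by (simp add: pos_le_divide_eq)
    qed
    have "(1 / norm v) *\<^sub>R v = N y s"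
    proof (rule sym, rule unit_if_inner_1)
      show "N y s \<bullet> (1 / norm v) *\<^sub>R v = 1" using vN v0 by (simp add: inner_commute)
    qed (use n1 v0 in auto)
    hence "N y s \<bullet> i = (v \<bullet> i) / norm v" by (metis inner_scaleR_left times_divide_eq_left mult_1)
    also have "\<dots> = \<nu> i (y, s)"
    proof -
      have "G 0 (b2 (y, s)) = (norm v powr 2) powr (- 1/2)" unfolding G_def b2n[OF y(3)] v_def[symmetric] using v0 by simp
      also have "\<dots> = 1 / norm v" using v0 by (simp only: powr_powr) (simp add: powr_minus_divide)
      finally show ?thesis unfolding \<nu>_def v_def gradB[OF y(3) i] by simp
    qed
    finally show ?thesis .
  qed
  have Ha: "H y s j \<bullet> i = a i j (y, s)" if yS: "(y, s) \<in> S" "(y, s) \<in> N0" and i: "i \<in> Basis" and j: "j \<in> Basis" for y s i j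
  proof -
    note y = SV[OF yS]
    have d0: "d y s = 0" using yS S_iff by blast
    have dD: "\<bar>d y s\<bar> < D" "\<bar>d y s\<bar> \<le> D" using d0 D by auto
    have pr: "proj y s = y" unfolding proj_def d0 by simp
    obtain e where e: "e > 0" "ball (y, s) e \<subseteq> N0" using N0(1) y(3) open_contains_ball by blast
    have yV: "(y, s) \<in> V" by (rule SinV[OF yS])
    have nud: "\<nu> i differentiable (at (y, s))" using nuCk[OF i, of "Suc 0"] yV by simp
    define L where "L w = frechet_derivative (\<nu> i) (at (y, s)) (w, 0)" for w
    have Ld: "((\<lambda>z. \<nu> i (z, s)) has_derivative L) (at y)" unfolding L_def by (rule slice_derivative(1)[OF nud])
    have "H y s j \<bullet> i = L (j - (d y s *\<^sub>R H y s j + (N y s \<bullet> j) *\<^sub>R N y s))"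
    proof (rule normal_through_projection[OF y(2) dD(1), where G="\<lambda>z. \<nu> i (z, s)" and ?e0.0=e])
      show "((\<lambda>z. \<nu> i (z, s)) has_derivative L) (at (proj y s))" unfolding pr by (rule Ld)
      show "\<exists>r>0. \<forall>x\<in>ball y r. dist (proj x s) (proj y s) < e" if "e > 0" for e by (rule proj_continuous[OF y(2) dD(2) that])
      show "\<nu> i (proj x s, s) = N x s \<bullet> i" if x: "\<bar>d x s\<bar> < D" "dist (proj x s) (proj y s) < e" for x
      proof -
        have pf: "proj x s \<in> frontier (\<Omega> s)" unfolding proj_def by (rule eikonal(2)[OF y(2)]) (use x in simp)
        hence "(proj x s, s) \<in> S" unfolding S_def using y(2) by simp
        moreover have "(proj x s, s) \<in> N0" using e(2) x(2) unfolding pr by (auto simp: dist_Pair_Pair dist_commute)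
        ultimately have "N (proj x s) s \<bullet> i = \<nu> i (proj x s, s)" by (rule Nnu[OF _ _ i])
        moreover have "N (proj x s) s = N x s" unfolding proj_def by (rule eikonal(3)[OF y(2)]) (use x in simp)
        ultimately show ?thesis by simp
      qed
    qed (rule e(1))
    also have "\<dots> = L (j - (N y s \<bullet> j) *\<^sub>R N y s)" unfolding d0 by simp
    also have "\<dots> = (\<Sum>k\<in>Basis. ((j - (N y s \<bullet> j) *\<^sub>R N y s) \<bullet> k) *\<^sub>R L k)" by (rule linear_sum_basis[OF has_derivative_linear[OF Ld]])
    also have "\<dots> = a i j (y, s)" unfolding a_def
    proof (rule sum.cong[OF refl])
      fix k :: 'a assume k: "k \<in> Basis"
      show "((j - (N y s \<bullet> j) *\<^sub>R N y s) \<bullet> k) *\<^sub>R L k = (j \<bullet> k + (- 1) * (\<nu> j (y, s) * \<nu> k (y, s))) * dir_deriv (\<nu> i) (k, 0) (y, s)"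
        using Nnu[OF yS j] Nnu[OF yS k] by (simp add: inner_diff_left L_def dir_deriv_def)
    qed
    finally show ?thesis .
  qed
  have z0V: "z0 \<in> V" using z0 N0(2) SinV unfolding z0e by blast
  show ?thesis
  proof (intro exI[of _ V] exI[of _ \<nu>] exI[of _ a] conjI ballI allI impI)
    show "open V" by (rule V(1))
    show "z0 \<in> V" by (rule z0V)
    fix i :: 'a assume i: "i \<in> Basis"
    show "Ck_on 1 V (\<nu> i)" by (rule nuCk[OF i])
    show "Ck_on 1 V (a i j)" if "j \<in> Basis" for j by (rule aCk[OF i that])
    show "N y s \<bullet> i = \<nu> i (y, s)" if "(y, s) \<in> V \<inter> S" for y s by (rule Nnu[OF _ _ i]) (use that V(2) in auto)
    show "H y s j \<bullet> i = a i j (y, s)" if "(y, s) \<in> V \<inter> S" "j \<in> Basis" for y s j by (rule Ha[OF _ _ i that(2)]) (use that V(2) in auto)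
  qed
qed

end

section \<open>Lipschitz bounds, traces and difference quotients\<close>

lemma Ck_one_locally_lipschitz:
  fixes f :: "'b::euclidean_space \<Rightarrow> real"
  assumes V: "open V" "z0 \<in> V" and f: "Ck_on 1 V f"
  shows "\<exists>r>0. \<exists>L. \<forall>y\<in>ball z0 r. \<forall>z\<in>ball z0 r. \<bar>f y - f z\<bar> \<le> L * dist y z"
proof -
  obtain r where r: "r > 0" "cball z0 r \<subseteq> V" using V open_contains_cball by blast
  have df: "f differentiable (at y)" if "y \<in> V" for y using f that by simp
  have "continuous_on V (dir_deriv f b)" if "b \<in> Basis" for b using f that by simp
  hence "continuous_on (cball z0 r) (dir_deriv f b)" if "b \<in> Basis" for b using that r(2) continuous_on_subset by blast
  hence "continuous_on (cball z0 r) (grad f)" unfolding grad_def[abs_def]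
    by (intro continuous_on_sum continuous_on_scaleR continuous_on_const)
  hence "bounded (grad f ` cball z0 r)" by (intro compact_imp_bounded compact_continuous_image compact_cball)
  then obtain L where L: "\<And>y. y \<in> cball z0 r \<Longrightarrow> norm (grad f y) \<le> L" unfolding bounded_iff by blast
  have "\<bar>f y - f z\<bar> \<le> L * dist y z" if yz: "y \<in> cball z0 r" "z \<in> cball z0 r" for y z
  proof -
    have "norm (f y - f z) \<le> L * norm (y - z)"
    proof (rule differentiable_bound[OF convex_cball[of z0 r]])
      fix x assume x: "x \<in> cball z0 r"
      show "(f has_derivative (\<lambda>w. grad f x \<bullet> w)) (at x within cball z0 r)"
        by (rule has_derivative_at_withinI[OF has_derivative_grad[OF df]]) (use x r(2) in blast)
      show "onorm (\<lambda>w. grad f x \<bullet> w) \<le> L"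
      proof (rule onorm_bound)
        show "0 \<le> L" using L[OF x] norm_ge_zero order_trans by blast
        fix w
        have "norm (grad f x \<bullet> w) \<le> norm (grad f x) * norm w" by (simp add: Cauchy_Schwarz_ineq2)
        also have "\<dots> \<le> L * norm w" by (intro mult_right_mono L[OF x] norm_ge_zero)
        finally show "norm (grad f x \<bullet> w) \<le> L * norm w" .
      qed
    qed (use yz in auto)
    thus ?thesis by (simp add: dist_norm)
  qed
  hence "\<forall>y\<in>ball z0 r. \<forall>z\<in>ball z0 r. \<bar>f y - f z\<bar> \<le> L * dist y z" using ball_subset_cball by blast
  thus ?thesis using r(1) by blast
qed

lemma locally_lipschitz_on_compact:
  fixes F :: "'b::metric_space \<Rightarrow> real"
  assumes S: "compact S"
    and loc: "\<And>z. z \<in> S \<Longrightarrow> \<exists>r>0. \<exists>L. \<forall>y\<in>ball z r \<inter> S. \<forall>y'\<in>ball z r \<inter> S. \<bar>F y - F y'\<bar> \<le> L * dist y y'"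
  shows "\<exists>L\<ge>0. \<forall>y\<in>S. \<bar>F y\<bar> \<le> L \<and> (\<forall>y'\<in>S. \<bar>F y - F y'\<bar> \<le> L * dist y y')"
proof -
  have "\<forall>z\<in>S. \<exists>r. r > 0 \<and> (\<exists>L. \<forall>y\<in>ball z r \<inter> S. \<forall>y'\<in>ball z r \<inter> S. \<bar>F y - F y'\<bar> \<le> L * dist y y')" using loc by blast
  from this[unfolded bchoice_iff] obtain r
    where r': "\<forall>z\<in>S. r z > 0 \<and> (\<exists>L. \<forall>y\<in>ball z (r z) \<inter> S. \<forall>y'\<in>ball z (r z) \<inter> S. \<bar>F y - F y'\<bar> \<le> L * dist y y')" by (elim exE)
  hence r: "\<And>z. z \<in> S \<Longrightarrow> r z > 0" by blast
  have "\<forall>z\<in>S. \<exists>L. \<forall>y\<in>ball z (r z) \<inter> S. \<forall>y'\<in>ball z (r z) \<inter> S. \<bar>F y - F y'\<bar> \<le> L * dist y y'" using r' by blast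
  then obtain L0 where L0: "\<And>z y y'. z \<in> S \<Longrightarrow> y \<in> ball z (r z) \<inter> S \<Longrightarrow> y' \<in> ball z (r z) \<inter> S \<Longrightarrow> \<bar>F y - F y'\<bar> \<le> L0 z * dist y y'"
    unfolding bchoice_iff by blast
  have cov: "S \<subseteq> (\<Union>z\<in>S. ball z (r z))" using r by auto
  obtain Z where Z: "Z \<subseteq> S" "finite Z" "S \<subseteq> (\<Union>z\<in>Z. ball z (r z))"
    by (rule compactE_image[OF S, of S "\<lambda>z. ball z (r z)"]) (use cov in auto)
  define L where "L = (\<Sum>z\<in>Z. \<bar>L0 z\<bar>)"
  define B where "B = (\<Sum>z\<in>Z. \<bar>F z\<bar> + \<bar>L0 z\<bar> * r z)"
  have r0: "0 \<le> r z" if "z \<in> Z" for z using r Z(1) that by (meson less_imp_le subsetD)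
  have L0L: "L0 z \<le> L" if "z \<in> Z" for z
    using member_le_sum[of z Z "\<lambda>z. \<bar>L0 z\<bar>"] that Z(2) unfolding L_def by simp
  have Lnn: "L \<ge> 0" unfolding L_def by (intro sum_nonneg) simp
  have FB: "\<bar>F y\<bar> \<le> B" if y: "y \<in> S" for y
  proof -
    obtain z where z: "z \<in> Z" "y \<in> ball z (r z)" using Z(3) y by blast
    have zS: "z \<in> S" using z Z by blast
    have "\<bar>F y - F z\<bar> \<le> L0 z * dist y z" by (rule L0[OF zS]) (use z y zS r[OF zS] in auto)
    also have "\<dots> \<le> \<bar>L0 z\<bar> * r z" using z(2) by (intro mult_mono) (auto simp: dist_commute)
    finally have "\<bar>F y\<bar> \<le> \<bar>F z\<bar> + \<bar>L0 z\<bar> * r z" by linarith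
    also have "\<dots> \<le> B" unfolding B_def
      by (rule member_le_sum[of z Z "\<lambda>z. \<bar>F z\<bar> + \<bar>L0 z\<bar> * r z"]) (use z(1) Z(2) r0 in auto)
    finally show ?thesis .
  qed
  define \<G> where "\<G> = (\<lambda>z. ball z (r z)) ` Z"
  have covG: "S \<subseteq> \<Union>\<G>" unfolding \<G>_def using Z(3) by simp
  have op: "open G" if "G \<in> \<G>" for G using that unfolding \<G>_def by auto
  obtain e where e: "e > 0" "\<forall>y\<in>S. \<exists>G\<in>\<G>. ball y e \<subseteq> G"
    by (rule Heine_Borel_lemma[OF S covG op]) (assumption, metis that)
  define M where "M = L + 2 * \<bar>B\<bar> / e + \<bar>B\<bar>"
  have M: "M \<ge> 0" "L \<le> M" "2 * \<bar>B\<bar> / e \<le> M" "B \<le> M"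
  proof -
    have "2 * \<bar>B\<bar> / e \<ge> 0" using e(1) by simp
    thus "M \<ge> 0" "L \<le> M" "2 * \<bar>B\<bar> / e \<le> M" "B \<le> M" unfolding M_def using Lnn by linarith+
  qed
  have "\<bar>F y - F y'\<bar> \<le> M * dist y y'" if y: "y \<in> S" "y' \<in> S" for y y'
  proof (cases "dist y y' < e")
    case True
    obtain z where z: "z \<in> Z" "ball y e \<subseteq> ball z (r z)" using e(2) y(1) unfolding \<G>_def by blast
    have "y \<in> ball y e" "y' \<in> ball y e" using True e(1) by auto
    hence "y \<in> ball z (r z) \<inter> S" "y' \<in> ball z (r z) \<inter> S" using z(2) y by blast+
    hence "\<bar>F y - F y'\<bar> \<le> L0 z * dist y y'" using L0 z(1) Z(1) by blast
    also have "\<dots> \<le> M * dist y y'" using L0L[OF z(1)] M(2) by (intro mult_right_mono) auto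
    finally show ?thesis .
  next
    case False
    have "\<bar>F y - F y'\<bar> \<le> 2 * \<bar>B\<bar>" using FB[OF y(1)] FB[OF y(2)] by linarith
    also have "\<dots> = 2 * \<bar>B\<bar> / e * e" using e(1) by simp
    also have "\<dots> \<le> M * dist y y'" using False e(1) M by (intro mult_mono) auto
    finally show ?thesis .
  qed
  thus ?thesis using M FB by (intro exI[of _ M]) force
qed

text \<open>The trace may be computed in the orthonormal basis \<open>B \<union> {n}\<close> instead of the
  standard one, and \<open>n\<close> contributes nothing.\<close>

lemma trace_orthonormal:
  fixes L :: "'a::euclidean_space \<Rightarrow> 'a"
  assumes L: "linear L" and B: "pairwise orthogonal B" "\<forall>e\<in>B. norm e = 1"
    and sp: "span B = {v. v \<bullet> n = 0}" and n: "norm n = 1" "L n = 0"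
    and eig: "\<forall>e\<in>B. L e = - \<kappa> e *\<^sub>R e"
  shows "(\<Sum>b\<in>Basis. L b \<bullet> b) = - (\<Sum>e\<in>B. \<kappa> e)"
proof -
  interpret linear L by (rule L)
  have "0 \<notin> B" using B(2) by force
  hence finB: "finite B" using pairwise_orthogonal_independent[OF B(1)] independent_imp_finite by blast
  have Bn: "e \<bullet> n = 0" if "e \<in> B" for e using span_base[OF that] sp by blast
  have nn: "n \<bullet> n = 1" using n(1) by (simp add: norm_eq_1)
  have nB: "n \<notin> B" using Bn nn by force
  define C where "C = insert n B"
  have fin: "finite C" unfolding C_def using finB by simp
  have pw: "pairwise orthogonal C" unfolding C_def
    using B(1) Bn by (auto simp: pairwise_insert orthogonal_def inner_commute)
  have n1: "norm c = 1" if "c \<in> C" for c using that B(2) n(1) unfolding C_def by auto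
  have spC: "x \<in> span C" for x
  proof -
    have "x - (x \<bullet> n) *\<^sub>R n \<in> span B" unfolding sp using nn by (simp add: inner_diff_left)
    hence "x - (x \<bullet> n) *\<^sub>R n \<in> span C" using span_mono[of B C] unfolding C_def by blast
    moreover have "(x \<bullet> n) *\<^sub>R n \<in> span C" unfolding C_def by (intro span_scale span_base) simp
    ultimately have "x - (x \<bullet> n) *\<^sub>R n + (x \<bullet> n) *\<^sub>R n \<in> span C" by (rule span_add)
    thus ?thesis by simp
  qed
  have ex: "(\<Sum>c\<in>C. (x \<bullet> c) *\<^sub>R c) = x" for x
    using orthonormal_basis_expand[OF pw n1 spC fin] .
  have "(\<Sum>b\<in>Basis. L b \<bullet> b) = (\<Sum>b\<in>Basis. \<Sum>c\<in>C. (b \<bullet> c) * (L c \<bullet> b))"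
  proof (rule sum.cong[OF refl])
    fix b :: 'a
    have "L b = L (\<Sum>c\<in>C. (b \<bullet> c) *\<^sub>R c)" unfolding ex ..
    also have "\<dots> = (\<Sum>c\<in>C. (b \<bullet> c) *\<^sub>R L c)" by (simp add: sum scale)
    finally show "L b \<bullet> b = (\<Sum>c\<in>C. (b \<bullet> c) * (L c \<bullet> b))" by (simp add: inner_sum_left)
  qed
  also have "\<dots> = (\<Sum>c\<in>C. \<Sum>b\<in>Basis. (L c \<bullet> b) * (c \<bullet> b))" by (subst sum.swap) (simp add: mult.commute inner_commute)
  also have "\<dots> = (\<Sum>c\<in>C. L c \<bullet> c)" by (intro sum.cong refl) (rule euclidean_inner[symmetric])
  also have "\<dots> = (\<Sum>e\<in>B. L e \<bullet> e)" unfolding C_def using finB nB n(2) by simp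
  also have "\<dots> = (\<Sum>e\<in>B. - \<kappa> e)" using eig B(2) by (intro sum.cong) (auto simp: norm_eq_1)
  finally show ?thesis by (simp add: sum_negf)
qed

lemma admissible_forcing_bounds:
  fixes g :: "'a::euclidean_space \<Rightarrow> real \<Rightarrow> real"
  assumes T: "T > 0" and adm: "admissible_forcing T g"
  shows "\<exists>L\<ge>1. (\<forall>x. \<forall>t\<in>{0..T}. \<bar>g x t\<bar> \<le> L) \<and>
    (\<forall>t\<in>{0..T}. \<forall>i\<in>Basis. \<forall>x a r s. \<bar>(g (x + s *\<^sub>R i) t - g x t) * r - s * (g (a + r *\<^sub>R i) t - g a t)\<bar>
       \<le> L * \<bar>s\<bar> * \<bar>r\<bar> * (norm (x - a) + \<bar>s\<bar> + \<bar>r\<bar>)) \<and>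
    (\<forall>t\<in>{0..T}. \<forall>t'\<in>{0..T}. \<forall>i\<in>Basis. \<forall>a r. \<bar>g (a + r *\<^sub>R i) t - g a t - g (a + r *\<^sub>R i) t' + g a t'\<bar> \<le> L * \<bar>r\<bar> * \<bar>t - t'\<bar>)"
proof -
  have c: "continuous_on (UNIV \<times> {0..T}) (\<lambda>(x, t). g x t)" using adm unfolding admissible_forcing_def by blast
  obtain M where M: "\<And>t. t \<in> {0..T} \<Longrightarrow> sobolev_inf_le (Suc (Suc (Suc 0))) M UNIV (\<lambda>x. g x t)"
    using adm unfolding admissible_forcing_def numeral_3_eq_3 by blast
  obtain gt M' where gt: "has_weak_deriv (UNIV \<times> {0<..<T}) (0, 1) (\<lambda>(x, t). g x t) gt" "sobolev_inf_le 1 M' (UNIV \<times> {0<..<T}) gt"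
    using adm unfolding admissible_forcing_def sobolev_inf_def by blast
  have ct: "continuous_on UNIV (\<lambda>x. g x t)" if "t \<in> {0..T}" for t
  proof -
    have "continuous_on UNIV ((\<lambda>(x, t). g x t) \<circ> (\<lambda>x. (x, t)))"
      by (intro continuous_on_compose continuous_intros continuous_on_subset[OF c]) (use that in auto)
    thus ?thesis by (simp add: comp_def)
  qed
  define L where "L = 1 + \<bar>M\<bar> + real DIM('a) * \<bar>M\<bar> + \<bar>M'\<bar>"
  have L: "L \<ge> 1" "M \<le> L" "real DIM('a) * M \<le> L" "M' \<le> L"
  proof -
    have "real DIM('a) * M \<le> real DIM('a) * \<bar>M\<bar>" "0 \<le> real DIM('a) * \<bar>M\<bar>" by (auto intro!: mult_left_mono)
    thus "L \<ge> 1" "M \<le> L" "real DIM('a) * M \<le> L" "M' \<le> L" unfolding L_def by linarith+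
  qed
  have b: "\<bar>g x t\<bar> \<le> M" if "t \<in> {0..T}" for x t by (rule sobolev_slope_bounds(1)[OF ct[OF that] M[OF that]])
  show ?thesis
  proof (intro exI[of _ L] conjI ballI allI)
    fix t assume t: "t \<in> {0..T}"
    show "\<bar>g x t\<bar> \<le> L" for x using b[OF t] L(2) by (rule order_trans)
    fix i :: 'a assume i: "i \<in> Basis"
    show "\<bar>(g (x + s *\<^sub>R i) t - g x t) * r - s * (g (a + r *\<^sub>R i) t - g a t)\<bar> \<le> L * \<bar>s\<bar> * \<bar>r\<bar> * (norm (x - a) + \<bar>s\<bar> + \<bar>r\<bar>)" for x a r s
      by (rule order_trans[OF sobolev_slope_bounds(2)[OF ct[OF t] M[OF t] i]]) (intro mult_right_mono L(3); simp)
    show "\<bar>g (a + r *\<^sub>R i) t - g a t - g (a + r *\<^sub>R i) t' + g a t'\<bar> \<le> L * \<bar>r\<bar> * \<bar>t - t'\<bar>" if t': "t' \<in> {0..T}" for a r t'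
      by (rule order_trans[OF sobolev_mixed_difference[OF c b gt i t t' T]]) (auto intro!: mult_right_mono L(4))
  qed (rule L(1))
qed

text \<open>A first-order expansion in which difference quotients of step \<open>\<epsilon>\<close> replace
  the partial derivatives; the coordinates are changed one at a time, and each change is compared with the
  step \<open>\<epsilon>\<close> at \<open>a\<close>.\<close>

lemma difference_quotient_taylor:
  fixes f :: "'a::euclidean_space \<Rightarrow> real"
  assumes L: "L \<ge> 0" and \<epsilon>: "\<epsilon> > 0"
    and sl: "\<And>i x a r s. i \<in> Basis \<Longrightarrow> \<bar>(f (x + s *\<^sub>R i) - f x) * r - s * (f (a + r *\<^sub>R i) - f a)\<bar>
       \<le> L * \<bar>s\<bar> * \<bar>r\<bar> * (norm (x - a) + \<bar>s\<bar> + \<bar>r\<bar>)"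
  shows "\<bar>f (a + w) - f a - (\<Sum>i\<in>Basis. (w \<bullet> i) * ((f (a + \<epsilon> *\<^sub>R i) - f a) / \<epsilon>))\<bar>
     \<le> real DIM('a) * (L * (real DIM('a) + 1)) * norm w * (norm w + \<epsilon>)"
proof -
  define E where "E = L * norm w * ((real DIM('a) + 1) * norm w + \<epsilon>)"
  have "\<bar>f (a + (\<Sum>i\<in>F. (w \<bullet> i) *\<^sub>R i)) - f a - (\<Sum>i\<in>F. (w \<bullet> i) * ((f (a + \<epsilon> *\<^sub>R i) - f a) / \<epsilon>))\<bar> \<le> real (card F) * E"
    if "F \<subseteq> Basis" for F
    using finite_subset[OF that finite_Basis] that
  proof (induction F)
    case (insert i F)
    define v where "v = (\<Sum>i\<in>F. (w \<bullet> i) *\<^sub>R i)"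
    define Q where "Q i = (f (a + \<epsilon> *\<^sub>R i) - f a) / \<epsilon>" for i
    have i: "i \<in> Basis" using insert by simp
    have wi: "\<bar>w \<bullet> i\<bar> \<le> norm w" by (rule Basis_le_norm[OF i])
    have "norm v \<le> (\<Sum>i\<in>F. norm ((w \<bullet> i) *\<^sub>R i))" unfolding v_def by (rule norm_sum)
    also have "\<dots> \<le> (\<Sum>i\<in>F. norm w)" using insert.prems by (intro sum_mono) (auto simp: Basis_le_norm)
    also have "\<dots> \<le> real DIM('a) * norm w" using insert.prems by (simp add: mult_right_mono card_mono)
    finally have nv: "norm v \<le> real DIM('a) * norm w" .
    have "\<bar>(f (a + v + (w \<bullet> i) *\<^sub>R i) - f (a + v)) * \<epsilon> - (w \<bullet> i) * (f (a + \<epsilon> *\<^sub>R i) - f a)\<bar>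
        \<le> L * \<bar>w \<bullet> i\<bar> * \<bar>\<epsilon>\<bar> * (norm (a + v - a) + \<bar>w \<bullet> i\<bar> + \<bar>\<epsilon>\<bar>)" by (rule sl[OF i])
    also have "\<dots> \<le> (L * norm w * \<epsilon>) * ((real DIM('a) + 1) * norm w + \<epsilon>)"
    proof (intro mult_mono)
      show "norm (a + v - a) + \<bar>w \<bullet> i\<bar> + \<bar>\<epsilon>\<bar> \<le> (real DIM('a) + 1) * norm w + \<epsilon>"
        using nv wi \<epsilon> by (simp add: distrib_right)
    qed (use L \<epsilon> wi in auto)
    also have "\<dots> = E * \<epsilon>" unfolding E_def by (simp add: mult_ac)
    finally have "\<bar>(f (a + v + (w \<bullet> i) *\<^sub>R i) - f (a + v)) * \<epsilon> - (w \<bullet> i) * (f (a + \<epsilon> *\<^sub>R i) - f a)\<bar> / \<epsilon> \<le> E"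
      using \<epsilon> by (simp add: pos_divide_le_eq)
    moreover have "\<bar>(f (a + v + (w \<bullet> i) *\<^sub>R i) - f (a + v)) * \<epsilon> - (w \<bullet> i) * (f (a + \<epsilon> *\<^sub>R i) - f a)\<bar> / \<epsilon>
       = \<bar>f (a + v + (w \<bullet> i) *\<^sub>R i) - f (a + v) - (w \<bullet> i) * Q i\<bar>"
    proof -
      have "((f (a + v + (w \<bullet> i) *\<^sub>R i) - f (a + v)) * \<epsilon> - (w \<bullet> i) * (f (a + \<epsilon> *\<^sub>R i) - f a)) / \<epsilon> = f (a + v + (w \<bullet> i) *\<^sub>R i) - f (a + v) - (w \<bullet> i) * Q i"
        unfolding Q_def diff_divide_distrib[of "_ * \<epsilon>" _ \<epsilon>] using \<epsilon> by simp
      moreover have "\<bar>X\<bar> / \<epsilon> = \<bar>X / \<epsilon>\<bar>" for X :: real using \<epsilon> by simp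
      ultimately show ?thesis by metis
    qed
    ultimately have s: "\<bar>f (a + v + (w \<bullet> i) *\<^sub>R i) - f (a + v) - (w \<bullet> i) * Q i\<bar> \<le> E" by simp
    have IH: "\<bar>f (a + v) - f a - (\<Sum>i\<in>F. (w \<bullet> i) * Q i)\<bar> \<le> real (card F) * E"
      using insert unfolding v_def Q_def by blast
    have e1: "a + (\<Sum>j\<in>insert i F. (w \<bullet> j) *\<^sub>R j) = a + v + (w \<bullet> i) *\<^sub>R i" unfolding v_def using insert by (simp add: add_ac)
    have e2: "(\<Sum>j\<in>insert i F. (w \<bullet> j) * Q j) = (w \<bullet> i) * Q i + (\<Sum>i\<in>F. (w \<bullet> i) * Q i)" using insert by simp
    have e3: "real (card (insert i F)) * E = real (card F) * E + E" using insert by (simp add: distrib_right)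
    show ?case unfolding Q_def[symmetric] e1 e2 e3 using s IH by linarith
  qed simp
  from this[OF subset_refl]
  have "\<bar>f (a + w) - f a - (\<Sum>i\<in>Basis. (w \<bullet> i) * ((f (a + \<epsilon> *\<^sub>R i) - f a) / \<epsilon>))\<bar> \<le> real DIM('a) * E"
    by (simp add: euclidean_representation)
  also have "E \<le> L * norm w * ((real DIM('a) + 1) * (norm w + \<epsilon>))" unfolding E_def
    using L \<epsilon> by (intro mult_left_mono) (auto simp: distrib_left distrib_right)
  also have "real DIM('a) * \<dots> = real DIM('a) * (L * (real DIM('a) + 1)) * norm w * (norm w + \<epsilon>)" by (simp only: mult_ac)
  finally show ?thesis by simp
qed

text \<open>The bound on the quotient itself comes from comparing the step \<open>\<epsilon>\<close> with the
  step 1, over which the increment is at most \<open>2 L\<close>.\<close>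

lemma difference_quotient_bounds:
  fixes f :: "'a::euclidean_space \<Rightarrow> real"
  assumes \<epsilon>: "0 < \<epsilon>" "\<epsilon> \<le> 1" and L: "L \<ge> 0" and f: "\<And>x. \<bar>f x\<bar> \<le> L" and i: "i \<in> Basis"
    and sl: "\<And>x a r s. \<bar>(f (x + s *\<^sub>R i) - f x) * r - s * (f (a + r *\<^sub>R i) - f a)\<bar>
       \<le> L * \<bar>s\<bar> * \<bar>r\<bar> * (norm (x - a) + \<bar>s\<bar> + \<bar>r\<bar>)"
  shows "\<bar>(f (a + \<epsilon> *\<^sub>R i) - f a) / \<epsilon>\<bar> \<le> 4 * L"
    and "\<bar>(f (x + \<epsilon> *\<^sub>R i) - f x) / \<epsilon> - (f (a + \<epsilon> *\<^sub>R i) - f a) / \<epsilon>\<bar> \<le> L * (norm (x - a) + 2 * \<epsilon>)"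
proof -
  have "\<bar>(f (a + 1 *\<^sub>R i) - f a) * \<epsilon> - 1 * (f (a + \<epsilon> *\<^sub>R i) - f a)\<bar> \<le> L * \<bar>1\<bar> * \<bar>\<epsilon>\<bar> * (norm (a - a) + \<bar>1\<bar> + \<bar>\<epsilon>\<bar>)" by (rule sl)
  hence a: "\<bar>(f (a + i) - f a) * \<epsilon> - (f (a + \<epsilon> *\<^sub>R i) - f a)\<bar> \<le> (L * \<epsilon>) * (1 + \<epsilon>)" using \<epsilon> by simp
  have b: "(L * \<epsilon>) * (1 + \<epsilon>) \<le> (L * \<epsilon>) * 2" using \<epsilon> L by (intro mult_left_mono) auto
  have "\<bar>f (a + i) - f a\<bar> \<le> 2 * L" using f[of "a + i"] f[of a] by linarith
  hence "\<bar>f (a + i) - f a\<bar> * \<epsilon> \<le> 2 * L * \<epsilon>" using \<epsilon> by (intro mult_right_mono) auto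
  hence "\<bar>(f (a + i) - f a) * \<epsilon>\<bar> \<le> 2 * (L * \<epsilon>)" using \<epsilon> by (simp add: abs_mult mult.assoc)
  hence "\<bar>f (a + \<epsilon> *\<^sub>R i) - f a\<bar> \<le> 4 * (L * \<epsilon>)" using a b by linarith
  thus "\<bar>(f (a + \<epsilon> *\<^sub>R i) - f a) / \<epsilon>\<bar> \<le> 4 * L" unfolding abs_divide using \<epsilon> by (simp add: pos_divide_le_eq mult.assoc)
  have "\<bar>(f (x + \<epsilon> *\<^sub>R i) - f x) * \<epsilon> - \<epsilon> * (f (a + \<epsilon> *\<^sub>R i) - f a)\<bar> \<le> L * \<bar>\<epsilon>\<bar> * \<bar>\<epsilon>\<bar> * (norm (x - a) + \<bar>\<epsilon>\<bar> + \<bar>\<epsilon>\<bar>)" by (rule sl)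
  also have "\<dots> = (L * (norm (x - a) + 2 * \<epsilon>) * \<epsilon>) * \<epsilon>" using \<epsilon> by simp
  also have "(f (x + \<epsilon> *\<^sub>R i) - f x) * \<epsilon> - \<epsilon> * (f (a + \<epsilon> *\<^sub>R i) - f a) = ((f (x + \<epsilon> *\<^sub>R i) - f x) - (f (a + \<epsilon> *\<^sub>R i) - f a)) * \<epsilon>"
    using left_diff_distrib[of "f (x + \<epsilon> *\<^sub>R i) - f x" "f (a + \<epsilon> *\<^sub>R i) - f a" \<epsilon>, symmetric] by (simp only: mult.commute)
  finally have "\<bar>(f (x + \<epsilon> *\<^sub>R i) - f x) - (f (a + \<epsilon> *\<^sub>R i) - f a)\<bar> \<le> L * (norm (x - a) + 2 * \<epsilon>) * \<epsilon>"
    using \<epsilon> by (simp add: abs_mult)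
  thus "\<bar>(f (x + \<epsilon> *\<^sub>R i) - f x) / \<epsilon> - (f (a + \<epsilon> *\<^sub>R i) - f a) / \<epsilon>\<bar> \<le> L * (norm (x - a) + 2 * \<epsilon>)"
    unfolding diff_divide_distrib[symmetric] abs_divide using \<epsilon> by (simp add: pos_divide_le_eq)
qed

section \<open>Curvature on the moving boundary\<close>

lemma lipschitz_by_defining_functions:
  fixes F :: "'b::euclidean_space \<Rightarrow> real"
  assumes S: "compact S"
    and rep: "\<And>z. z \<in> S \<Longrightarrow> \<exists>V f. open V \<and> z \<in> V \<and> Ck_on 1 V f \<and> (\<forall>y\<in>V \<inter> S. F y = f y)"
  shows "\<exists>L\<ge>0. \<forall>y\<in>S. \<bar>F y\<bar> \<le> L \<and> (\<forall>y'\<in>S. \<bar>F y - F y'\<bar> \<le> L * dist y y')"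
proof (rule locally_lipschitz_on_compact[OF S])
  fix z assume z: "z \<in> S"
  obtain V f where V: "open V" "z \<in> V" "Ck_on 1 V f" "\<forall>y\<in>V \<inter> S. F y = f y" using rep[OF z] by blast
  obtain r L where r: "r > 0" "\<forall>y\<in>ball z r. \<forall>y'\<in>ball z r. \<bar>f y - f y'\<bar> \<le> L * dist y y'"
    using Ck_one_locally_lipschitz[OF V(1-3)] by blast
  obtain e where e: "e > 0" "ball z e \<subseteq> V" using V(1,2) open_contains_ball by blast
  have "\<bar>F y - F y'\<bar> \<le> L * dist y y'" if "y \<in> ball z (min r e) \<inter> S" "y' \<in> ball z (min r e) \<inter> S" for y y'
  proof -
    have "y \<in> ball z e" "y' \<in> ball z e" "y \<in> ball z r" "y' \<in> ball z r" using that by simp_all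
    hence "F y = f y" "F y' = f y'" "\<bar>f y - f y'\<bar> \<le> L * dist y y'" using V(4) e(2) r(2) that by blast+
    thus ?thesis by (simp only:)
  qed
  thus "\<exists>r>0. \<exists>L. \<forall>y\<in>ball z r \<inter> S. \<forall>y'\<in>ball z r \<inter> S. \<bar>F y - F y'\<bar> \<le> L * dist y y'"
    using r(1) e(1) by (intro exI[of _ "min r e"] conjI exI[of _ L] ballI) simp_all
qed

context regular_tube begin

text \<open>The trace of the square of the Hessian; on the boundary, the sum of the squared principal
  curvatures.\<close>

definition weingarten_square where
  "weingarten_square z = (\<Sum>i\<in>Basis. \<Sum>j\<in>Basis. (H (fst z) (snd z) j \<bullet> i) * (H (fst z) (snd z) i \<bullet> j))"

lemma S_compact: "compact S" and S_nonempty: "S \<noteq> {}"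
proof -
  have Se: "S = {z \<in> UNIV \<times> {0..T}. signed_dist (\<Omega> (snd z)) (fst z) = 0}"
    using S_iff unfolding d_def by (auto simp: mem_Times_iff)
  have "closed (UNIV \<times> {0..T} :: ('a \<times> real) set)" by (intro closed_Times closed_UNIV closed_atLeastAtMost)
  hence cl: "closed S" unfolding Se by (rule continuous_closed_preimage_constant[OF signed_dist_continuous[OF smooth]])
  obtain R where R: "\<forall>t\<in>{0..T}. frontier (\<Omega> t) \<subseteq> cball 0 R" using smooth_family_bounded[OF smooth] T by (meson less_imp_le)
  have "S \<subseteq> cball 0 R \<times> {0..T}" unfolding S_def using R by (auto simp: mem_Times_iff subset_iff)
  moreover have "bounded (cball 0 R \<times> {0..T} :: ('a \<times> real) set)" by (intro bounded_Times bounded_cball bounded_closed_interval)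
  ultimately have "bounded S" using bounded_subset by blast
  thus "compact S" using cl compact_eq_bounded_closed by blast
  have "frontier (\<Omega> 0) \<noteq> {}" using Omega(2)[of 0] T by simp
  thus "S \<noteq> {}" unfolding S_def using T by auto
qed

lemma S_lipschitz:
  "\<exists>L\<ge>1. (\<forall>y\<in>S. \<forall>y'\<in>S. dist y y' \<le> L \<and> \<bar>weingarten_square y - weingarten_square y'\<bar> \<le> L * dist y y' \<and>
       (\<forall>i\<in>Basis. \<bar>N (fst y) (snd y) \<bullet> i - N (fst y') (snd y') \<bullet> i\<bar> \<le> L * dist y y')) \<and>
     (\<forall>y\<in>S. \<bar>weingarten_square y\<bar> \<le> L \<and> (\<forall>w. norm (H (fst y) (snd y) w) \<le> L * norm w))"
proof -
  let ?P = "\<lambda>F L. L \<ge> 0 \<and> (\<forall>y\<in>S. \<bar>F y\<bar> \<le> L \<and> (\<forall>y'\<in>S. \<bar>F y - F y'\<bar> \<le> L * dist y y'))"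
  have n: "\<exists>L. ?P (\<lambda>z. N (fst z) (snd z) \<bullet> i) L" if i: "i \<in> Basis" for i
  proof (rule lipschitz_by_defining_functions[OF S_compact])
    fix z assume "z \<in> S"
    from local_representation[OF this] i
    show "\<exists>V f. open V \<and> z \<in> V \<and> Ck_on 1 V f \<and> (\<forall>y\<in>V \<inter> S. N (fst y) (snd y) \<bullet> i = f y)"
      by (metis prod.collapse)
  qed
  have a: "\<exists>L. ?P (\<lambda>z. H (fst z) (snd z) j \<bullet> i) L" if i: "i \<in> Basis" "j \<in> Basis" for i j
  proof (rule lipschitz_by_defining_functions[OF S_compact])
    fix z assume "z \<in> S"
    from local_representation[OF this] i
    show "\<exists>V f. open V \<and> z \<in> V \<and> Ck_on 1 V f \<and> (\<forall>y\<in>V \<inter> S. H (fst y) (snd y) j \<bullet> i = f y)"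
      by (metis prod.collapse)
  qed
  have th: "\<exists>L. ?P weingarten_square L"
  proof (rule lipschitz_by_defining_functions[OF S_compact])
    fix z assume "z \<in> S"
    from local_representation[OF this] obtain V \<nu> a where V: "open V" "z \<in> V"
      and a: "\<forall>i\<in>Basis. \<forall>j\<in>Basis. Ck_on 1 V (a i j)"
      and e: "\<forall>y s. (y, s) \<in> V \<inter> S \<longrightarrow> (\<forall>i\<in>Basis. N y s \<bullet> i = \<nu> i (y, s) \<and> (\<forall>j\<in>Basis. H y s j \<bullet> i = a i j (y, s)))"
      by (elim exE conjE)
    show "\<exists>V f. open V \<and> z \<in> V \<and> Ck_on 1 V f \<and> (\<forall>y\<in>V \<inter> S. weingarten_square y = f y)"
    proof (intro exI[of _ V] exI[of _ "\<lambda>y. \<Sum>i\<in>Basis. \<Sum>j\<in>Basis. a i j y * a j i y"] conjI ballI V)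
      show "Ck_on 1 V (\<lambda>y. \<Sum>i\<in>Basis. \<Sum>j\<in>Basis. a i j y * a j i y)"
        by (intro Ck_on_sum[OF V(1)] Ck_on_mult[OF V(1)] a[rule_format])
      fix y assume y: "y \<in> V \<inter> S"
      have "H (fst y) (snd y) j \<bullet> i = a i j y" if "i \<in> Basis" "j \<in> Basis" for i j
        using e[THEN spec, THEN spec, THEN mp, of "fst y" "snd y"] y that by simp
      thus "weingarten_square y = (\<Sum>i\<in>Basis. \<Sum>j\<in>Basis. a i j y * a j i y)" unfolding weingarten_square_def by simp
    qed
  qed
  obtain Ln where Ln: "\<And>i. i \<in> Basis \<Longrightarrow> ?P (\<lambda>z. N (fst z) (snd z) \<bullet> i) (Ln i)" using n by metis
  obtain La where La: "\<And>i j. i \<in> Basis \<Longrightarrow> j \<in> Basis \<Longrightarrow> ?P (\<lambda>z. H (fst z) (snd z) j \<bullet> i) (La i j)" using a by metis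
  obtain Lt where Lt: "?P weingarten_square Lt" using th by blast
  obtain Ld where Ld: "\<And>y y'. y \<in> S \<Longrightarrow> y' \<in> S \<Longrightarrow> dist y y' \<le> Ld"
    using compact_imp_bounded[OF S_compact] bounded_two_points by metis
  define L where "L = 1 + \<bar>Ld\<bar> + Lt + (\<Sum>i\<in>Basis. Ln i) + (\<Sum>j\<in>Basis. \<Sum>i\<in>Basis. La i j)"
  have nn: "0 \<le> (\<Sum>i\<in>Basis. Ln i)" "0 \<le> (\<Sum>j\<in>Basis. \<Sum>i\<in>Basis. La i j)" using Ln La by (auto intro!: sum_nonneg)
  have L: "L \<ge> 1" "Ld \<le> L" "Lt \<le> L" "(\<Sum>j\<in>Basis. \<Sum>i\<in>Basis. La i j) \<le> L" "(\<Sum>i\<in>Basis. Ln i) \<le> L"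
    unfolding L_def using nn Lt by linarith+
  have LnL: "Ln i \<le> L" if "i \<in> Basis" for i
    using member_le_sum[of i Basis Ln] that Ln L(5) by fastforce
  show ?thesis
  proof (intro exI[of _ L] conjI ballI allI)
    fix y y' assume y: "y \<in> S" "y' \<in> S"
    show "dist y y' \<le> L" using Ld[OF y] L(2) by simp
    have "\<bar>weingarten_square y - weingarten_square y'\<bar> \<le> Lt * dist y y'" using Lt y by blast
    also have "\<dots> \<le> L * dist y y'" by (intro mult_right_mono L(3) zero_le_dist)
    finally show "\<bar>weingarten_square y - weingarten_square y'\<bar> \<le> L * dist y y'" .
    fix i :: 'a assume i: "i \<in> Basis"
    have "\<bar>N (fst y) (snd y) \<bullet> i - N (fst y') (snd y') \<bullet> i\<bar> \<le> Ln i * dist y y'" using Ln[OF i] y by blast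
    also have "\<dots> \<le> L * dist y y'" by (intro mult_right_mono LnL[OF i] zero_le_dist)
    finally show "\<bar>N (fst y) (snd y) \<bullet> i - N (fst y') (snd y') \<bullet> i\<bar> \<le> L * dist y y'" .
  next
    fix y assume y: "y \<in> S"
    show "\<bar>weingarten_square y\<bar> \<le> L" using Lt y L(3) by force
    fix w :: 'a
    have "fst y \<in> frontier (\<Omega> (snd y))" "snd y \<in> {0..T}" using y unfolding S_def by auto
    hence lin: "linear (H (fst y) (snd y))" using d_zero[of "snd y" "fst y"] D by (intro H_linear) auto
    have "norm (H (fst y) (snd y) w) = norm (\<Sum>j\<in>Basis. (w \<bullet> j) *\<^sub>R H (fst y) (snd y) j)"
      unfolding linear_sum_basis[OF lin, symmetric] ..
    also have "\<dots> \<le> (\<Sum>j\<in>Basis. norm ((w \<bullet> j) *\<^sub>R H (fst y) (snd y) j))" by (rule norm_sum)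
    also have "\<dots> \<le> (\<Sum>j\<in>Basis. norm w * (\<Sum>i\<in>Basis. La i j))"
    proof (rule sum_mono)
      fix j :: 'a assume j: "j \<in> Basis"
      have "norm (H (fst y) (snd y) j) \<le> (\<Sum>i\<in>Basis. \<bar>H (fst y) (snd y) j \<bullet> i\<bar>)" by (rule norm_le_l1)
      also have "\<dots> \<le> (\<Sum>i\<in>Basis. La i j)" by (intro sum_mono) (use La[OF _ j] y in blast)
      finally show "norm ((w \<bullet> j) *\<^sub>R H (fst y) (snd y) j) \<le> norm w * (\<Sum>i\<in>Basis. La i j)"
        unfolding norm_scaleR using Basis_le_norm[OF j, of w] by (intro mult_mono) auto
    qed
    also have "\<dots> = norm w * (\<Sum>j\<in>Basis. \<Sum>i\<in>Basis. La i j)" by (simp only: sum_distrib_left)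
    also have "\<dots> \<le> norm w * L" by (intro mult_left_mono L(4) norm_ge_zero)
    finally show "norm (H (fst y) (snd y) w) \<le> L * norm w" by (simp only: mult.commute)
  qed (rule L(1))
qed

lemma d_line_derivs:
  assumes t: "t \<in> {0..T}" and x: "\<bar>d x t\<bar> < D"
  shows "line_derivs (\<lambda>y. d y t) x b (N x t \<bullet> b) (H x t b \<bullet> b)"
proof -
  have line: "((\<lambda>s. x + s *\<^sub>R b) has_derivative (\<lambda>s. s *\<^sub>R b)) (at s)" for s by (auto intro!: derivative_eq_intros)
  obtain e where e: "e > 0" "\<forall>y\<in>ball x e. \<bar>d y t\<bar> < D" using d_nbhd[OF t x] by blast
  have "((\<lambda>s. x + s *\<^sub>R b) \<longlongrightarrow> x + 0 *\<^sub>R b) (nhds 0)"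
    by (intro tendsto_add tendsto_const tendsto_scaleR filterlim_ident)
  hence "((\<lambda>s. x + s *\<^sub>R b) \<longlongrightarrow> x) (nhds 0)" by simp
  from tendstoD[OF this e(1)] have ev: "\<forall>\<^sub>F s in nhds 0. ((\<lambda>s. d (x + s *\<^sub>R b) t) has_real_derivative N (x + s *\<^sub>R b) t \<bullet> b) (at s)"
  proof eventually_elim
    case (elim s)
    hence "\<bar>d (x + s *\<^sub>R b) t\<bar> \<le> D" using e(2) by (simp add: dist_commute less_imp_le)
    from has_derivative_compose[OF line d_deriv[OF t this]]
    have "((\<lambda>s. d (x + s *\<^sub>R b) t) has_derivative (\<lambda>r. N (x + s *\<^sub>R b) t \<bullet> (r *\<^sub>R b))) (at s)" .
    moreover have "(\<lambda>r. N (x + s *\<^sub>R b) t \<bullet> (r *\<^sub>R b)) = (*) (N (x + s *\<^sub>R b) t \<bullet> b)" by (rule ext) simp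
    ultimately show ?case unfolding has_field_derivative_def by (simp only:)
  qed
  have "((\<lambda>y. N y t) has_derivative H x t) (at (x + 0 *\<^sub>R b))" using N_deriv[OF t less_imp_le[OF x]] by simp
  from has_derivative_inner_left[OF has_derivative_compose[OF line this], of b]
  have "((\<lambda>s. N (x + s *\<^sub>R b) t \<bullet> b) has_derivative (\<lambda>s. H x t (s *\<^sub>R b) \<bullet> b)) (at 0)" .
  moreover have "(\<lambda>s. H x t (s *\<^sub>R b) \<bullet> b) = (*) (H x t b \<bullet> b)"
    by (rule ext) (simp add: linear_cmul[OF H_linear[OF t less_imp_le[OF x]]])
  ultimately have "((\<lambda>s. N (x + s *\<^sub>R b) t \<bullet> b) has_real_derivative H x t b \<bullet> b) (at 0)"
    unfolding has_field_derivative_def by (simp only:)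
  thus ?thesis unfolding line_derivs_def using ev by (intro exI[of _ "\<lambda>s. N (x + s *\<^sub>R b) t \<bullet> b"]) simp
qed

lemma proj_on_S:
  assumes t: "t \<in> {0..T}" and x: "\<bar>d x t\<bar> \<le> D"
  shows "(proj x t, t) \<in> S" "dist x (proj x t) = \<bar>d x t\<bar>" "N (proj x t) t = N x t" "d (proj x t) t = 0"
proof -
  show "(proj x t, t) \<in> S" using eikonal(2)[OF t x] t unfolding S_def proj_def by simp
  thus "d (proj x t) t = 0" using S_iff by blast
  show "dist x (proj x t) = \<bar>d x t\<bar>" unfolding proj_def dist_norm using eikonal(1)[OF t x] by simp
  show "N (proj x t) t = N x t" using eikonal(3)[OF t x] unfolding proj_def .
qed

lemma mean_curvature_trace:
  assumes t: "t \<in> {0..T}" and x: "d x t = 0" and k: "has_mean_curvature (\<Omega> t) x k"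
  shows "(\<Sum>b\<in>Basis. H x t b \<bullet> b) = - k"
proof -
  have dD: "\<bar>d x t\<bar> < D" "\<bar>d x t\<bar> \<le> D" using x D by auto
  obtain B \<kappa> where B: "pairwise orthogonal B" "\<forall>e\<in>B. norm e = 1" "span B = {v. v \<bullet> N x t = 0}"
    "\<forall>e\<in>B. H x t e = - \<kappa> e *\<^sub>R e" "k = (\<Sum>e\<in>B. \<kappa> e)"
    using k unfolding has_mean_curvature_def N_def H_def by blast
  have pr: "proj x t = x" unfolding proj_def x by simp
  have "H x t (N x t) = 0" using hessian_identity(2)[OF t dD(1)] unfolding pr .
  from trace_orthonormal[OF H_linear[OF t dD(2)] B(1,2,3) eikonal(1)[OF t dD(2)] this B(4)]
  show ?thesis unfolding B(5) .
qed

text \<open>Inserting the identity \<open>B = A - d A B\<close> for the Hessians \<open>B\<close> at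
  \<open>x\<close> and \<open>A\<close> at the foot point into itself gives \<open>B = A - d A\<^sup>2 +
  d\<^sup>2 A\<^sup>2 B\<close>; the traces are compared term by term.\<close>

lemma trace_expansion:
  assumes t: "t \<in> {0..T}" and x: "\<bar>d x t\<bar> < D" and K: "K \<ge> 1" "\<And>w. norm (H (proj x t) t w) \<le> K * norm w"
    and small: "\<bar>d x t\<bar> * K \<le> 1/2"
  shows "\<bar>(\<Sum>b\<in>Basis. H x t b \<bullet> b) - (\<Sum>b\<in>Basis. H (proj x t) t b \<bullet> b) + d x t * weingarten_square (proj x t, t)\<bar>
      \<le> real DIM('a) * (2 * K ^ 3) * (d x t)\<^sup>2"
    and "\<bar>\<Sum>b\<in>Basis. H x t b \<bullet> b\<bar> \<le> real DIM('a) * (2 * K)"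
    and "\<bar>\<Sum>b\<in>Basis. H (proj x t) t b \<bullet> b\<bar> \<le> real DIM('a) * K"
proof -
  define A where "A = H (proj x t) t"
  define B where "B = H x t"
  define \<rho> where "\<rho> = d x t"
  have "\<bar>d (proj x t) t\<bar> \<le> D" using proj_on_S(4)[OF t less_imp_le[OF x]] D by simp
  hence linA: "linear A" unfolding A_def by (rule H_linear[OF t])
  interpret A: linear A by (rule linA)
  have id: "B w = A w - \<rho> *\<^sub>R A (B w)" for w unfolding A_def B_def \<rho>_def by (rule hessian_identity(1)[OF t x])
  have KA: "norm (A w) \<le> K * norm w" for w using K(2) unfolding A_def .
  have KB: "norm (B w) \<le> 2 * K * norm w" for w
  proof -
    have "norm (B w) \<le> norm (A w) + \<bar>\<rho>\<bar> * norm (A (B w))" by (subst id) (metis norm_scaleR norm_triangle_ineq4)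
    also have "\<bar>\<rho>\<bar> * norm (A (B w)) \<le> \<bar>\<rho>\<bar> * (K * norm (B w))" by (intro mult_left_mono KA) simp
    also have "\<dots> \<le> 1/2 * norm (B w)" using mult_right_mono[OF small norm_ge_zero[of "B w"]] unfolding \<rho>_def by (simp add: mult.assoc)
    finally have "norm (B w) \<le> 2 * norm (A w)" by simp
    thus ?thesis using KA[of w] by simp
  qed
  have KAAB: "norm (A (A (B w))) \<le> 2 * K ^ 3 * norm w" for w
  proof -
    have "norm (A (A (B w))) \<le> K * (K * (2 * K * norm w))"
      by (rule order_trans[OF KA mult_left_mono[OF order_trans[OF KA mult_left_mono[OF KB]]]]) (use K(1) in auto)
    thus ?thesis by (simp add: power3_eq_cube mult_ac)
  qed
  have exp: "B w = A w - \<rho> *\<^sub>R A (A w) + \<rho>\<^sup>2 *\<^sub>R A (A (B w))" for w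
  proof -
    have AB: "A (B w) = A (A w) - \<rho> *\<^sub>R A (A (B w))" by (subst id) (simp only: A.diff A.scale)
    have "B w = A w - \<rho> *\<^sub>R (A (A w) - \<rho> *\<^sub>R A (A (B w)))" by (subst AB[symmetric]) (rule id)
    from this show ?thesis unfolding scaleR_diff_right scaleR_scaleR power2_eq_square diff_diff_eq2 diff_add_eq .
  qed
  have tr2: "weingarten_square (proj x t, t) = (\<Sum>b\<in>Basis. A (A b) \<bullet> b)"
    unfolding weingarten_square_def fst_conv snd_conv A_def[symmetric]
  proof (rule sum.cong[OF refl])
    fix i :: 'a assume "i \<in> Basis"
    have "A (A i) = (\<Sum>j\<in>Basis. (A i \<bullet> j) *\<^sub>R A j)" by (rule linear_sum_basis[OF linA])
    thus "(\<Sum>j\<in>Basis. (A j \<bullet> i) * (A i \<bullet> j)) = A (A i) \<bullet> i" by (simp add: inner_sum_left mult.commute)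
  qed
  have sb: "\<bar>\<Sum>b\<in>Basis. G b \<bullet> b\<bar> \<le> real DIM('a) * c" if "\<And>w. norm (G w) \<le> c * norm w" for G :: "'a \<Rightarrow> 'a" and c
  proof -
    have "\<bar>\<Sum>b\<in>Basis. G b \<bullet> b\<bar> \<le> (\<Sum>b\<in>Basis. \<bar>G b \<bullet> b\<bar>)" by (rule sum_abs)
    also have "\<dots> \<le> (\<Sum>b\<in>(Basis::'a set). c)"
    proof (rule sum_mono)
      fix b :: 'a assume b: "b \<in> Basis"
      have "\<bar>G b \<bullet> b\<bar> \<le> norm (G b)" by (rule Basis_le_norm[OF b])
      thus "\<bar>G b \<bullet> b\<bar> \<le> c" using that[of b] b by simp
    qed
    finally show ?thesis by simp
  qed
  show "\<bar>\<Sum>b\<in>Basis. H x t b \<bullet> b\<bar> \<le> real DIM('a) * (2 * K)" using sb[of B "2 * K"] KB unfolding B_def by blast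
  show "\<bar>\<Sum>b\<in>Basis. H (proj x t) t b \<bullet> b\<bar> \<le> real DIM('a) * K" using sb[of A K] KA unfolding A_def by blast
  have "(\<Sum>b\<in>Basis. B b \<bullet> b) = (\<Sum>b\<in>Basis. A b \<bullet> b - \<rho> * (A (A b) \<bullet> b) + \<rho>\<^sup>2 * (A (A (B b)) \<bullet> b))"
    by (intro sum.cong refl, subst exp) (simp add: inner_add_left inner_diff_left)
  also have "\<dots> = (\<Sum>b\<in>Basis. A b \<bullet> b) - \<rho> * weingarten_square (proj x t, t) + \<rho>\<^sup>2 * (\<Sum>b\<in>Basis. A (A (B b)) \<bullet> b)"
    unfolding tr2 by (simp only: sum.distrib sum_subtractf sum_distrib_left)
  finally have "(\<Sum>b\<in>Basis. B b \<bullet> b) - (\<Sum>b\<in>Basis. A b \<bullet> b) + \<rho> * weingarten_square (proj x t, t) = \<rho>\<^sup>2 * (\<Sum>b\<in>Basis. A (A (B b)) \<bullet> b)" by linarith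
  hence "\<bar>(\<Sum>b\<in>Basis. B b \<bullet> b) - (\<Sum>b\<in>Basis. A b \<bullet> b) + \<rho> * weingarten_square (proj x t, t)\<bar> = \<rho>\<^sup>2 * \<bar>\<Sum>b\<in>Basis. A (A (B b)) \<bullet> b\<bar>"
    by (simp add: abs_mult)
  also have "\<dots> \<le> \<rho>\<^sup>2 * (real DIM('a) * (2 * K ^ 3))" by (intro mult_left_mono sb KAAB) simp
  also have "\<dots> = real DIM('a) * (2 * K ^ 3) * \<rho>\<^sup>2" by (simp only: mult.commute)
  finally show "\<bar>(\<Sum>b\<in>Basis. H x t b \<bullet> b) - (\<Sum>b\<in>Basis. H (proj x t) t b \<bullet> b) + d x t * weingarten_square (proj x t, t)\<bar>
      \<le> real DIM('a) * (2 * K ^ 3) * (d x t)\<^sup>2" unfolding A_def B_def \<rho>_def .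
qed

end

section \<open>Motion of the distance\<close>

locale forced_tube = regular_tube T D \<Omega> for T D :: real and \<Omega> :: "real \<Rightarrow> 'a::euclidean_space set" +
  fixes g :: "'a \<Rightarrow> real \<Rightarrow> real"
  assumes dtime: "\<And>x t. t \<in> {0..T} \<Longrightarrow> \<bar>signed_dist (\<Omega> t) x\<bar> \<le> D \<Longrightarrow>
       (\<lambda>s. signed_dist (\<Omega> s) x) differentiable (at t within {0..T})"
    and dtime_cont: "continuous_on (tube T \<Omega> D)
       (\<lambda>(x, t). vector_derivative (\<lambda>s. signed_dist (\<Omega> s) x) (at t within {0..T}))"
    and forcing: "admissible_forcing T g"
    and motion: "\<And>x t. t \<in> {0..T} \<Longrightarrow> x \<in> frontier (\<Omega> t) \<Longrightarrow>
       \<exists>V k. has_normal_velocity T \<Omega> t x V \<and> has_mean_curvature (\<Omega> t) x k \<and> V = k + g x t"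
begin

definition Dt where "Dt x t = vector_derivative (\<lambda>s. d x s) (at t within {0..T})"

lemma tube_iff: "(x, t) \<in> tube T \<Omega> D \<longleftrightarrow> t \<in> {0..T} \<and> \<bar>d x t\<bar> \<le> D"
  unfolding tube_def d_def by auto

lemma Dt_deriv:
  assumes t: "0 < t" "t < T" and x: "\<bar>d x t\<bar> \<le> D"
  shows "((\<lambda>s. d x s) has_real_derivative Dt x t) (at t)"
proof -
  have tT: "t \<in> {0..T}" using t by simp
  have "(\<lambda>s. d x s) differentiable (at t within {0..T})" unfolding d_def by (rule dtime[OF tT]) (use x in \<open>simp add: d_def\<close>)
  hence "((\<lambda>s. d x s) has_vector_derivative Dt x t) (at t within {0..T})"
    unfolding Dt_def using vector_derivative_works by blast
  thus ?thesis unfolding has_real_derivative_iff_has_vector_derivative at_within_Icc_at[OF t] .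
qed

lemma d_joint_nbhd:
  assumes t: "t \<in> {0..T}" and x: "\<bar>d x t\<bar> < D"
  shows "\<exists>r>0. \<forall>y. \<forall>s\<in>{0..T}. dist (y, s) (x, t) < r \<longrightarrow> \<bar>d y s\<bar> < D"
proof -
  have c: "continuous_on (UNIV \<times> {0..T}) (\<lambda>z. d (fst z) (snd z))" unfolding d_def by (rule signed_dist_continuous[OF smooth])
  have m: "(x, t) \<in> UNIV \<times> {0..T}" using t by simp
  have "D - \<bar>d x t\<bar> > 0" using x by simp
  from c[unfolded continuous_on_iff, rule_format, OF m this]
  obtain r where r: "r > 0" "\<forall>z\<in>UNIV \<times> {0..T}. dist z (x, t) < r \<longrightarrow> dist (d (fst z) (snd z)) (d (fst (x, t)) (snd (x, t))) < D - \<bar>d x t\<bar>"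
    by blast
  show ?thesis
  proof (intro exI[of _ r] conjI allI ballI impI)
    fix y s assume "s \<in> {0..T}" "dist (y, s) (x, t) < r"
    hence "dist (d y s) (d x t) < D - \<bar>d x t\<bar>" using r(2)[rule_format, of "(y, s)"] by simp
    thus "\<bar>d y s\<bar> < D" unfolding dist_real_def by linarith
  qed (rule r(1))
qed

text \<open>Let \<open>\<gamma>\<close> be the curve carried by the boundary. The quotient of \<open>d
  (\<gamma> s) t\<close> by \<open>s - t\<close> tends to \<open>V\<close> by the chain rule in space. As
  \<open>d (\<gamma> s) s = 0\<close>, the mean value theorem in time, at the fixed point \<open>\<gamma>
  s\<close>, makes it minus a value of \<open>Dt\<close> nearby, and \<open>Dt\<close> is continuous.\<close>

lemma normal_velocity:
  assumes t: "0 < t" "t < T" and x: "x \<in> frontier (\<Omega> t)" and V: "has_normal_velocity T \<Omega> t x V"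
  shows "Dt x t = - V"
proof -
  have tT: "t \<in> {0..T}" using t by simp
  have d0: "d x t = 0" using d_zero[OF tT] x by blast
  have dD: "\<bar>d x t\<bar> < D" "\<bar>d x t\<bar> \<le> D" using d0 D by auto
  obtain \<gamma> \<gamma>' where \<gamma>0: "\<gamma> t = x" and \<gamma>f: "\<forall>\<^sub>F s in at t. \<gamma> s \<in> frontier (\<Omega> s)"
    and \<gamma>d: "(\<gamma> has_vector_derivative \<gamma>') (at t)" and Ve: "V = N x t \<bullet> \<gamma>'"
    using V unfolding has_normal_velocity_def at_within_Icc_at[OF t] N_def by (metis inner_commute)
  have "((\<lambda>s. d (\<gamma> s) t) has_derivative (\<lambda>r. N x t \<bullet> (r *\<^sub>R \<gamma>'))) (at t)"
    by (rule has_derivative_compose[OF \<gamma>d[unfolded has_vector_derivative_def]]) (simp add: \<gamma>0 d_deriv[OF tT dD(2)])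
  moreover have "(\<lambda>r. N x t \<bullet> (r *\<^sub>R \<gamma>')) = (*) V" by (rule ext) (simp add: Ve)
  ultimately have "((\<lambda>s. d (\<gamma> s) t) has_real_derivative V) (at t)" unfolding has_field_derivative_def by (simp only:)
  hence lim1: "((\<lambda>s. (d (\<gamma> s) t - d (\<gamma> t) t) / (s - t)) \<longlongrightarrow> V) (at t)" unfolding has_field_derivative_iff .
  have lim2: "((\<lambda>s. (d (\<gamma> s) t - d (\<gamma> t) t) / (s - t)) \<longlongrightarrow> - Dt x t) (at t)"
  proof (rule tendstoI)
    fix e :: real assume e: "e > 0"
    have m: "(x, t) \<in> tube T \<Omega> D" unfolding tube_iff using tT dD by simp
    have "continuous_on (tube T \<Omega> D) (\<lambda>z. Dt (fst z) (snd z))"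
      using dtime_cont unfolding Dt_def d_def case_prod_beta .
    from this[unfolded continuous_on_iff, rule_format, OF m e]
    obtain r1 where r1: "r1 > 0" "\<forall>z\<in>tube T \<Omega> D. dist z (x, t) < r1 \<longrightarrow> dist (Dt (fst z) (snd z)) (Dt (fst (x, t)) (snd (x, t))) < e" by blast
    obtain r2 where r2: "r2 > 0" "\<forall>y. \<forall>s\<in>{0..T}. dist (y, s) (x, t) < r2 \<longrightarrow> \<bar>d y s\<bar> < D" using d_joint_nbhd[OF tT dD(1)] by blast
    define r where "r = min (min r1 r2 / 2) (min t (T - t))"
    have r: "r > 0" "r \<le> r1 / 2" "r \<le> r2 / 2" "r \<le> t" "r \<le> T - t" 
    proof -
      define m where "m = min r1 r2 / 2"
      have m: "m > 0" "m \<le> r1 / 2" "m \<le> r2 / 2" using r1(1) r2(1) unfolding m_def by simp_all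
      have rm: "r = min m (min t (T - t))" unfolding r_def m_def ..
      have "r \<le> m" unfolding rm by (rule min.cobounded1)
      thus "r \<le> r1 / 2" "r \<le> r2 / 2" using m by linarith+
      show "r > 0" "r \<le> t" "r \<le> T - t" unfolding rm using m(1) t by simp_all
    qed
    have "isCont \<gamma> t" by (rule has_derivative_continuous[OF \<gamma>d[unfolded has_vector_derivative_def]])
    hence "(\<gamma> \<longlongrightarrow> x) (at t)" unfolding isCont_def \<gamma>0 .
    from tendstoD[OF this r(1)] have ev1: "\<forall>\<^sub>F s in at t. dist (\<gamma> s) x < r" .
    from tendstoD[OF tendsto_ident_at r(1)] have ev2: "\<forall>\<^sub>F s in at t. dist s t < r" .
    have ev3: "\<forall>\<^sub>F s in at t. s \<noteq> t" by (simp add: eventually_at_filter)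
    from ev1 ev2 ev3 \<gamma>f show "\<forall>\<^sub>F s in at t. dist ((d (\<gamma> s) t - d (\<gamma> t) t) / (s - t)) (- Dt x t) < e"
    proof eventually_elim
      case (elim s)
      define y where "y = \<gamma> s"
      have near: "\<tau> \<in> {0..T} \<and> 0 < \<tau> \<and> \<tau> < T \<and> dist (y, \<tau>) (x, t) < min r1 r2" if "\<bar>\<tau> - t\<bar> \<le> \<bar>s - t\<bar>" for \<tau>
      proof -
        have a: "\<bar>\<tau> - t\<bar> < r" using that elim(2) by (simp add: dist_real_def)
        have "dist (y, \<tau>) (x, t) \<le> dist y x + dist \<tau> t" unfolding dist_Pair_Pair by (rule sqrt_sum_squares_le_sum) auto
        also have "\<dots> < r + r" using a elim(1) unfolding y_def dist_real_def by (intro add_strict_mono)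
        finally show ?thesis using a r by auto
      qed
      have yD: "\<bar>d y \<tau>\<bar> < D" if "\<bar>\<tau> - t\<bar> \<le> \<bar>s - t\<bar>" for \<tau> using near[OF that] r2(2) by simp
      have ys: "d y s = 0"
      proof -
        have "s \<in> {0..T}" using near[of s] by simp
        thus ?thesis using d_zero elim(4) unfolding y_def by blast
      qed
      have "\<exists>\<xi>\<in>closed_segment 0 (s - t). d y (t + (s - t)) - d y (t + 0) = (s - t) * Dt y (t + \<xi>)"
      proof (rule mean_value_from_0[where P="\<lambda>r. d y (t + r)" and P'="\<lambda>r. Dt y (t + r)"])
        fix \<rho> assume "\<rho> \<in> closed_segment 0 (s - t)"
        hence a: "\<bar>t + \<rho> - t\<bar> \<le> \<bar>s - t\<bar>" by (auto simp: closed_segment_eq_real_ivl split: if_splits)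
        have "((\<lambda>s. d y s) has_real_derivative Dt y (t + \<rho>)) (at (t + \<rho>))"
          by (rule Dt_deriv) (use near[OF a] yD[OF a] in auto)
        thus "((\<lambda>r. d y (t + r)) has_real_derivative Dt y (t + \<rho>)) (at \<rho>)"
          unfolding DERIV_shift[of "\<lambda>s. d y s" _ \<rho> t, symmetric] by (simp only: add.commute DERIV_shift[symmetric])
      qed
      then obtain \<xi> where xi: "\<xi> \<in> closed_segment 0 (s - t)" "d y (t + (s - t)) - d y (t + 0) = (s - t) * Dt y (t + \<xi>)" by blast
      have a: "\<bar>t + \<xi> - t\<bar> \<le> \<bar>s - t\<bar>" using xi(1) by (auto simp: closed_segment_eq_real_ivl split: if_splits)
      have "- d y t = (s - t) * Dt y (t + \<xi>)" using xi(2) ys by simp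
      hence "(d y t - d (\<gamma> t) t) / (s - t) = - Dt y (t + \<xi>)" using elim(3) d0 \<gamma>0 by (simp add: divide_eq_eq minus_equation_iff mult.commute)
      moreover have "dist (Dt y (t + \<xi>)) (Dt x t) < e"
      proof -
        have "(y, t + \<xi>) \<in> tube T \<Omega> D" unfolding tube_iff using near[OF a] yD[OF a] by simp
        from bspec[OF r1(2) this] show ?thesis using near[OF a] by simp
      qed
      ultimately show ?case unfolding y_def[symmetric] by (simp add: dist_real_def abs_minus_commute)
    qed
  qed
  have "V = - Dt x t" by (rule tendsto_unique[OF _ lim1 lim2]) simp
  thus ?thesis by simp
qed

text \<open>The function \<open>s \<mapsto> d x s - d (proj x t) s\<close> is bounded by \<open>dist x (proj x
  t) = \<bar>d x t\<bar>\<close>, and attains this bound up to sign at \<open>s = t\<close>, so its derivative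
  vanishes there.\<close>

lemma Dt_projection:
  assumes t: "0 < t" "t < T" and x: "\<bar>d x t\<bar> < D"
  shows "Dt x t = Dt (proj x t) t"
proof -
  have tT: "t \<in> {0..T}" using t by simp
  note p = proj_on_S[OF tT less_imp_le[OF x]]
  define f where "f s = d x s - d (proj x t) s" for s
  have "\<bar>d (proj x t) t\<bar> \<le> D" using p(4) D by simp
  hence df: "(f has_real_derivative Dt x t - Dt (proj x t) t) (at t)"
    unfolding f_def by (intro DERIV_diff Dt_deriv t less_imp_le[OF x])
  have ft: "f t = d x t" unfolding f_def p(4) by simp
  have near: "s \<in> {0..T}" if "\<bar>t - s\<bar> < min t (T - t)" for s using that by auto
  have fs: "\<bar>f s\<bar> \<le> \<bar>f t\<bar>" if "s \<in> {0..T}" for s unfolding ft unfolding f_def using d_lip[OF that, of x "proj x t"] p(2) by simp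
  have pos: "0 < min t (T - t)" using t by simp
  have "Dt x t - Dt (proj x t) t = 0"
  proof (cases "f t \<ge> 0")
    case True
    have "f s \<le> f t" if "\<bar>t - s\<bar> < min t (T - t)" for s using fs[OF near[OF that]] True by linarith
    thus ?thesis using DERIV_local_max[OF df pos] by blast
  next
    case False
    have "f t \<le> f s" if "\<bar>t - s\<bar> < min t (T - t)" for s using fs[OF near[OF that]] False by linarith
    thus ?thesis using DERIV_local_min[OF df pos] by blast
  qed
  thus ?thesis by simp
qed

lemma Dt_eq:
  assumes t: "0 < t" "t < T" and x: "\<bar>d x t\<bar> < D"
  shows "Dt x t = (\<Sum>b\<in>Basis. H (proj x t) t b \<bullet> b) - g (proj x t) t"
proof -
  have tT: "t \<in> {0..T}" using t by simp
  note p = proj_on_S[OF tT less_imp_le[OF x]]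
  have pf: "proj x t \<in> frontier (\<Omega> t)" using p(4) d_zero[OF tT] by blast
  obtain V k where V: "has_normal_velocity T \<Omega> t (proj x t) V" "has_mean_curvature (\<Omega> t) (proj x t) k" "V = k + g (proj x t) t"
    using motion[OF tT pf] by blast
  show ?thesis unfolding Dt_projection[OF assms] normal_velocity[OF t pf V(1)] mean_curvature_trace[OF tT p(4) V(2)] V(3) by simp
qed

definition quotient where
  "quotient \<epsilon> i z = (g (fst z + \<epsilon> *\<^sub>R i) (snd z) - g (fst z) (snd z)) / \<epsilon>"

text \<open>The function \<open>h\<close> of the expansion of \<open>d\<^sub>t - \<Delta>d + g\<close>, with
  the normal derivative of \<open>g\<close> replaced by difference quotients of step
  \<open>\<epsilon>\<close>: they make sense pointwise for a Sobolev function, and errors of order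
  \<open>\<epsilon>\<close> are harmless.\<close>

definition slope where
  "slope \<epsilon> z = weingarten_square z + (\<Sum>i\<in>Basis. (N (fst z) (snd z) \<bullet> i) * quotient \<epsilon> i z)"

text \<open>On the boundary the law of motion reads \<open>d\<^sub>t = tr A - g\<close>. At \<open>x\<close>
  the time derivative is that of the foot point, the Laplacian is \<open>tr A - d tr A\<^sup>2\<close> up to
  \<open>O(d\<^sup>2)\<close>, and \<open>g\<close> is expanded at the foot point in the normal direction.\<close>

theorem distance_is_tracked:
  "\<exists>C\<ge>1. \<exists>\<delta>>0. \<forall>\<epsilon>. 0 < \<epsilon> \<and> \<epsilon> \<le> 1 \<longrightarrow> tracked_distance T C \<delta> \<epsilon> S d g (slope \<epsilon>)"
proof -
  from admissible_forcing_bounds[OF T forcing] obtain G where G1: "G \<ge> 1"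
    and G: "\<forall>x. \<forall>t\<in>{0..T}. \<bar>g x t\<bar> \<le> G"
    "\<forall>t\<in>{0..T}. \<forall>i\<in>Basis. \<forall>x a r s. \<bar>(g (x + s *\<^sub>R i) t - g x t) * r - s * (g (a + r *\<^sub>R i) t - g a t)\<bar>
       \<le> G * \<bar>s\<bar> * \<bar>r\<bar> * (norm (x - a) + \<bar>s\<bar> + \<bar>r\<bar>)"
    "\<forall>t\<in>{0..T}. \<forall>t'\<in>{0..T}. \<forall>i\<in>Basis. \<forall>a r. \<bar>g (a + r *\<^sub>R i) t - g a t - g (a + r *\<^sub>R i) t' + g a t'\<bar> \<le> G * \<bar>r\<bar> * \<bar>t - t'\<bar>"
    by (elim exE conjE)
  note gG = G(1)[rule_format] and sl = G(2)[rule_format] and mx = G(3)[rule_format]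
  obtain L where L1: "L \<ge> 1" and Ld: "\<And>y y'. y \<in> S \<Longrightarrow> y' \<in> S \<Longrightarrow> dist y y' \<le> L"
    and Lw: "\<And>y y'. y \<in> S \<Longrightarrow> y' \<in> S \<Longrightarrow> \<bar>weingarten_square y - weingarten_square y'\<bar> \<le> L * dist y y'"
    and Ln: "\<And>y y' i. y \<in> S \<Longrightarrow> y' \<in> S \<Longrightarrow> i \<in> Basis \<Longrightarrow> \<bar>N (fst y) (snd y) \<bullet> i - N (fst y') (snd y') \<bullet> i\<bar> \<le> L * dist y y'"
    and Lb: "\<And>y. y \<in> S \<Longrightarrow> \<bar>weingarten_square y\<bar> \<le> L"
    and LH: "\<And>y w. y \<in> S \<Longrightarrow> norm (H (fst y) (snd y) w) \<le> L * norm w"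
    using S_lipschitz by blast
  define n where "n = real DIM('a)"
  have n0: "n \<ge> 0" unfolding n_def by simp
  have L0: "L \<ge> 0" and G0: "G \<ge> 0" using L1 G1 by auto
  have SN: "snd y \<in> {0..T}" "norm (N (fst y) (snd y)) = 1" if "y \<in> S" for y
  proof -
    show "snd y \<in> {0..T}" using that unfolding S_def by simp
    moreover have "d (fst y) (snd y) = 0" using S_iff[of "fst y" "snd y"] that by simp
    ultimately show "norm (N (fst y) (snd y)) = 1" using eikonal(1) D by simp
  qed
  define C1 where "C1 = L + n * (4 * L * G + 2 * G)"
  define C where "C = 1 + L + G + C1 + n * (4 * G) + n * (2 * L ^ 3) + n * (G * (n + 1)) + n * (2 * L)"
  have nn: "0 \<le> n * (4 * L * G + 2 * G)" "0 \<le> n * (4 * G)" "0 \<le> n * (2 * L ^ 3)" "0 \<le> n * (G * (n + 1))" "0 \<le> n * (2 * L)" "0 \<le> n * L"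
    using n0 L0 G0 by simp_all
  have C: "C \<ge> 1" "L \<le> C" "G \<le> C" "C1 \<le> C" "L + n * (4 * G) \<le> C" "n * (2 * L) \<le> C" "n * L + G \<le> C"
    "n * (2 * L ^ 3) + n * (G * (n + 1)) + C1 \<le> C" "C1 \<ge> 0"
    unfolding C_def C1_def using nn L0 G0 by linarith+
  define \<delta> where "\<delta> = min D (1 / (2 * L))"
  have \<delta>: "\<delta> > 0" unfolding \<delta>_def using D L1 by simp
  have small: "\<bar>d x t\<bar> < D" "\<bar>d x t\<bar> * L \<le> 1/2" if "\<bar>d x t\<bar> < \<delta>" for x t
  proof -
    show "\<bar>d x t\<bar> < D" using that unfolding \<delta>_def by simp
    have "\<bar>d x t\<bar> \<le> 1 / (2 * L)" using that unfolding \<delta>_def by simp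
    hence "\<bar>d x t\<bar> * L \<le> 1 / (2 * L) * L" using L0 by (intro mult_right_mono)
    thus "\<bar>d x t\<bar> * L \<le> 1/2" using L1 by simp
  qed
  have "tracked_distance T C \<delta> \<epsilon> S d g (slope \<epsilon>)" if \<epsilon>: "0 < \<epsilon>" "\<epsilon> \<le> 1" for \<epsilon>
  proof -
    have qb: "\<bar>quotient \<epsilon> i y\<bar> \<le> 4 * G" if y: "y \<in> S" and i: "i \<in> Basis" for y i
      unfolding quotient_def
      by (rule difference_quotient_bounds(1)[where f="\<lambda>x. g x (snd y)", OF \<epsilon> G0 gG[OF SN(1)[OF y]] i sl[OF SN(1)[OF y] i]])
    have ql: "\<bar>quotient \<epsilon> i y - quotient \<epsilon> i y'\<bar> \<le> 2 * G * (dist y y' + \<epsilon>)" if y: "y \<in> S" "y' \<in> S" and i: "i \<in> Basis" for y y' i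
    proof -
      obtain x t where ye: "y = (x, t)" by (cases y)
      obtain x' t' where ye': "y' = (x', t')" by (cases y')
      have t: "t \<in> {0..T}" "t' \<in> {0..T}" using SN(1)[OF y(1)] SN(1)[OF y(2)] ye ye' by auto
      have a: "\<bar>(g (x + \<epsilon> *\<^sub>R i) t - g x t) / \<epsilon> - (g (x' + \<epsilon> *\<^sub>R i) t - g x' t) / \<epsilon>\<bar> \<le> G * (norm (x - x') + 2 * \<epsilon>)"
        by (rule difference_quotient_bounds(2)[where f="\<lambda>x. g x t", OF \<epsilon> G0 gG[OF t(1)] i sl[OF t(1) i]])
      have "\<bar>g (x' + \<epsilon> *\<^sub>R i) t - g x' t - g (x' + \<epsilon> *\<^sub>R i) t' + g x' t'\<bar> \<le> G * \<bar>\<epsilon>\<bar> * \<bar>t - t'\<bar>" by (rule mx[OF t i])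
      hence "\<bar>(g (x' + \<epsilon> *\<^sub>R i) t - g x' t) - (g (x' + \<epsilon> *\<^sub>R i) t' - g x' t')\<bar> \<le> (G * \<bar>t - t'\<bar>) * \<epsilon>" using \<epsilon> by (simp add: algebra_simps)
      hence b: "\<bar>(g (x' + \<epsilon> *\<^sub>R i) t - g x' t) / \<epsilon> - (g (x' + \<epsilon> *\<^sub>R i) t' - g x' t') / \<epsilon>\<bar> \<le> G * \<bar>t - t'\<bar>"
        unfolding diff_divide_distrib[symmetric] abs_divide using \<epsilon> by (simp add: pos_divide_le_eq)
      have c: "norm (x - x') \<le> dist y y'" "\<bar>t - t'\<bar> \<le> dist y y'"
        using dist_fst_le[of y y'] dist_snd_le[of y y'] unfolding ye ye' by (simp_all add: dist_norm)
      have "G * (norm (x - x') + 2 * \<epsilon>) \<le> G * (dist y y' + 2 * \<epsilon>)" "G * \<bar>t - t'\<bar> \<le> G * dist y y'"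
        using c G0 by (auto intro!: mult_left_mono)
      hence "\<bar>quotient \<epsilon> i y - quotient \<epsilon> i y'\<bar> \<le> G * (dist y y' + 2 * \<epsilon>) + G * dist y y'"
        using a b unfolding quotient_def ye ye' fst_conv snd_conv by linarith
      thus ?thesis by (simp add: algebra_simps)
    qed
    have ni: "\<bar>N (fst y) (snd y) \<bullet> i\<bar> \<le> 1" if "y \<in> S" "i \<in> Basis" for y i
      using Basis_le_norm[OF that(2), of "N (fst y) (snd y)"] SN(2)[OF that(1)] by simp
    have hl: "\<bar>slope \<epsilon> y - slope \<epsilon> y'\<bar> \<le> C1 * (dist y y' + \<epsilon>)" if y: "y \<in> S" "y' \<in> S" for y y'
    proof -
      define D' where "D' = dist y y' + \<epsilon>"
      have D': "dist y y' \<le> D'" "D' \<ge> 0" unfolding D'_def using \<epsilon> by simp_all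
      have "\<bar>(N (fst y) (snd y) \<bullet> i) * quotient \<epsilon> i y - (N (fst y') (snd y') \<bullet> i) * quotient \<epsilon> i y'\<bar> \<le> (4 * L * G + 2 * G) * D'" if i: "i \<in> Basis" for i
      proof -
        define a a' b b' where "a = N (fst y) (snd y) \<bullet> i" "a' = N (fst y') (snd y') \<bullet> i" "b = quotient \<epsilon> i y" "b' = quotient \<epsilon> i y'"
        have "\<bar>a - a'\<bar> * \<bar>b\<bar> \<le> (L * D') * (4 * G)"
          using order_trans[OF Ln[OF y i] mult_left_mono[OF D'(1) L0]] qb[OF y(1) i] L0 D'(2) unfolding a_a'_b_b'_def by (intro mult_mono) auto
        moreover have "\<bar>a'\<bar> * \<bar>b - b'\<bar> \<le> 1 * (2 * G * D')"
          using ni[OF y(2) i] ql[OF y i] unfolding a_a'_b_b'_def D'_def by (intro mult_mono) auto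
        moreover have "a * b - a' * b' = (a - a') * b + a' * (b - b')" by (simp add: algebra_simps)
        hence "\<bar>a * b - a' * b'\<bar> \<le> \<bar>a - a'\<bar> * \<bar>b\<bar> + \<bar>a'\<bar> * \<bar>b - b'\<bar>" by (metis abs_mult abs_triangle_ineq)
        ultimately have "\<bar>a * b - a' * b'\<bar> \<le> (L * D') * (4 * G) + 1 * (2 * G * D')" by linarith
        thus ?thesis unfolding a_a'_b_b'_def by (simp add: algebra_simps)
      qed
      hence "(\<Sum>i\<in>Basis. \<bar>(N (fst y) (snd y) \<bullet> i) * quotient \<epsilon> i y - (N (fst y') (snd y') \<bullet> i) * quotient \<epsilon> i y'\<bar>)
          \<le> (\<Sum>i\<in>(Basis::'a set). (4 * L * G + 2 * G) * D')" by (intro sum_mono)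
      hence "\<bar>(\<Sum>i\<in>Basis. (N (fst y) (snd y) \<bullet> i) * quotient \<epsilon> i y) - (\<Sum>i\<in>Basis. (N (fst y') (snd y') \<bullet> i) * quotient \<epsilon> i y')\<bar>
          \<le> n * ((4 * L * G + 2 * G) * D')"
        unfolding sum_subtractf[symmetric] n_def by (intro order_trans[OF sum_abs]) simp
      moreover have "\<bar>weingarten_square y - weingarten_square y'\<bar> \<le> L * D'"
        by (rule order_trans[OF Lw[OF y] mult_left_mono[OF D'(1) L0]])
      ultimately have "\<bar>slope \<epsilon> y - slope \<epsilon> y'\<bar> \<le> L * D' + n * ((4 * L * G + 2 * G) * D')" unfolding slope_def by linarith
      also have "\<dots> = C1 * D'" unfolding C1_def by (simp only: distrib_right mult.assoc)
      finally show ?thesis unfolding D'_def .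
    qed
    have hb: "\<bar>slope \<epsilon> y\<bar> \<le> L + n * (4 * G)" if y: "y \<in> S" for y
    proof -
      have "\<bar>\<Sum>i\<in>Basis. (N (fst y) (snd y) \<bullet> i) * quotient \<epsilon> i y\<bar> \<le> (\<Sum>i\<in>(Basis::'a set). 1 * (4 * G))"
      proof (rule order_trans[OF sum_abs sum_mono])
        fix i :: 'a assume i: "i \<in> Basis"
        show "\<bar>(N (fst y) (snd y) \<bullet> i) * quotient \<epsilon> i y\<bar> \<le> 1 * (4 * G)"
          unfolding abs_mult using ni[OF y i] qb[OF y i] by (intro mult_mono) auto
      qed
      hence "\<bar>\<Sum>i\<in>Basis. (N (fst y) (snd y) \<bullet> i) * quotient \<epsilon> i y\<bar> \<le> n * (4 * G)" unfolding n_def by simp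
      thus ?thesis unfolding slope_def using Lb[OF y] by linarith
    qed
    have gc: "continuous_on (UNIV \<times> {0..T}) (\<lambda>z. g (fst z) (snd z))"
      using forcing unfolding admissible_forcing_def case_prod_beta by blast
    have hc: "continuous_on S (slope \<epsilon>)"
    proof -
      have "continuous_on S weingarten_square"
        by (rule lipschitz_on_continuous_on[of L], rule lipschitz_onI) (use Lw L0 in \<open>auto simp: dist_real_def\<close>)
      moreover have "continuous_on S (\<lambda>y. N (fst y) (snd y) \<bullet> i)" if "i \<in> Basis" for i
        by (rule lipschitz_on_continuous_on[of L], rule lipschitz_onI) (use Ln that L0 in \<open>auto simp: dist_real_def\<close>)
      moreover have "continuous_on S (quotient \<epsilon> i)" for i
      proof -
        have "continuous_on S (\<lambda>z. g (fst (fst z + \<epsilon> *\<^sub>R i, snd z)) (snd (fst z + \<epsilon> *\<^sub>R i, snd z)))"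
          by (rule continuous_on_compose2[OF gc]) (use SN(1) in \<open>auto intro!: continuous_intros\<close>)
        moreover have "continuous_on S (\<lambda>z. g (fst z) (snd z))"
          by (rule continuous_on_subset[OF gc]) (use SN(1) in \<open>auto simp: mem_Times_iff\<close>)
        ultimately show ?thesis unfolding quotient_def[abs_def] using \<epsilon> by (intro continuous_intros) auto
      qed
      ultimately show ?thesis unfolding slope_def[abs_def] by (intro continuous_on_add continuous_on_sum continuous_on_mult)
    qed
    have jet: "distance_jet C \<epsilon> S d g (slope \<epsilon>) x t" if t: "t \<in> {0<..<T}" and x: "\<bar>d x t\<bar> < \<delta>" for x t
    proof -
      have t': "0 < t" "t < T" and tT: "t \<in> {0..T}" using t by auto
      note sm = small[OF x]
      note p = proj_on_S[OF tT less_imp_le[OF sm(1)]]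
      define \<pi> where "\<pi> = proj x t"
      have HL: "norm (H (proj x t) t w) \<le> L * norm w" for w using LH[OF p(1)] by simp
      note tr = trace_expansion[OF tT sm(1) L1 HL sm(2), folded n_def \<pi>_def]
      define trA where "trA = (\<Sum>b\<in>Basis. H \<pi> t b \<bullet> b)"
      define trH where "trH = (\<Sum>b\<in>Basis. H x t b \<bullet> b)"
      define \<rho> where "\<rho> = d x t"
      have dt: "Dt x t = trA - g \<pi> t" unfolding trA_def \<pi>_def by (rule Dt_eq[OF t' sm(1)])
      have xp: "x = \<pi> + \<rho> *\<^sub>R N x t" unfolding \<pi>_def proj_def \<rho>_def by simp
      have ta: "\<bar>g (\<pi> + \<rho> *\<^sub>R N x t) t - g \<pi> t - (\<Sum>i\<in>Basis. ((\<rho> *\<^sub>R N x t) \<bullet> i) * ((g (\<pi> + \<epsilon> *\<^sub>R i) t - g \<pi> t) / \<epsilon>))\<bar>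
          \<le> n * (G * (n + 1)) * norm (\<rho> *\<^sub>R N x t) * (norm (\<rho> *\<^sub>R N x t) + \<epsilon>)"
        unfolding n_def by (rule difference_quotient_taylor[OF G0 \<epsilon>(1), where f="\<lambda>x. g x t"]) (rule sl[OF tT])
      have sN: "(\<Sum>i\<in>Basis. ((\<rho> *\<^sub>R N x t) \<bullet> i) * ((g (\<pi> + \<epsilon> *\<^sub>R i) t - g \<pi> t) / \<epsilon>)) = \<rho> * (slope \<epsilon> (\<pi>, t) - weingarten_square (\<pi>, t))"
        unfolding slope_def quotient_def fst_conv snd_conv \<pi>_def p(3) by (simp add: sum_distrib_left mult.assoc)
      have nN: "norm (\<rho> *\<^sub>R N x t) = \<bar>\<rho>\<bar>" using eikonal(1)[OF tT less_imp_le[OF sm(1)]] by simp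
      have t1: "\<bar>trH - trA + \<rho> * weingarten_square (\<pi>, t)\<bar> \<le> n * (2 * L ^ 3) * \<rho>\<^sup>2" using tr(1) unfolding trH_def trA_def \<rho>_def .
      have t2: "\<bar>g x t - g \<pi> t - \<rho> * (slope \<epsilon> (\<pi>, t) - weingarten_square (\<pi>, t))\<bar> \<le> n * (G * (n + 1)) * \<bar>\<rho>\<bar> * (\<bar>\<rho>\<bar> + \<epsilon>)"
        using ta unfolding sN nN xp[symmetric] .
      have res: "\<bar>Dt x t - trH + g x t - \<rho> * slope \<epsilon> y\<bar> \<le> C * \<bar>\<rho>\<bar> * (\<bar>\<rho>\<bar> + dist (x, t) y + \<epsilon>)" if y: "y \<in> S" for y
      proof -
        define Q where "Q = \<bar>\<rho>\<bar> + dist (x, t) y + \<epsilon>"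
        have Q: "\<bar>\<rho>\<bar> \<le> Q" "\<bar>\<rho>\<bar> + \<epsilon> \<le> Q" "0 \<le> Q" unfolding Q_def using \<epsilon> by simp_all
        have "dist (\<pi>, t) y \<le> dist (x, t) (\<pi>, t) + dist (x, t) y" by (rule dist_triangle3)
        also have "dist (x, t) (\<pi>, t) = \<bar>\<rho>\<bar>" using p(2) unfolding \<pi>_def \<rho>_def by (simp add: dist_Pair_Pair)
        finally have Q2: "dist (\<pi>, t) y + \<epsilon> \<le> Q" unfolding Q_def by simp
        have pS: "(\<pi>, t) \<in> S" using p(1) unfolding \<pi>_def .
        have "\<bar>slope \<epsilon> (\<pi>, t) - slope \<epsilon> y\<bar> \<le> C1 * Q" by (rule order_trans[OF hl[OF pS y] mult_left_mono[OF Q2 C(9)]])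
        hence t3: "\<bar>\<rho> * (slope \<epsilon> (\<pi>, t) - slope \<epsilon> y)\<bar> \<le> \<bar>\<rho>\<bar> * (C1 * Q)" unfolding abs_mult by (intro mult_left_mono) auto
        have t1': "\<bar>trH - trA + \<rho> * weingarten_square (\<pi>, t)\<bar> \<le> n * (2 * L ^ 3) * (\<bar>\<rho>\<bar> * Q)"
        proof (rule order_trans[OF t1 mult_left_mono[OF _ nn(3)]])
          have "\<rho>\<^sup>2 = \<bar>\<rho>\<bar> * \<bar>\<rho>\<bar>" by (simp add: power2_eq_square)
          also have "\<dots> \<le> \<bar>\<rho>\<bar> * Q" by (intro mult_left_mono Q(1)) simp
          finally show "\<rho>\<^sup>2 \<le> \<bar>\<rho>\<bar> * Q" .
        qed
        have t2': "\<bar>g x t - g \<pi> t - \<rho> * (slope \<epsilon> (\<pi>, t) - weingarten_square (\<pi>, t))\<bar> \<le> n * (G * (n + 1)) * \<bar>\<rho>\<bar> * Q"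
          by (rule order_trans[OF t2 mult_left_mono[OF Q(2)]]) (use nn(4) in simp)
        have e1: "\<rho> * (slope \<epsilon> (\<pi>, t) - slope \<epsilon> y) = \<rho> * slope \<epsilon> (\<pi>, t) - \<rho> * slope \<epsilon> y"
          "\<rho> * (slope \<epsilon> (\<pi>, t) - weingarten_square (\<pi>, t)) = \<rho> * slope \<epsilon> (\<pi>, t) - \<rho> * weingarten_square (\<pi>, t)" by (simp_all only: right_diff_distrib)
        have "\<bar>Dt x t - trH + g x t - \<rho> * slope \<epsilon> y\<bar> \<le> n * (2 * L ^ 3) * (\<bar>\<rho>\<bar> * Q) + n * (G * (n + 1)) * \<bar>\<rho>\<bar> * Q + \<bar>\<rho>\<bar> * (C1 * Q)"
          using t1' t2' t3 unfolding dt e1 by linarith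
        also have "\<dots> = (n * (2 * L ^ 3) + n * (G * (n + 1)) + C1) * (\<bar>\<rho>\<bar> * Q)" by (simp add: algebra_simps)
        also have "\<dots> \<le> C * (\<bar>\<rho>\<bar> * Q)" using Q(3) by (intro mult_right_mono C(8)) simp
        finally show ?thesis unfolding Q_def by (simp add: mult.assoc)
      qed
      have "\<bar>Dt x t\<bar> \<le> n * L + G" using tr(3) gG[OF tT, of \<pi>] unfolding dt trA_def by linarith
      hence b1: "\<bar>Dt x t\<bar> \<le> C" using C(7) by linarith
      have b2: "\<bar>trH\<bar> \<le> C" using tr(2) C(6) unfolding trH_def by linarith
      have one: "(\<Sum>b\<in>Basis. (N x t \<bullet> b)\<^sup>2) = 1"
      proof -
        have "(\<Sum>b\<in>Basis. (N x t \<bullet> b)\<^sup>2) = N x t \<bullet> N x t" by (subst euclidean_inner) (simp add: power2_eq_square)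
        thus ?thesis using eikonal(1)[OF tT less_imp_le[OF sm(1)]] by (simp add: norm_eq_1)
      qed
      show ?thesis unfolding distance_jet_def
        by (rule exI[of _ "Dt x t"], rule exI[of _ "\<lambda>b. N x t \<bullet> b"], rule exI[of _ "\<lambda>b. H x t b \<bullet> b"])
          (use Dt_deriv[OF t' less_imp_le[OF sm(1)]] d_line_derivs[OF tT sm(1)] one b1 b2 res in \<open>simp add: trH_def \<rho>_def\<close>)
    qed
    have dc: "continuous_on (UNIV \<times> {0..T}) (\<lambda>(x, t). d x t)"
      using signed_dist_continuous[OF smooth] unfolding d_def case_prod_beta .
    have near: "\<exists>p\<in>S. dist (x, t) p \<le> \<bar>d x t\<bar>" if "t \<in> {0..T}" "\<bar>d x t\<bar> < \<delta>" for x t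
      using proj_on_S(1,2)[OF that(1) less_imp_le[OF small(1)[OF that(2)]]]
      by (intro bexI[of _ "(proj x t, t)"]) (simp_all add: dist_Pair_Pair)
    have h1: "\<bar>slope \<epsilon> p\<bar> \<le> C" if "p \<in> S" for p using hb[OF that] C(5) by linarith
    have h2: "\<bar>slope \<epsilon> p - slope \<epsilon> p'\<bar> \<le> C * (dist p p' + \<epsilon>)" if "p \<in> S" "p' \<in> S" for p p'
      by (rule order_trans[OF hl[OF that] mult_right_mono[OF C(4)]]) (use \<epsilon> in simp)
    have h3: "dist p p' \<le> C" if "p \<in> S" "p' \<in> S" for p p' using Ld[OF that] C(2) by linarith
    have h4: "\<bar>g x t\<bar> \<le> C" if "t \<in> {0..T}" for x t using gG[OF that, of x] C(3) by linarith
    show ?thesis unfolding tracked_distance_def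
    proof (intro conjI ballI allI impI)
      show "\<exists>p\<in>S. dist (x, t) p \<le> \<bar>d x t\<bar>" if "t \<in> {0..T}" "\<bar>d x t\<bar> < \<delta>" for x t by (rule near[OF that])
      show "distance_jet C \<epsilon> S d g (slope \<epsilon>) x t" if "t \<in> {0<..<T}" "\<bar>d x t\<bar> < \<delta>" for x t by (rule jet[OF that])
      show "\<bar>slope \<epsilon> p\<bar> \<le> C" if "p \<in> S" for p by (rule h1[OF that])
      show "\<bar>slope \<epsilon> p - slope \<epsilon> p'\<bar> \<le> C * (dist p p' + \<epsilon>)" if "p \<in> S" "p' \<in> S" for p p' by (rule h2[OF that])
      show "dist p p' \<le> C" if "p \<in> S" "p' \<in> S" for p p' by (rule h3[OF that])
      show "\<bar>g x t\<bar> \<le> C" if "t \<in> {0..T}" for x t by (rule h4[OF that])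
    qed (fact dc S_compact S_nonempty hc)+
  qed
  hence "\<forall>\<epsilon>. 0 < \<epsilon> \<and> \<epsilon> \<le> 1 \<longrightarrow> tracked_distance T C \<delta> \<epsilon> S d g (slope \<epsilon>)" by (intro allI impI) (elim conjE)
  with C(1) \<delta> show ?thesis by (intro exI conjI)
qed

end

section \<open>Zero level sets of Allen-Cahn solutions\<close>

lemma line_derivs_dir_deriv:
  fixes f :: "'a::euclidean_space \<Rightarrow> real"
  assumes f: "\<And>y. f differentiable (at y)" and f': "dir_deriv f b differentiable (at x)"
  shows "line_derivs f x b (dir_deriv f b x) (dir_deriv (dir_deriv f b) b x)"
proof -
  have line: "((\<lambda>s. F (x + s *\<^sub>R b)) has_real_derivative dir_deriv F b (x + s *\<^sub>R b)) (at s)"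
    if F: "F differentiable (at (x + s *\<^sub>R b))" for F :: "'a \<Rightarrow> real" and s
  proof -
    have l: "((\<lambda>s. x + s *\<^sub>R b) has_derivative (\<lambda>s. s *\<^sub>R b)) (at s)" by (auto intro!: derivative_eq_intros)
    have d: "(F has_derivative frechet_derivative F (at (x + s *\<^sub>R b))) (at (x + s *\<^sub>R b))" using F frechet_derivative_works by blast
    have "(\<lambda>r. frechet_derivative F (at (x + s *\<^sub>R b)) (r *\<^sub>R b)) = (*) (dir_deriv F b (x + s *\<^sub>R b))"
      by (rule ext) (simp add: dir_deriv_def linear_cmul[OF has_derivative_linear[OF d]])
    with has_derivative_compose[OF l d] show ?thesis unfolding has_field_derivative_def by (simp only:)
  qed
  show ?thesis unfolding line_derivs_def
    using line[OF f] line[of "dir_deriv f b" 0] f' by (intro exI[of _ "\<lambda>s. dir_deriv f b (x + s *\<^sub>R b)"]) simp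
qed

lemma allen_cahn_solution_flow:
  assumes "allen_cahn_solution T g \<Omega>\<^sub>0 \<epsilon> u"
  shows "ac_flow T \<epsilon> g u" and "u x 0 = q (signed_dist \<Omega>\<^sub>0 x / \<epsilon>)"
proof -
  note sol = assms[unfolded allen_cahn_solution_def]
  show "u x 0 = q (signed_dist \<Omega>\<^sub>0 x / \<epsilon>)" using sol by blast
  have "bounded ((\<lambda>(x, t). u x t) ` (UNIV \<times> {0..T}))" using sol by blast
  then obtain B where B: "\<And>y. y \<in> (\<lambda>(x, t). u x t) ` (UNIV \<times> {0..T}) \<Longrightarrow> norm y \<le> B" unfolding bounded_iff by blast
  have "\<bar>u x t\<bar> \<le> B" if "t \<in> {0..T}" for x t
  proof -
    have "u x t \<in> (\<lambda>(x, t). u x t) ` (UNIV \<times> {0..T})" by (rule image_eqI[of _ _ "(x, t)"]) (use that in auto)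
    thus ?thesis using B by force
  qed
  moreover have "parabolic_jet u x t (laplacian (\<lambda>y. u y t) x + ac_reaction \<epsilon> (g x t) (u x t)) (laplacian (\<lambda>y. u y t) x)"
    if t: "t \<in> {0<..<T}" for x t
  proof -
    have C: "(\<lambda>s. u x s) differentiable (at t)" "(\<lambda>y. u y t) differentiable (at x)"
      "\<And>i. i \<in> Basis \<Longrightarrow> dir_deriv (\<lambda>y. u y t) i differentiable (at x)" for x
      using sol t unfolding C21_def by blast+
    have "((\<lambda>s. u x s) has_real_derivative deriv (\<lambda>s. u x s) t) (at t)"
      using C(1)[of x] DERIV_deriv_iff_real_differentiable by blast
    moreover have "deriv (\<lambda>s. u x s) t = laplacian (\<lambda>y. u y t) x - 1 / \<epsilon>\<^sup>2 * deriv W (u x t) + 1 / \<epsilon> * sqrt (2 * W (u x t)) * g x t"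
      using sol t by blast
    hence "deriv (\<lambda>s. u x s) t = laplacian (\<lambda>y. u y t) x + ac_reaction \<epsilon> (g x t) (u x t)" unfolding ac_reaction_def by simp
    ultimately have "((\<lambda>s. u x s) has_real_derivative laplacian (\<lambda>y. u y t) x + ac_reaction \<epsilon> (g x t) (u x t)) (at t)" by (simp only:)
    moreover have "line_derivs (\<lambda>y. u y t) x b (dir_deriv (\<lambda>y. u y t) b x) (dir_deriv (dir_deriv (\<lambda>y. u y t) b) b x)" if "b \<in> Basis" for b
      by (rule line_derivs_dir_deriv[OF C(2) C(3)[OF that]])
    ultimately show ?thesis unfolding parabolic_jet_def
      by (intro conjI exI[of _ "\<lambda>b. dir_deriv (\<lambda>y. u y t) b x"] exI[of _ "\<lambda>b. dir_deriv (dir_deriv (\<lambda>y. u y t) b) b x"] ballI)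
        (simp_all add: laplacian_def)
  qed
  moreover have "continuous_on (UNIV \<times> {0..T}) (\<lambda>(x, t). u x t)" using sol by blast
  ultimately show "ac_flow T \<epsilon> g u" unfolding ac_flow_def by blast
qed

lemma regular_flow_tube:
  assumes T: "T > 0" and adm: "admissible_forcing T g" and flow: "regular_forced_mcf T g \<Omega>"
  shows "\<exists>D. forced_tube T D \<Omega> g"
proof -
  have sm: "smooth_family T \<Omega>" and rd: "regular_distance T \<Omega>"
    and mo: "\<forall>t\<in>{0..T}. \<forall>x\<in>frontier (\<Omega> t). \<exists>V k. has_normal_velocity T \<Omega> t x V \<and> has_mean_curvature (\<Omega> t) x k \<and> V = k + g x t"
    using flow unfolding regular_forced_mcf_def by blast+
  from rd obtain D where D: "D > 0"
    and t1: "\<forall>(x, t)\<in>closure (tube T \<Omega> D). (\<lambda>s. signed_dist (\<Omega> s) x) differentiable (at t within {0..T})"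
    and t2: "continuous_on (closure (tube T \<Omega> D)) (\<lambda>(x, t). vector_derivative (\<lambda>s. signed_dist (\<Omega> s) x) (at t within {0..T}))"
    and x1: "\<forall>(x, t)\<in>closure (tube T \<Omega> D). signed_dist (\<Omega> t) differentiable (at x) \<and>
        (\<forall>i\<in>Basis. dir_deriv (signed_dist (\<Omega> t)) i differentiable (at x))"
    unfolding regular_distance_def by (elim exE conjE)
  have tube: "(x, t) \<in> closure (tube T \<Omega> D)" if "t \<in> {0..T}" "\<bar>signed_dist (\<Omega> t) x\<bar> \<le> D" for x t
  proof -
    have "(x, t) \<in> tube T \<Omega> D" unfolding tube_def using that by auto
    thus ?thesis using closure_subset by blast
  qed
  have "forced_tube T D \<Omega> g"
  proof
    show "(\<lambda>s. signed_dist (\<Omega> s) x) differentiable (at t within {0..T})" if "t \<in> {0..T}" "\<bar>signed_dist (\<Omega> t) x\<bar> \<le> D" for x t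
      using bspec[OF t1 tube[OF that]] by simp
    show "signed_dist (\<Omega> t) differentiable (at x)" if "t \<in> {0..T}" "\<bar>signed_dist (\<Omega> t) x\<bar> \<le> D" for x t
      using bspec[OF x1 tube[OF that]] by simp
    show "dir_deriv (signed_dist (\<Omega> t)) i differentiable (at x)" if "t \<in> {0..T}" "\<bar>signed_dist (\<Omega> t) x\<bar> \<le> D" "i \<in> Basis" for x t i
      using bspec[OF x1 tube[OF that(1,2)]] that(3) by simp
    show "continuous_on (tube T \<Omega> D) (\<lambda>(x, t). vector_derivative (\<lambda>s. signed_dist (\<Omega> s) x) (at t within {0..T}))"
      by (rule continuous_on_subset[OF t2 closure_subset])
    show "\<exists>V k. has_normal_velocity T \<Omega> t x V \<and> has_mean_curvature (\<Omega> t) x k \<and> V = k + g x t"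
      if "t \<in> {0..T}" "x \<in> frontier (\<Omega> t)" for x t using mo that by blast
  qed (fact T D sm adm)+
  thus ?thesis by blast
qed

theorem theorem1:
  fixes T :: real
    and g :: "real ^ 'n \<Rightarrow> real \<Rightarrow> real"
    and \<Omega> :: "real \<Rightarrow> (real ^ 'n) set"
    and \<Omega>\<^sub>0 :: "(real ^ 'n) set"
  assumes "T > 0"
    and "admissible_forcing T g"
    and "regular_forced_mcf T g \<Omega>"
    and "\<Omega> 0 = \<Omega>\<^sub>0"
  shows "\<exists>\<epsilon>\<^sub>0>0. \<exists>C. \<forall>\<epsilon>. 0 < \<epsilon> \<and> \<epsilon> \<le> \<epsilon>\<^sub>0 \<longrightarrow>
    (\<forall>u. allen_cahn_solution T g \<Omega>\<^sub>0 \<epsilon> u \<longrightarrow>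
      (\<forall>t\<in>{0..T}. {x. u x t = 0} \<subseteq>
         {x. infdist x (frontier (\<Omega> t)) \<le> C * \<epsilon>\<^sup>2 * \<bar>ln \<epsilon>\<bar>\<^sup>2}))"
proof -
  obtain D where "forced_tube T D \<Omega> g" using regular_flow_tube[OF assms(1-3)] by blast
  then interpret forced_tube T D \<Omega> g .
  obtain C \<delta> where C: "C \<ge> 1" "\<delta> > 0"
    and tr: "\<And>\<epsilon>. 0 < \<epsilon> \<Longrightarrow> \<epsilon> \<le> 1 \<Longrightarrow> tracked_distance T C \<delta> \<epsilon> S d g (slope \<epsilon>)"
    using distance_is_tracked by blast
  obtain \<epsilon>\<^sub>1 M where e1: "\<epsilon>\<^sub>1 > 0" and M: "\<forall>\<epsilon> S (\<rho> :: real ^ 'n \<Rightarrow> real \<Rightarrow> real) g h u.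
    0 < \<epsilon> \<and> \<epsilon> \<le> \<epsilon>\<^sub>1 \<longrightarrow> tracked_distance T C \<delta> \<epsilon> S \<rho> g h \<longrightarrow> ac_flow T \<epsilon> g u \<longrightarrow>
    (\<forall>x. u x 0 = q (\<rho> x 0 / \<epsilon>)) \<longrightarrow> (\<forall>x. \<forall>t\<in>{0..T}. u x t = 0 \<longrightarrow> \<rho> x t \<le> M * \<epsilon>\<^sup>2)"
    using zero_level_upper_bound[OF assms(1) C] by (elim exE conjE)
  have le: "infdist x (frontier (\<Omega> t)) \<le> \<bar>M\<bar> * \<epsilon>\<^sup>2 * \<bar>ln \<epsilon>\<bar>\<^sup>2"
    if \<epsilon>: "0 < \<epsilon>" "\<epsilon> \<le> min \<epsilon>\<^sub>1 (exp (- 1))" and sol: "allen_cahn_solution T g \<Omega>\<^sub>0 \<epsilon> u"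
      and t: "t \<in> {0..T}" and u0: "u x t = 0" for \<epsilon> u t x
  proof -
    have e: "0 < \<epsilon> \<and> \<epsilon> \<le> \<epsilon>\<^sub>1" "\<epsilon> \<le> exp (- 1)" using \<epsilon> by simp_all
    have "exp (- 1 :: real) \<le> 1" by simp
    hence "\<epsilon> \<le> 1" using e(2) by linarith
    note td = tr[OF \<epsilon>(1) this]
    note fl = allen_cahn_solution_flow(1)[OF sol]
    have init: "u y 0 = q (d y 0 / \<epsilon>)" for y
      using allen_cahn_solution_flow(2)[OF sol, of y] unfolding d_def assms(4) .
    have up: "d x t \<le> M * \<epsilon>\<^sup>2"
      using M[rule_format, OF e(1) td fl init t u0] .
    have init': "- u y 0 = q (- d y 0 / \<epsilon>)" for y unfolding init q_def by simp
    have lo: "- d x t \<le> M * \<epsilon>\<^sup>2"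
      by (rule M[rule_format, OF e(1) tracked_distance_uminus[OF td] ac_flow_uminus[OF fl] init' t]) (simp add: u0)
    \<comment> \<open>The barrier bound is quadratic in \<open>\<epsilon>\<close>; the logarithm only enters through \<open>\<bar>ln \<epsilon>\<bar> \<ge> 1\<close>.\<close>
    have "ln \<epsilon> \<le> - 1" using ln_le_cancel_iff[of \<epsilon> "exp (- 1)"] e \<epsilon>(1) by simp
    hence "1 \<le> \<bar>ln \<epsilon>\<bar>" by simp
    hence "1 \<le> \<bar>ln \<epsilon>\<bar>\<^sup>2" by (rule one_le_power)
    hence "\<bar>M\<bar> * \<epsilon>\<^sup>2 * 1 \<le> \<bar>M\<bar> * \<epsilon>\<^sup>2 * \<bar>ln \<epsilon>\<bar>\<^sup>2" by (intro mult_left_mono) simp_all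
    moreover have "M * \<epsilon>\<^sup>2 \<le> \<bar>M\<bar> * \<epsilon>\<^sup>2" by (intro mult_right_mono) simp_all
    moreover have "infdist x (frontier (\<Omega> t)) = \<bar>d x t\<bar>" unfolding d_def abs_signed_dist ..
    ultimately show ?thesis using up lo by linarith
  qed
  have "min \<epsilon>\<^sub>1 (exp (- 1)) > 0" using e1 by simp
  moreover have "\<forall>\<epsilon>. 0 < \<epsilon> \<and> \<epsilon> \<le> min \<epsilon>\<^sub>1 (exp (- 1)) \<longrightarrow> (\<forall>u. allen_cahn_solution T g \<Omega>\<^sub>0 \<epsilon> u \<longrightarrow>
      (\<forall>t\<in>{0..T}. {x. u x t = 0} \<subseteq> {x. infdist x (frontier (\<Omega> t)) \<le> \<bar>M\<bar> * \<epsilon>\<^sup>2 * \<bar>ln \<epsilon>\<bar>\<^sup>2}))"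
    by (intro allI impI ballI subsetI, elim conjE, simp only: mem_Collect_eq) (rule le)
  ultimately show ?thesis by blast
qed

end
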